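(* Let $g_1,g_2,g>0$ satisfy $g^2<g_1g_2$, $g>\frac{g_1+\sqrt{g_1^2+8g_1g_2}}{4}$ and $g_1<g_2$. Let $(\eta_{1,\varepsilon},\eta_{2,\varepsilon})$ be the positive minimizer of $E^0_\varepsilon$ in $\mathcal{H}$, with associated Lagrange multipliers $\lambda_{1,\varepsilon},\lambda_{2,\varepsilon}$. Then there exist constants $c,C>0$ (independent of $\varepsilon$) such that, for sufficiently small $\varepsilon>0$: $$|\lambda_{i,\varepsilon}-\lambda_{i,0}|\le C|\log\varepsilon|\varepsilon^2,\qquad \|\eta_{i,\varepsilon}-\sqrt{a_i}\|_{L^\infty(\mathbb{R}^2)}\le C\varepsilon^{1/3},\qquad i=1,2;$$ $$|\eta_{1,\varepsilon}(r)-\sqrt{a_1(r)}|\le C\varepsilon^{1/3}\sqrt{a_1(r)}\quad\text{for } r=|x|\le R_{1,0}-\varepsilon^{1/3};$$ $$|\eta_{2,\varepsilon}(r)-\sqrt{a_2(r)}|\le C\varepsilon^{1/3}\sqrt{a_2(r)}\quad\text{for } R_{2,0}^-+\varepsilon^{1/3}<|x|\le R_{2,0}^+-\varepsilon^{1/3};$$ $$\eta_{1,\varepsilon}(r)\le C\varepsilon^{1/3}\exp\Big\{-c\frac{r-R_{1,0}}{\varepsilon^{2/3}}\Big\},\ r\ge R_{1,0};\qquad \eta_{2,\varepsilon}(r)\le C\varepsilon^{1/3}\exp\Big\{-c\frac{r-R_{2,0}^+}{\varepsilon^{2/3}}\Big\},\ r\ge R_{2,0}^+;$$ and on fixed compact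 sets away from $|x|=R_{1,0}$ and $|x|=R_{2,0}^\pm$, $(\eta_{1,\varepsilon},\eta_{2,\varepsilon})$ is uniformly close to $(\sqrt{a_1},\sqrt{a_2})$ with an error of order $\mathcal{O}(|\log\varepsilon|)\varepsilon^2$ (i.e. for each such compact set $K$ there is $C_K>0$ with $\|\eta_{i,\varepsilon}-\sqrt{a_i}\|_{L^\infty(K)}\le C_K|\log\varepsilon|\varepsilon^2$, $i=1,2$, for small $\varepsilon$).
   Context: The space is $$\mathcal{H}=\Big\{(u_1,u_2):\ u_j\in H^1(\mathbb{R}^2,\mathbb{C}),\ \int_{\mathbb{R}^2}|x|^2|u_j|^2\,dx<\infty,\ \|u_j\|_{L^2(\mathbb{R}^2)}=1,\ j=1,2\Big\},$$ and $$E^0_\varepsilon(u_1,u_2)=\sum_{j=1}^2\int_{\mathbb{R}^2}\Big\{\frac{|\nabla u_j|^2}{2}+\frac{|x|^2}{2\varepsilon^2}|u_j|^2+\frac{g_j}{4\varepsilon^2}|u_j|^4\Big\}dx+\frac{g}{2\varepsilon^2}\int_{\mathbb{R}^2}|u_1|^2|u_2|^2\,dx .$$ When $g^2<g_1g_2$ the positive minimizer of $E^0_\varepsilon$ in $\mathcal{H}$ is unique and radial ($r=|x|$), and it solves $$-\varepsilon^2\Delta\eta_{1}+|x|^2\eta_{1}+g_1\eta_{1}^3+g\,\eta_{1}\eta_{2}^2=\lambda_{1,\varepsilon}\eta_{1},\qquad -\varepsilon^2\Delta\eta_{2}+|x|^2\eta_{2}+g_2\eta_{2}^3+g\,\eta_{1}^2\eta_{2}=\lambda_{2,\varepsilon}\eta_{2}\quad\text{in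 }\mathbb{R}^2,$$ where $\lambda_{1,\varepsilon},\lambda_{2,\varepsilon}$ are the Lagrange multipliers. Set $\Gamma_1=1-\frac{g}{g_1}$, $\Gamma_2=1-\frac{g}{g_2}$, $\Gamma=1-\frac{g^2}{g_1g_2}$ (here $\Gamma_1<0$). Define $\lambda_{1,0},\lambda_{2,0}$ by $$\lambda_{1,0}=\sqrt{\frac{2g_1\big(1+\frac{g_2^2}{g^2}(1-\Gamma_2)^2\big)}{\pi}},\qquad \lambda_{2,0}-\lambda_{1,0}=\sqrt{-\Gamma_1\Gamma_2}\,\sqrt{\frac{2g_1g_2^2(1-\Gamma_2)}{\pi g^2}},$$ and the radii $0<R_{2,0}^-<R_{1,0}<R_{2,0}^+$ by $$\lambda_{2,0}=(R_{2,0}^+)^2,\qquad \lambda_{1,0}-\frac{g}{g_2}\lambda_{2,0}=\Gamma_2R_{1,0}^2,\qquad \lambda_{2,0}-\frac{g}{g_1}\lambda_{1,0}=\Gamma_1(R_{2,0}^-)^2 .$$ Let $$a_{1,0}(r)=\frac{1}{g_1\Gamma}\Big(\lambda_{1,0}-\frac{g}{g_2}\lambda_{2,0}-\Gamma_2r^2\Big),\qquad a_{2,0}(r)=\frac{1}{g_2\Gamma}\Big(\lambda_{2,0}-\frac{g}{g_1}\lambda_{1,0}-\Gamma_1r^2\Big).$$ Then $a_1=a_{1,0}+\frac{g}{g_1}a_{2,0}$ for $0\le r\le R_{2,0}^-$, $a_1=a_{1,0}$ for $R_{2,0}^-\le r\le R_{1,0}$, $a_1=0$ for $r\ge R_{1,0}$;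 and $a_2=0$ for $0\le r\le R_{2,0}^-$, $a_2=a_{2,0}$ for $R_{2,0}^-\le r\le R_{1,0}$, $a_2=a_{2,0}+\frac{g}{g_2}a_{1,0}$ for $R_{1,0}\le r\le R_{2,0}^+$, $a_2=0$ for $r\ge R_{2,0}^+$. *)

theory Defs
  imports "HOL-Probability.Probability"
begin

section \<open>The Sobolev space \<open>H\<^sup>1(\<real>\<^sup>2, \<complex>)\<close>\<close>

definition partial_deriv :: "2 \<Rightarrow> (real^2 \<Rightarrow> real) \<Rightarrow> real^2 \<Rightarrow> real" where
  "partial_deriv i f x = frechet_derivative f (at x) (axis i 1)"

definition laplacian :: "(real^2 \<Rightarrow> real) \<Rightarrow> real^2 \<Rightarrow> real" where
  "laplacian f x = (\<Sum>i\<in>UNIV. partial_deriv i (partial_deriv i f) x)"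

fun C_k :: "nat \<Rightarrow> (real^2 \<Rightarrow> real) \<Rightarrow> bool" where
  "C_k 0 f \<longleftrightarrow> continuous_on UNIV f"
| "C_k (Suc k) f \<longleftrightarrow> (\<forall>x. f differentiable (at x)) \<and> (\<forall>i. C_k k (partial_deriv i f))"

definition test_function :: "(real^2 \<Rightarrow> real) \<Rightarrow> bool" where
  "test_function \<phi> \<longleftrightarrow> (\<forall>k. C_k k \<phi>) \<and> compact (closure {x. \<phi> x \<noteq> 0})"

definition locally_integrable :: "(real^2 \<Rightarrow> complex) \<Rightarrow> bool" where
  "locally_integrable f \<longleftrightarrow>
     f \<in> borel_measurable lborel \<and> (\<forall>K. compact K \<longrightarrow> set_integrable lborel K f)"

text \<open>Real-valued test functions suffice for complex-valued \<open>u\<close>, by linearity.\<close>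

definition is_weak_partial :: "2 \<Rightarrow> (real^2 \<Rightarrow> complex) \<Rightarrow> (real^2 \<Rightarrow> complex) \<Rightarrow> bool" where
  "is_weak_partial i u v \<longleftrightarrow> locally_integrable v \<and>
     (\<forall>\<phi>. test_function \<phi> \<longrightarrow>
        (LINT x|lborel. partial_deriv i \<phi> x *\<^sub>R u x) = - (LINT x|lborel. \<phi> x *\<^sub>R v x))"

text \<open>A weak partial derivative is unique up to a null set; we choose a representative. It is only
  used under integrals and for functions that have one.\<close>

definition weak_partial :: "2 \<Rightarrow> (real^2 \<Rightarrow> complex) \<Rightarrow> real^2 \<Rightarrow> complex" where
  "weak_partial i u = (SOME v. is_weak_partial i u v)"

definition L2 :: "(real^2 \<Rightarrow> complex) set" where
  "L2 = {u. u \<in> borel_measurable lborel \<and> integrable lborel (\<lambda>x. (cmod (u x))\<^sup>2)}"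

definition L2_norm :: "(real^2 \<Rightarrow> complex) \<Rightarrow> real" where
  "L2_norm u = sqrt (LINT x|lborel. (cmod (u x))\<^sup>2)"

definition H1 :: "(real^2 \<Rightarrow> complex) set" where
  "H1 = {u \<in> L2. \<forall>i. \<exists>v\<in>L2. is_weak_partial i u v}"

definition grad_norm_sq :: "(real^2 \<Rightarrow> complex) \<Rightarrow> real^2 \<Rightarrow> real" where
  "grad_norm_sq u x = (\<Sum>i\<in>UNIV. (cmod (weak_partial i u x))\<^sup>2)"

definition Linf_norm :: "(real^2) set \<Rightarrow> (real^2 \<Rightarrow> real) \<Rightarrow> ereal" where
  "Linf_norm A f = esssup (restrict_space lborel A) (\<lambda>x. ereal \<bar>f x\<bar>)"


section \<open>The energy and its positive minimizer\<close>

definition space_H :: "((real^2 \<Rightarrow> complex) \<times> (real^2 \<Rightarrow> complex)) set" where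
  "space_H = {(u1, u2). \<forall>u\<in>{u1, u2}. u \<in> H1 \<and>
      integrable lborel (\<lambda>x. (norm x)\<^sup>2 * (cmod (u x))\<^sup>2) \<and> L2_norm u = 1}"

text \<open>For \<open>g1, g2, g \<ge> 0\<close> all integrands are nonnegative, so the energy is taken in
  \<open>[0, \<infinity>]\<close>. This avoids the convention that the Bochner integral of a non-integrable
  function is \<open>0\<close>.\<close>

definition energy :: "real \<Rightarrow> real \<Rightarrow> real \<Rightarrow> real \<Rightarrow>
    (real^2 \<Rightarrow> complex) \<Rightarrow> (real^2 \<Rightarrow> complex) \<Rightarrow> ennreal" where
  "energy g1 g2 g \<epsilon> u1 u2 =
     (\<Sum>(gj, u) \<leftarrow> [(g1, u1), (g2, u2)].
        \<integral>\<^sup>+x. ennreal (grad_norm_sq u x / 2 + (norm x)\<^sup>2 / (2 * \<epsilon>\<^sup>2) * (cmod (u x))\<^sup>2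
                     + gj / (4 * \<epsilon>\<^sup>2) * (cmod (u x))^4) \<partial>lborel)
     + ennreal (g / (2 * \<epsilon>\<^sup>2)) * (\<integral>\<^sup>+x. ennreal ((cmod (u1 x))\<^sup>2 * (cmod (u2 x))\<^sup>2) \<partial>lborel)"

definition positive_minimizer :: "real \<Rightarrow> real \<Rightarrow> real \<Rightarrow> real \<Rightarrow>
    (real^2 \<Rightarrow> real) \<Rightarrow> (real^2 \<Rightarrow> real) \<Rightarrow> bool" where
  "positive_minimizer g1 g2 g \<epsilon> \<eta>1 \<eta>2 \<longleftrightarrow>
     (\<forall>x. \<eta>1 x > 0 \<and> \<eta>2 x > 0) \<and>
     (complex_of_real \<circ> \<eta>1, complex_of_real \<circ> \<eta>2) \<in> space_H \<and>
     (\<forall>(u1, u2) \<in> space_H.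
        energy g1 g2 g \<epsilon> (complex_of_real \<circ> \<eta>1) (complex_of_real \<circ> \<eta>2) \<le> energy g1 g2 g \<epsilon> u1 u2)"

text \<open>The Euler-Lagrange system, in the classical sense. Elements of \<open>space_H\<close> are functions rather
  than classes modulo null sets. The regularity required here picks out, for a minimizer, the
  representative for which pointwise statements make sense; by elliptic regularity it exists.\<close>

definition lagrange_multipliers :: "real \<Rightarrow> real \<Rightarrow> real \<Rightarrow> real \<Rightarrow>
    (real^2 \<Rightarrow> real) \<Rightarrow> (real^2 \<Rightarrow> real) \<Rightarrow> real \<Rightarrow> real \<Rightarrow> bool" where
  "lagrange_multipliers g1 g2 g \<epsilon> \<eta>1 \<eta>2 lam1 lam2 \<longleftrightarrow>
     C_k 2 \<eta>1 \<and> C_k 2 \<eta>2 \<and>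
     (\<forall>x. - \<epsilon>\<^sup>2 * laplacian \<eta>1 x + (norm x)\<^sup>2 * \<eta>1 x + g1 * (\<eta>1 x)^3 + g * \<eta>1 x * (\<eta>2 x)\<^sup>2
            = lam1 * \<eta>1 x) \<and>
     (\<forall>x. - \<epsilon>\<^sup>2 * laplacian \<eta>2 x + (norm x)\<^sup>2 * \<eta>2 x + g2 * (\<eta>2 x)^3 + g * (\<eta>1 x)\<^sup>2 * \<eta>2 x
            = lam2 * \<eta>2 x)"


section \<open>The limiting profile\<close>

definition \<Gamma>1 :: "real \<Rightarrow> real \<Rightarrow> real \<Rightarrow> real" where
  "\<Gamma>1 g1 g2 g = 1 - g / g1"

definition \<Gamma>2 :: "real \<Rightarrow> real \<Rightarrow> real \<Rightarrow> real" where
  "\<Gamma>2 g1 g2 g = 1 - g / g2"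

definition \<Gamma>0 :: "real \<Rightarrow> real \<Rightarrow> real \<Rightarrow> real" where
  "\<Gamma>0 g1 g2 g = 1 - g\<^sup>2 / (g1 * g2)"

definition lam10 :: "real \<Rightarrow> real \<Rightarrow> real \<Rightarrow> real" where
  "lam10 g1 g2 g = sqrt (2 * g1 * (1 + g2\<^sup>2 / g\<^sup>2 * (1 - \<Gamma>2 g1 g2 g)\<^sup>2) / pi)"

definition lam20 :: "real \<Rightarrow> real \<Rightarrow> real \<Rightarrow> real" where
  "lam20 g1 g2 g = lam10 g1 g2 g +
     sqrt (- \<Gamma>1 g1 g2 g * \<Gamma>2 g1 g2 g) * sqrt (2 * g1 * g2\<^sup>2 * (1 - \<Gamma>2 g1 g2 g) / (pi * g\<^sup>2))"

text \<open>The radii are given by explicit square roots; lemma \<open>radii\<close> below shows that they are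
  positive, ordered, and satisfy their defining equations.\<close>

definition R2_plus :: "real \<Rightarrow> real \<Rightarrow> real \<Rightarrow> real" where
  "R2_plus g1 g2 g = sqrt (lam20 g1 g2 g)"

definition R1 :: "real \<Rightarrow> real \<Rightarrow> real \<Rightarrow> real" where
  "R1 g1 g2 g = sqrt ((lam10 g1 g2 g - g / g2 * lam20 g1 g2 g) / \<Gamma>2 g1 g2 g)"

definition R2_minus :: "real \<Rightarrow> real \<Rightarrow> real \<Rightarrow> real" where
  "R2_minus g1 g2 g = sqrt ((lam20 g1 g2 g - g / g1 * lam10 g1 g2 g) / \<Gamma>1 g1 g2 g)"

definition a10 :: "real \<Rightarrow> real \<Rightarrow> real \<Rightarrow> real \<Rightarrow> real" where
  "a10 g1 g2 g r =
     1 / (g1 * \<Gamma>0 g1 g2 g) * (lam10 g1 g2 g - g / g2 * lam20 g1 g2 g - \<Gamma>2 g1 g2 g * r\<^sup>2)"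

definition a20 :: "real \<Rightarrow> real \<Rightarrow> real \<Rightarrow> real \<Rightarrow> real" where
  "a20 g1 g2 g r =
     1 / (g2 * \<Gamma>0 g1 g2 g) * (lam20 g1 g2 g - g / g1 * lam10 g1 g2 g - \<Gamma>1 g1 g2 g * r\<^sup>2)"

text \<open>At the interface radii the adjacent branches agree, see lemma \<open>profile_matching\<close>.\<close>

definition a1 :: "real \<Rightarrow> real \<Rightarrow> real \<Rightarrow> real \<Rightarrow> real" where
  "a1 g1 g2 g r =
     (if r \<le> R2_minus g1 g2 g then a10 g1 g2 g r + g / g1 * a20 g1 g2 g r
      else if r \<le> R1 g1 g2 g then a10 g1 g2 g r
      else 0)"

definition a2 :: "real \<Rightarrow> real \<Rightarrow> real \<Rightarrow> real \<Rightarrow> real" where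
  "a2 g1 g2 g r =
     (if r \<le> R2_minus g1 g2 g then 0
      else if r \<le> R1 g1 g2 g then a20 g1 g2 g r
      else if r \<le> R2_plus g1 g2 g then a20 g1 g2 g r + g / g2 * a10 g1 g2 g r
      else 0)"

lemma radii:
  fixes g1 g2 g :: real
  assumes pos: "g1 > 0" "g2 > 0" "g > 0" and "g\<^sup>2 < g1 * g2"
    and G: "g > (g1 + sqrt (g1\<^sup>2 + 8 * g1 * g2)) / 4" and lt: "g1 < g2"
  shows "0 < R2_minus g1 g2 g" "R2_minus g1 g2 g < R1 g1 g2 g" "R1 g1 g2 g < R2_plus g1 g2 g"
    and "lam20 g1 g2 g = (R2_plus g1 g2 g)\<^sup>2"
    and "lam10 g1 g2 g - g / g2 * lam20 g1 g2 g = \<Gamma>2 g1 g2 g * (R1 g1 g2 g)\<^sup>2"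
    and "lam20 g1 g2 g - g / g1 * lam10 g1 g2 g = \<Gamma>1 g1 g2 g * (R2_minus g1 g2 g)\<^sup>2"
    and "\<Gamma>1 g1 g2 g < 0" and "0 < \<Gamma>2 g1 g2 g" and "0 < \<Gamma>0 g1 g2 g"
proof -
  define d where "d = lam20 g1 g2 g - lam10 g1 g2 g"
  define l where "l = lam10 g1 g2 g"
  have l2: "lam20 g1 g2 g = l + d" by (simp add: d_def l_def)
  have gg2: "g < g2"
  proof (rule ccontr)
    assume "\<not> g < g2"
    then have "g1 * g2 \<le> g1 * g" "g1 * g < g * g" using pos lt by auto
    then show False using \<open>g\<^sup>2 < g1 * g2\<close> by (simp add: power2_eq_square)
  qed
  have gg1: "g1 < g"
  proof -
    have "(3 * g1)\<^sup>2 < g1\<^sup>2 + 8 * g1 * g2" using pos lt by (simp add: power2_eq_square)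
    then have "3 * g1 < sqrt (g1\<^sup>2 + 8 * g1 * g2)" by (rule real_less_rsqrt)
    then show ?thesis using G by simp
  qed
  have quad: "0 < 2 * g\<^sup>2 - g1 * g - g1 * g2"
  proof -
    have "sqrt (g1\<^sup>2 + 8 * g1 * g2) < 4 * g - g1" using G by simp
    moreover have "0 \<le> g1\<^sup>2 + 8 * g1 * g2" using pos by simp
    ultimately have "(sqrt (g1\<^sup>2 + 8 * g1 * g2))\<^sup>2 < (4 * g - g1)\<^sup>2"
      by (intro power_strict_mono) auto
    then have "g1\<^sup>2 + 8 * g1 * g2 < (4 * g - g1)\<^sup>2"
      using \<open>0 \<le> g1\<^sup>2 + 8 * g1 * g2\<close> by simp
    then show ?thesis by (simp add: power2_eq_square algebra_simps)
  qed
  show G1: "\<Gamma>1 g1 g2 g < 0" using pos gg1 by (simp add: \<Gamma>1_def)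
  show G2: "0 < \<Gamma>2 g1 g2 g" using pos gg2 by (simp add: \<Gamma>2_def)
  show "0 < \<Gamma>0 g1 g2 g" using pos \<open>g\<^sup>2 < g1 * g2\<close> by (simp add: \<Gamma>0_def)
  have lsq: "l\<^sup>2 = 4 * g1 / pi" and lpos: "0 < l"
    using pos by (simp_all add: l_def lam10_def \<Gamma>2_def field_simps add_pos_pos)
  have dd: "d = sqrt (- \<Gamma>1 g1 g2 g * \<Gamma>2 g1 g2 g) * sqrt (2 * g1 * g2 / (pi * g))"
    using pos by (simp add: d_def lam20_def \<Gamma>2_def power2_eq_square field_simps)
  have np: "0 < - \<Gamma>1 g1 g2 g * \<Gamma>2 g1 g2 g" using G1 G2 by (simp add: mult_neg_pos)
  have dpos: "0 < d" unfolding dd using np pos by simp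
  have dsq: "d\<^sup>2 = - \<Gamma>1 g1 g2 g * \<Gamma>2 g1 g2 g * (2 * g1 * g2 / (pi * g))"
    unfolding dd power_mult_distrib using np pos by simp
  have S2m: "(lam20 g1 g2 g - g / g1 * lam10 g1 g2 g) / \<Gamma>1 g1 g2 g = l + d / \<Gamma>1 g1 g2 g"
    using G1 pos unfolding l2 l_def[symmetric] \<Gamma>1_def by (simp add: field_simps)
  have S1: "(lam10 g1 g2 g - g / g2 * lam20 g1 g2 g) / \<Gamma>2 g1 g2 g = l + d - d / \<Gamma>2 g1 g2 g"
    using G2 pos unfolding l2 l_def[symmetric] \<Gamma>2_def by (simp add: field_simps)
  have "d\<^sup>2 < (l * - \<Gamma>1 g1 g2 g)\<^sup>2"
  proof -
    have "0 < (2 * g\<^sup>2 - g1 * g - g1 * g2) * (2 * g1 * g2)" using quad pos by simp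
    then have "\<Gamma>2 g1 g2 g * (2 * g1 * g2 / g) < - \<Gamma>1 g1 g2 g * (4 * g1)"
      using pos by (simp add: \<Gamma>1_def \<Gamma>2_def field_simps power2_eq_square)
    then have "\<Gamma>2 g1 g2 g * (2 * g1 * g2 / g) / pi * - \<Gamma>1 g1 g2 g
        < - \<Gamma>1 g1 g2 g * (4 * g1) / pi * - \<Gamma>1 g1 g2 g"
      using G1 by (intro mult_strict_right_mono divide_strict_right_mono) auto
    then show ?thesis unfolding power_mult_distrib dsq lsq
      by (simp add: power2_eq_square mult_ac)
  qed
  then have "d < l * - \<Gamma>1 g1 g2 g"
    by (rule power2_less_imp_less) (use lpos G1 in \<open>simp add: mult_nonneg_nonpos\<close>)
  then have S2m_pos: "0 < l + d / \<Gamma>1 g1 g2 g" using G1 by (simp add: field_simps)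
  have S12: "l + d / \<Gamma>1 g1 g2 g < l + d - d / \<Gamma>2 g1 g2 g"
  proof -
    have "0 < 1 - 1 / \<Gamma>1 g1 g2 g - 1 / \<Gamma>2 g1 g2 g"
    proof -
      have "1 / \<Gamma>1 g1 g2 g = - (g1 / (g - g1))" "1 / \<Gamma>2 g1 g2 g = g2 / (g2 - g)"
        using pos gg1 gg2 by (simp_all add: \<Gamma>1_def \<Gamma>2_def divide_simps) (simp add: algebra_simps)
      moreover have "1 - - (g1 / (g - g1)) - g2 / (g2 - g) = (g1 * g2 - g\<^sup>2) / ((g - g1) * (g2 - g))"
        using gg1 gg2 by (simp add: field_simps power2_eq_square)
      ultimately show ?thesis using gg1 gg2 \<open>g\<^sup>2 < g1 * g2\<close> by simp
    qed
    then have "0 < d * (1 - 1 / \<Gamma>1 g1 g2 g - 1 / \<Gamma>2 g1 g2 g)" using dpos by simp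
    then show ?thesis by (simp add: algebra_simps)
  qed
  show "0 < R2_minus g1 g2 g" using S2m_pos unfolding R2_minus_def S2m by simp
  show "R2_minus g1 g2 g < R1 g1 g2 g" using S12 unfolding R2_minus_def R1_def S2m S1 by simp
  show "R1 g1 g2 g < R2_plus g1 g2 g"
    using dpos G2 unfolding R1_def R2_plus_def S1 unfolding l2 by simp
  show "lam20 g1 g2 g = (R2_plus g1 g2 g)\<^sup>2" using lpos dpos by (simp add: R2_plus_def l2)
  show "lam10 g1 g2 g - g / g2 * lam20 g1 g2 g = \<Gamma>2 g1 g2 g * (R1 g1 g2 g)\<^sup>2"
  proof -
    have "(R1 g1 g2 g)\<^sup>2 = (lam10 g1 g2 g - g / g2 * lam20 g1 g2 g) / \<Gamma>2 g1 g2 g"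
      using S1 S12 S2m_pos unfolding R1_def by (intro real_sqrt_pow2) linarith
    then show ?thesis using G2 by simp
  qed
  show "lam20 g1 g2 g - g / g1 * lam10 g1 g2 g = \<Gamma>1 g1 g2 g * (R2_minus g1 g2 g)\<^sup>2"
  proof -
    have "(R2_minus g1 g2 g)\<^sup>2 = (lam20 g1 g2 g - g / g1 * lam10 g1 g2 g) / \<Gamma>1 g1 g2 g"
      using S2m S2m_pos unfolding R2_minus_def by (intro real_sqrt_pow2) linarith
    then show ?thesis using G1 by simp
  qed
qed

lemma profile_matching:
  fixes g1 g2 g :: real
  assumes "g1 > 0" "g2 > 0" "g > 0" "g\<^sup>2 < g1 * g2"
    and "g > (g1 + sqrt (g1\<^sup>2 + 8 * g1 * g2)) / 4" "g1 < g2"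
  shows "a10 g1 g2 g (R1 g1 g2 g) = 0" and "a20 g1 g2 g (R2_minus g1 g2 g) = 0"
    and "a20 g1 g2 g (R2_plus g1 g2 g) + g / g2 * a10 g1 g2 g (R2_plus g1 g2 g) = 0"
proof -
  note R = radii[OF assms]
  show "a10 g1 g2 g (R1 g1 g2 g) = 0" unfolding a10_def R(5) by simp
  show "a20 g1 g2 g (R2_minus g1 g2 g) = 0" unfolding a20_def R(6) by simp
  have "\<Gamma>0 g1 g2 g \<noteq> 0" using R(9) by simp
  then show "a20 g1 g2 g (R2_plus g1 g2 g) + g / g2 * a10 g1 g2 g (R2_plus g1 g2 g) = 0"
    using assms(1,2) by (simp add: a10_def a20_def R(4)[symmetric] \<Gamma>1_def \<Gamma>2_def field_simps)
qed

end

theory Submission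
  imports Defs "HOL-Real_Asymp.Real_Asymp"
begin

text \<open>
  Let \<open>A\<^sub>i\<close> be the limiting densities as functions of \<open>s = |x|\<^sup>2\<close> and \<open>W\<^sub>i = s + g\<^sub>i A\<^sub>i + g A\<^sub>j - \<lambda>\<^sub>i\<close>, so that \<open>W\<^sub>i \<ge> 0\<close> and
  \<open>W\<^sub>i A\<^sub>i = 0\<close>. Completing the square, the energy of \<open>(\<eta>\<^sub>1, \<eta>\<^sub>2)\<close> exceeds the limiting one by a kinetic term, a definite
  quadratic form in \<open>\<eta>\<^sub>i\<^sup>2 - A\<^sub>i\<close>, and \<open>\<integral>W\<^sub>i \<eta>\<^sub>i\<^sup>2\<close>; an explicit competitor bounds this excess by \<open>\<epsilon>\<^sup>2 |log \<epsilon>|\<close>, which gives the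
  multipliers up to \<open>\<epsilon>\<^bsup>2/3\<^esup>\<close>. Barriers on balls of radius \<open>\<epsilon>\<^bsup>2/3\<^esup>\<close> then yield \<open>|\<eta>\<^sub>i\<^sup>2 - A\<^sub>i| \<le> C \<epsilon>\<^bsup>2/3\<^esup>\<close> everywhere: the one-sided
  errors of the two components bound each other through a loop that contracts because \<open>g\<^sup>2 < g\<^sub>1 g\<^sub>2\<close>. The uniform,
  relative and exponential bounds follow. On fixed balls away from the interfaces the same barriers leave an error of the
  order of \<open>\<epsilon>\<^sup>2\<close> and of the error of the multipliers. The latter is found from two Pohozaev identities: the field \<open>x\<close>
  determines \<open>\<lambda>\<^sub>1 + \<lambda>\<^sub>2\<close>, and a field equal to \<open>x / |x|\<^sup>2\<close> outside a small disc, on which only \<open>\<eta>\<^sub>1\<close> is present, determines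
  \<open>\<lambda>\<^sub>1\<^sup>2\<close> up to \<open>\<epsilon>\<^sup>2 |log \<epsilon>|\<close>.
\<close>

text \<open>Two losses shape the argument. Testing an equation with its own solution gives a
  multiplier error that is linear in \<open>\<eta>\<^sup>2 - A\<close>, while the energy controls
  only the square of this difference; hence the first bound on the multipliers is merely the square
  root of the energy excess. A Pohozaev identity has the kinetic energy itself as remainder, so it
  keeps the full order of the excess. Two unknown multipliers call for two fields, and the second is
  chosen so that, apart from the masses, its contribution lives on a disc where the solution is
  explicit up to \<epsilon>^2. The other obstacle is the competitive coupling: raising one density
  lowers the other, so the two upper errors cannot be compared. The upper error of one component and
  the lower error of the other do form a pair of the right sign, and the loop is run twice with
  exchanged roles. The logarithm is the price of the edges: the square root of a density that
  vanishes linearly just fails to have a finite Dirichlet integral.\<close>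

abbreviation nsq :: "real^2 \<Rightarrow> real" where "nsq x \<equiv> (norm x)\<^sup>2"

abbreviation cplx :: "(real^2 \<Rightarrow> real) \<Rightarrow> real^2 \<Rightarrow> complex" where "cplx u \<equiv> complex_of_real \<circ> u"

section \<open>Calculus in the plane\<close>

lemma integral_lborel_shift:
  fixes f :: "real^2 \<Rightarrow> real"
  assumes "integrable lborel f"
  shows "(LINT x|lborel. f (x + a)) = (LINT x|lborel. f x)"
    and "integrable lborel (\<lambda>x. f (x + a))"
proof -
  have [measurable]: "f \<in> borel_measurable borel" using assms by auto
  have d: "distr lborel borel ((+) a) = (lborel :: (real^2) measure)"
    by (rule lborel_distr_plus)
  have "(LINT x|lborel. f x) = (LINT x|distr lborel borel ((+) a). f x)" by (simp add: d)
  also have "\<dots> = (LINT x|lborel. f (a + x))" by (subst integral_distr) auto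
  finally show "(LINT x|lborel. f (x + a)) = (LINT x|lborel. f x)" by (simp add: add.commute)
  have "integrable (distr lborel borel ((+) a)) f" using assms by (simp add: d)
  then have "integrable lborel (\<lambda>x. f (a + x))" by (subst (asm) integrable_distr_eq) auto
  then show "integrable lborel (\<lambda>x. f (x + a))" by (simp add: add.commute)
qed

text \<open>Translation invariance of the integral and dominated convergence of the difference quotients
  replace Fubini's theorem in this form of the fundamental theorem of calculus.\<close>

lemma integral_directional_derivative_zero:
  fixes f f' B :: "real^2 \<Rightarrow> real"
  assumes f: "integrable lborel f" and B: "integrable lborel B"
    and m: "f' \<in> borel_measurable lborel"
    and d: "AE x in lborel. ((\<lambda>t. f (x + t *\<^sub>R v)) has_real_derivative f' x) (at 0)"
    and b: "\<And>x t. 0 < t \<Longrightarrow> t \<le> 1 \<Longrightarrow> \<bar>f (x + t *\<^sub>R v) - f x\<bar> \<le> t * B x"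
  shows "integrable lborel f'" "(LINT x|lborel. f' x) = 0"
proof -
  define h where "h n = 1 / real (Suc n)" for n
  have h: "0 < h n" "h n \<le> 1" for n by (auto simp: h_def)
  have h0: "h \<longlonglongrightarrow> 0" unfolding h_def using LIMSEQ_inverse_real_of_nat by (simp add: inverse_eq_divide)
  define q where "q n x = (f (x + h n *\<^sub>R v) - f x) / h n" for n x
  have qi: "integrable lborel (q n)" and q0: "(LINT x|lborel. q n x) = 0" for n
    unfolding q_def using integral_lborel_shift[OF f, of "h n *\<^sub>R v"] f by auto
  have lim: "AE x in lborel. (\<lambda>n. q n x) \<longlonglongrightarrow> f' x"
  proof -
    have "(\<lambda>n. q n x) \<longlonglongrightarrow> f' x"
      if "((\<lambda>t. f (x + t *\<^sub>R v)) has_real_derivative f' x) (at 0)" for x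
    proof -
      have "((\<lambda>t. (f (x + t *\<^sub>R v) - f x) / t) \<longlongrightarrow> f' x) (at 0)"
        using that by (simp add: DERIV_def)
      then show ?thesis unfolding q_def
        by (rule filterlim_compose) (use h h0 in \<open>auto simp: filterlim_at intro!: always_eventually less_imp_neq[symmetric]\<close>)
    qed
    then show ?thesis using d by auto
  qed
  have bd: "AE x in lborel. norm (q n x) \<le> B x" for n
    using b[OF h(1)[of n] h(2)[of n]] h(1)[of n] by (auto simp: q_def field_simps)
  have [measurable]: "q n \<in> borel_measurable lborel" for n using qi by auto
  show "integrable lborel f'" 
    by (rule integrable_dominated_convergence[OF m _ B lim bd]) simp
  have "(\<lambda>n. LINT x|lborel. q n x) \<longlonglongrightarrow> (LINT x|lborel. f' x)"
    by (rule integral_dominated_convergence[OF m _ B lim bd]) simp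
  then show "(LINT x|lborel. f' x) = 0" by (simp add: q0 LIMSEQ_const_iff)
qed

text \<open>A disc of squared radius \<open>c\<close> has area \<open>pi * c\<close>, so in the
  variable \<open>s = |x|\<^sup>2\<close> plane measure is pi times length on the half-line: polar
  coordinates with constant weight. This is why the profile and all radial fields are written in
  \<open>s\<close> instead of the radius.\<close>

lemma distr_norm_square:
  "distr lborel borel (\<lambda>x::real^2. nsq x) = density lborel (\<lambda>s. ennreal (pi * indicator {0..} s))"
  (is "?M = ?N")
proof (rule measure_eqI_generator_eq[where E="range (\<lambda>(a,b). {a<..b::real})" and \<Omega>=UNIV and A="\<lambda>n. {- real n<..real n}"])
  show "Int_stable (range (\<lambda>(a, b). {a<..b::real}))"
    by (auto simp: Int_stable_def intro!: image_eqI[of _ _ "(max _ _, min _ _)"]) 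
  have *: "emeasure ?M {a<..b} = ennreal (pi * max 0 b - pi * max 0 a) \<and>
        emeasure ?N {a<..b} = ennreal (pi * max 0 b - pi * max 0 a)" if "a \<le> b" for a b
  proof
    have cb: "emeasure lborel {x::real^2. nsq x \<le> c} = ennreal (pi * max 0 c)" for c
    proof (cases "0 \<le> c")
      case True
      then have "{x::real^2. nsq x \<le> c} = cball 0 (sqrt c)"
        by (auto simp: real_le_rsqrt) (metis norm_ge_zero power_mono real_sqrt_pow2)
      then show ?thesis using True by (simp add: emeasure_cball unit_ball_vol_2)
    next
      case False
      then have "{x::real^2. nsq x \<le> c} = {}"
        by (auto simp: not_le) (metis not_less order_trans zero_le_power2 less_le_trans)
      then show ?thesis using False by simp
    qed
    have "emeasure ?M {a<..b} = emeasure lborel ({x::real^2. nsq x \<le> b} - {x. nsq x \<le> a})"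
      by (subst emeasure_distr) (auto intro!: arg_cong[where f="emeasure lborel"])
    also have "\<dots> = emeasure lborel {x::real^2. nsq x \<le> b} - emeasure lborel {x::real^2. nsq x \<le> a}"
      using that by (intro emeasure_Diff) (auto simp: cb)
    also have "\<dots> = ennreal (pi * max 0 b - pi * max 0 a)"
      unfolding cb by (subst ennreal_minus) auto
    finally show "emeasure ?M {a<..b} = ennreal (pi * max 0 b - pi * max 0 a)" .
    have "emeasure ?N {a<..b} = (\<integral>\<^sup>+s. ennreal pi * indicator {s \<in> {a<..b}. 0 \<le> s} s \<partial>lborel)"
      by (subst emeasure_density) (auto intro!: nn_integral_cong simp: indicator_def ennreal_mult)
    also have "\<dots> = ennreal pi * emeasure lborel {s \<in> {a<..b}. 0 \<le> s}"
      by (subst nn_integral_cmult_indicator) auto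
    also have "emeasure lborel {s \<in> {a<..b}. 0 \<le> s} = ennreal (max 0 b - max 0 a)"
    proof (cases "0 \<le> a")
      case True
      then have "{s \<in> {a<..b}. 0 \<le> s} = {a<..b}" by auto
      then show ?thesis using True that by simp
    next
      case False
      show ?thesis
      proof (cases "0 \<le> b")
        case True
        then have "{s \<in> {a<..b}. 0 \<le> s} = {0..b}" using False by auto
        then show ?thesis using True False by simp
      next
        case F: False
        then have "{s \<in> {a<..b}. 0 \<le> s} = {}" by auto
        moreover have "max 0 a = 0" "max 0 b = 0" using F False by auto
          ultimately show ?thesis by (metis diff_self emeasure_empty ennreal_0)
      qed
    qed
    finally show "emeasure ?N {a<..b} = ennreal (pi * max 0 b - pi * max 0 a)"
      using that by (simp add: ennreal_mult[symmetric] algebra_simps)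
  qed
  show "emeasure ?M X = emeasure ?N X" if "X \<in> range (\<lambda>(a, b). {a<..b::real})" for X
  proof -
    from that obtain a b where X: "X = {a<..b}" by auto
    show ?thesis using *[of a b] unfolding X by (cases "a \<le> b") auto
  qed
  show "sets ?M = sigma_sets UNIV (range (\<lambda>(a, b). {a<..b::real}))"
    "sets ?N = sigma_sets UNIV (range (\<lambda>(a, b). {a<..b::real}))"
    using borel_sigma_sets_Ioc by (auto simp: borel_sigma_sets_Ioc)
  show "emeasure ?M {- real i<..real i} \<noteq> \<infinity>" for i using *[of "- real i" "real i"] by auto
  show "range (\<lambda>n. {- real n<..real n}) \<subseteq> range (\<lambda>(a, b). {a<..b::real})" by auto
  show "(\<Union>n. {- real n<..real n}) = UNIV"
  proof -
    have "\<exists>n. x \<in> {- real n<..real n}" for x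
    proof -
      obtain n where "\<bar>x\<bar> < real n" using reals_Archimedean2 by blast
      then show ?thesis by (intro exI[of _ n]) auto
    qed
    then show ?thesis by auto
  qed
qed auto

lemma
  fixes h :: "real \<Rightarrow> real"
  assumes [measurable]: "h \<in> borel_measurable borel"
  shows integrable_norm_square_iff:
      "integrable lborel (\<lambda>x::real^2. h (nsq x)) \<longleftrightarrow> integrable lborel (\<lambda>s. indicator {0..} s * h s)"
    and integral_norm_square:
      "(LINT x|lborel. h (nsq x)) = pi * (LINT s|lborel. indicator {0..} s * h s)"
proof -
  have "integrable lborel (\<lambda>x::real^2. h (nsq x)) \<longleftrightarrow> integrable (distr lborel borel (\<lambda>x::real^2. nsq x)) h"
    by (subst integrable_distr_eq) auto
  also have "\<dots> \<longleftrightarrow> integrable lborel (\<lambda>s. pi * (indicator {0..} s * h s))"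
    unfolding distr_norm_square by (subst integrable_density) (auto simp: mult.assoc)
  also have "\<dots> \<longleftrightarrow> integrable lborel (\<lambda>s. indicator {0..} s * h s)" by simp
  finally show "integrable lborel (\<lambda>x::real^2. h (nsq x)) \<longleftrightarrow> integrable lborel (\<lambda>s. indicator {0..} s * h s)" .
  have "(LINT x|lborel. h (nsq x)) = integral\<^sup>L (distr lborel borel (\<lambda>x::real^2. nsq x)) h"
    by (subst integral_distr) auto
  also have "\<dots> = (LINT s|lborel. pi * (indicator {0..} s * h s))"
    unfolding distr_norm_square by (subst integral_density) (auto simp: mult.assoc)
  finally show "(LINT x|lborel. h (nsq x)) = pi * (LINT s|lborel. indicator {0..} s * h s)" by simp
qed

text \<open>Spheres are null sets. This covers radial functions that fail to be differentiable at
  finitely many radii, as the trial functions do at the knots of the profile.\<close>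

lemma AE_norm_square_notin_finite:
  assumes "finite S"
  shows "AE x::real^2 in lborel. nsq x \<notin> S"
proof -
  have "AE x::real^2 in lborel. nsq x \<noteq> c" for c
  proof -
    have "{x::real^2. nsq x = c} \<subseteq> sphere 0 (sqrt c)" by auto
    moreover have "sphere 0 (sqrt c) \<in> null_sets (lborel::(real^2) measure)"
      using negligible_sphere[of "0::real^2" "sqrt c"]
      by (auto simp: null_sets_completion_iff negligible_iff_null_sets)
    ultimately show ?thesis by (intro AE_I'[where N="sphere 0 (sqrt c)"]) auto
  qed
  then have "AE x::real^2 in lborel. \<forall>c\<in>S. nsq x \<noteq> c"
    using assms by (intro AE_finite_allI) auto
  then show ?thesis by (auto elim!: eventually_mono)
qed

section \<open>Derivatives along the axes and the classes \<open>C_k\<close>\<close>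

abbreviation has_axis_deriv :: "(real^2 \<Rightarrow> real) \<Rightarrow> real \<Rightarrow> 2 \<Rightarrow> real^2 \<Rightarrow> bool" where
  "has_axis_deriv f d i x \<equiv> ((\<lambda>t. f (x + t *\<^sub>R axis i 1)) has_real_derivative d) (at 0)"

lemma has_axis_deriv_shift:
  assumes "\<And>x. has_axis_deriv f (f' x) i x"
  shows "((\<lambda>t. f (x + t *\<^sub>R axis i 1)) has_real_derivative f' (x + t *\<^sub>R axis i 1)) (at t)"
proof -
  have "((\<lambda>s. f ((x + t *\<^sub>R axis i 1) + s *\<^sub>R axis i 1)) has_real_derivative f' (x + t *\<^sub>R axis i 1)) (at 0)"
    by (rule assms)
  then have "((\<lambda>s. f (x + (s + t) *\<^sub>R axis i 1)) has_real_derivative f' (x + t *\<^sub>R axis i 1)) (at 0)"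
    by (simp add: algebra_simps)
  then show ?thesis
    using DERIV_shift[of "\<lambda>s. f (x + s *\<^sub>R axis i 1)" "f' (x + t *\<^sub>R axis i 1)" 0 t] by simp
qed

text \<open>Links \<open>partial_deriv\<close>, defined through the Frechet derivative, to the
  one-variable derivative along the axis. Later calculus is done with the latter, to which the usual
  \<open>DERIV\<close> rules apply and which also makes sense for the trial functions.\<close>

lemma has_axis_deriv_partial_deriv:
  assumes "f differentiable (at x)"
  shows "has_axis_deriv f (partial_deriv i f x) i x"
proof -
  have f: "(f has_derivative frechet_derivative f (at x)) (at x)"
    using assms by (simp add: frechet_derivative_works)
  have l: "linear (frechet_derivative f (at x))" using assms by (rule linear_frechet_derivative)
  have "((\<lambda>t. x + t *\<^sub>R axis i 1) has_derivative (\<lambda>t. t *\<^sub>R axis i (1::real))) (at 0)"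
    by (auto intro!: derivative_eq_intros)
  then have "(f \<circ> (\<lambda>t. x + t *\<^sub>R axis i 1) has_derivative frechet_derivative f (at x) \<circ> (\<lambda>t. t *\<^sub>R axis i 1)) (at 0)"
    by (intro diff_chain_at) (use f in auto)
  moreover have "frechet_derivative f (at x) \<circ> (\<lambda>t. t *\<^sub>R axis i 1) = (*) (partial_deriv i f x)"
    by (auto simp: o_def partial_deriv_def linear_cmul[OF l])
  ultimately show ?thesis by (simp add: has_field_derivative_def o_def)
qed

lemma partial_deriv_eq:
  assumes "f differentiable (at x)" "has_axis_deriv f d i x"
  shows "partial_deriv i f x = d"
  using has_axis_deriv_partial_deriv[OF assms(1)] assms(2) DERIV_unique by blast

lemma C_k_Suc_D: "C_k (Suc k) f \<Longrightarrow> C_k k f"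
proof (induction k arbitrary: f)
  case 0
  then have "isCont f x" for x by (simp add: differentiable_imp_continuous_within)
  then show ?case by (simp add: continuous_at_imp_continuous_on)
next
  case (Suc k)
  from Suc.prems have "\<And>x. f differentiable (at x)" "\<And>i. C_k (Suc k) (partial_deriv i f)"
    by (simp_all only: C_k.simps(2)[of "Suc k"])
  with Suc.IH show ?case by (simp only: C_k.simps(2)[of k] simp_thms)
qed

lemma C_k_continuous: "C_k k f \<Longrightarrow> continuous_on UNIV f"
proof (induction k)
  case (Suc k)
  then show ?case using C_k_Suc_D[of k f] by blast
qed simp

lemma C_k_add: "C_k k f \<Longrightarrow> C_k k g \<Longrightarrow> C_k k (\<lambda>x. f x + g x)"
proof (induction k arbitrary: f g)
  case 0
  then show ?case by (auto intro: continuous_intros)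
next
  case (Suc k)
  have "partial_deriv i (\<lambda>x. f x + g x) = (\<lambda>x. partial_deriv i f x + partial_deriv i g x)" for i
    
  proof
    fix x
    have df: "f differentiable (at x)" "g differentiable (at x)" using Suc.prems by auto
    show "partial_deriv i (\<lambda>x. f x + g x) x = partial_deriv i f x + partial_deriv i g x"
      using DERIV_add[OF has_axis_deriv_partial_deriv[OF df(1)] has_axis_deriv_partial_deriv[OF df(2)], of i i]
      by (intro partial_deriv_eq) (use df in auto)
  qed
  then show ?case using Suc by auto
qed

lemma C_k_mult: "C_k k f \<Longrightarrow> C_k k g \<Longrightarrow> C_k k (\<lambda>x. f x * g x)"
proof (induction k arbitrary: f g)
  case 0
  then show ?case by (auto intro: continuous_intros)
next
  case (Suc k)
  have df: "f differentiable (at x)" "g differentiable (at x)" for x using Suc.prems by auto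
  have "partial_deriv i (\<lambda>x. f x * g x) = (\<lambda>x. f x * partial_deriv i g x + partial_deriv i f x * g x)" for i
  proof
    fix x
    have "has_axis_deriv (\<lambda>x. f x * g x) (f x * partial_deriv i g x + partial_deriv i f x * g x) i x"
      using DERIV_mult[OF has_axis_deriv_partial_deriv[OF df(1)] has_axis_deriv_partial_deriv[OF df(2)], of x i x i]
      by (simp add: algebra_simps)
    then show "partial_deriv i (\<lambda>x. f x * g x) x = f x * partial_deriv i g x + partial_deriv i f x * g x"
      by (intro partial_deriv_eq) (use df in auto)
  qed
  moreover have "C_k k (\<lambda>x. f x * partial_deriv i g x + partial_deriv i f x * g x)" for i
    using Suc.prems C_k_Suc_D[of k f] C_k_Suc_D[of k g] by (intro C_k_add Suc.IH) auto
  ultimately show ?case using df by auto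
qed

text \<open>\<open>F n\<close> is the \<open>n\<close>-th derivative of one function of one
  variable. A partial derivative of \<open>c * F n (a * x $ j + b)\<close> is either zero or the
  same expression with \<open>n\<close> raised and \<open>c\<close> multiplied by \<open>a\<close>,
  so arbitrary \<open>c\<close> and \<open>n\<close> make the induction on \<open>k\<close>
  close.\<close>

lemma C_k_coordinate:
  fixes F :: "nat \<Rightarrow> real \<Rightarrow> real"
  assumes F: "\<And>n t. (F n has_real_derivative F (Suc n) t) (at t)"
  shows "C_k k (\<lambda>x. c * F n (a * x $ j + b))"
proof (induction k arbitrary: n c)
  case 0
  have "continuous_on UNIV (F n)" for n using F by (auto intro!: DERIV_continuous_on)
  then have "continuous_on UNIV (\<lambda>x::real^2. F n (a * x $ j + b))"
    by (rule continuous_on_compose2) (auto intro!: continuous_intros)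
  then show ?case by (auto intro!: continuous_intros)
next
  case (Suc k)
  have dx: "((\<lambda>x. c * F n (a * x $ j + b)) has_derivative (\<lambda>h. c * (F (Suc n) (a * x $ j + b) * (a * h $ j)))) (at x)" for x :: "real^2"
  proof -
    have "((\<lambda>x::real^2. a * x $ j + b) has_derivative (\<lambda>h. a * h $ j)) (at x)"
      by (auto intro!: derivative_eq_intros bounded_linear.has_derivative[OF bounded_linear_vec_nth])
    then have "(F n \<circ> (\<lambda>x::real^2. a * x $ j + b) has_derivative (*) (F (Suc n) (a * x $ j + b)) \<circ> (\<lambda>h. a * h $ j)) (at x)"
      by (intro diff_chain_at) (use F in \<open>auto simp: has_field_derivative_def\<close>)
    then show ?thesis by (auto simp: o_def intro!: derivative_eq_intros)
  qed
  have "partial_deriv i (\<lambda>x. c * F n (a * x $ j + b)) = (\<lambda>x. (c * a * (if i = j then 1 else 0)) * F (Suc n) (a * x $ j + b))" for i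
    using frechet_derivative_at[OF dx, symmetric]
    by (auto simp: partial_deriv_def fun_eq_iff axis_def)
  moreover have "(\<lambda>x. c * F n (a * x $ j + b)) differentiable (at x)" for x :: "real^2"
    using dx by (rule differentiableI)
  ultimately show ?case using Suc by simp
qed

lemma C_k_2D:
  assumes "C_k 2 f"
  shows "f differentiable (at x)" "partial_deriv i f differentiable (at x)"
    "continuous_on UNIV f" "continuous_on UNIV (partial_deriv i f)"
    "continuous_on UNIV (partial_deriv j (partial_deriv i f))"
    "has_axis_deriv f (partial_deriv i f x) i x"
    "has_axis_deriv (partial_deriv i f) (partial_deriv j (partial_deriv i f) x) j x"
proof -
  have *: "C_k (Suc (Suc 0)) f" using assms by (simp add: numeral_2_eq_2)
  then show "f differentiable (at x)" "partial_deriv i f differentiable (at x)"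
    "continuous_on UNIV (partial_deriv j (partial_deriv i f))" by auto
  then show "has_axis_deriv f (partial_deriv i f x) i x"
    "has_axis_deriv (partial_deriv i f) (partial_deriv j (partial_deriv i f) x) j x"
    by (auto intro: has_axis_deriv_partial_deriv)
  show "continuous_on UNIV f" using assms C_k_continuous by blast
  have "C_k (Suc 0) (partial_deriv i f)" using * by auto
  then show "continuous_on UNIV (partial_deriv i f)" by (rule C_k_continuous)
qed

text \<open>The mean value theorem is applied first to the difference in direction \<open>j\<close>
  as a function along \<open>i\<close>, then to the resulting difference of partial derivatives
  along \<open>j\<close>.\<close>

lemma mixed_difference_mvt:
  fixes f :: "real^2 \<Rightarrow> real"
  assumes f: "C_k 2 f" and h: "0 < h"
  shows "\<exists>s t. 0 < s \<and> s < h \<and> 0 < t \<and> t < h \<and>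
    f (x + h *\<^sub>R axis i 1 + h *\<^sub>R axis j 1) - f (x + h *\<^sub>R axis i 1) - f (x + h *\<^sub>R axis j 1) + f x
      = h * h * partial_deriv j (partial_deriv i f) (x + s *\<^sub>R axis i 1 + t *\<^sub>R axis j 1)"
proof -
  define ei ej where e: "ei = (axis i 1 :: real^2)" "ej = (axis j 1 :: real^2)"
  define p where "p = partial_deriv i f"
  define p' where "p' = partial_deriv j p"
  define u where "u s = f (x + h *\<^sub>R ej + s *\<^sub>R ei) - f (x + s *\<^sub>R ei)" for s
  have "(u has_real_derivative p (x + h *\<^sub>R ej + s *\<^sub>R ei) - p (x + s *\<^sub>R ei)) (at s)" for s
    unfolding u_def p_def e
    by (rule DERIV_diff[OF has_axis_deriv_shift[OF C_k_2D(6)[OF f]] has_axis_deriv_shift[OF C_k_2D(6)[OF f]]])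
  from MVT2[OF h, of u "\<lambda>s. p (x + h *\<^sub>R ej + s *\<^sub>R ei) - p (x + s *\<^sub>R ei)", OF this] obtain s where s: "0 < s" "s < h"
    "u h - u 0 = h * (p (x + h *\<^sub>R ej + s *\<^sub>R ei) - p (x + s *\<^sub>R ei))" by auto
  define y where "y = x + s *\<^sub>R ei"
  have "((\<lambda>t. p (y + t *\<^sub>R ej)) has_real_derivative p' (y + t *\<^sub>R ej)) (at t)" for t
    unfolding p'_def p_def e by (rule has_axis_deriv_shift[OF C_k_2D(7)[OF f]])
  from MVT2[OF h, of "\<lambda>t. p (y + t *\<^sub>R ej)" "\<lambda>t. p' (y + t *\<^sub>R ej)", OF this] obtain t where t: "0 < t" "t < h" "p (y + h *\<^sub>R ej) - p y = h * p' (y + t *\<^sub>R ej)" by auto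
  have c: "x + h *\<^sub>R ej + r *\<^sub>R ei = x + r *\<^sub>R ei + h *\<^sub>R ej" for r by (simp only: add_ac)
  have "u h - u 0 = h * h * p' (y + t *\<^sub>R ej)"
    using s(3) t(3) unfolding c y_def by simp
  moreover have "u h - u 0 = f (x + h *\<^sub>R ei + h *\<^sub>R ej) - f (x + h *\<^sub>R ei) - f (x + h *\<^sub>R ej) + f x"
    unfolding u_def c by simp
  ultimately have "f (x + h *\<^sub>R ei + h *\<^sub>R ej) - f (x + h *\<^sub>R ei) - f (x + h *\<^sub>R ej) + f x
      = h * h * p' (x + s *\<^sub>R ei + t *\<^sub>R ej)" unfolding y_def by linarith
  then show ?thesis unfolding e p_def p'_def using s(1,2) t(1,2) by blast
qed

text \<open>Schwarz's theorem: the second difference is symmetric in \<open>i\<close> and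
  \<open>j\<close>, and its quotient by \<open>h * h\<close> tends to either mixed derivative by
  their continuity. The divergence of the stress tensor below relies on it.\<close>

lemma partial_deriv_commute:
  assumes f: "C_k 2 f"
  shows "partial_deriv i (partial_deriv j f) x = partial_deriv j (partial_deriv i f) x"
proof -
  define h where "h n = 1 / real (Suc n)" for n
  have h: "0 < h n" for n by (simp add: h_def)
  have h0: "h \<longlonglongrightarrow> 0" unfolding h_def using LIMSEQ_inverse_real_of_nat by (simp add: inverse_eq_divide)
  define e where "e i = (axis i 1 :: real^2)" for i :: 2
  define R where "R i j n = f (x + h n *\<^sub>R e i + h n *\<^sub>R e j) - f (x + h n *\<^sub>R e i)
      - f (x + h n *\<^sub>R e j) + f x" for i j n
  have *: "(\<lambda>n. R i j n / (h n * h n)) \<longlonglongrightarrow> partial_deriv j (partial_deriv i f) x" for i j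
  proof -
    have "\<exists>p. 0 < fst p \<and> fst p < h n \<and> 0 < snd p \<and> snd p < h n \<and>
       R i j n = h n * h n * partial_deriv j (partial_deriv i f) (x + fst p *\<^sub>R e i + snd p *\<^sub>R e j)" for n
    proof -
      obtain s t where "0 < s \<and> s < h n \<and> 0 < t \<and> t < h n \<and>
       R i j n = h n * h n * partial_deriv j (partial_deriv i f) (x + s *\<^sub>R e i + t *\<^sub>R e j)"
        unfolding R_def e_def using mixed_difference_mvt[OF f h[of n], of x i j] by blast
      then show ?thesis by (intro exI[of _ "(s, t)"]) (simp only: fst_conv snd_conv)
    qed
    then have "\<forall>n. \<exists>p. 0 < fst p \<and> fst p < h n \<and> 0 < snd p \<and> snd p < h n \<and>
       R i j n = h n * h n * partial_deriv j (partial_deriv i f) (x + fst p *\<^sub>R e i + snd p *\<^sub>R e j)" by (rule allI)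
    from choice[OF this] obtain p where p: "\<forall>n. 0 < fst (p n) \<and> fst (p n) < h n \<and> 0 < snd (p n) \<and> snd (p n) < h n \<and>
       R i j n = h n * h n * partial_deriv j (partial_deriv i f) (x + fst (p n) *\<^sub>R e i + snd (p n) *\<^sub>R e j)" ..
    define s where "s n = fst (p n)" for n
    define t where "t n = snd (p n)" for n
    have st: "0 < s n" "s n < h n" "0 < t n" "t n < h n"
      "R i j n = h n * h n * partial_deriv j (partial_deriv i f) (x + s n *\<^sub>R e i + t n *\<^sub>R e j)" for n
      using spec[OF p, of n] unfolding s_def t_def by (simp_all only: simp_thms)
    have s0: "s \<longlonglongrightarrow> 0"
      by (rule tendsto_sandwich[OF _ _ tendsto_const h0]) (auto intro!: always_eventually less_imp_le[OF st(1)] less_imp_le[OF st(2)])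
    have t0: "t \<longlonglongrightarrow> 0"
      by (rule tendsto_sandwich[OF _ _ tendsto_const h0]) (auto intro!: always_eventually less_imp_le[OF st(3)] less_imp_le[OF st(4)])
    have "(\<lambda>n. x + s n *\<^sub>R e i + t n *\<^sub>R e j) \<longlonglongrightarrow> x + 0 *\<^sub>R e i + 0 *\<^sub>R e j"
      by (intro tendsto_intros s0 t0)
    then have "(\<lambda>n. x + s n *\<^sub>R e i + t n *\<^sub>R e j) \<longlonglongrightarrow> x" by simp
    moreover have "isCont (partial_deriv j (partial_deriv i f)) x"
      using C_k_2D(5)[OF f, of j i] by (simp add: continuous_on_eq_continuous_at)
    ultimately have "(\<lambda>n. partial_deriv j (partial_deriv i f) (x + s n *\<^sub>R e i + t n *\<^sub>R e j)) \<longlonglongrightarrow> partial_deriv j (partial_deriv i f) x"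
      by (rule isCont_tendsto_compose[rotated])
    moreover have "R i j n / (h n * h n) = partial_deriv j (partial_deriv i f) (x + s n *\<^sub>R e i + t n *\<^sub>R e j)" for n
      unfolding st(5) using h[of n] by simp
    ultimately show ?thesis by simp
  qed
  have "R j i n = R i j n" for n
  proof -
    have "x + h n *\<^sub>R e j + h n *\<^sub>R e i = x + h n *\<^sub>R e i + h n *\<^sub>R e j" by (simp only: add_ac)
    then show ?thesis unfolding R_def by (simp only:)
  qed
  then have "R j i = R i j" by (rule ext)
  with *[of j i] have "(\<lambda>n. R i j n / (h n * h n)) \<longlonglongrightarrow> partial_deriv i (partial_deriv j f) x" by (simp only:)
  then show ?thesis using *[of i j] by (rule LIMSEQ_unique)
qed

section \<open>The divergence theorem on the whole plane\<close>

lemma continuous_bounded_on_cball: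
  fixes f :: "real^2 \<Rightarrow> real"
  assumes "continuous_on UNIV f"
  shows "\<exists>M>0. \<forall>x. norm x \<le> R \<longrightarrow> \<bar>f x\<bar> \<le> M"
proof -
  have "continuous_on (cball 0 R) f" using assms by (rule continuous_on_subset) simp
  then have "bounded (f ` cball 0 R)"
    using compact_cball compact_continuous_image compact_imp_bounded by blast
  then show ?thesis by (auto simp: bounded_pos)
qed

lemma integral_axis_deriv_compact_support:
  assumes d: "\<And>x. has_axis_deriv f (f' x) i x"
    and c: "continuous_on UNIV f" "continuous_on UNIV f'"
    and z: "\<And>x. norm x > R \<Longrightarrow> f x = 0" "\<And>x. norm x > R \<Longrightarrow> f' x = 0"
  shows "(LINT x|lborel. f' x) = 0"
proof -
  obtain M where M: "\<And>x. norm x \<le> R \<Longrightarrow> \<bar>f' x\<bar> \<le> M" "0 < M"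
    using continuous_bounded_on_cball[OF c(2), of R] by blast
  then have M': "\<bar>f' x\<bar> \<le> M" for x using z(2)[of x] by (cases "norm x \<le> R") auto
  have int: "integrable lborel (\<lambda>x::real^2. c * indicator (cball 0 r) x)" for c r :: real
    by (intro integrable_mult_right integrable_real_indicator) (use emeasure_lborel_cball_finite[of 0 r] in auto)
  have [measurable]: "f \<in> borel_measurable borel" "f' \<in> borel_measurable borel"
    using c by (auto intro: borel_measurable_continuous_onI)
  obtain N where N: "\<And>x. norm x \<le> R \<Longrightarrow> \<bar>f x\<bar> \<le> N" "0 < N"
    using continuous_bounded_on_cball[OF c(1), of R] by blast
  have fi: "integrable lborel f"
    by (rule Bochner_Integration.integrable_bound[OF int[of N R]])
      (use N z(1) in \<open>auto simp: indicator_def not_le intro!: AE_I2\<close>)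
  show ?thesis
  \<comment> \<open>For steps \<open>t \<le> 1\<close> the difference quotients vanish outside the
    ball of radius \<open>R + 1\<close>, so a multiple of its indicator dominates them.\<close>
  proof (rule integral_directional_derivative_zero(2)[OF fi int[of M "R + 1"]])
    show "AE x in lborel. has_axis_deriv f (f' x) i x" using d by simp
    fix x :: "real^2" and t :: real assume t: "0 < t" "t \<le> 1"
    obtain s where s: "0 < s" "s < t"
      "f (x + t *\<^sub>R axis i 1) - f (x + 0 *\<^sub>R axis i 1) = (t - 0) * f' (x + s *\<^sub>R axis i 1)"
      using MVT2[OF t(1), of "\<lambda>t. f (x + t *\<^sub>R axis i 1)" "\<lambda>t. f' (x + t *\<^sub>R axis i 1)"]
        has_axis_deriv_shift[OF d] by blast
    show "\<bar>f (x + t *\<^sub>R axis i 1) - f x\<bar> \<le> t * (M * indicator (cball 0 (R + 1)) x)"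
    proof (cases "norm x \<le> R + 1")
      case True
      then show ?thesis using s M'[of "x + s *\<^sub>R axis i 1"] t by (simp add: abs_mult)
    next
      case False
      have "norm x \<le> norm (x + s *\<^sub>R axis i 1) + norm (s *\<^sub>R axis i (1::real) :: real^2)"
        using norm_triangle_ineq4[of "x + s *\<^sub>R axis i 1" "s *\<^sub>R axis i (1::real) :: real^2"] by simp
      then have "f' (x + s *\<^sub>R axis i 1) = 0" using False s t by (intro z(2)) simp
      then show ?thesis using s t M(2) by simp
    qed
  qed simp
qed



text \<open>Squaring removes the kink of the positive part, so that the cutoff
  \<open>(max 0 (1 - |x|\<^sup>2 / N\<^sup>2))\<^sup>2\<close> is continuously differentiable with
  an explicit derivative.\<close>

lemma has_real_derivative_pos_part_square:
  "((\<lambda>u. (max 0 u)\<^sup>2) has_real_derivative 2 * max 0 u) (at u)" for u :: real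
proof (cases "u = 0")
  case True
  have "((\<lambda>h. (max 0 h)\<^sup>2 / h) \<longlongrightarrow> 0) (at (0::real))"
  proof (rule tendsto_rabs_zero_cancel, rule tendsto_sandwich[OF _ _ tendsto_const])
    show "((\<lambda>h. \<bar>h\<bar>) \<longlongrightarrow> 0) (at (0::real))" by (auto intro!: tendsto_eq_intros)
    show "\<forall>\<^sub>F h in at (0::real). \<bar>(max 0 h)\<^sup>2 / h\<bar> \<le> \<bar>h\<bar>"
      by (auto intro!: always_eventually simp: max_def power2_eq_square)
  qed auto
  then show ?thesis using True by (simp add: DERIV_def)
next
  case False
  then consider "u > 0" | "u < 0" by linarith
  then show ?thesis
  proof cases
    case 1
    have "((\<lambda>u. u\<^sup>2) has_real_derivative 2 * max 0 u) (at u)"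
      using 1 by (auto intro!: derivative_eq_intros)
    then show ?thesis
      by (rule has_field_derivative_transform_within_open[where S="{0<..}"]) (use 1 in auto)
  next
    case 2
    have "((\<lambda>u. 0) has_real_derivative 2 * max 0 u) (at u)"
      using 2 by (auto intro!: derivative_eq_intros)
    then show ?thesis
      by (rule has_field_derivative_transform_within_open[where S="{..<0}"]) (use 2 in auto)
  qed
qed

lemma norm_square_axis:
  fixes x :: "real^2"
  shows "(norm (x + t *\<^sub>R axis i 1))\<^sup>2 = nsq x + 2 * t * x $ i + t\<^sup>2"
proof -
  have v: "x \<bullet> (t *\<^sub>R axis i 1) = t * x $ i" "(t *\<^sub>R axis i 1) \<bullet> (t *\<^sub>R axis i (1::real) :: real^2) = t\<^sup>2"
    by (simp_all add: inner_axis power2_eq_square)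
  have "(norm (x + t *\<^sub>R axis i 1))\<^sup>2 = nsq x + (norm (t *\<^sub>R axis i (1::real) :: real^2))\<^sup>2 + 2 * (x \<bullet> (t *\<^sub>R axis i 1))"
    using dot_norm[of x "t *\<^sub>R axis i 1"] by simp
  then show ?thesis unfolding v by (simp add: power_mult_distrib)
qed

lemma has_axis_deriv_norm_square: "has_axis_deriv (\<lambda>x. nsq x) (2 * x $ i) i x"
  unfolding norm_square_axis by (auto intro!: derivative_eq_intros)

lemma has_axis_deriv_radial:
  assumes "(h has_real_derivative d) (at (nsq x))"
  shows "has_axis_deriv (\<lambda>x. h (nsq x)) (d * (2 * x $ i)) i x"
  using DERIV_chain2[of h d "\<lambda>t. (norm (x + t *\<^sub>R axis i 1))\<^sup>2" 0, OF _ has_axis_deriv_norm_square[of x i]] assms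
  by simp

lemma abs_component_le_norm: "\<bar>x $ i\<bar> \<le> norm x" for x :: "real^2"
  using component_le_norm_cart[of x i] by simp

text \<open>The cutoffs below have gradient of size \<open>norm x / R\<^sup>2\<close> on their support, so a field of linear growth
  against an integrable weight has vanishing flux at infinity.\<close>

lemma integral_divergence_zero:
  fixes F D :: "2 \<Rightarrow> real^2 \<Rightarrow> real"
  assumes d: "\<And>i x. has_axis_deriv (F i) (D i x) i x"
    and c: "\<And>i. continuous_on UNIV (F i)" "\<And>i. continuous_on UNIV (D i)"
    and w: "integrable lborel w" and Fw: "\<And>i x. \<bar>F i x\<bar> \<le> (1 + norm x) * w x"
    and g: "integrable lborel (\<lambda>x. \<Sum>i\<in>UNIV. D i x)"
  shows "(LINT x|lborel. (\<Sum>i\<in>UNIV. D i x)) = 0"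
proof -
  define N where "N n = real (Suc n)" for n
  have N1: "1 \<le> N n" for n by (simp add: N_def)
  define q where "q n = 1 / (N n)\<^sup>2" for n
  define u where "u n x = 1 - q n * nsq x" for n and x :: "real^2"
  define cf where "cf n x = (max 0 (u n x))\<^sup>2" for n and x :: "real^2"
  define cf' where "cf' i n x = 2 * max 0 (u n x) * (- 2 * x $ i * q n)" for i n and x :: "real^2"
  have uneg: "u n x < 0" if "norm x > N n" for n x
  proof -
    have "(N n)\<^sup>2 < nsq x" using that N1[of n] by (intro power_strict_mono) auto
    then show ?thesis using N1[of n] by (simp add: u_def q_def divide_simps)
  qed
  have dchi: "has_axis_deriv (cf n) (cf' i n x) i x" for n i x
  proof -
    have "((\<lambda>s. (max 0 (1 - q n * s))\<^sup>2) has_real_derivative 2 * max 0 (1 - q n * nsq x) * (- q n)) (at (nsq x))"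
      by (rule DERIV_chain2[OF has_real_derivative_pos_part_square])
        (auto intro!: derivative_eq_intros)
    from has_axis_deriv_radial[OF this] show ?thesis by (simp add: cf_def cf'_def u_def mult_ac)
  qed
  have cu: "continuous_on UNIV (u n)" for n
    unfolding u_def by (intro continuous_intros)
  have cchi: "continuous_on UNIV (cf n)" "continuous_on UNIV (cf' i n)" for n i
    unfolding cf_def cf'_def by (intro continuous_intros cu)+
  have z: "cf n x = 0" "cf' i n x = 0" if "norm x > N n" for n i x
    using uneg[OF that] by (auto simp: cf_def cf'_def max_def)
  have cut: "(LINT x|lborel. cf n x * D i x + F i x * cf' i n x) = 0" for i n
  proof (rule integral_axis_deriv_compact_support[where f="\<lambda>x. cf n x * F i x" and R="N n"])
    show "has_axis_deriv (\<lambda>x. cf n x * F i x) (cf n x * D i x + F i x * cf' i n x) i x" for x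
      using DERIV_mult[OF dchi[of n x i] d[of i x]] by (simp add: algebra_simps)
  qed (auto intro!: continuous_intros cchi c simp: z)
  have [measurable]: "F i \<in> borel_measurable borel" "D i \<in> borel_measurable borel"
    "cf n \<in> borel_measurable borel" "cf' i n \<in> borel_measurable borel" for i n
    using c cchi by (auto intro: borel_measurable_continuous_onI)
  have [measurable]: "w \<in> borel_measurable borel" using w by auto
  have intchi: "integrable lborel (\<lambda>x. cf n x * D i x)" "integrable lborel (\<lambda>x. F i x * cf' i n x)" for i n
  proof -
    have *: "integrable lborel h" if h: "continuous_on UNIV h" "\<And>x. norm x > N n \<Longrightarrow> h x = 0" for h :: "real^2 \<Rightarrow> real"
    proof -
      have "integrable lborel (\<lambda>x. indicator (cball 0 (N n)) x *\<^sub>R h x)"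
        by (rule borel_integrable_compact) (auto intro: continuous_on_subset[OF h(1)])
      moreover have "(\<lambda>x. indicator (cball 0 (N n)) x *\<^sub>R h x) = h"
        using h(2) by (auto simp: indicator_def fun_eq_iff not_le)
      ultimately show ?thesis by simp
    qed
    show "integrable lborel (\<lambda>x. cf n x * D i x)" "integrable lborel (\<lambda>x. F i x * cf' i n x)"
      by (auto intro!: * continuous_intros cchi c simp: z)
  qed
  have eq: "(LINT x|lborel. cf n x * (\<Sum>i\<in>UNIV. D i x)) = - (\<Sum>i\<in>UNIV. LINT x|lborel. F i x * cf' i n x)" for n
  proof -
    have "(LINT x|lborel. cf n x * (\<Sum>i\<in>UNIV. D i x)) = (\<Sum>i\<in>UNIV. LINT x|lborel. cf n x * D i x)"
      unfolding sum_distrib_left by (rule Bochner_Integration.integral_sum) (rule intchi)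
    also have "\<dots> = (\<Sum>i\<in>UNIV. - (LINT x|lborel. F i x * cf' i n x))"
      using cut[of n] intchi by (intro sum.cong) (auto simp: add_eq_0_iff2)
    finally show ?thesis by (simp add: sum_negf)
  qed
  have u1: "u n x \<le> 1" for n x by (simp add: u_def q_def)
  have Nlim: "(\<lambda>n. c / (N n)\<^sup>2) \<longlonglongrightarrow> 0" for c :: real unfolding N_def by real_asymp
  have ulim: "(\<lambda>n. u n x) \<longlonglongrightarrow> 1" for x
    unfolding u_def q_def using tendsto_diff[OF tendsto_const[of 1] Nlim[of "nsq x"]] by simp
  have L1: "(\<lambda>n. LINT x|lborel. cf n x * (\<Sum>i\<in>UNIV. D i x)) \<longlonglongrightarrow> (LINT x|lborel. (\<Sum>i\<in>UNIV. D i x))"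
  proof (rule integral_dominated_convergence[where w="\<lambda>x. \<bar>\<Sum>i\<in>UNIV. D i x\<bar>"])
    show "integrable lborel (\<lambda>x. \<bar>\<Sum>i\<in>UNIV. D i x\<bar>)" using g by simp
    show "AE x in lborel. norm (cf n x * (\<Sum>i\<in>UNIV. D i x)) \<le> \<bar>\<Sum>i\<in>UNIV. D i x\<bar>" for n
    proof (rule AE_I2)
      fix x
      have "cf n x \<le> 1" "0 \<le> cf n x" using u1[of n x] by (auto simp: cf_def power_le_one)
      then show "norm (cf n x * (\<Sum>i\<in>UNIV. D i x)) \<le> \<bar>\<Sum>i\<in>UNIV. D i x\<bar>"
        by (simp add: abs_mult mult_left_le_one_le)
    qed
    have "(\<lambda>n. cf n x * (\<Sum>i\<in>UNIV. D i x)) \<longlonglongrightarrow> (max 0 1)\<^sup>2 * (\<Sum>i\<in>UNIV. D i x)" for x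
      unfolding cf_def by (intro tendsto_intros ulim)
    then show "AE x in lborel. (\<lambda>n. cf n x * (\<Sum>i\<in>UNIV. D i x)) \<longlonglongrightarrow> (\<Sum>i\<in>UNIV. D i x)" by simp
  qed measurable
  have b': "\<bar>cf' i n x\<bar> \<le> (if norm x \<le> N n then 4 * norm x / (N n)\<^sup>2 else 0)" for i n x
  proof (cases "norm x \<le> N n")
    case True
    have "\<bar>cf' i n x\<bar> = 4 * max 0 (u n x) * (\<bar>x $ i\<bar> / (N n)\<^sup>2)"
      by (simp add: cf'_def q_def abs_mult)
    also have "\<dots> \<le> 4 * 1 * (norm x / (N n)\<^sup>2)"
      using u1[of n x] abs_component_le_norm[of x i] by (intro mult_mono divide_right_mono) auto
    finally show ?thesis using True by simp
  qed (use z in auto)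
  \<comment> \<open>On the support of the cutoff \<open>norm x \<le> N n\<close>, so
    \<open>(1 + norm x) * norm x \<le> 2 * (N n)\<^sup>2\<close>; the factor
    \<open>4 / (N n)\<^sup>2\<close> of the gradient absorbs this and leaves the dominating function
    \<open>8 * w\<close>.\<close>
  have L2: "(\<lambda>n. LINT x|lborel. F i x * cf' i n x) \<longlonglongrightarrow> (LINT x|(lborel::(real^2) measure). 0)" for i
  proof (rule integral_dominated_convergence[where w="\<lambda>x. 8 * w x"])
    show "integrable lborel (\<lambda>x. 8 * w x)" using w by simp
    have w0: "0 \<le> w x" for x
    proof -
      have "0 \<le> (1 + norm x) * w x" using Fw[of i x] by linarith
      then show ?thesis by (simp add: zero_le_mult_iff) (smt (verit) norm_ge_zero)
    qed
    show "AE x in lborel. norm (F i x * cf' i n x) \<le> 8 * w x" for n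
    proof (rule AE_I2)
      fix x
      show "norm (F i x * cf' i n x) \<le> 8 * w x"
      proof (cases "norm x \<le> N n")
        case True
        have "norm (F i x * cf' i n x) \<le> ((1 + norm x) * w x) * (4 * norm x / (N n)\<^sup>2)"
          unfolding real_norm_def abs_mult using Fw[of i x] b'[of i n x] True by (intro mult_mono) auto
        also have "\<dots> = ((1 + norm x) * norm x) * (4 * w x / (N n)\<^sup>2)" by simp
        also have "\<dots> \<le> ((N n + N n) * N n) * (4 * w x / (N n)\<^sup>2)"
          using True N1[of n] w0[of x] by (intro mult_right_mono mult_mono) auto
        also have "\<dots> = 8 * w x" using N1[of n] by (simp add: power2_eq_square)
        finally show ?thesis .
      qed (use w0 z in auto)
    qed
    have "(\<lambda>n. F i x * cf' i n x) \<longlonglongrightarrow> 0" for x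
    proof -
      have "(\<lambda>n. cf' i n x) \<longlonglongrightarrow> 0"
      proof (rule tendsto_rabs_zero_cancel, rule tendsto_sandwich[OF _ _ tendsto_const Nlim[of "4 * norm x"]])
        show "\<forall>\<^sub>F n in sequentially. \<bar>cf' i n x\<bar> \<le> 4 * norm x / (N n)\<^sup>2"
          using b'[of i _ x] by (intro always_eventually allI) (smt (verit) divide_nonneg_nonneg norm_ge_zero zero_le_power2)
      qed auto
      then show ?thesis by (intro tendsto_mult_right_zero)
    qed
    then show "AE x in lborel. (\<lambda>n. F i x * cf' i n x) \<longlonglongrightarrow> 0" by simp
  qed measurable
  have "(\<lambda>n. - (\<Sum>i\<in>UNIV. LINT x|lborel. F i x * cf' i n x)) \<longlonglongrightarrow> - (\<Sum>i\<in>(UNIV::2 set). 0)"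
    using L2 by (intro tendsto_minus tendsto_sum) simp
  then show ?thesis using L1 unfolding eq using LIMSEQ_unique by fastforce
qed

section \<open>Weak derivatives\<close>

lemma poly_div_exp_tendsto_0: "((\<lambda>y. poly p y * exp (- y)) \<longlongrightarrow> (0::real)) at_top"
proof -
  \<comment> \<open>The free power \<open>k\<close> makes the induction on the polynomial work:
    \<open>pCons a p\<close> passes the tail \<open>p\<close> on with \<open>Suc k\<close>.\<close>
  have "((\<lambda>y. y ^ k * poly p y * exp (- y)) \<longlongrightarrow> (0::real)) at_top" for k
  proof (induction p arbitrary: k)
    case 0
    then show ?case by simp
  next
    case (pCons a p)
    have "((\<lambda>y. a * (y ^ k / exp y) + y ^ Suc k * poly p y * exp (- y)) \<longlongrightarrow> a * 0 + 0) at_top"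
      by (intro tendsto_intros tendsto_power_div_exp_0 pCons)
    then show ?case by (simp add: algebra_simps exp_minus divide_inverse)
  qed
  from this[of 0] show ?thesis by simp
qed

text \<open>Differentiating \<open>p (1 / t) * exp (- 1 / t)\<close> gives
  \<open>(1 / t)\<^sup>2 * (p - p') (1 / t) * exp (- 1 / t)\<close>, whence the recursion.\<close>

fun flat_poly :: "nat \<Rightarrow> real poly" where
  "flat_poly 0 = 1"
| "flat_poly (Suc n) = monom 1 2 * (flat_poly n - pderiv (flat_poly n))"

text \<open>The \<open>n\<close>-th derivative of the flat function \<open>exp (- 1 / t)\<close>, extended by \<open>0\<close>.\<close>

definition flat :: "nat \<Rightarrow> real \<Rightarrow> real" where
  "flat n t = (if t > 0 then poly (flat_poly n) (1 / t) * exp (- (1 / t)) else 0)"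

lemma flat_has_derivative: "(flat n has_real_derivative flat (Suc n) t) (at t)"
proof -
  consider "t > 0" | "t < 0" | "t = 0" by linarith
  then show ?thesis
  proof cases
    case 1
    have "((\<lambda>t. poly (flat_poly n) (1 / t) * exp (- (1 / t))) has_real_derivative flat (Suc n) t) (at t)"
      by (rule derivative_eq_intros DERIV_chain2[OF poly_DERIV] refl | use 1 in force)+
        (use 1 in \<open>simp add: flat_def poly_monom power2_eq_square field_simps\<close>)
    then show ?thesis
      by (rule has_field_derivative_transform_within_open[where S="{0<..}"]) (use 1 in \<open>auto simp: flat_def\<close>)
  next
    case 2
    have "((\<lambda>t. 0) has_real_derivative flat (Suc n) t) (at t)"
      using 2 by (auto simp: flat_def)
    then show ?thesis
      by (rule has_field_derivative_transform_within_open[where S="{..<0}"]) (use 2 in \<open>auto simp: flat_def\<close>)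
  next
    case 3
    have "((\<lambda>t. poly (pCons 0 (flat_poly n)) (inverse t) * exp (- inverse t)) \<longlongrightarrow> 0) (at_right 0)"
      using poly_div_exp_tendsto_0 filterlim_inverse_at_top_right by (rule filterlim_compose)
    then have R: "((\<lambda>h. flat n h / h) \<longlongrightarrow> 0) (at_right 0)"
      by (rule Lim_transform_eventually)
        (auto simp: eventually_at_filter flat_def field_simps inverse_eq_divide intro!: always_eventually)
    have L: "((\<lambda>h. flat n h / h) \<longlongrightarrow> 0) (at_left 0)"
      by (rule Lim_transform_eventually[OF tendsto_const])
        (auto simp: eventually_at_filter flat_def intro!: always_eventually)
    have "((\<lambda>h. flat n h / h) \<longlongrightarrow> 0) (at 0)" using L R by (simp add: filterlim_at_split)
    then show ?thesis using 3 by (simp add: DERIV_def flat_def)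
  qed
qed

text \<open>Four one-sided flat factors cut out the box from \<open>a\<close> to \<open>b\<close>;
  since \<open>flat 0 t\<close> tends to 1 as \<open>t\<close> grows, letting \<open>m\<close> grow
  turns the bump into the indicator. Each factor has the shape required by
  \<open>C_k_coordinate\<close>.\<close>

definition bump :: "real^2 \<Rightarrow> real^2 \<Rightarrow> real \<Rightarrow> real^2 \<Rightarrow> real" where
  "bump a b m x = (1 * flat 0 (m * x $ 1 + m * (- a $ 1))) * (1 * flat 0 ((- m) * x $ 1 + m * b $ 1)) *
     ((1 * flat 0 (m * x $ 2 + m * (- a $ 2))) * (1 * flat 0 ((- m) * x $ 2 + m * b $ 2)))"

lemma flat0: "0 \<le> flat 0 t" "flat 0 t \<le> 1" "t \<le> 0 \<Longrightarrow> flat 0 t = 0"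
  by (auto simp: flat_def)

lemma mem_box_2: "(x::real^2) \<in> box a b \<longleftrightarrow> a $ 1 < x $ 1 \<and> x $ 1 < b $ 1 \<and> a $ 2 < x $ 2 \<and> x $ 2 < b $ 2"
  by (auto simp: mem_box_cart forall_2)

lemma bump_bounds:
  assumes "m > 0"
  shows "0 \<le> bump a b m x" "bump a b m x \<le> 1" "x \<notin> box a b \<Longrightarrow> bump a b m x = 0"
proof -
  show "0 \<le> bump a b m x" by (simp add: bump_def flat0)
  show "bump a b m x \<le> 1" unfolding bump_def by (intro mult_le_one) (simp_all add: flat0)
  have s: "m * x $ i + m * (- a $ i) \<le> 0 \<longleftrightarrow> x $ i \<le> a $ i" "(- m) * x $ i + m * b $ i \<le> 0 \<longleftrightarrow> b $ i \<le> x $ i" for i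
    using assms by (auto simp: field_simps)
  assume "x \<notin> box a b"
  then show "bump a b m x = 0"
    unfolding mem_box_2 bump_def using flat0(3) s by (auto simp: not_less)
qed

lemma bump_test_function:
  assumes "m > 0"
  shows "test_function (bump a b m)"
proof -
  have "C_k k (bump a b m)" for k
    unfolding bump_def by (intro C_k_mult C_k_coordinate flat_has_derivative)
  moreover have "closure {x. bump a b m x \<noteq> 0} \<subseteq> cbox a b"
    using bump_bounds(3)[OF assms] box_subset_cbox by (intro closure_minimal) (blast, simp add: closed_cbox)
  then have "compact (closure {x. bump a b m x \<noteq> 0})"
    by (meson bounded_cbox bounded_subset closed_closure compact_eq_bounded_closed)
  ultimately show ?thesis by (simp add: test_function_def)
qed

lemma bump_tendsto_indicator:
  "(\<lambda>n. bump a b (real (Suc n)) x) \<longlonglongrightarrow> indicator (box a b) x"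
proof (cases "x \<in> box a b")
  case True
  have *: "(\<lambda>n. flat 0 (real (Suc n) * s)) \<longlonglongrightarrow> 1" if "s > 0" for s
  proof -
    have "(\<lambda>n. exp (- (1 / (real (Suc n) * s)))) \<longlonglongrightarrow> 1" using that by real_asymp
    then show ?thesis using that by (simp add: flat_def)
  qed
  have e: "real (Suc n) * x $ i + real (Suc n) * (- a $ i) = real (Suc n) * (x $ i - a $ i)"
     "(- real (Suc n)) * x $ i + real (Suc n) * b $ i = real (Suc n) * (b $ i - x $ i)" for n i
    by (simp_all add: algebra_simps del: of_nat_Suc)
  have "(\<lambda>n. bump a b (real (Suc n)) x) \<longlonglongrightarrow> (1 * 1) * (1 * 1) * ((1 * 1) * (1 * 1))"
    unfolding bump_def e by (intro tendsto_intros *) (use True in \<open>simp_all add: mem_box_2\<close>)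
  then show ?thesis using True by simp
next
  case False
  then show ?thesis by (simp add: bump_bounds(3) del: of_nat_Suc)
qed

section \<open>The fundamental lemma and uniqueness of weak derivatives\<close>

lemma density_pos_neg_parts_eq:
  fixes w :: "real^2 \<Rightarrow> real"
  assumes i: "\<And>a b. integrable lborel (\<lambda>x. indicator (box a b) x * w x)"
    and z: "\<And>a b. (LINT x|lborel. indicator (box a b) x * w x) = 0"
    and [measurable]: "w \<in> borel_measurable borel"
  shows "AE x in lborel. w x = 0"
proof -
  \<comment> \<open>\<open>ennreal\<close> sends negative numbers to 0, so these are the measures
    with the positive and the negative part of \<open>w\<close> as densities. Vanishing integrals
    over boxes make them agree on a generator of the Borel sets that is closed under intersection,
    and densities are unique.\<close>
  let ?M = "density lborel (\<lambda>x. ennreal (w x))" and ?N = "density lborel (\<lambda>x. ennreal (- w x))"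
  have M: "emeasure ?M (box a b) = ennreal (LINT x|lborel. max 0 (indicator (box a b) x * w x))"
    and N: "emeasure ?N (box a b) = ennreal (LINT x|lborel. max 0 (- (indicator (box a b) x * w x)))" for a b
  proof -
    have "emeasure ?M (box a b) = (\<integral>\<^sup>+x. ennreal (max 0 (indicator (box a b) x * w x)) \<partial>lborel)"
      by (subst emeasure_density) (auto intro!: nn_integral_cong simp: indicator_def ennreal_eq_0_iff max_def ennreal_neg)
    also have "\<dots> = ennreal (LINT x|lborel. max 0 (indicator (box a b) x * w x))"
      by (intro nn_integral_eq_integral integrable_max i) auto
    finally show "emeasure ?M (box a b) = ennreal (LINT x|lborel. max 0 (indicator (box a b) x * w x))" .
    have "emeasure ?N (box a b) = (\<integral>\<^sup>+x. ennreal (max 0 (- (indicator (box a b) x * w x))) \<partial>lborel)"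
      by (subst emeasure_density) (auto intro!: nn_integral_cong simp: indicator_def ennreal_eq_0_iff max_def ennreal_neg)
    also have "\<dots> = ennreal (LINT x|lborel. max 0 (- (indicator (box a b) x * w x)))"
      by (intro nn_integral_eq_integral integrable_max Bochner_Integration.integrable_minus i) auto
    finally show "emeasure ?N (box a b) = ennreal (LINT x|lborel. max 0 (- (indicator (box a b) x * w x)))" .
  qed
  have eq: "(LINT x|lborel. max 0 (indicator (box a b) x * w x)) = (LINT x|lborel. max 0 (- (indicator (box a b) x * w x)))" for a b
  proof -
    have "(LINT x|lborel. max 0 (indicator (box a b) x * w x)) - (LINT x|lborel. max 0 (- (indicator (box a b) x * w x)))
       = (LINT x|lborel. max 0 (indicator (box a b) x * w x) - max 0 (- (indicator (box a b) x * w x)))"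
      by (intro Bochner_Integration.integral_diff[symmetric] integrable_max Bochner_Integration.integrable_minus i) auto
    also have "\<dots> = (LINT x|lborel. indicator (box a b) x * w x)"
      by (intro Bochner_Integration.integral_cong) auto
    finally show ?thesis using z[of a b] by simp
  qed
  have "?M = ?N"
  proof (rule measure_eqI_generator_eq[where E="range (\<lambda>(a, b). box a (b::real^2))" and \<Omega>=UNIV
        and A="\<lambda>n. box (- (real n *\<^sub>R One)) (real n *\<^sub>R One)"])
    show "Int_stable (range (\<lambda>(a, b). box a (b::real^2)))" by (auto simp: Int_stable_def box_Int_box)
    show "sets ?M = sigma_sets UNIV (range (\<lambda>(a, b). box a (b::real^2)))"
      "sets ?N = sigma_sets UNIV (range (\<lambda>(a, b). box a (b::real^2)))"
      by (simp_all add: borel_eq_box)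
    show "emeasure ?M X = emeasure ?N X" if "X \<in> range (\<lambda>(a, b). box a (b::real^2))" for X
      using that by (auto simp only: M N eq)
    show "(\<Union>n. box (- (real n *\<^sub>R One)) (real n *\<^sub>R One)) = (UNIV :: (real^2) set)"
      by (rule UN_box_eq_UNIV)
    show "emeasure ?M (box (- (real i *\<^sub>R One)) (real i *\<^sub>R One)) \<noteq> \<infinity>" for i by (simp only: M ennreal_neq_top infinity_ennreal_def not_False_eq_True)
  qed auto
  then have "AE x in lborel. ennreal (w x) = ennreal (- w x)"
    by (intro sigma_finite_measure.density_unique[OF sigma_finite_lborel]) auto
  then show ?thesis
    by eventually_elim (metis ennreal_eq_0_iff ennreal_neg le_cases neg_le_0_iff_le order_antisym)
qed


lemma locally_integrable_bounded_support:
  assumes w: "locally_integrable w" and c[measurable]: "c \<in> borel_measurable borel"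
    and b: "\<And>x. \<bar>c x\<bar> \<le> M" and z: "\<And>x. norm x > R \<Longrightarrow> c x = (0::real)"
  shows "integrable lborel (\<lambda>x. c x *\<^sub>R w x)"
proof -
  have [measurable]: "w \<in> borel_measurable borel" using w by (simp add: locally_integrable_def)
  have "set_integrable lborel (cball 0 R) w" using w by (simp add: locally_integrable_def)
  then have "integrable lborel (\<lambda>x. M * norm (indicator (cball 0 R) x *\<^sub>R w x))"
    unfolding set_integrable_def by (intro integrable_mult_right integrable_norm)
  then show ?thesis
  proof (rule Bochner_Integration.integrable_bound)
    show "AE x in lborel. norm (c x *\<^sub>R w x) \<le> norm (M * norm (indicator (cball 0 R) x *\<^sub>R w x))"
    proof (rule AE_I2)
      fix x
      have "0 \<le> M" using b[of x] by linarith
      then show "norm (c x *\<^sub>R w x) \<le> norm (M * norm (indicator (cball 0 R) x *\<^sub>R w x))"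
        using b[of x] z[of x] by (cases "norm x \<le> R") (auto intro: mult_right_mono)
    qed
  qed measurable
qed

lemma indicator_box_bounded_support: "\<exists>R. \<forall>x. norm x > R \<longrightarrow> indicator (box a b) (x::real^2) = (0::real)"
proof -
  obtain R where "\<forall>x\<in>box a b. norm x \<le> R" using bounded_box[of a b] by (auto simp: bounded_iff)
  then show ?thesis by (intro exI[of _ R]) (auto simp: indicator_def not_le[symmetric])
qed

text \<open>The bumps lie below the indicator of their box and converge to it, so dominated
  convergence passes from test functions to boxes; the real and the imaginary part are treated
  separately.\<close>

lemma weak_zero_imp_AE_zero:
  assumes w: "locally_integrable w"
    and z: "\<And>\<phi>. test_function \<phi> \<Longrightarrow> (LINT x|lborel. \<phi> x *\<^sub>R w x) = 0"
  shows "AE x in lborel. w x = 0"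
proof -
  have [measurable]: "w \<in> borel_measurable borel" using w by (simp add: locally_integrable_def)
  have i: "integrable lborel (\<lambda>x. indicator (box a b) x *\<^sub>R w x)" for a b
    using indicator_box_bounded_support[of a b]
    by (auto intro!: locally_integrable_bounded_support[OF w, where M=1] simp: indicator_def)
  have i0: "(LINT x|lborel. indicator (box a b) x *\<^sub>R w x) = 0" for a b
  proof -
    have "(\<lambda>n. LINT x|lborel. bump a b (real (Suc n)) x *\<^sub>R w x) \<longlonglongrightarrow> (LINT x|lborel. indicator (box a b) x *\<^sub>R w x)"
    proof (rule integral_dominated_convergence[where w="\<lambda>x. norm (indicator (box a b) x *\<^sub>R w x)"])
      show "integrable lborel (\<lambda>x. norm (indicator (box a b) x *\<^sub>R w x))" using i by (rule integrable_norm)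
      show "AE x in lborel. (\<lambda>n. bump a b (real (Suc n)) x *\<^sub>R w x) \<longlonglongrightarrow> indicator (box a b) x *\<^sub>R w x"
        by (intro AE_I2 tendsto_intros bump_tendsto_indicator)
      show "AE x in lborel. norm (bump a b (real (Suc n)) x *\<^sub>R w x) \<le> norm (indicator (box a b) x *\<^sub>R w x)" for n
      proof (rule AE_I2)
        fix x
        have "0 < real (Suc n)" by simp
        from bump_bounds[OF this, where x=x and a=a and b=b]
        show "norm (bump a b (real (Suc n)) x *\<^sub>R w x) \<le> norm (indicator (box a b) x *\<^sub>R w x)"
          by (cases "x \<in> box a b") (auto simp: mult_left_le_one_le simp del: of_nat_Suc)
      qed
      have "continuous_on UNIV (bump a b (real (Suc n)))" for n
        using bump_test_function[of "real (Suc n)" a b] C_k_continuous[of 0 "bump a b (real (Suc n))"]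
        unfolding test_function_def by simp
      then have [measurable]: "bump a b (real (Suc n)) \<in> borel_measurable borel" for n
        by (rule borel_measurable_continuous_onI)
      show "(\<lambda>x. bump a b (real (Suc n)) x *\<^sub>R w x) \<in> borel_measurable lborel" for n by measurable
    qed measurable
    then show ?thesis by (simp add: z bump_test_function LIMSEQ_const_iff del: of_nat_Suc)
  qed
  have "AE x in lborel. Re (w x) = 0"
  proof (rule density_pos_neg_parts_eq)
    show "integrable lborel (\<lambda>x. indicator (box a b) x * Re (w x))" for a b
      using integrable_Re[OF i[of a b]] by simp
    show "(LINT x|lborel. indicator (box a b) x * Re (w x)) = 0" for a b
      using integral_Re[OF i[of a b]] i0[of a b] by simp
  qed measurable
  moreover have "AE x in lborel. Im (w x) = 0"
  proof (rule density_pos_neg_parts_eq)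
    show "integrable lborel (\<lambda>x. indicator (box a b) x * Im (w x))" for a b
      using integrable_Im[OF i[of a b]] by simp
    show "(LINT x|lborel. indicator (box a b) x * Im (w x)) = 0" for a b
      using integral_Im[OF i[of a b]] i0[of a b] by simp
  qed measurable
  ultimately show ?thesis by eventually_elim (simp add: complex_eq_iff)
qed

lemma test_functionD:
  assumes "test_function \<phi>"
  shows "continuous_on UNIV \<phi>" "continuous_on UNIV (partial_deriv i \<phi>)" "has_axis_deriv \<phi> (partial_deriv i \<phi> x) i x"
    "\<exists>R>0. \<forall>x. norm x > R \<longrightarrow> \<phi> x = 0 \<and> partial_deriv i \<phi> x = 0"
    "\<exists>M>0. \<forall>x. \<bar>\<phi> x\<bar> \<le> M \<and> \<bar>partial_deriv i \<phi> x\<bar> \<le> M"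
proof -
  have C: "C_k 2 \<phi>" using assms by (simp add: test_function_def)
  note D = C_k_2D[OF C]
  show c: "continuous_on UNIV \<phi>" "continuous_on UNIV (partial_deriv i \<phi>)" by (rule D(3), rule D(4))
  show d: "has_axis_deriv \<phi> (partial_deriv i \<phi> x) i x" for x by (rule D(6))
  have "bounded (closure {x. \<phi> x \<noteq> 0})" using assms by (simp add: test_function_def compact_imp_bounded)
  then obtain R where R: "R > 0" "\<And>x. x \<in> closure {x. \<phi> x \<noteq> 0} \<Longrightarrow> norm x \<le> R" by (auto simp: bounded_pos)
  have z: "\<phi> x = 0" if "norm x > R" for x
    using R(2)[of x] that closure_subset[of "{x. \<phi> x \<noteq> 0}"] by fastforce
  have z': "partial_deriv i \<phi> x = 0" if "norm x > R" for x
  proof -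
    have "open {y::real^2. norm y > R}" by (intro open_Collect_less continuous_intros)
    moreover have "((\<lambda>t. x + t *\<^sub>R axis i (1::real)) \<longlongrightarrow> x + 0 *\<^sub>R axis i 1) (nhds 0)"
      by (intro tendsto_intros filterlim_ident)
    ultimately have "\<forall>\<^sub>F t in nhds 0. norm (x + t *\<^sub>R axis i (1::real)) > R"
      using that by (auto dest!: topological_tendstoD[where S="{y. norm y > R}"])
    then have "\<forall>\<^sub>F t in nhds 0. \<phi> (x + t *\<^sub>R axis i 1) = 0" by eventually_elim (rule z)
    then have "((\<lambda>t. 0) has_real_derivative partial_deriv i \<phi> x) (at 0)"
      using d[of x] DERIV_cong_ev[OF refl, of "\<lambda>t. \<phi> (x + t *\<^sub>R axis i 1)" "\<lambda>t. 0" 0, OF _ refl] by blast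
    then show ?thesis by (rule DERIV_unique[OF _ DERIV_const])
  qed
  show "\<exists>R>0. \<forall>x. norm x > R \<longrightarrow> \<phi> x = 0 \<and> partial_deriv i \<phi> x = 0"
    using R(1) z z' by blast
  obtain M where M: "M > 0" "\<And>x. norm x \<le> R \<Longrightarrow> \<bar>\<phi> x\<bar> \<le> M" using continuous_bounded_on_cball[OF c(1)] by blast
  obtain N where N: "N > 0" "\<And>x. norm x \<le> R \<Longrightarrow> \<bar>partial_deriv i \<phi> x\<bar> \<le> N" using continuous_bounded_on_cball[OF c(2)] by blast
  have "\<bar>\<phi> x\<bar> \<le> max M N \<and> \<bar>partial_deriv i \<phi> x\<bar> \<le> max M N" for x
    using M(1) M(2)[of x] N(2)[of x] z[of x] z'[of x] by (cases "norm x \<le> R") auto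
  then show "\<exists>M>0. \<forall>x. \<bar>\<phi> x\<bar> \<le> M \<and> \<bar>partial_deriv i \<phi> x\<bar> \<le> M"
    using M(1) by (intro exI[of _ "max M N"]) auto
qed

lemma weak_partial_unique:
  assumes "is_weak_partial i u v" "is_weak_partial i u v'"
  shows "AE x in lborel. v x = v' x"
proof -
  have l: "locally_integrable v" "locally_integrable v'" using assms by (auto simp: is_weak_partial_def)
  then have [measurable]: "v \<in> borel_measurable borel" "v' \<in> borel_measurable borel"
    by (auto simp: locally_integrable_def)
  have "AE x in lborel. v x - v' x = 0"
  proof (rule weak_zero_imp_AE_zero)
    show "locally_integrable (\<lambda>x. v x - v' x)"
      using l by (auto simp: locally_integrable_def intro!: set_integral_diff)
    fix \<phi> assume \<phi>: "test_function \<phi>"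
    note D = test_functionD[OF \<phi>]
    obtain R where R: "\<And>x. norm x > R \<Longrightarrow> \<phi> x = 0" using D(4) by blast
    obtain M where M: "\<And>x. \<bar>\<phi> x\<bar> \<le> M" using D(5) by blast
    have i: "integrable lborel (\<lambda>x. \<phi> x *\<^sub>R v x)" "integrable lborel (\<lambda>x. \<phi> x *\<^sub>R v' x)"
      by (auto intro!: locally_integrable_bounded_support[OF _ borel_measurable_continuous_onI[OF D(1)] M R] l)
    have "(LINT x|lborel. \<phi> x *\<^sub>R v x) = (LINT x|lborel. \<phi> x *\<^sub>R v' x)"
      using assms \<phi> by (auto simp: is_weak_partial_def)
    then show "(LINT x|lborel. \<phi> x *\<^sub>R (v x - v' x)) = 0"
      using i by (simp add: scaleR_diff_right)
  qed
  then show ?thesis by simp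
qed

text \<open>The representative chosen in \<open>weak_partial\<close> agrees almost everywhere with
  any weak derivative found by computation, so energies may be computed with the latter.\<close>

lemma weak_partial_AE:
  assumes "is_weak_partial i u v"
  shows "AE x in lborel. weak_partial i u x = v x"
proof -
  have "is_weak_partial i u (weak_partial i u)"
    unfolding weak_partial_def using assms someI[of "is_weak_partial i u" v] by simp
  then show ?thesis using assms by (rule weak_partial_unique)
qed

text \<open>The hypotheses are those of the trial functions: locally Lipschitz along the axis and
  differentiable almost everywhere. The difference quotients of \<open>\<phi> * u\<close> remain
  dominated, so the integral of the derivative of this product still vanishes.\<close>

lemma is_weak_partial_of_real:
  fixes u u' :: "real^2 \<Rightarrow> real"
  assumes c: "continuous_on UNIV u" and [measurable]: "u' \<in> borel_measurable borel"
    and d: "AE x in lborel. has_axis_deriv u (u' x) i x"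
    and L: "\<And>R. \<exists>L. (\<forall>x t. norm x \<le> R \<longrightarrow> 0 < t \<longrightarrow> t \<le> 1 \<longrightarrow> \<bar>u (x + t *\<^sub>R axis i 1) - u x\<bar> \<le> L * t)"
    and b: "\<And>R. \<exists>M. \<forall>x. norm x \<le> R \<longrightarrow> \<bar>u' x\<bar> \<le> M"
  shows "is_weak_partial i (\<lambda>x. complex_of_real (u x)) (\<lambda>x. complex_of_real (u' x))"
  unfolding is_weak_partial_def
proof (intro conjI allI impI)
  have int: "integrable lborel (\<lambda>x::real^2. c * indicator (cball 0 r) x)" for c r :: real
    by (intro integrable_mult_right integrable_real_indicator) (use emeasure_lborel_cball_finite[of 0 r] in auto)
  have "set_integrable lborel K (\<lambda>x. complex_of_real (u' x))" if K: "compact K" for K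
  proof -
    obtain R where R: "\<And>x. x \<in> K \<Longrightarrow> norm x \<le> R" using compact_imp_bounded[OF K] by (auto simp: bounded_iff)
    obtain M where M: "\<And>x. norm x \<le> R \<Longrightarrow> \<bar>u' x\<bar> \<le> M" using b by blast
    have [measurable]: "K \<in> sets borel" using K by (simp add: borel_compact)
    show ?thesis unfolding set_integrable_def
      by (rule Bochner_Integration.integrable_bound[OF int[of M R]])
        (use R M in \<open>auto intro!: AE_I2 simp: indicator_def\<close>, force?)
  qed
  then show "locally_integrable (\<lambda>x. complex_of_real (u' x))"
    by (auto simp: locally_integrable_def)
  fix \<phi> assume \<phi>: "test_function \<phi>"
  note D = test_functionD[OF \<phi>]
  obtain R where R: "R > 0" "\<And>x. norm x > R \<Longrightarrow> \<phi> x = 0 \<and> partial_deriv i \<phi> x = 0" using D(4)[of i] by blast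
  obtain M where M: "M > 0" "\<And>x. \<bar>\<phi> x\<bar> \<le> M \<and> \<bar>partial_deriv i \<phi> x\<bar> \<le> M" using D(5)[of i] by blast
  obtain L where L: "\<And>x t. norm x \<le> R + 1 \<Longrightarrow> 0 < t \<Longrightarrow> t \<le> 1 \<Longrightarrow> \<bar>u (x + t *\<^sub>R axis i 1) - u x\<bar> \<le> L * t"
    using L[of "R + 1"] by blast
  obtain N where N: "N > 0" "\<And>x. norm x \<le> R + 2 \<Longrightarrow> \<bar>u x\<bar> \<le> N" using continuous_bounded_on_cball[OF c] by blast
  obtain N' where N': "\<And>x. norm x \<le> R \<Longrightarrow> \<bar>u' x\<bar> \<le> N'" using b by blast
  have [measurable]: "u \<in> borel_measurable borel" "\<phi> \<in> borel_measurable borel" "partial_deriv i \<phi> \<in> borel_measurable borel"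
    using c D by (auto intro: borel_measurable_continuous_onI)
  have bd: "integrable lborel h" if [measurable]: "h \<in> borel_measurable borel" and "\<And>x. norm x > R \<Longrightarrow> h x = 0"
    "\<And>x. norm x \<le> R \<Longrightarrow> \<bar>h x\<bar> \<le> K" for h :: "real^2 \<Rightarrow> real" and K
    by (rule Bochner_Integration.integrable_bound[OF int[of K R]])
      (use that in \<open>auto simp: indicator_def not_le intro!: AE_I2 order_trans[OF _ abs_ge_self]\<close>)
  have i1: "integrable lborel (\<lambda>x. \<phi> x * u x)"
    by (rule bd[where K="M * N"]) (use R M N in \<open>auto simp: abs_mult intro!: mult_mono\<close>)
  have i2: "integrable lborel (\<lambda>x. partial_deriv i \<phi> x * u x)"
    by (rule bd[where K="M * N"]) (use R M N in \<open>auto simp: abs_mult intro!: mult_mono\<close>)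
  have i3: "integrable lborel (\<lambda>x. \<phi> x * u' x)"
    by (rule bd[where K="M * N'"]) (use R M N' in \<open>auto simp: abs_mult intro!: mult_mono\<close>)
  have "(LINT x|lborel. partial_deriv i \<phi> x * u x + \<phi> x * u' x) = 0"
  proof (rule integral_directional_derivative_zero(2)[where f="\<lambda>x. \<phi> x * u x" and v="axis i 1", OF i1 int[of "M * L + M * N" "R + 1"]])
    show "AE x in lborel. has_axis_deriv (\<lambda>x. \<phi> x * u x) (partial_deriv i \<phi> x * u x + \<phi> x * u' x) i x"
      using d
    proof eventually_elim
      case (elim x)
      from DERIV_mult[OF D(3) this] show ?case by (simp add: algebra_simps)
    qed
    fix x :: "real^2" and t :: real assume t: "0 < t" "t \<le> 1"
    let ?e = "axis i 1 :: real^2"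
    have n1: "norm x \<le> norm (x + t *\<^sub>R ?e) + t"
      using norm_triangle_ineq4[of "x + t *\<^sub>R ?e" "t *\<^sub>R ?e"] t by simp
    show "\<bar>\<phi> (x + t *\<^sub>R ?e) * u (x + t *\<^sub>R ?e) - \<phi> x * u x\<bar> \<le> t * ((M * L + M * N) * indicator (cball 0 (R + 1)) x)"
    proof (cases "norm x \<le> R + 1")
      case True
      obtain s where s: "0 < s" "s < t" "\<phi> (x + t *\<^sub>R ?e) - \<phi> x = t * partial_deriv i \<phi> (x + s *\<^sub>R ?e)"
        using MVT2[OF t(1), of "\<lambda>t. \<phi> (x + t *\<^sub>R ?e)" "\<lambda>t. partial_deriv i \<phi> (x + t *\<^sub>R ?e)"]
          has_axis_deriv_shift[where f=\<phi> and f'="partial_deriv i \<phi>", OF D(3)] by auto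
      have "norm (x + t *\<^sub>R ?e) \<le> R + 2" using norm_triangle_ineq[of x "t *\<^sub>R ?e"] True t by simp
      then have "\<bar>(\<phi> (x + t *\<^sub>R ?e) - \<phi> x) * u (x + t *\<^sub>R ?e)\<bar> \<le> (t * M) * N"
        unfolding s(3) abs_mult using M N t by (intro mult_mono) auto
      moreover have "\<bar>\<phi> x * (u (x + t *\<^sub>R ?e) - u x)\<bar> \<le> M * (L * t)"
        unfolding abs_mult using M(2)[of x] L[OF True t] by (intro mult_mono) auto
      moreover have "\<phi> (x + t *\<^sub>R ?e) * u (x + t *\<^sub>R ?e) - \<phi> x * u x
        = (\<phi> (x + t *\<^sub>R ?e) - \<phi> x) * u (x + t *\<^sub>R ?e) + \<phi> x * (u (x + t *\<^sub>R ?e) - u x)" by (simp add: algebra_simps)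
      ultimately show ?thesis using True by (simp add: algebra_simps)
    next
      case False
      then show ?thesis using R(2)[of x] R(2)[of "x + t *\<^sub>R ?e"] n1 t by simp
    qed
  qed measurable
  then have e: "(LINT x|lborel. partial_deriv i \<phi> x * u x) = - (LINT x|lborel. \<phi> x * u' x)"
    using i2 i3 by simp
  have "(LINT x|lborel. partial_deriv i \<phi> x *\<^sub>R complex_of_real (u x)) = complex_of_real (LINT x|lborel. partial_deriv i \<phi> x * u x)"
    by (simp add: scaleR_conv_of_real of_real_mult[symmetric] del: of_real_mult)
  also have "\<dots> = - complex_of_real (LINT x|lborel. \<phi> x * u' x)" unfolding e by simp
  also have "\<dots> = - (LINT x|lborel. \<phi> x *\<^sub>R complex_of_real (u' x))"
    by (simp add: scaleR_conv_of_real of_real_mult[symmetric] del: of_real_mult)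
  finally show "(LINT x|lborel. partial_deriv i \<phi> x *\<^sub>R complex_of_real (u x)) = - (LINT x|lborel. \<phi> x *\<^sub>R complex_of_real (u' x))" .
qed

lemma is_weak_partial_C2:
  assumes "C_k 2 u"
  shows "is_weak_partial i (\<lambda>x. complex_of_real (u x)) (\<lambda>x. complex_of_real (partial_deriv i u x))"
proof (rule is_weak_partial_of_real)
  note D = C_k_2D[OF assms]
  show "continuous_on UNIV u" by (rule D(3))
  show "partial_deriv i u \<in> borel_measurable borel" by (rule borel_measurable_continuous_onI[OF D(4)])
  show "AE x in lborel. has_axis_deriv u (partial_deriv i u x) i x" using D(6) by simp
  show "\<exists>M. \<forall>x. norm x \<le> R \<longrightarrow> \<bar>partial_deriv i u x\<bar> \<le> M" for R
    using continuous_bounded_on_cball[OF D(4)] by blast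
  show "\<exists>L. \<forall>x t. norm x \<le> R \<longrightarrow> 0 < t \<longrightarrow> t \<le> 1 \<longrightarrow> \<bar>u (x + t *\<^sub>R axis i 1) - u x\<bar> \<le> L * t" for R
  proof -
    obtain M where M: "\<And>x. norm x \<le> R + 1 \<Longrightarrow> \<bar>partial_deriv i u x\<bar> \<le> M" using continuous_bounded_on_cball[OF D(4)] by blast
    have "\<bar>u (x + t *\<^sub>R axis i 1) - u x\<bar> \<le> M * t" if xt: "norm x \<le> R" "0 < t" "t \<le> 1" for x t
    proof -
      obtain s where s: "0 < s" "s < t" "u (x + t *\<^sub>R axis i 1) - u x = t * partial_deriv i u (x + s *\<^sub>R axis i 1)"
        using MVT2[OF xt(2), of "\<lambda>t. u (x + t *\<^sub>R axis i 1)" "\<lambda>t. partial_deriv i u (x + t *\<^sub>R axis i 1)"]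
          has_axis_deriv_shift[where f=u and f'="partial_deriv i u", OF D(6)] by auto
      have "norm (x + s *\<^sub>R axis i 1) \<le> R + 1"
        using norm_triangle_ineq[of x "s *\<^sub>R axis i 1"] xt s by simp
      then show ?thesis unfolding s(3) abs_mult using M[of "x + s *\<^sub>R axis i 1"] xt
        by (simp add: mult.commute mult_left_mono)
    qed
    then show ?thesis by blast
  qed
qed

section \<open>The limiting profile\<close>

text \<open>The profile is piecewise affine in \<open>s = r\<^sup>2\<close>. The squared radii are \<open>s1 = (R\<^sub>2\<^sup>-)\<^sup>2\<close>, \<open>s2 = R\<^sub>1\<^sup>2\<close> and \<open>l2 = \<lambda>\<^sub>2 = (R\<^sub>2\<^sup>+)\<^sup>2\<close>, and
  \<open>k1 (s2 - s)\<close>, \<open>k2 (s - s1)\<close> are \<open>a\<^sub>1\<^sub>,\<^sub>0\<close>, \<open>a\<^sub>2\<^sub>,\<^sub>0\<close>; \<open>bal1\<close>, \<open>bal2\<close> are the limiting equations where both densities are positive.\<close>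

locale tf_data =
  fixes g1 g2 g l1 l2 k1 k2 s1 s2 :: real
  assumes g_pos: "0 < g1" "0 < g2" "0 < g" and g_det: "g\<^sup>2 < g1 * g2" and g1_less: "g1 < g" and g_less: "g < g2"
    and s_ord: "0 < s1" "s1 < s2" "s2 < l2" and k_pos: "0 < k1" "0 < k2"
    and bal1: "\<And>s. l1 - s = g1 * (k1 * (s2 - s)) + g * (k2 * (s - s1))"
    and bal2: "\<And>s. l2 - s = g2 * (k2 * (s - s1)) + g * (k1 * (s2 - s))"
    and l1_sq: "l1\<^sup>2 = 4 * g1 / pi"
    and area2: "(l2 - s1) * (l2 - s2) = 2 * g2 / pi"
begin

definition A1 :: "real \<Rightarrow> real" where
  "A1 s = (if s \<le> s1 then (l1 - s) / g1 else if s \<le> s2 then k1 * (s2 - s) else 0)"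

definition A2 :: "real \<Rightarrow> real" where
  "A2 s = (if s \<le> s1 then 0 else if s \<le> s2 then k2 * (s - s1) else if s \<le> l2 then (l2 - s) / g2 else 0)"

definition A1' :: "real \<Rightarrow> real" where
  "A1' s = (if s < s1 then - (1 / g1) else if s < s2 then - k1 else 0)"

definition A2' :: "real \<Rightarrow> real" where
  "A2' s = (if s < s1 then 0 else if s < s2 then k2 else if s < l2 then - (1 / g2) else 0)"

text \<open>\<open>W1\<close> and \<open>W2\<close> are the first variation of the limiting
  functional at the profile, with the multipliers subtracted. Together with
  \<open>A1, A2 \<ge> 0\<close> they satisfy the complementarity conditions of an obstacle problem:
  nonnegative, and zero where the corresponding density is positive.\<close>

definition W1 :: "real \<Rightarrow> real" where "W1 s = s + g1 * A1 s + g * A2 s - l1"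

definition W2 :: "real \<Rightarrow> real" where "W2 s = s + g2 * A2 s + g * A1 s - l2"

definition Q :: "real \<Rightarrow> real \<Rightarrow> real" where
  "Q m n = g1 * m\<^sup>2 / 2 + g2 * n\<^sup>2 / 2 + g * m * n"

lemma knots:
  "l1 - s1 = g1 * (k1 * (s2 - s1))" "l1 - s2 = g * (k2 * (s2 - s1))"
  "l2 - s1 = g * (k1 * (s2 - s1))" "l2 - s2 = g2 * (k2 * (s2 - s1))"
  using bal1[of s1] bal1[of s2] bal2[of s1] bal2[of s2] by simp_all

lemma l_order: "s2 < l1" "l1 < l2"
proof -
  have "0 < g * (k2 * (s2 - s1))" "0 < (k1 * (s2 - s1))" using g_pos k_pos s_ord by auto
  then show "s2 < l1" "l1 < l2" using knots(1,2,3) mult_strict_right_mono[OF g1_less, of "k1 * (s2 - s1)"] by linarith+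
qed

text \<open>The two affine branches differ by a multiple of \<open>s - s1\<close>, so on either side
  of \<open>s1\<close> the active one is the smaller. In this form continuity and the Lipschitz
  bound are seen without looking at the knots.\<close>

lemma A1_min: "A1 s = max 0 (min ((l1 - s) / g1) (k1 * (s2 - s)))"
proof -
  have d: "(l1 - s) / g1 - k1 * (s2 - s) = (g / g1) * (k2 * (s - s1))"
    using bal1[of s] g_pos by (simp add: field_simps)
  have "(0 \<le> s - s1) \<longleftrightarrow> 0 \<le> (g / g1) * (k2 * (s - s1))"
    using g_pos k_pos by (simp add: zero_le_mult_iff zero_le_divide_iff)
  moreover have "(s - s1 \<le> 0) \<longleftrightarrow> (g / g1) * (k2 * (s - s1)) \<le> 0"
    using g_pos k_pos by (simp add: mult_le_0_iff divide_le_0_iff)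
  moreover have "s \<le> s2 \<longleftrightarrow> 0 \<le> k1 * (s2 - s)" using k_pos by (simp add: zero_le_mult_iff)
  moreover have "s \<le> s1 \<Longrightarrow> 0 \<le> (l1 - s) / g1" using g_pos l_order s_ord by simp
  ultimately show ?thesis using d s_ord unfolding A1_def by (auto simp: min_def max_def split: if_splits)
qed

lemma A2_min: "A2 s = max 0 (min (k2 * (s - s1)) ((l2 - s) / g2))"
proof -
  have d: "(l2 - s) / g2 - k2 * (s - s1) = (g / g2) * (k1 * (s2 - s))"
    using bal2[of s] g_pos by (simp add: field_simps)
  have "(0 \<le> s2 - s) \<longleftrightarrow> 0 \<le> (g / g2) * (k1 * (s2 - s))"
    using g_pos k_pos by (simp add: zero_le_mult_iff zero_le_divide_iff)
  moreover have "(s2 - s \<le> 0) \<longleftrightarrow> (g / g2) * (k1 * (s2 - s)) \<le> 0"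
    using g_pos k_pos by (simp add: mult_le_0_iff divide_le_0_iff)
  moreover have "s \<le> l2 \<longleftrightarrow> 0 \<le> (l2 - s) / g2" using g_pos by (simp add: zero_le_divide_iff)
  moreover have "s1 \<le> s \<longleftrightarrow> 0 \<le> k2 * (s - s1)" using k_pos by (simp add: zero_le_mult_iff)
  ultimately show ?thesis using d s_ord unfolding A2_def by (auto simp: min_def max_def split: if_splits)
qed

definition L where "L = max (max (1 / g1) k1) (max k2 (1 / g2))"

lemma L_ge: "1 / g1 \<le> L" "k1 \<le> L" "k2 \<le> L" "1 / g2 \<le> L" "0 < L"
  using k_pos by (auto simp: L_def)

lemma lipschitz_min_affine:
  fixes a b c d M :: real
  assumes "\<bar>a - c\<bar> \<le> M" "\<bar>b - d\<bar> \<le> M"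
  shows "\<bar>max 0 (min a b) - max 0 (min c d)\<bar> \<le> M"
  using assms by linarith

lemma A_lipschitz: "\<bar>A1 s - A1 t\<bar> \<le> L * \<bar>s - t\<bar>" "\<bar>A2 s - A2 t\<bar> \<le> L * \<bar>s - t\<bar>"
proof -
  have "\<bar>(l1 - s) / g1 - (l1 - t) / g1\<bar> = (1 / g1) * \<bar>s - t\<bar>"
    using g_pos by (simp add: diff_divide_distrib[symmetric] abs_divide abs_minus_commute)
  moreover have "\<bar>k1 * (s2 - s) - k1 * (s2 - t)\<bar> = k1 * \<bar>s - t\<bar>"
    using k_pos by (simp add: right_diff_distrib[symmetric] abs_mult abs_minus_commute)
  ultimately show "\<bar>A1 s - A1 t\<bar> \<le> L * \<bar>s - t\<bar>"
    unfolding A1_min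
    using mult_right_mono[OF L_ge(1) abs_ge_zero[of "s - t"]] mult_right_mono[OF L_ge(2) abs_ge_zero[of "s - t"]]
    by (intro lipschitz_min_affine) linarith+
  have "\<bar>(l2 - s) / g2 - (l2 - t) / g2\<bar> = (1 / g2) * \<bar>s - t\<bar>"
    using g_pos by (simp add: diff_divide_distrib[symmetric] abs_divide abs_minus_commute)
  moreover have "\<bar>k2 * (s - s1) - k2 * (t - s1)\<bar> = k2 * \<bar>s - t\<bar>"
    using k_pos by (simp add: right_diff_distrib[symmetric] abs_mult abs_minus_commute)
  ultimately show "\<bar>A2 s - A2 t\<bar> \<le> L * \<bar>s - t\<bar>"
    unfolding A2_min
    using mult_right_mono[OF L_ge(3) abs_ge_zero[of "s - t"]] mult_right_mono[OF L_ge(4) abs_ge_zero[of "s - t"]]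
    by (intro lipschitz_min_affine) linarith+
qed

lemma A_continuous: "continuous_on S A1" "continuous_on S A2"
  unfolding A1_min[abs_def] A2_min[abs_def] using g_pos by (auto intro!: continuous_intros)

lemma A_nonneg: "0 \<le> A1 s" "0 \<le> A2 s" by (simp_all add: A1_min A2_min)

lemma A_zero: "s \<ge> s2 \<Longrightarrow> A1 s = 0" "s \<le> s1 \<Longrightarrow> A2 s = 0" "s \<ge> l2 \<Longrightarrow> A2 s = 0"
  using s_ord by (auto simp: A1_def A2_def)

lemma A_upper: "0 \<le> s \<Longrightarrow> A1 s \<le> L * l2" "0 \<le> s \<Longrightarrow> A2 s \<le> L * l2"
proof -
  assume s: "0 \<le> s"
  show "A1 s \<le> L * l2"
  proof (cases "s \<le> s2")
    case True
    then have "\<bar>s - s2\<bar> \<le> l2" using s s_ord by auto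
    then have "L * \<bar>s - s2\<bar> \<le> L * l2" using L_ge by (intro mult_left_mono) auto
    then show ?thesis using A_lipschitz(1)[of s s2] A_zero(1)[of s2] by simp
  qed (use A_zero(1)[of s] L_ge s_ord in simp)
  show "A2 s \<le> L * l2"
  proof (cases "s \<le> l2")
    case True
    then have "\<bar>s - l2\<bar> \<le> l2" using s s_ord by auto
    then have "L * \<bar>s - l2\<bar> \<le> L * l2" using L_ge by (intro mult_left_mono) auto
    then show ?thesis using A_lipschitz(2)[of s l2] A_zero(3)[of l2] by simp
  qed (use A_zero(3)[of s] L_ge s_ord in simp)
qed

lemma A_deriv:
  "s \<notin> {s1, s2, l2} \<Longrightarrow> (A1 has_real_derivative A1' s) (at s)"
  "s \<notin> {s1, s2, l2} \<Longrightarrow> (A2 has_real_derivative A2' s) (at s)"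
proof -
  assume ns: "s \<notin> {s1, s2, l2}"
  have tr: "(f has_real_derivative d) (at s)"
    if "open U" "s \<in> U" "\<And>t. t \<in> U \<Longrightarrow> h t = f t" "(h has_real_derivative d) (at s)" for f h :: "real \<Rightarrow> real" and U d
    using has_field_derivative_transform_within_open[OF that(4,1,2,3)] .
  have d: "((\<lambda>t. (c - t) / b) has_real_derivative - (1 / b)) (at s)"
    "((\<lambda>t. k * (c - t)) has_real_derivative - k) (at s)" "((\<lambda>t. k * (t - c)) has_real_derivative k) (at s)"
    "((\<lambda>t. 0::real) has_real_derivative 0) (at s)" for b c k :: real
    by (cases "b = 0"; auto intro!: derivative_eq_intros)+
  consider "s < s1" | "s1 < s" "s < s2" | "s2 < s" "s < l2" | "l2 < s" using ns by force
  then have "(A1 has_real_derivative A1' s) (at s) \<and> (A2 has_real_derivative A2' s) (at s)"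
  proof cases
    case 1
    show ?thesis
      by (intro conjI tr[of "{..<s1}", OF _ _ _ DERIV_cong[OF d(1)[of l1 g1]]] tr[of "{..<s1}", OF _ _ _ DERIV_cong[OF d(4)]])
        (use 1 s_ord in \<open>auto simp: A1_def A2_def A1'_def A2'_def\<close>)
  next
    case 2
    show ?thesis
      by (intro conjI tr[of "{s1<..<s2}", OF _ _ _ DERIV_cong[OF d(2)[of k1 s2]]] tr[of "{s1<..<s2}", OF _ _ _ DERIV_cong[OF d(3)[of k2 s1]]])
        (use 2 s_ord in \<open>auto simp: A1_def A2_def A1'_def A2'_def\<close>)
  next
    case 3
    show ?thesis
      by (intro conjI tr[of "{s2<..<l2}", OF _ _ _ DERIV_cong[OF d(4)]] tr[of "{s2<..<l2}", OF _ _ _ DERIV_cong[OF d(1)[of l2 g2]]])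
        (use 3 s_ord in \<open>auto simp: A1_def A2_def A1'_def A2'_def\<close>)
  next
    case 4
    show ?thesis
      by (intro conjI tr[of "{l2<..}", OF _ _ _ DERIV_cong[OF d(4)]])
        (use 4 s_ord in \<open>auto simp: A1_def A2_def A1'_def A2'_def\<close>)
  qed
  then show "(A1 has_real_derivative A1' s) (at s)" "(A2 has_real_derivative A2' s) (at s)" by auto
qed

lemma W1_eq:
  "s \<le> s2 \<Longrightarrow> W1 s = 0"
  "s2 \<le> s \<Longrightarrow> s \<le> l2 \<Longrightarrow> W1 s = (1 - g / g2) * (s - s2)"
  "l2 \<le> s \<Longrightarrow> W1 s = (s - l2) + (1 - g / g2) * (l2 - s2)"
proof -
  have b: "s2 + g * ((l2 - s2) / g2) - l1 = 0" using knots(2,4) g_pos by simp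
  show "s \<le> s2 \<Longrightarrow> W1 s = 0"
    using bal1[of s] g_pos s_ord by (auto simp: W1_def A1_def A2_def)
  show "s2 \<le> s \<Longrightarrow> s \<le> l2 \<Longrightarrow> W1 s = (1 - g / g2) * (s - s2)"
  proof -
    assume s: "s2 \<le> s" "s \<le> l2"
    have "W1 s = s + g * ((l2 - s) / g2) - l1"
    proof (cases "s = s2")
      case True
      then show ?thesis using b bal1[of s2] s_ord by (simp add: W1_def A1_def A2_def)
    qed (use s s_ord in \<open>simp add: W1_def A1_def A2_def\<close>)
    also have "g * ((l2 - s) / g2) = g * ((l2 - s2) / g2) - (g / g2) * (s - s2)"
      using g_pos by (simp add: field_simps)
    finally show "W1 s = (1 - g / g2) * (s - s2)" using b by (simp add: left_diff_distrib)
  qed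
  show "l2 \<le> s \<Longrightarrow> W1 s = (s - l2) + (1 - g / g2) * (l2 - s2)"
    using b g_pos s_ord by (cases "s = l2") (auto simp: W1_def A1_def A2_def field_simps)
qed

lemma W2_eq:
  "s \<le> s1 \<Longrightarrow> W2 s = (g / g1 - 1) * (s1 - s)"
  "s1 \<le> s \<Longrightarrow> s \<le> l2 \<Longrightarrow> W2 s = 0"
  "l2 \<le> s \<Longrightarrow> W2 s = s - l2"
proof -
  have b: "s1 + g * ((l1 - s1) / g1) - l2 = 0" using knots(1,3) g_pos by simp
  show "s \<le> s1 \<Longrightarrow> W2 s = (g / g1 - 1) * (s1 - s)"
    using b g_pos by (auto simp: W2_def A1_def A2_def field_simps)
  show "s1 \<le> s \<Longrightarrow> s \<le> l2 \<Longrightarrow> W2 s = 0"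
    using bal2[of s] b g_pos s_ord by (cases "s = s1") (auto simp: W2_def A1_def A2_def)
  show "l2 \<le> s \<Longrightarrow> W2 s = s - l2"
    using g_pos s_ord by (cases "s = l2") (auto simp: W2_def A1_def A2_def)
qed

lemma W_ge: "s2 \<le> s \<Longrightarrow> (1 - g / g2) * (s - s2) \<le> W1 s" "l2 \<le> s \<Longrightarrow> s - l2 \<le> W2 s"
proof -
  assume s: "s2 \<le> s"
  show "(1 - g / g2) * (s - s2) \<le> W1 s"
  proof (cases "s \<le> l2")
    case True
    then show ?thesis using W1_eq(2) s by simp
  next
    case False
    have le: "(1 - g / g2) * (s - l2) \<le> 1 * (s - l2)" using False g_pos by (intro mult_right_mono) auto
    have e: "(1 - g / g2) * (s - s2) = (1 - g / g2) * (s - l2) + (1 - g / g2) * (l2 - s2)"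
      by (simp add: distrib_left[symmetric])
    have w: "W1 s = (s - l2) + (1 - g / g2) * (l2 - s2)" using False by (intro W1_eq) auto
    show ?thesis unfolding e w using add_right_mono[OF le] by (simp only: mult_1)
  qed
qed (simp add: W2_eq)

text \<open>The inequalities \<open>g1 < g < g2\<close> enter here. In the inner disc the repulsion
  from the first component raises the potential of the second above \<open>l2\<close>, which is why
  \<open>A2\<close> has a hole there; between \<open>s2\<close> and \<open>l2\<close> the slope of
  \<open>W1\<close> is \<open>1 - g / g2\<close>.\<close>

lemma W_nonneg: "0 \<le> W1 s" "0 \<le> W2 s"
proof -
  have *: "0 < 1 - g / g2" "0 < g / g1 - 1" using g_pos g_less g1_less by auto
  show "0 \<le> W1 s"
  proof (cases "s \<le> s2")
    case False
    then have "0 \<le> (1 - g / g2) * (s - s2)" using * by simp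
    then show ?thesis using W_ge(1)[of s] False by linarith
  qed (simp add: W1_eq)
  show "0 \<le> W2 s"
    using W2_eq(1)[of s] W2_eq(2)[of s] W2_eq(3)[of s] * by (cases "s \<le> s1"; cases "s \<le> l2") auto
qed

lemma WA_zero: "W1 s * A1 s = 0" "W2 s * A2 s = 0"
  using W1_eq(1)[of s] A_zero(1)[of s] W2_eq(2)[of s] A_zero(2,3)[of s]
  by (cases "s \<le> s2"; simp; cases "s \<le> s1"; cases "s \<le> l2"; simp)+

section \<open>Pressure, masses and virial identity of the profile\<close>

lemma FTC_finite:
  fixes f f' :: "real \<Rightarrow> real"
  assumes "a \<le> b" "finite S" "continuous_on {a..b} f" "\<And>x. x \<in> {a<..<b} - S \<Longrightarrow> (f has_real_derivative f' x) (at x)"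
  shows "(f' has_integral (f b - f a)) {a..b}"
  using assms by (intro fundamental_theorem_of_calculus_interior_strong[where S=S])
    (auto simp: has_real_derivative_iff_has_vector_derivative)

lemma integral_norm_square_FTC:
  fixes h H :: "real \<Rightarrow> real"
  assumes "0 \<le> b" "finite S" and h: "continuous_on UNIV h" "\<And>s. s > b \<Longrightarrow> h s = 0" and H: "continuous_on {0..b} H"
    and d: "\<And>s. s \<in> {0<..<b} - S \<Longrightarrow> (H has_real_derivative h s) (at s)"
  shows "integrable lborel (\<lambda>x::real^2. h (nsq x))"
    "(LINT x|lborel. h (nsq x)) = pi * (H b - H 0)"
proof -
  have [measurable]: "h \<in> borel_measurable borel" using h by (rule_tac borel_measurable_continuous_onI)
  have e: "(\<lambda>s. indicator {0..} s * h s) = (\<lambda>s. indicator {0..b} s *\<^sub>R h s)"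
    using h(2) by (auto simp: fun_eq_iff indicator_def not_le)
  have si: "set_integrable lborel {0..b} h"
    unfolding set_integrable_def by (rule borel_integrable_compact) (auto intro: continuous_on_subset[OF h(1)])
  show "integrable lborel (\<lambda>x::real^2. h (nsq x))"
    using si unfolding integrable_norm_square_iff[OF \<open>h \<in> borel_measurable borel\<close>] e set_integrable_def .
  have "(LINT s|lborel. indicator {0..b} s *\<^sub>R h s) = integral {0..b} h"
    using set_borel_integral_eq_integral(2)[OF si] by (simp add: set_lebesgue_integral_def)
  also have "\<dots> = H b - H 0" using FTC_finite[OF assms(1,2) H d] by (simp add: integral_unique)
  finally show "(LINT x|lborel. h (nsq x)) = pi * (H b - H 0)"
    unfolding integral_norm_square[OF \<open>h \<in> borel_measurable borel\<close>] e by simp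
qed

text \<open>Density of the limiting functional minus the multiplier terms. Its derivative in
  \<open>s\<close> is \<open>A1 + A2\<close>, because the remaining terms \<open>W1 * A1'\<close>
  and \<open>W2 * A2'\<close> vanish; so it is a primitive of the total density.\<close>

definition press :: "real \<Rightarrow> real" where
  "press s = (s - l1) * A1 s + (s - l2) * A2 s + Q (A1 s) (A2 s)"

lemma press_eq: "press s = - Q (A1 s) (A2 s)"
proof -
  have "W1 s * A1 s + W2 s * A2 s = 0" by (simp only: WA_zero add_0)
  then show ?thesis
    unfolding W1_def W2_def press_def Q_def by (simp add: algebra_simps power2_eq_square)
qed

lemma press_deriv:
  assumes "s \<notin> {s1, s2, l2}"
  shows "(press has_real_derivative A1 s + A2 s) (at s)"
proof -
  have "(press has_real_derivative (A1 s + (s - l1) * A1' s) + (A2 s + (s - l2) * A2' s) +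
     (g1 * A1 s * A1' s + g2 * A2 s * A2' s + g * (A1' s * A2 s + A1 s * A2' s))) (at s)"
    unfolding press_def[abs_def] Q_def
    by (auto intro!: derivative_eq_intros A_deriv[OF assms] simp: algebra_simps)
  moreover have "W1 s * A1' s = 0"
    using W1_eq(1)[of s] s_ord by (cases "s \<le> s2") (auto simp: A1'_def)
  moreover have "W2 s * A2' s = 0"
    using W2_eq(2)[of s] by (cases "s < s1"; cases "s \<le> l2") (use s_ord in \<open>auto simp: A2'_def\<close>)
  ultimately show ?thesis
    by (elim DERIV_cong) (simp add: W1_def W2_def algebra_simps)
qed

lemma press_continuous: "continuous_on S press"
  unfolding press_def[abs_def] Q_def by (intro continuous_intros A_continuous) auto

lemma press_bdry: "press 0 = - (2 / pi)" "press l2 = 0"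
  using l1_sq g_pos s_ord A_zero by (simp_all add: press_eq Q_def A1_def A2_def power_divide field_simps power2_eq_square)

text \<open>The locale assumptions \<open>l1_sq\<close> and \<open>area2\<close> are the
  normalisations of the masses: the first makes \<open>press\<close> increase by
  \<open>2 / pi\<close>, that is, the total mass is 2; the second gives mass 1 to \<open>A2\<close>;
  the first mass is then the difference.\<close>

lemma mass:
  "integrable lborel (\<lambda>x::real^2. A1 (nsq x))" "(LINT x|lborel. A1 (nsq x)) = 1"
  "integrable lborel (\<lambda>x::real^2. A2 (nsq x))" "(LINT x|lborel. A2 (nsq x)) = 1"
proof -
  define H where "H s = (if s \<le> s1 then 0 else if s \<le> s2 then k2 * (s - s1)\<^sup>2 / 2
     else k2 * (s2 - s1)\<^sup>2 / 2 + (l2 - s2)\<^sup>2 / (2 * g2) - (l2 - s)\<^sup>2 / (2 * g2))" for s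
  have Hc: "continuous_on {0..l2} H"
  proof -
    \<comment> \<open>The same primitive written with \<open>min\<close> and \<open>max\<close>, so
      that its continuity at the knots is immediate.\<close>
    define H' where "H' s = k2 * (max 0 (min s s2 - s1))\<^sup>2 / 2 + (l2 - s2)\<^sup>2 / (2 * g2) - (l2 - max s s2)\<^sup>2 / (2 * g2)" for s
    have "H = H'" using s_ord by (auto simp: H_def H'_def fun_eq_iff min_def max_def)
    moreover have "continuous_on {0..l2} H'" unfolding H'_def using g_pos by (intro continuous_intros) auto
    ultimately show ?thesis by simp
  qed
  have Hd: "(H has_real_derivative A2 s) (at s)" if s: "s \<in> {0<..<l2} - {s1, s2}" for s
  proof -
    consider "s < s1" | "s1 < s" "s < s2" | "s2 < s" using s by force
    then show ?thesis
    proof cases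
      case 1
      then have "((\<lambda>s. 0) has_real_derivative A2 s) (at s)" by (simp add: A2_def)
      then show ?thesis
        by (rule has_field_derivative_transform_within_open[where S="{..<s1}"]) (use 1 in \<open>auto simp: H_def\<close>)
    next
      case 2
      then have "((\<lambda>s. k2 * (s - s1)\<^sup>2 / 2) has_real_derivative A2 s) (at s)"
        by (auto intro!: derivative_eq_intros simp: A2_def)
      then show ?thesis
        by (rule has_field_derivative_transform_within_open[where S="{s1<..<s2}"]) (use 2 in \<open>auto simp: H_def\<close>)
    next
      case 3
      then have "((\<lambda>s. k2 * (s2 - s1)\<^sup>2 / 2 + (l2 - s2)\<^sup>2 / (2 * g2) - (l2 - s)\<^sup>2 / (2 * g2)) has_real_derivative A2 s) (at s)"
        using s s_ord g_pos by (auto intro!: derivative_eq_intros simp: A2_def field_simps)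
      then show ?thesis
        by (rule has_field_derivative_transform_within_open[where S="{s2<..}"]) (use 3 s_ord in \<open>auto simp: H_def\<close>)
    qed
  qed
  have l20: "0 \<le> l2" using s_ord by linarith
  note i2 = integral_norm_square_FTC[OF l20 _ A_continuous(2) _ Hc Hd, of "{s1, s2}"]
  show "integrable lborel (\<lambda>x::real^2. A2 (nsq x))" by (rule i2(1)) (auto simp: A_zero)
  have "(LINT x|lborel. A2 (nsq x)) = pi * (H l2 - H 0)" by (rule i2(2)) (auto simp: A_zero)
  also have "H l2 - H 0 = (l2 - s1) * (l2 - s2) / (2 * g2)"
  proof -
    have "k2 * (s2 - s1)\<^sup>2 / 2 = (l2 - s2) * (s2 - s1) / (2 * g2)"
      using knots(4) g_pos by (simp add: power2_eq_square)
    then have "H l2 - H 0 = (l2 - s2) * (s2 - s1) / (2 * g2) + (l2 - s2)\<^sup>2 / (2 * g2)"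
      using s_ord by (simp add: H_def)
    also have "\<dots> = (l2 - s1) * (l2 - s2) / (2 * g2)" using g_pos by (simp add: field_simps power2_eq_square)
    finally show ?thesis .
  qed
  finally show m2: "(LINT x|lborel. A2 (nsq x)) = 1" using area2 g_pos by simp
  note i12 = integral_norm_square_FTC[OF l20 _ _ _ press_continuous press_deriv, of "{s1, s2, l2}"]
  have c12: "continuous_on UNIV (\<lambda>s. A1 s + A2 s)" by (intro continuous_intros A_continuous)
  have I12: "integrable lborel (\<lambda>x::real^2. A1 (nsq x) + A2 (nsq x))"
    by (rule i12(1)) (use c12 s_ord in \<open>auto simp: A_zero\<close>)
  have "(LINT x|lborel. A1 (nsq x) + A2 (nsq x)) = pi * (press l2 - press 0)"
    by (rule i12(2)) (use c12 s_ord in \<open>auto simp: A_zero\<close>)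
  then have m12: "(LINT x|lborel. A1 (nsq x) + A2 (nsq x)) = 2" by (simp add: press_bdry)
  show I1: "integrable lborel (\<lambda>x::real^2. A1 (nsq x))"
    using Bochner_Integration.integrable_diff[OF I12 i2(1)] s_ord by (auto simp: A_zero)
  show "(LINT x|lborel. A1 (nsq x)) = 1"
    using m12 m2 I1 i2(1) by (subst (asm) Bochner_Integration.integral_add) (auto simp: A_zero)
qed

text \<open>The derivative of \<open>s * press s\<close> is
  \<open>press s + s * (A1 s + A2 s)\<close> and both boundary values vanish, while
  \<open>press = - Q\<close>: this is the identity that dilations give for the limiting
  functional.\<close>

lemma tf_virial:
  "integrable lborel (\<lambda>x::real^2. nsq x * (A1 (nsq x) + A2 (nsq x)))"
  "integrable lborel (\<lambda>x::real^2. Q (A1 (nsq x)) (A2 (nsq x)))"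
  "(LINT x|lborel. nsq x * (A1 (nsq x) + A2 (nsq x)))
    = (LINT x|lborel. Q (A1 (nsq x)) (A2 (nsq x)))"
proof -
  have l20: "0 \<le> l2" using s_ord by linarith
  have *: "integrable lborel (\<lambda>x::real^2. h (nsq x))"
    if h: "continuous_on UNIV h" "\<And>s. s > l2 \<Longrightarrow> h s = 0" for h :: "real \<Rightarrow> real"
  proof -
    have [measurable]: "h \<in> borel_measurable borel" using h by (rule_tac borel_measurable_continuous_onI)
    have e: "(\<lambda>s. indicator {0..} s * h s) = (\<lambda>s. indicator {0..l2} s *\<^sub>R h s)"
      using h(2) by (auto simp: fun_eq_iff indicator_def not_le)
    have "integrable lborel (\<lambda>s. indicator {0..l2} s *\<^sub>R h s)"
      by (rule borel_integrable_compact) (auto intro: continuous_on_subset[OF h(1)])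
    then show ?thesis unfolding integrable_norm_square_iff[OF \<open>h \<in> borel_measurable borel\<close>] e .
  qed
  show i1: "integrable lborel (\<lambda>x::real^2. nsq x * (A1 (nsq x) + A2 (nsq x)))"
    by (rule *[of "\<lambda>s. s * (A1 s + A2 s)"]) (use s_ord in \<open>auto intro!: continuous_intros A_continuous simp: A_zero\<close>)
  show i2: "integrable lborel (\<lambda>x::real^2. Q (A1 (nsq x)) (A2 (nsq x)))"
    by (rule *[of "\<lambda>s. Q (A1 s) (A2 s)"]) (use s_ord in \<open>auto intro!: continuous_intros A_continuous simp: A_zero Q_def\<close>)
  have "(LINT x|lborel. press (nsq x) + nsq x * (A1 (nsq x) + A2 (nsq x)))
    = pi * (l2 * press l2 - 0 * press 0)"
  proof (rule integral_norm_square_FTC(2)[where S="{s1, s2, l2}" and H="\<lambda>s. s * press s", OF l20])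
    fix s assume "s \<in> {0<..<l2} - {s1, s2, l2}"
    then have ns: "s \<notin> {s1, s2, l2}" by simp
    show "((\<lambda>s. s * press s) has_real_derivative press s + s * (A1 s + A2 s)) (at s)"
      by (auto intro!: derivative_eq_intros press_deriv[OF ns])
  qed (use s_ord in \<open>auto intro!: continuous_intros press_continuous A_continuous simp: press_eq A_zero Q_def\<close>)
  then have z: "(LINT x|lborel. press (nsq x) + nsq x * (A1 (nsq x) + A2 (nsq x))) = 0"
    by (simp add: press_bdry)
  have "(LINT x|lborel. press (nsq x) + nsq x * (A1 (nsq x) + A2 (nsq x)))
    = - (LINT x|lborel. Q (A1 (nsq x)) (A2 (nsq x))) + (LINT x|lborel. nsq x * (A1 (nsq x) + A2 (nsq x)))"
    unfolding press_eq by (subst Bochner_Integration.integral_add) (use i1 i2 in auto)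
  then show "(LINT x|lborel. nsq x * (A1 (nsq x) + A2 (nsq x)))
    = (LINT x|lborel. Q (A1 (nsq x)) (A2 (nsq x)))" using z by simp
qed

end

section \<open>Comparison of energies\<close>

text \<open>A regularised square root: close to \<open>sqrt a\<close> where \<open>a\<close> is
  large compared with \<epsilon>, and to \<open>a / sqrt \<epsilon>\<close> where it is
  small.\<close>

definition desing :: "real \<Rightarrow> real \<Rightarrow> real" where
  "desing \<epsilon> a = a / sqrt (a + \<epsilon>)"

definition desing' :: "real \<Rightarrow> real \<Rightarrow> real" where
  "desing' \<epsilon> a = (a + 2 * \<epsilon>) / (2 * (a + \<epsilon>) * sqrt (a + \<epsilon>))"

lemma desing_deriv:
  assumes "\<epsilon> > 0" "a \<ge> 0"
  shows "(desing \<epsilon> has_real_derivative desing' \<epsilon> a) (at a)"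
proof -
  have p: "a + \<epsilon> > 0" using assms by simp
  have "((\<lambda>a. a / sqrt (a + \<epsilon>)) has_real_derivative
      (1 * sqrt (a + \<epsilon>) - a * (inverse (sqrt (a + \<epsilon>)) / 2)) / (sqrt (a + \<epsilon>) * sqrt (a + \<epsilon>))) (at a)"
    using p by (auto intro!: derivative_eq_intros)
  moreover have "(1 * sqrt (a + \<epsilon>) - a * (inverse (sqrt (a + \<epsilon>)) / 2)) / (sqrt (a + \<epsilon>) * sqrt (a + \<epsilon>)) = desing' \<epsilon> a"
  proof -
    define r where "r = sqrt (a + \<epsilon>)"
    have r: "r > 0" "r * r = a + \<epsilon>" using p by (auto simp: r_def)
    have "(1 * r - a * (inverse r / 2)) / (r * r) = (2 * (r * r) - a) / (2 * (r * r) * r)"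
      using r(1) by (simp add: field_simps)
    also have "\<dots> = (a + 2 * \<epsilon>) / (2 * (r * r) * r)" unfolding r(2) by (simp add: algebra_simps)
    also have "\<dots> = desing' \<epsilon> a" unfolding desing'_def r(2) by (simp add: r_def)
    finally show ?thesis unfolding r_def .
  qed
  ultimately show ?thesis by (simp add: desing_def[abs_def])
qed

text \<open>The bound \<open>(desing' \<epsilon> a)\<^sup>2 \<le> 1 / (a + \<epsilon>)\<close> leads
  to the logarithm, as the density vanishes linearly at its edges; the bound by
  \<open>1 / sqrt \<epsilon>\<close> makes the trial function Lipschitz for fixed
  \<epsilon>.\<close>

lemma desing'_bounds:
  assumes "\<epsilon> > 0" "a \<ge> 0"
  shows "0 \<le> desing' \<epsilon> a" "desing' \<epsilon> a \<le> 1 / sqrt (a + \<epsilon>)" "(desing' \<epsilon> a)\<^sup>2 \<le> 1 / (a + \<epsilon>)"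
    "desing' \<epsilon> a \<le> 1 / sqrt \<epsilon>"
proof -
  show p: "0 \<le> desing' \<epsilon> a" using assms by (simp add: desing'_def)
  have "desing' \<epsilon> a = (a + 2 * \<epsilon>) / (2 * (a + \<epsilon>)) * (1 / sqrt (a + \<epsilon>))" by (simp add: desing'_def)
  also have "\<dots> \<le> 1 * (1 / sqrt (a + \<epsilon>))" using assms by (intro mult_right_mono) auto
  finally show b: "desing' \<epsilon> a \<le> 1 / sqrt (a + \<epsilon>)" by simp
  then have "(desing' \<epsilon> a)\<^sup>2 \<le> (1 / sqrt (a + \<epsilon>))\<^sup>2" using p by (rule power_mono)
  then show "(desing' \<epsilon> a)\<^sup>2 \<le> 1 / (a + \<epsilon>)" using assms by (simp add: power_divide)
  have "1 / sqrt (a + \<epsilon>) \<le> 1 / sqrt \<epsilon>" using assms by (intro divide_left_mono) auto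
  then show "desing' \<epsilon> a \<le> 1 / sqrt \<epsilon>" using b by linarith
qed

lemma desing_lipschitz:
  assumes "\<epsilon> > 0" "a \<ge> 0" "b \<ge> 0"
  shows "\<bar>desing \<epsilon> a - desing \<epsilon> b\<bar> \<le> (1 / sqrt \<epsilon>) * \<bar>a - b\<bar>"
proof -
  have *: "\<bar>desing \<epsilon> b - desing \<epsilon> a\<bar> \<le> (1 / sqrt \<epsilon>) * \<bar>b - a\<bar>" if ab: "0 \<le> a" "a < b" for a b
  proof -
    obtain z where z: "a < z" "z < b" "desing \<epsilon> b - desing \<epsilon> a = (b - a) * desing' \<epsilon> z"
      using MVT2[OF ab(2), of "desing \<epsilon>" "desing' \<epsilon>"] desing_deriv[OF assms(1)] ab by auto
    have "\<bar>b - a\<bar> * \<bar>desing' \<epsilon> z\<bar> \<le> \<bar>b - a\<bar> * (1 / sqrt \<epsilon>)"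
      using desing'_bounds(1,4)[OF assms(1), of z] z ab by (intro mult_left_mono) auto
    then show ?thesis unfolding z(3) abs_mult by (simp only: mult.commute)
  qed
  show ?thesis using *[of a b] *[of b a] assms by (cases a b rule: linorder_cases) (auto simp: abs_minus_commute)
qed

lemma desing_square:
  assumes "\<epsilon> > 0" "a \<ge> 0"
  shows "(desing \<epsilon> a)\<^sup>2 \<le> a" "a - \<epsilon> \<le> (desing \<epsilon> a)\<^sup>2" "0 \<le> desing \<epsilon> a"
proof -
  have e: "(desing \<epsilon> a)\<^sup>2 = a\<^sup>2 / (a + \<epsilon>)" using assms by (simp add: desing_def power_divide)
  show "(desing \<epsilon> a)\<^sup>2 \<le> a" unfolding e using assms by (simp add: field_simps power2_eq_square)
  show "a - \<epsilon> \<le> (desing \<epsilon> a)\<^sup>2" unfolding e using assms by (simp add: field_simps power2_eq_square)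
  show "0 \<le> desing \<epsilon> a" using assms by (simp add: desing_def)
qed

lemma log_integral:
  fixes c \<epsilon> p q :: real
  assumes "c > 0" "\<epsilon> > 0" "p < q"
  shows "has_bochner_integral lborel (\<lambda>s. (1 / (c * (s - p) + \<epsilon>)) * indicator {p..q} s) ((ln (c * (q - p) + \<epsilon>) - ln \<epsilon>) / c)"
    "has_bochner_integral lborel (\<lambda>s. (1 / (c * (q - s) + \<epsilon>)) * indicator {p..q} s) ((ln (c * (q - p) + \<epsilon>) - ln \<epsilon>) / c)"
proof -
  have pos: "0 < c * (s - p) + \<epsilon>" "0 < c * (q - s) + \<epsilon>" if "p \<le> s" "s \<le> q" for s
    using assms that by (auto intro!: add_nonneg_pos)
  have "has_bochner_integral lborel (\<lambda>s. (1 / (c * (s - p) + \<epsilon>)) * indicator {p..q} s)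
     (ln (c * (q - p) + \<epsilon>) / c - ln (c * (p - p) + \<epsilon>) / c)"
    by (rule has_bochner_integral_FTC_Icc_real[where F="\<lambda>s. ln (c * (s - p) + \<epsilon>) / c"])
      (use assms pos(1) in \<open>force intro!: derivative_eq_intros continuous_intros\<close>)+
  then show "has_bochner_integral lborel (\<lambda>s. (1 / (c * (s - p) + \<epsilon>)) * indicator {p..q} s) ((ln (c * (q - p) + \<epsilon>) - ln \<epsilon>) / c)"
    by (simp add: diff_divide_distrib)
  have "has_bochner_integral lborel (\<lambda>s. (1 / (c * (q - s) + \<epsilon>)) * indicator {p..q} s)
     (- ln (c * (q - q) + \<epsilon>) / c - - ln (c * (q - p) + \<epsilon>) / c)"
    by (rule has_bochner_integral_FTC_Icc_real[where F="\<lambda>s. - ln (c * (q - s) + \<epsilon>) / c"])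
      (use assms pos(2) in \<open>force intro!: derivative_eq_intros continuous_intros\<close>)+
  then show "has_bochner_integral lborel (\<lambda>s. (1 / (c * (q - s) + \<epsilon>)) * indicator {p..q} s) ((ln (c * (q - p) + \<epsilon>) - ln \<epsilon>) / c)"
    by (simp add: diff_divide_distrib)
qed

definition competitor :: "(real \<Rightarrow> real) \<Rightarrow> real set \<Rightarrow> real \<Rightarrow> real \<Rightarrow> (real^2 \<Rightarrow> real) \<Rightarrow> bool" where
  "competitor A J C \<epsilon> u \<longleftrightarrow> continuous_on UNIV u \<and> cplx u \<in> H1 \<and>
     (LINT x|lborel. (u x)\<^sup>2) = 1 \<and> integrable lborel (grad_norm_sq (cplx u)) \<and>
     (LINT x|lborel. grad_norm_sq (cplx u) x) \<le> C * \<bar>ln \<epsilon>\<bar> \<and>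
     (\<forall>x. \<bar>(u x)\<^sup>2 - A (nsq x)\<bar> \<le> C * \<epsilon> * indicator {x. nsq x \<in> J} x)"

text \<open>The trial function is \<open>A / sqrt (A + \<epsilon>)\<close>, normalised: the density is off by \<open>O(\<epsilon>)\<close>, and the gradient is
  cut off where \<open>A\<close> is of order \<open>\<epsilon>\<close>, which makes the Dirichlet integral logarithmic.\<close>

lemma trial_function:
  fixes A A' :: "real \<Rightarrow> real"
  assumes lip: "\<And>s t. \<bar>A s - A t\<bar> \<le> L * \<bar>s - t\<bar>" and L: "L > 0" and nonneg: "\<And>s. 0 \<le> A s"
    and fin: "finite F" and d: "\<And>s. s \<notin> F \<Longrightarrow> (A has_real_derivative A' s) (at s)"
    and A'm[measurable]: "A' \<in> borel_measurable borel" and A'b: "\<And>s. \<bar>A' s\<bar> \<le> L"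
    and pq: "0 \<le> p" "p < q" and z: "\<And>s. 0 \<le> s \<Longrightarrow> s \<notin> {p..q} \<Longrightarrow> A s = 0 \<and> A' s = 0"
    and c: "c > 0" "\<And>s. p \<le> s \<Longrightarrow> s \<le> q \<Longrightarrow> c * min (s - p) (q - s) \<le> A s"
    and mass: "(LINT x|lborel. A (nsq x)) = 1"
  shows "\<exists>C>0. \<exists>e>0. \<forall>\<epsilon>. 0 < \<epsilon> \<longrightarrow> \<epsilon> < e \<longrightarrow> (\<exists>u. competitor A {p..q} C \<epsilon> u)"
proof -
  define Amax where "Amax = A q + L * q"
  have Amax: "0 \<le> Amax" "\<And>s. 0 \<le> s \<Longrightarrow> A s \<le> Amax"
  proof -
    show a0: "0 \<le> Amax" using nonneg[of q] L pq by (simp add: Amax_def)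
    fix s :: real assume s: "0 \<le> s"
    show "A s \<le> Amax"
    proof (cases "s \<le> q")
      case True
      then have "L * \<bar>s - q\<bar> \<le> L * q" using s pq L by (intro mult_left_mono) auto
      then show ?thesis using lip[of s q] by (simp add: Amax_def)
    qed (use z s a0 in auto)
  qed
  have cA: "continuous_on UNIV A"
  proof -
    have "L-lipschitz_on UNIV A" using lip L by (auto simp: lipschitz_on_def dist_real_def)
    then show ?thesis by (rule lipschitz_on_continuous_on)
  qed
  \<comment> \<open>\<open>K0\<close> absorbs the constant part of the logarithm, using
    \<open>ln 2 \<le> \<bar>ln \<epsilon>\<bar>\<close> for \<open>\<epsilon> < 1 / 2\<close>. The
    two entries of \<open>C\<close> bound the Dirichlet integral and the error of the density; the
    second entry of \<open>e\<close> keeps the mass before normalisation above 1/2.\<close>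
  define K0 where "K0 = \<bar>ln (c * (q - p) + 1)\<bar> / ln 2 + 1"
  have K0: "1 \<le> K0" by (simp add: K0_def)
  define C where "C = max (8 * q * pi * L\<^sup>2 * (2 * K0 / c)) (2 + 2 * Amax * pi * q)"
  define e where "e = min (1/2) (1 / (2 * pi * q))"
  have C0: "C > 0" unfolding C_def using Amax pq by (intro max.strict_coboundedI2 add_pos_nonneg) auto
  have e0: "e > 0" using pq by (simp add: e_def)
  have int_ind: "integrable lborel (indicator {x::real^2. nsq x \<le> q} :: _ \<Rightarrow> real)"
    "(LINT x|lborel. indicator {x::real^2. nsq x \<le> q} x) = pi * q"
  proof -
    have *: "(\<lambda>x::real^2. indicator {x. nsq x \<le> q} x) = (\<lambda>x. indicator {..q} (nsq x) :: real)"
      by (auto simp: fun_eq_iff indicator_def)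
    have **: "(\<lambda>s. indicator {0..} s * indicator {..q} s) = (indicator {0..q} :: real \<Rightarrow> real)"
      by (auto simp: fun_eq_iff indicator_def)
    show "integrable lborel (indicator {x::real^2. nsq x \<le> q} :: _ \<Rightarrow> real)"
      unfolding * by (subst integrable_norm_square_iff) (use pq in \<open>auto simp: **\<close>)
    show "(LINT x|lborel. indicator {x::real^2. nsq x \<le> q} x) = pi * q"
      unfolding * by (subst integral_norm_square) (use pq in \<open>auto simp: **\<close>)
  qed
  have mA: "integrable lborel (\<lambda>x::real^2. A (nsq x))"
    using mass not_integrable_integral_eq by force
  have main: "\<exists>u. competitor A {p..q} C \<epsilon> u"
    if \<epsilon>: "0 < \<epsilon>" "\<epsilon> < e" for \<epsilon>
  proof -
    define B where "B s = desing \<epsilon> (A s)" for s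
    define B' where "B' s = desing' \<epsilon> (A s) * A' s" for s
    have B0: "0 \<le> B s" "(B s)\<^sup>2 \<le> A s" "A s - \<epsilon> \<le> (B s)\<^sup>2" for s
      unfolding B_def using desing_square[OF \<epsilon>(1) nonneg] by auto
    have Bz: "B s = 0" "B' s = 0" if "0 \<le> s" "s \<notin> {p..q}" for s
      using z[OF that] by (auto simp: B_def B'_def desing_def)
    have Blip: "\<bar>B s - B t\<bar> \<le> (L / sqrt \<epsilon>) * \<bar>s - t\<bar>" for s t
    proof -
      have "\<bar>B s - B t\<bar> \<le> (1 / sqrt \<epsilon>) * \<bar>A s - A t\<bar>" unfolding B_def by (rule desing_lipschitz[OF \<epsilon>(1) nonneg nonneg])
      also have "\<dots> \<le> (1 / sqrt \<epsilon>) * (L * \<bar>s - t\<bar>)" using lip \<epsilon> by (intro mult_left_mono) auto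
      finally show ?thesis by simp
    qed
    have cB: "continuous_on UNIV B"
    proof -
      have "(L / sqrt \<epsilon>)-lipschitz_on UNIV B" using Blip L \<epsilon> by (auto simp: lipschitz_on_def dist_real_def)
      then show ?thesis by (rule lipschitz_on_continuous_on)
    qed
    have dB: "(B has_real_derivative B' s) (at s)" if "s \<notin> F" for s
      unfolding B_def[abs_def] B'_def by (rule DERIV_chain2[OF desing_deriv[OF \<epsilon>(1) nonneg] d[OF that]])
    have [measurable]: "A \<in> borel_measurable borel" "B \<in> borel_measurable borel"
      using cA cB by (auto intro: borel_measurable_continuous_onI)
    have [measurable]: "B' \<in> borel_measurable borel" unfolding B'_def desing'_def by measurable
    have B'b: "\<bar>B' s\<bar> \<le> L / sqrt \<epsilon>" for s
    proof -
      have "\<bar>B' s\<bar> \<le> (1 / sqrt \<epsilon>) * L"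
        unfolding B'_def abs_mult using desing'_bounds(1,4)[OF \<epsilon>(1) nonneg[of s]] A'b[of s] \<epsilon> by (intro mult_mono) auto
      then show ?thesis by simp
    qed
    let ?h = "\<lambda>s. 1 / (c * (s - p) + \<epsilon>) * indicator {p..q} s + 1 / (c * (q - s) + \<epsilon>) * indicator {p..q} s"
    \<comment> \<open>\<open>A\<close> dominates \<open>c\<close> times the distance to the nearer
      edge, so \<open>1 / (A + \<epsilon>)\<close> is at most the sum of the two kernels of
      \<open>log_integral\<close>, one for each edge.\<close>
    have B'sq: "(B' s)\<^sup>2 \<le> L\<^sup>2 * ?h s" if s: "0 \<le> s" for s
    proof (cases "s \<in> {p..q}")
      case True
      define k where "k = min (s - p) (q - s)"
      have k: "0 \<le> k" using True by (simp add: k_def)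
      have "(B' s)\<^sup>2 = (A' s)\<^sup>2 * (desing' \<epsilon> (A s))\<^sup>2" by (simp add: B'_def power_mult_distrib)
      also have "\<dots> \<le> L\<^sup>2 * (1 / (A s + \<epsilon>))"
        using A'b[of s] L by (intro mult_mono desing'_bounds(3)[OF \<epsilon>(1) nonneg] power2_le_iff_abs_le[THEN iffD2]) auto
      also have "1 / (A s + \<epsilon>) \<le> 1 / (c * k + \<epsilon>)"
        using c(1) c(2)[of s] True \<epsilon> k nonneg[of s] by (intro divide_left_mono mult_pos_pos) (auto simp: k_def intro!: add_nonneg_pos)
      also have "1 / (c * k + \<epsilon>) \<le> 1 / (c * (s - p) + \<epsilon>) + 1 / (c * (q - s) + \<epsilon>)"
        using True c(1) \<epsilon> unfolding k_def min_def by auto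
      finally show ?thesis using True L by (simp add: mult_left_mono)
    qed (use Bz[OF s] in simp)
    define m where "m = (LINT x|lborel. (B (nsq x))\<^sup>2)"
    have iB: "integrable lborel (\<lambda>x::real^2. (B (nsq x))\<^sup>2)"
      by (rule Bochner_Integration.integrable_bound[OF mA]) (use B0 nonneg in auto)
    have m: "m \<le> 1" "1 - \<epsilon> * (pi * q) \<le> m"
    proof -
      show "m \<le> 1" unfolding m_def mass[symmetric] by (rule integral_mono[OF iB mA]) (rule B0)
      have "1 - \<epsilon> * (pi * q) = (LINT x|lborel. A (nsq x) - \<epsilon> * indicator {x::real^2. nsq x \<le> q} x)"
        using mA int_ind mass by simp
      also have "\<dots> \<le> m" unfolding m_def
      proof (rule integral_mono)
        show "integrable lborel (\<lambda>x. A (nsq x) - \<epsilon> * indicator {x::real^2. nsq x \<le> q} x)"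
          using mA int_ind by simp
        show "A (nsq x) - \<epsilon> * indicator {x::real^2. nsq x \<le> q} x \<le> (B (nsq x))\<^sup>2" for x :: "real^2"
          using B0(3)[of "nsq x"] z[of "nsq x"] by (cases "nsq x \<le> q") auto
      qed (rule iB)
      finally show "1 - \<epsilon> * (pi * q) \<le> m" .
    qed
    have eq: "\<epsilon> * (pi * q) \<le> 1 / 2"
    proof -
      have "\<epsilon> * (pi * q) \<le> (1 / (2 * pi * q)) * (pi * q)" using \<epsilon> pq by (intro mult_right_mono) (auto simp: e_def)
      then show ?thesis using pq by simp
    qed
    then have mh: "1 / 2 \<le> m" using m by linarith
    define u where "u x = B (nsq x) / sqrt m" for x :: "real^2"
    define u' where "u' i x = B' (nsq x) * (2 * x $ i) / sqrt m" for i and x :: "real^2"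
    have [measurable]: "u' i \<in> borel_measurable borel" for i unfolding u'_def by measurable
    have cu: "continuous_on UNIV u"
      unfolding u_def using mh by (intro continuous_intros continuous_on_compose2[OF cB]) auto
    have [measurable]: "u \<in> borel_measurable borel" using cu by (rule borel_measurable_continuous_onI)
    have u2: "(u x)\<^sup>2 = (B (nsq x))\<^sup>2 / m" for x using mh by (simp add: u_def power_divide)
    have weak: "is_weak_partial i (cplx u) (\<lambda>x. complex_of_real (u' i x))" for i
      unfolding o_def
    proof (rule is_weak_partial_of_real[OF cu])
      have "has_axis_deriv u (u' i x) i x" if "nsq x \<notin> F" for x
        unfolding u_def u'_def using has_axis_deriv_radial[OF dB[OF that], of i] by (rule DERIV_cdivide)
      then show "AE x in lborel. has_axis_deriv u (u' i x) i x"
        using AE_norm_square_notin_finite[OF fin] by (auto elim!: eventually_mono)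
      show "\<exists>La. \<forall>x t. norm x \<le> R \<longrightarrow> 0 < t \<longrightarrow> t \<le> 1 \<longrightarrow> \<bar>u (x + t *\<^sub>R axis i 1) - u x\<bar> \<le> La * t" for R
      proof (intro exI allI impI)
        fix x :: "real^2" and t assume x: "norm x \<le> R" "0 < t" "t \<le> (1::real)"
        have "\<bar>2 * t * x $ i + t\<^sup>2\<bar> \<le> 2 * t * R + t * 1"
        proof -
          have "\<bar>2 * t * x $ i\<bar> \<le> 2 * t * R" using abs_component_le_norm[of x i] x by (simp add: abs_mult)
          moreover have "t\<^sup>2 \<le> t * 1" using x by (simp add: power2_eq_square)
          ultimately show ?thesis using abs_triangle_ineq[of "2 * t * x $ i" "t\<^sup>2"] by simp
        qed
        then have "(L / sqrt \<epsilon>) * \<bar>2 * t * x $ i + t\<^sup>2\<bar> \<le> (L / sqrt \<epsilon>) * (2 * t * R + t * 1)" using L \<epsilon> by (intro mult_left_mono) auto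
        then have Bb: "\<bar>B ((norm (x + t *\<^sub>R axis i 1))\<^sup>2) - B (nsq x)\<bar> \<le> (L / sqrt \<epsilon>) * (2 * t * R + t * 1)"
          using Blip[of "(norm (x + t *\<^sub>R axis i 1))\<^sup>2" "nsq x"] unfolding norm_square_axis by simp
        have eu: "\<bar>u (x + t *\<^sub>R axis i 1) - u x\<bar> = \<bar>B ((norm (x + t *\<^sub>R axis i 1))\<^sup>2) - B (nsq x)\<bar> / sqrt m"
          using mh by (simp add: u_def diff_divide_distrib[symmetric])
        have "\<bar>u (x + t *\<^sub>R axis i 1) - u x\<bar> \<le> (L / sqrt \<epsilon>) * (2 * t * R + t * 1) / sqrt m"
          unfolding eu by (rule divide_right_mono[OF Bb]) (use mh in simp)
        then show "\<bar>u (x + t *\<^sub>R axis i 1) - u x\<bar> \<le> ((L / sqrt \<epsilon>) * (2 * R + 1) / sqrt m) * t" by (simp add: algebra_simps)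
      qed
      show "\<exists>M. \<forall>x. norm x \<le> R \<longrightarrow> \<bar>u' i x\<bar> \<le> M" for R
      proof (intro exI allI impI)
        fix x :: "real^2" assume x: "norm x \<le> R"
        have e: "\<bar>u' i x\<bar> = \<bar>B' (nsq x)\<bar> * (2 * \<bar>x $ i\<bar>) / sqrt m"
          using mh by (simp add: u'_def abs_mult)
        show "\<bar>u' i x\<bar> \<le> (L / sqrt \<epsilon>) * (2 * R) / sqrt m"
          unfolding e using mh B'b[of "nsq x"] abs_component_le_norm[of x i] x L \<epsilon>
          by (intro divide_right_mono mult_mono) auto
      qed
    qed measurable
    have norm_sum: "(\<Sum>i\<in>UNIV. (x $ i)\<^sup>2) = nsq x" for x :: "real^2"
      by (simp add: norm_vec_def L2_set_def sum_nonneg)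
    have gs: "(\<Sum>i\<in>UNIV. (u' i x)\<^sup>2) = 4 * nsq x * (B' (nsq x))\<^sup>2 / m" for x
    proof -
      have "(\<Sum>i\<in>UNIV. (u' i x)\<^sup>2) = (\<Sum>i\<in>UNIV. (4 * (B' (nsq x))\<^sup>2 / m) * (x $ i)\<^sup>2)"
        using mh by (intro sum.cong) (auto simp: u'_def power_divide power_mult_distrib)
      also have "\<dots> = (4 * (B' (nsq x))\<^sup>2 / m) * nsq x" by (simp only: sum_distrib_left[symmetric] norm_sum)
      finally show ?thesis by simp
    qed
    define I where "I = 8 * q * L\<^sup>2 * (pi * (2 * ((ln (c * (q - p) + \<epsilon>) - ln \<epsilon>) / c)))"
    have hb: "has_bochner_integral lborel ?h ((ln (c * (q - p) + \<epsilon>) - ln \<epsilon>) / c + (ln (c * (q - p) + \<epsilon>) - ln \<epsilon>) / c)"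
      by (intro has_bochner_integral_add log_integral c \<epsilon> pq)
    have ih: "(\<lambda>s. indicator {0..} s * ?h s) = ?h" using pq by (auto simp: fun_eq_iff indicator_def)
    have hm[measurable]: "?h \<in> borel_measurable borel" by measurable
    have ih2: "integrable lborel (\<lambda>x::real^2. ?h (nsq x))"
      unfolding integrable_norm_square_iff[OF hm] ih using hb by (rule integrable.intros)
    have Ih2: "(LINT x|lborel. 8 * q * L\<^sup>2 * ?h (nsq x)) = I"
      unfolding integral_mult_right_zero integral_norm_square[OF hm] ih has_bochner_integral_integral_eq[OF hb] I_def by simp
    have gb: "(\<Sum>i\<in>UNIV. (u' i x)\<^sup>2) \<le> 8 * q * L\<^sup>2 * ?h (nsq x)" for x
    proof (cases "nsq x \<le> q")
      case True
      have "(\<Sum>i\<in>UNIV. (u' i x)\<^sup>2) \<le> 4 * nsq x * (B' (nsq x))\<^sup>2 / (1 / 2)"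
        unfolding gs using mh by (intro divide_left_mono) auto
      also have "\<dots> \<le> 8 * q * (L\<^sup>2 * ?h (nsq x))"
        using True B'sq[of "nsq x"] pq by (simp, intro mult_mono) auto
      finally show ?thesis by (simp only: mult.assoc)
    next
      case False
      then have "B' (nsq x) = 0" by (intro Bz) auto
      then show ?thesis unfolding gs using False by simp
    qed
    have ig: "integrable lborel (\<lambda>x. \<Sum>i\<in>UNIV. (u' i x)\<^sup>2)"
    proof (rule Bochner_Integration.integrable_bound[OF integrable_mult_right[OF ih2, of "8 * q * L\<^sup>2"]])
      show "AE x in lborel. norm (\<Sum>i\<in>UNIV. (u' i x)\<^sup>2) \<le> norm (8 * q * L\<^sup>2 * ?h (nsq x))"
      proof (rule AE_I2)
        fix x
        have "norm (\<Sum>i\<in>UNIV. (u' i x)\<^sup>2) = (\<Sum>i\<in>UNIV. (u' i x)\<^sup>2)" by (simp add: sum_nonneg)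
        also note gb[of x]
        also have "8 * q * L\<^sup>2 * ?h (nsq x) \<le> norm (8 * q * L\<^sup>2 * ?h (nsq x))"
          unfolding real_norm_def by (rule abs_ge_self)
        finally show "norm (\<Sum>i\<in>UNIV. (u' i x)\<^sup>2) \<le> norm (8 * q * L\<^sup>2 * ?h (nsq x))" .
      qed
    qed measurable
    have gAE: "AE x in lborel. grad_norm_sq (cplx u) x = (\<Sum>i\<in>UNIV. (u' i x)\<^sup>2)"
    proof -
      have "AE x in lborel. \<forall>i\<in>UNIV. weak_partial i (cplx u) x = complex_of_real (u' i x)"
        using weak_partial_AE[OF weak] by (intro AE_finite_allI) auto
      then show ?thesis by eventually_elim (simp add: grad_norm_sq_def)
    qed
    have wm: "weak_partial i (cplx u) \<in> borel_measurable borel" for i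
    proof -
      have "is_weak_partial i (cplx u) (weak_partial i (cplx u))"
        unfolding weak_partial_def using weak[of i] by (rule someI[of "is_weak_partial i (cplx u)"])
      then show ?thesis by (simp add: is_weak_partial_def locally_integrable_def)
    qed
    have gm[measurable]: "grad_norm_sq (cplx u) \<in> borel_measurable borel"
      unfolding grad_norm_sq_def[abs_def] using wm by measurable
    have ig': "integrable lborel (grad_norm_sq (cplx u))"
      using ig by (subst integrable_cong_AE[OF _ _ gAE]) auto
    have Ig: "(LINT x|lborel. grad_norm_sq (cplx u) x) \<le> I"
    proof -
      have "(LINT x|lborel. grad_norm_sq (cplx u) x) = (LINT x|lborel. (\<Sum>i\<in>UNIV. (u' i x)\<^sup>2))"
        by (rule integral_cong_AE[OF _ _ gAE]) measurable
      also have "\<dots> \<le> (LINT x|lborel. 8 * q * L\<^sup>2 * ?h (nsq x))"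
        by (rule integral_mono[OF ig]) (use ih2 gb in auto)
      finally show ?thesis unfolding Ih2 .
    qed
    have "I \<le> C * \<bar>ln \<epsilon>\<bar>"
    proof -
      have e2: "\<epsilon> < 1 / 2" using \<epsilon> by (simp add: e_def)
      have "ln \<epsilon> \<le> ln (1 / 2)" using \<epsilon> e2 by (subst ln_le_cancel_iff) auto
      moreover have "ln (1 / 2 :: real) = - ln 2" "0 < ln (2::real)" by (simp_all add: ln_div)
      ultimately have l: "ln 2 \<le> \<bar>ln \<epsilon>\<bar>" "\<bar>ln \<epsilon>\<bar> = - ln \<epsilon>" by linarith+
      have cq: "0 < c * (q - p)" using c pq by simp
      have "ln (c * (q - p) + \<epsilon>) \<le> ln (c * (q - p) + 1)" using cq \<epsilon> e2 by (subst ln_le_cancel_iff) auto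
      also have "\<dots> \<le> \<bar>ln (c * (q - p) + 1)\<bar> / ln 2 * \<bar>ln \<epsilon>\<bar>"
      proof -
        have "\<bar>ln (c * (q - p) + 1)\<bar> / ln 2 * ln 2 \<le> \<bar>ln (c * (q - p) + 1)\<bar> / ln 2 * \<bar>ln \<epsilon>\<bar>"
          using l by (intro mult_left_mono) auto
        then show ?thesis by simp
      qed
      finally have "ln (c * (q - p) + \<epsilon>) - ln \<epsilon> \<le> K0 * \<bar>ln \<epsilon>\<bar>" using l(2) by (simp add: K0_def algebra_simps)
      then have "I \<le> 8 * q * L\<^sup>2 * (pi * (2 * (K0 * \<bar>ln \<epsilon>\<bar> / c)))"
        unfolding I_def using c pq by (intro mult_left_mono divide_right_mono) auto
      also have "\<dots> = (8 * q * pi * L\<^sup>2 * (2 * K0 / c)) * \<bar>ln \<epsilon>\<bar>" by simp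
      also have "\<dots> \<le> C * \<bar>ln \<epsilon>\<bar>" unfolding C_def by (intro mult_right_mono) auto
      finally show ?thesis .
    qed
    then have G: "(LINT x|lborel. grad_norm_sq (cplx u) x) \<le> C * \<bar>ln \<epsilon>\<bar>" using Ig by linarith
    have iu: "integrable lborel (\<lambda>x. (u x)\<^sup>2)" unfolding u2 using iB by simp
    have mu: "(LINT x|lborel. (u x)\<^sup>2) = 1" unfolding u2 using mh by (simp add: m_def[symmetric])
    have H: "cplx u \<in> H1"
    proof -
      have "cplx u \<in> L2" using iu by (simp add: L2_def o_def)
      moreover have "(\<lambda>x. complex_of_real (u' i x)) \<in> L2" for i
      proof -
        have "integrable lborel (\<lambda>x. (u' i x)\<^sup>2)"
          by (rule Bochner_Integration.integrable_bound[OF ig])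
            (auto intro!: AE_I2 member_le_sum order_trans[OF _ abs_ge_self])
        then show ?thesis by (simp add: L2_def)
      qed
      ultimately show ?thesis using weak by (auto simp: H1_def)
    qed
    have err: "\<bar>(u x)\<^sup>2 - A (nsq x)\<bar> \<le> C * \<epsilon> * indicator {x. nsq x \<in> {p..q}} x" for x
    proof (cases "nsq x \<in> {p..q}")
      case True
      define a b where "a = A (nsq x)" and "b = (B (nsq x))\<^sup>2"
      have ab: "b \<le> a" "a - \<epsilon> \<le> b" "0 \<le> b" "a \<le> Amax" using B0 Amax by (auto simp: a_def b_def)
      \<comment> \<open>Before normalisation the density lies between \<open>a - \<epsilon>\<close>
        and \<open>a\<close>. Dividing by \<open>m\<close>, which lies between
        \<open>1 - \<epsilon> * (pi * q)\<close> and 1, raises it by O(\<epsilon>) only.\<close>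
      have "(u x)\<^sup>2 - a \<le> a * (1 / m - 1)"
        unfolding u2 b_def[symmetric] using ab mh by (simp add: right_diff_distrib divide_right_mono)
      also have "\<dots> \<le> Amax * (2 * (\<epsilon> * (pi * q)))"
      proof (intro mult_mono)
        have "1 / m - 1 = (1 - m) / m" using mh by (simp add: diff_divide_distrib)
        also have "\<dots> \<le> (\<epsilon> * (pi * q)) / (1 / 2)" using m mh \<epsilon> pq by (intro frac_le) auto
        finally show "1 / m - 1 \<le> 2 * (\<epsilon> * (pi * q))" by simp
        show "0 \<le> 1 / m - 1" using m mh by simp
      qed (use ab Amax in auto)
      finally have up: "(u x)\<^sup>2 - a \<le> (2 * Amax * pi * q) * \<epsilon>" by (simp add: algebra_simps)
      have "b \<le> b / m" using ab m mh by (simp add: le_divide_eq mult_left_le)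
      then have lo: "a - (u x)\<^sup>2 \<le> \<epsilon>" unfolding u2 b_def[symmetric] using ab by linarith
      have "0 \<le> (2 * Amax * pi * q) * \<epsilon>" using Amax pq \<epsilon> by simp
      then have "\<bar>(u x)\<^sup>2 - a\<bar> \<le> (2 + 2 * Amax * pi * q) * \<epsilon>" using up lo \<epsilon> by (simp add: distrib_right)
      also have "\<dots> \<le> C * \<epsilon>" unfolding C_def using \<epsilon> by (intro mult_right_mono) auto
      finally show ?thesis using True unfolding a_def by simp
    next
      case False
      then have "B (nsq x) = 0" "A (nsq x) = 0" using Bz(1)[of "nsq x"] z[of "nsq x"] by auto
      then show ?thesis using False by (simp add: u_def)
    qed
    show ?thesis
      unfolding competitor_def by (intro exI[of _ u] conjI allI cu H mu ig' G err)
  qed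
  show ?thesis using C0 e0 main by blast
qed

section \<open>The energy in terms of real integrals\<close>

definition gsq :: "(real^2 \<Rightarrow> real) \<Rightarrow> real^2 \<Rightarrow> real" where
  "gsq u x = (\<Sum>i\<in>UNIV. (partial_deriv i u x)\<^sup>2)"

lemma gsq_nonneg: "0 \<le> gsq u x" by (simp add: gsq_def sum_nonneg)

lemma gsq_continuous:
  assumes "C_k 2 u" shows "continuous_on UNIV (gsq u)"
  unfolding gsq_def[abs_def] by (intro continuous_intros C_k_2D(4)[OF assms])

lemma AE_grad_norm_sq:
  assumes "C_k 2 u"
  shows "AE x in lborel. grad_norm_sq (cplx u) x = gsq u x"
proof -
  have "AE x in lborel. \<forall>i\<in>UNIV. weak_partial i (cplx u) x = complex_of_real (partial_deriv i u x)"
    using weak_partial_AE[OF is_weak_partial_C2[OF assms]] by (intro AE_finite_allI) (auto simp: o_def)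
  then show ?thesis by eventually_elim (simp add: grad_norm_sq_def gsq_def)
qed

lemma grad_norm_sq_measurable:
  assumes "u \<in> H1" shows "grad_norm_sq u \<in> borel_measurable borel"
proof -
  have "weak_partial i u \<in> borel_measurable borel" for i
  proof -
    obtain v where "is_weak_partial i u v" using assms by (auto simp: H1_def)
    then have "is_weak_partial i u (weak_partial i u)"
      unfolding weak_partial_def by (rule someI[of "is_weak_partial i u"])
    then show ?thesis by (simp add: is_weak_partial_def locally_integrable_def)
  qed
  then show ?thesis unfolding grad_norm_sq_def[abs_def] by measurable
qed

lemma integrable_nn:
  assumes "f \<in> borel_measurable borel" "\<And>x::real^2. 0 \<le> f x" "(\<integral>\<^sup>+x. ennreal (f x) \<partial>lborel) < \<infinity>"
  shows "integrable lborel f" "(\<integral>\<^sup>+x. ennreal (f x) \<partial>lborel) = ennreal (LINT x|lborel. f x)"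
proof -
  show "integrable lborel f" using assms by (intro integrableI_nonneg) auto
  then show "(\<integral>\<^sup>+x. ennreal (f x) \<partial>lborel) = ennreal (LINT x|lborel. f x)"
    using assms(2) by (intro nn_integral_eq_integral) auto
qed

lemma ennreal_combine:
  "0 \<le> a \<Longrightarrow> 0 \<le> b \<Longrightarrow> 0 \<le> c \<Longrightarrow> 0 \<le> k \<Longrightarrow> ennreal a + ennreal b + ennreal k * ennreal c = ennreal (a + b + k * c)"
  by (simp add: ennreal_mult)

lemma ennreal_parts_finite:
  "a + b + ennreal k * c < \<infinity> \<Longrightarrow> 0 < k \<Longrightarrow> a < \<infinity> \<and> b < \<infinity> \<and> c < \<infinity>"
  by (auto simp: ennreal_mult_less_top)

definition edens :: "real \<Rightarrow> real \<Rightarrow> (real^2 \<Rightarrow> complex) \<Rightarrow> real^2 \<Rightarrow> real" where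
  "edens gj \<epsilon> u x = grad_norm_sq u x / 2 + nsq x / (2 * \<epsilon>\<^sup>2) * (cmod (u x))\<^sup>2 + gj / (4 * \<epsilon>\<^sup>2) * (cmod (u x))^4"

lemma edens_nonneg: "0 \<le> gj \<Longrightarrow> 0 \<le> edens gj \<epsilon> u x"
  by (simp add: edens_def grad_norm_sq_def sum_nonneg)

lemma energy_eq:
  "energy g1 g2 g \<epsilon> u1 u2 = (\<integral>\<^sup>+x. ennreal (edens g1 \<epsilon> u1 x) \<partial>lborel) + (\<integral>\<^sup>+x. ennreal (edens g2 \<epsilon> u2 x) \<partial>lborel)
     + ennreal (g / (2 * \<epsilon>\<^sup>2)) * (\<integral>\<^sup>+x. ennreal ((cmod (u1 x))\<^sup>2 * (cmod (u2 x))\<^sup>2) \<partial>lborel)"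
  by (simp add: energy_def edens_def)

text \<open>Energies take values in \<open>[0, \<infinity>]\<close>. The finite energy of the
  competitor bounds that of the minimizer, and since all parts are nonnegative each of them becomes
  integrable; then the inequality can be read between real numbers.\<close>

lemma energy_le_real:
  fixes u1 u2 v1 v2 :: "real^2 \<Rightarrow> complex"
  assumes pos: "0 < g1" "0 < g2" "0 < g" "0 < \<epsilon>"
    and H: "u1 \<in> H1" "u2 \<in> H1"
    and v: "integrable lborel (edens g1 \<epsilon> v1)" "integrable lborel (edens g2 \<epsilon> v2)"
      "integrable lborel (\<lambda>x. (cmod (v1 x))\<^sup>2 * (cmod (v2 x))\<^sup>2)"
    and le: "energy g1 g2 g \<epsilon> u1 u2 \<le> energy g1 g2 g \<epsilon> v1 v2"
  shows "integrable lborel (edens g1 \<epsilon> u1)" "integrable lborel (edens g2 \<epsilon> u2)"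
    "integrable lborel (\<lambda>x. (cmod (u1 x))\<^sup>2 * (cmod (u2 x))\<^sup>2)"
    "(LINT x|lborel. edens g1 \<epsilon> u1 x) + (LINT x|lborel. edens g2 \<epsilon> u2 x)
       + g / (2 * \<epsilon>\<^sup>2) * (LINT x|lborel. (cmod (u1 x))\<^sup>2 * (cmod (u2 x))\<^sup>2)
     \<le> (LINT x|lborel. edens g1 \<epsilon> v1 x) + (LINT x|lborel. edens g2 \<epsilon> v2 x)
       + g / (2 * \<epsilon>\<^sup>2) * (LINT x|lborel. (cmod (v1 x))\<^sup>2 * (cmod (v2 x))\<^sup>2)"
proof -
  have k: "0 < g / (2 * \<epsilon>\<^sup>2)" using pos by simp
  have n: "0 \<le> edens g1 \<epsilon> w x" "0 \<le> edens g2 \<epsilon> w x" "0 \<le> (cmod (v1 x))\<^sup>2 * (cmod (v2 x))\<^sup>2" "0 \<le> (cmod (u1 x))\<^sup>2 * (cmod (u2 x))\<^sup>2" for w x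
    using pos by (auto intro: edens_nonneg)
  have vE: "energy g1 g2 g \<epsilon> v1 v2 = ennreal ((LINT x|lborel. edens g1 \<epsilon> v1 x) + (LINT x|lborel. edens g2 \<epsilon> v2 x)
       + g / (2 * \<epsilon>\<^sup>2) * (LINT x|lborel. (cmod (v1 x))\<^sup>2 * (cmod (v2 x))\<^sup>2))"
    unfolding energy_eq nn_integral_eq_integral[OF v(1) AE_I2[OF n(1)]] nn_integral_eq_integral[OF v(2) AE_I2[OF n(2)]]
      nn_integral_eq_integral[OF v(3) AE_I2[OF n(3)]]
    using k n by (intro ennreal_combine integral_nonneg_AE AE_I2) auto
  have [measurable]: "u1 \<in> borel_measurable borel" "u2 \<in> borel_measurable borel" using H by (auto simp: H1_def L2_def)
  note [measurable] = grad_norm_sq_measurable[OF H(1)] grad_norm_sq_measurable[OF H(2)]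
  have m: "edens g1 \<epsilon> u1 \<in> borel_measurable borel" "edens g2 \<epsilon> u2 \<in> borel_measurable borel"
    "(\<lambda>x. (cmod (u1 x))\<^sup>2 * (cmod (u2 x))\<^sup>2) \<in> borel_measurable borel"
    unfolding edens_def[abs_def] by measurable
  have "energy g1 g2 g \<epsilon> v1 v2 < \<infinity>" unfolding vE by simp
  with le have fin: "energy g1 g2 g \<epsilon> u1 u2 < \<infinity>" by (rule le_less_trans)
  have f1: "(\<integral>\<^sup>+x. ennreal (edens g1 \<epsilon> u1 x) \<partial>lborel) < \<infinity>" and f2: "(\<integral>\<^sup>+x. ennreal (edens g2 \<epsilon> u2 x) \<partial>lborel) < \<infinity>"
    and f3: "(\<integral>\<^sup>+x. ennreal ((cmod (u1 x))\<^sup>2 * (cmod (u2 x))\<^sup>2) \<partial>lborel) < \<infinity>"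
    using ennreal_parts_finite[OF fin[unfolded energy_eq] k] by blast+
  show i1: "integrable lborel (edens g1 \<epsilon> u1)" by (rule integrable_nn(1)[OF m(1) n(1) f1])
  show i2: "integrable lborel (edens g2 \<epsilon> u2)" by (rule integrable_nn(1)[OF m(2) n(2) f2])
  show i3: "integrable lborel (\<lambda>x. (cmod (u1 x))\<^sup>2 * (cmod (u2 x))\<^sup>2)" by (rule integrable_nn(1)[OF m(3) _ f3]) simp
  have uE: "energy g1 g2 g \<epsilon> u1 u2 = ennreal ((LINT x|lborel. edens g1 \<epsilon> u1 x) + (LINT x|lborel. edens g2 \<epsilon> u2 x)
       + g / (2 * \<epsilon>\<^sup>2) * (LINT x|lborel. (cmod (u1 x))\<^sup>2 * (cmod (u2 x))\<^sup>2))"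
    unfolding energy_eq nn_integral_eq_integral[OF i1 AE_I2[OF n(1)]] nn_integral_eq_integral[OF i2 AE_I2[OF n(2)]]
      nn_integral_eq_integral[OF i3 AE_I2[OF n(4)]]
    using k n by (intro ennreal_combine integral_nonneg_AE AE_I2) auto
  have "0 \<le> (LINT x|lborel. edens g1 \<epsilon> v1 x) + (LINT x|lborel. edens g2 \<epsilon> v2 x)
       + g / (2 * \<epsilon>\<^sup>2) * (LINT x|lborel. (cmod (v1 x))\<^sup>2 * (cmod (v2 x))\<^sup>2)"
    using k n by (intro add_nonneg_nonneg mult_nonneg_nonneg integral_nonneg_AE) auto
  then show "(LINT x|lborel. edens g1 \<epsilon> u1 x) + (LINT x|lborel. edens g2 \<epsilon> u2 x)
       + g / (2 * \<epsilon>\<^sup>2) * (LINT x|lborel. (cmod (u1 x))\<^sup>2 * (cmod (u2 x))\<^sup>2)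
     \<le> (LINT x|lborel. edens g1 \<epsilon> v1 x) + (LINT x|lborel. edens g2 \<epsilon> v2 x)
       + g / (2 * \<epsilon>\<^sup>2) * (LINT x|lborel. (cmod (v1 x))\<^sup>2 * (cmod (v2 x))\<^sup>2)"
    using le unfolding uE vE by (simp add: ennreal_le_iff)
qed

lemma edens_parts:
  assumes i: "integrable lborel (edens gj \<epsilon> (cplx u))" and pos: "0 < gj" "0 < \<epsilon>"
    and m: "u \<in> borel_measurable borel" "grad_norm_sq (cplx u) \<in> borel_measurable borel"
  shows "integrable lborel (grad_norm_sq (cplx u))" "integrable lborel (\<lambda>x. nsq x * (u x)\<^sup>2)"
    "integrable lborel (\<lambda>x. ((u x)\<^sup>2)\<^sup>2)"
proof -
  note [measurable] = m
  have g0: "0 \<le> grad_norm_sq (cplx u) x" for x by (simp add: grad_norm_sq_def sum_nonneg)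
  have e: "edens gj \<epsilon> (cplx u) x = grad_norm_sq (cplx u) x / 2 + nsq x * (u x)\<^sup>2 / (2 * \<epsilon>\<^sup>2) + gj / (4 * \<epsilon>\<^sup>2) * ((u x)\<^sup>2)\<^sup>2" for x
    by (simp add: edens_def)
  have nn: "0 \<le> nsq x * (u x)\<^sup>2 / (2 * \<epsilon>\<^sup>2)" "0 \<le> gj / (4 * \<epsilon>\<^sup>2) * ((u x)\<^sup>2)\<^sup>2" for x using pos by auto
  have *: "integrable lborel h" if "h \<in> borel_measurable borel" "\<And>x. 0 \<le> h x" "\<And>x. h x \<le> K * edens gj \<epsilon> (cplx u) x" for h K
    by (rule Bochner_Integration.integrable_bound[OF integrable_mult_right[OF i, of K]]) (use that in \<open>auto intro!: AE_I2 order_trans[OF _ abs_ge_self]\<close>)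
  show "integrable lborel (grad_norm_sq (cplx u))"
  proof (rule *[where K=2])
    show "grad_norm_sq (cplx u) x \<le> 2 * edens gj \<epsilon> (cplx u) x" for x
      unfolding e using nn[of x] by (simp add: distrib_left)
  qed (use g0 in auto)
  show "integrable lborel (\<lambda>x. nsq x * (u x)\<^sup>2)"
  proof (rule *[where K="2 * \<epsilon>\<^sup>2"])
    fix x
    have "nsq x * (u x)\<^sup>2 = 2 * \<epsilon>\<^sup>2 * (nsq x * (u x)\<^sup>2 / (2 * \<epsilon>\<^sup>2))" using pos by simp
    also have "\<dots> \<le> 2 * \<epsilon>\<^sup>2 * edens gj \<epsilon> (cplx u) x"
      unfolding e using nn[of x] g0[of x] by (intro mult_left_mono) auto
    finally show "nsq x * (u x)\<^sup>2 \<le> 2 * \<epsilon>\<^sup>2 * edens gj \<epsilon> (cplx u) x" .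
  qed auto
  show "integrable lborel (\<lambda>x. ((u x)\<^sup>2)\<^sup>2)"
  proof (rule *[where K="4 * \<epsilon>\<^sup>2 / gj"])
    fix x
    have "((u x)\<^sup>2)\<^sup>2 = 4 * \<epsilon>\<^sup>2 / gj * (gj / (4 * \<epsilon>\<^sup>2) * ((u x)\<^sup>2)\<^sup>2)" using pos by simp
    also have "\<dots> \<le> 4 * \<epsilon>\<^sup>2 / gj * edens gj \<epsilon> (cplx u) x"
      unfolding e using nn[of x] g0[of x] pos by (intro mult_left_mono) auto
    finally show "((u x)\<^sup>2)\<^sup>2 \<le> 4 * \<epsilon>\<^sup>2 / gj * edens gj \<epsilon> (cplx u) x" .
  qed auto
qed

section \<open>Excess energy of the minimizer\<close>

context tf_data
begin

lemma Q_pos: "\<exists>\<kappa>>0. \<forall>m n. \<kappa> * (m\<^sup>2 + n\<^sup>2) \<le> Q m n"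
proof -
  \<comment> \<open>Determinant over trace of the coefficient matrix. It does not exceed the smaller
    eigenvalue: for this \<open>k\<close> one has
    \<open>(g1 - k) * (g2 - k) = g\<^sup>2 + k\<^sup>2\<close>.\<close>
  define k where "k = (g1 * g2 - g\<^sup>2) / (g1 + g2)"
  have k: "0 < k" "k * (g1 + g2) = g1 * g2 - g\<^sup>2" using g_pos g_det by (auto simp: k_def)
  have kg: "0 < g1 - k"
  proof -
    have "k * (g1 + g2) < g1 * (g1 + g2)" using k(2) mult_pos_pos[OF g_pos(1) g_pos(1)] zero_less_power[OF g_pos(3), of 2] unfolding distrib_left by linarith
    then show ?thesis using g_pos by simp
  qed
  have det: "g\<^sup>2 \<le> (g1 - k) * (g2 - k)"
  proof -
    have "(g1 - k) * (g2 - k) = g1 * g2 - k * (g1 + g2) + k\<^sup>2" by (simp add: algebra_simps power2_eq_square)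
    then show ?thesis using k by simp
  qed
  have "k / 2 * (m\<^sup>2 + n\<^sup>2) \<le> Q m n" for m n
  proof -
    have "0 \<le> ((g1 - k) * m + g * n)\<^sup>2 + ((g1 - k) * (g2 - k) - g\<^sup>2) * n\<^sup>2" using det by simp
    also have "\<dots> = (g1 - k) * ((g1 - k) * m\<^sup>2 + (g2 - k) * n\<^sup>2 + 2 * g * m * n)"
      by (simp add: power2_eq_square algebra_simps)
    finally have "0 \<le> (g1 - k) * m\<^sup>2 + (g2 - k) * n\<^sup>2 + 2 * g * m * n" using kg by (simp add: zero_le_mult_iff)
    then show ?thesis by (simp add: Q_def algebra_simps)
  qed
  then show ?thesis using k(1) by (intro exI[of _ "k / 2"]) auto
qed

text \<open>Value of the limiting functional at the profile, in the scaling of the energy by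
  \<open>2 * \<epsilon>\<^sup>2\<close> that \<open>energy_real_form\<close> uses.\<close>

definition Ea :: real where
  "Ea = (LINT x|lborel. nsq x * (A1 (nsq x) + A2 (nsq x)) + Q (A1 (nsq x)) (A2 (nsq x)))"

definition defect :: "real \<Rightarrow> real \<Rightarrow> real \<Rightarrow> real" where
  "defect s m n = Q (m - A1 s) (n - A2 s) + W1 s * m + W2 s * n"

text \<open>Completing the square around the Thomas-Fermi profile.\<close>

lemma defect_eq:
  "s * (m + n) + Q m n = (s * (A1 s + A2 s) + Q (A1 s) (A2 s)) + defect s m n + l1 * (m - A1 s) + l2 * (n - A2 s)"
proof -
  have "s * (m + n) + Q m n - (s * (A1 s + A2 s) + Q (A1 s) (A2 s)) - l1 * (m - A1 s) - l2 * (n - A2 s)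
     = Q (m - A1 s) (n - A2 s) + W1 s * (m - A1 s) + W2 s * (n - A2 s)"
    unfolding Q_def W1_def W2_def by (simp add: power2_eq_square field_simps)
  then show ?thesis using WA_zero[of s] by (simp add: defect_def right_diff_distrib)
qed

lemma A1_trial: "\<exists>C>0. \<exists>e>0. \<forall>\<epsilon>. 0 < \<epsilon> \<longrightarrow> \<epsilon> < e \<longrightarrow> (\<exists>u. competitor A1 {0..s2} C \<epsilon> u)"
proof (rule trial_function[where A'=A1' and F="{s1, s2, l2}" and c="min (1 / g1) k1"])
  show "A1' \<in> borel_measurable borel" unfolding A1'_def[abs_def] by measurable
  show "\<bar>A1' s\<bar> \<le> L" for s using L_ge k_pos g_pos by (auto simp: A1'_def)
  show "A1 s = 0 \<and> A1' s = 0" if "0 \<le> s" "s \<notin> {0..s2}" for s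
    using that s_ord by (auto simp: A1_def A1'_def)
  show "min (1 / g1) k1 * min (s - 0) (s2 - s) \<le> A1 s" if "0 \<le> s" "s \<le> s2" for s
  proof -
    have "min (1 / g1) k1 * min (s - 0) (s2 - s) \<le> (1 / g1) * (l1 - s)"
      using that g_pos k_pos l_order by (intro mult_mono) auto
    moreover have "min (1 / g1) k1 * min (s - 0) (s2 - s) \<le> k1 * (s2 - s)"
      using that g_pos k_pos by (intro mult_mono) auto
    ultimately show ?thesis unfolding A1_min by (simp add: le_max_iff_disj)
  qed
qed (use A_lipschitz L_ge A_nonneg A_deriv s_ord g_pos k_pos mass in auto)

lemma A2_trial: "\<exists>C>0. \<exists>e>0. \<forall>\<epsilon>. 0 < \<epsilon> \<longrightarrow> \<epsilon> < e \<longrightarrow> (\<exists>u. competitor A2 {s1..l2} C \<epsilon> u)"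
proof (rule trial_function[where A'=A2' and F="{s1, s2, l2}" and c="min k2 (1 / g2)"])
  show "A2' \<in> borel_measurable borel" unfolding A2'_def[abs_def] by measurable
  show "\<bar>A2' s\<bar> \<le> L" for s using L_ge k_pos g_pos by (auto simp: A2'_def)
  show "A2 s = 0 \<and> A2' s = 0" if "0 \<le> s" "s \<notin> {s1..l2}" for s
    using that s_ord by (auto simp: A2_def A2'_def)
  show "min k2 (1 / g2) * min (s - s1) (l2 - s) \<le> A2 s" if "s1 \<le> s" "s \<le> l2" for s
  proof -
    have "min k2 (1 / g2) * min (s - s1) (l2 - s) \<le> k2 * (s - s1)"
      using that g_pos k_pos by (intro mult_mono) auto
    moreover have "min k2 (1 / g2) * min (s - s1) (l2 - s) \<le> (1 / g2) * (l2 - s)"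
      using that g_pos k_pos by (intro mult_mono) auto
    ultimately show ?thesis unfolding A2_min by (simp add: le_max_iff_disj)
  qed
qed (use A_lipschitz L_ge A_nonneg A_deriv s_ord g_pos k_pos mass in auto)

definition sol :: "real \<Rightarrow> (real^2 \<Rightarrow> real) \<Rightarrow> (real^2 \<Rightarrow> real) \<Rightarrow> real \<Rightarrow> real \<Rightarrow> bool" where
  "sol \<epsilon> \<eta>1 \<eta>2 lam1 lam2 \<longleftrightarrow> 0 < \<epsilon> \<and> positive_minimizer g1 g2 g \<epsilon> \<eta>1 \<eta>2 \<and>
     lagrange_multipliers g1 g2 g \<epsilon> \<eta>1 \<eta>2 lam1 lam2"

lemma solD:
  assumes "sol \<epsilon> \<eta>1 \<eta>2 lam1 lam2"
  shows "0 < \<epsilon>" "\<And>x. 0 < \<eta>1 x" "\<And>x. 0 < \<eta>2 x" "C_k 2 \<eta>1" "C_k 2 \<eta>2"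
    "\<And>x. \<epsilon>\<^sup>2 * laplacian \<eta>1 x = \<eta>1 x * (nsq x + g1 * (\<eta>1 x)\<^sup>2 + g * (\<eta>2 x)\<^sup>2 - lam1)"
    "\<And>x. \<epsilon>\<^sup>2 * laplacian \<eta>2 x = \<eta>2 x * (nsq x + g2 * (\<eta>2 x)\<^sup>2 + g * (\<eta>1 x)\<^sup>2 - lam2)"
proof -
  show "0 < \<epsilon>" "\<And>x. 0 < \<eta>1 x" "\<And>x. 0 < \<eta>2 x" "C_k 2 \<eta>1" "C_k 2 \<eta>2"
    using assms by (auto simp: sol_def positive_minimizer_def lagrange_multipliers_def)
  fix x
  have "- \<epsilon>\<^sup>2 * laplacian \<eta>1 x + nsq x * \<eta>1 x + g1 * (\<eta>1 x)^3 + g * \<eta>1 x * (\<eta>2 x)\<^sup>2 = lam1 * \<eta>1 x"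
    "- \<epsilon>\<^sup>2 * laplacian \<eta>2 x + nsq x * \<eta>2 x + g2 * (\<eta>2 x)^3 + g * (\<eta>1 x)\<^sup>2 * \<eta>2 x = lam2 * \<eta>2 x"
    using assms by (auto simp: sol_def lagrange_multipliers_def)
  then show "\<epsilon>\<^sup>2 * laplacian \<eta>1 x = \<eta>1 x * (nsq x + g1 * (\<eta>1 x)\<^sup>2 + g * (\<eta>2 x)\<^sup>2 - lam1)"
    "\<epsilon>\<^sup>2 * laplacian \<eta>2 x = \<eta>2 x * (nsq x + g2 * (\<eta>2 x)\<^sup>2 + g * (\<eta>1 x)\<^sup>2 - lam2)"
    by (simp_all add: power2_eq_square power3_eq_cube algebra_simps)
qed

definition finite_energy :: "(real^2 \<Rightarrow> real) \<Rightarrow> (real^2 \<Rightarrow> real) \<Rightarrow> bool" where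
  "finite_energy \<eta>1 \<eta>2 \<longleftrightarrow>
     integrable lborel (gsq \<eta>1) \<and> integrable lborel (gsq \<eta>2) \<and>
     integrable lborel (\<lambda>x. nsq x * (\<eta>1 x)\<^sup>2) \<and> integrable lborel (\<lambda>x. nsq x * (\<eta>2 x)\<^sup>2) \<and>
     integrable lborel (\<lambda>x. ((\<eta>1 x)\<^sup>2)\<^sup>2) \<and> integrable lborel (\<lambda>x. ((\<eta>2 x)\<^sup>2)\<^sup>2) \<and>
     integrable lborel (\<lambda>x. (\<eta>1 x)\<^sup>2 * (\<eta>2 x)\<^sup>2) \<and>
     integrable lborel (\<lambda>x. (\<eta>1 x)\<^sup>2) \<and> integrable lborel (\<lambda>x. (\<eta>2 x)\<^sup>2) \<and>
     (LINT x|lborel. (\<eta>1 x)\<^sup>2) = 1 \<and> (LINT x|lborel. (\<eta>2 x)\<^sup>2) = 1"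

text \<open>Both densities have unit mass, as has the profile, so the linear multiplier terms in
  \<open>defect_eq\<close> integrate to zero and only the defect remains.\<close>

lemma defect_integral:
  assumes n: "integrable lborel n1" "integrable lborel n2" "integrable lborel (\<lambda>x::real^2. nsq x * n1 x)"
    "integrable lborel (\<lambda>x. nsq x * n2 x)" "integrable lborel (\<lambda>x. (n1 x)\<^sup>2)" "integrable lborel (\<lambda>x. (n2 x)\<^sup>2)"
    "integrable lborel (\<lambda>x. n1 x * n2 x)" and m: "(LINT x|lborel. n1 x) = 1" "(LINT x|lborel. n2 x) = 1"
  shows "integrable lborel (\<lambda>x. nsq x * (n1 x + n2 x) + Q (n1 x) (n2 x))"
    "integrable lborel (\<lambda>x. defect (nsq x) (n1 x) (n2 x))"
    "(LINT x|lborel. nsq x * (n1 x + n2 x) + Q (n1 x) (n2 x))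
      = Ea + (LINT x|lborel. defect (nsq x) (n1 x) (n2 x))"
proof -
  have e: "(\<lambda>x. nsq x * (n1 x + n2 x) + Q (n1 x) (n2 x)) = (\<lambda>x. nsq x * n1 x + nsq x * n2 x
      + (g1 / 2 * (n1 x)\<^sup>2 + g2 / 2 * (n2 x)\<^sup>2 + g * (n1 x * n2 x)))"
    by (auto simp: fun_eq_iff Q_def algebra_simps)
  show i: "integrable lborel (\<lambda>x. nsq x * (n1 x + n2 x) + Q (n1 x) (n2 x))"
    unfolding e by (intro Bochner_Integration.integrable_add integrable_mult_right n)
  let ?a = "\<lambda>x::real^2. nsq x * (A1 (nsq x) + A2 (nsq x)) + Q (A1 (nsq x)) (A2 (nsq x))"
  have ia: "integrable lborel ?a" by (intro Bochner_Integration.integrable_add tf_virial)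
  have d: "defect (nsq x) (n1 x) (n2 x) = (nsq x * (n1 x + n2 x) + Q (n1 x) (n2 x)) - ?a x
     - (l1 * (n1 x - A1 (nsq x)) + l2 * (n2 x - A2 (nsq x)))" for x
    unfolding defect_eq[of "nsq x" "n1 x" "n2 x"] by simp
  have il: "integrable lborel (\<lambda>x. l1 * (n1 x - A1 (nsq x)) + l2 * (n2 x - A2 (nsq x)))"
    by (intro Bochner_Integration.integrable_add integrable_mult_right Bochner_Integration.integrable_diff n mass)
  have il0: "(LINT x|lborel. l1 * (n1 x - A1 (nsq x)) + l2 * (n2 x - A2 (nsq x))) = 0"
  proof -
    have d1: "integrable lborel (\<lambda>x. n1 x - A1 (nsq x))" "integrable lborel (\<lambda>x. n2 x - A2 (nsq x))"
      using n mass by auto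
    have z: "(LINT x|lborel. n1 x - A1 (nsq x)) = 0" "(LINT x|lborel. n2 x - A2 (nsq x)) = 0"
      using n mass m by auto
    show ?thesis
      by (subst Bochner_Integration.integral_add) (use d1 z in auto)
  qed
  show "integrable lborel (\<lambda>x. defect (nsq x) (n1 x) (n2 x))"
    unfolding d by (intro Bochner_Integration.integrable_diff i ia il)
  have "(LINT x|lborel. defect (nsq x) (n1 x) (n2 x))
    = (LINT x|lborel. nsq x * (n1 x + n2 x) + Q (n1 x) (n2 x)) - (LINT x|lborel. ?a x)
     - (LINT x|lborel. l1 * (n1 x - A1 (nsq x)) + l2 * (n2 x - A2 (nsq x)))"
    unfolding d by (subst Bochner_Integration.integral_diff; (intro Bochner_Integration.integrable_diff i ia il)?)
      (subst Bochner_Integration.integral_diff; (intro i ia refl)?)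
  then show "(LINT x|lborel. nsq x * (n1 x + n2 x) + Q (n1 x) (n2 x))
      = Ea + (LINT x|lborel. defect (nsq x) (n1 x) (n2 x))"
    unfolding il0 Ea_def by simp
qed

end

lemma integrable_continuous_compact_support:
  fixes h :: "real^2 \<Rightarrow> real"
  assumes h: "continuous_on UNIV h" and z: "\<And>x. nsq x > c \<Longrightarrow> h x = 0"
  shows "integrable lborel h"
proof -
  have "integrable lborel (\<lambda>x. indicator (cball 0 (sqrt c)) x *\<^sub>R h x)"
    by (rule borel_integrable_compact) (auto intro: continuous_on_subset[OF h])
  moreover have "(\<lambda>x. indicator (cball 0 (sqrt c)) x *\<^sub>R h x) = h"
  proof
    fix x :: "real^2"
    show "indicator (cball 0 (sqrt c)) x *\<^sub>R h x = h x"
    proof (cases "norm x \<le> sqrt c")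
      case False
      then have "nsq x > c" using real_le_rsqrt[of "norm x" c] by force
      then show ?thesis using z by simp
    qed simp
  qed
  ultimately show ?thesis by simp
qed

lemma integrable_between:
  fixes f :: "real^2 \<Rightarrow> real"
  assumes "integrable lborel f" "h \<in> borel_measurable borel" "\<And>x. 0 \<le> h x" "\<And>x. h x \<le> K * f x"
  shows "integrable lborel h" "(LINT x|lborel. h x) \<le> K * (LINT x|lborel. f x)"
proof -
  have i: "integrable lborel (\<lambda>x. K * f x)" using assms(1) by simp
  show "integrable lborel h"
    by (rule Bochner_Integration.integrable_bound[OF i]) (use assms in \<open>auto intro!: AE_I2 order_trans[OF _ abs_ge_self]\<close>)
  then have "(LINT x|lborel. h x) \<le> (LINT x|lborel. K * f x)" using assms(4) by (intro integral_mono i) auto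
  then show "(LINT x|lborel. h x) \<le> K * (LINT x|lborel. f x)" by simp
qed

lemma scale_identity:
  fixes e :: real
  assumes "e \<noteq> 0"
  shows "2 * e * (((1 / 2) * a + (1 / (2 * e)) * b + (p / (4 * e)) * c) + ((1 / 2) * a' + (1 / (2 * e)) * b' + (p' / (4 * e)) * c')
      + q / (2 * e) * d) = e * (a + a') + (b + b' + ((p / 2) * c + (p' / 2) * c' + q * d))"
  using assms by (simp add: field_simps)

context tf_data
begin

lemma energy_real_form:
  fixes u1 u2 :: "real^2 \<Rightarrow> real"
  assumes \<epsilon>: "0 < \<epsilon>"
    and gr: "integrable lborel (grad_norm_sq (cplx u1))" "integrable lborel (grad_norm_sq (cplx u2))"
    and i: "integrable lborel (\<lambda>x. nsq x * (u1 x)\<^sup>2)" "integrable lborel (\<lambda>x. nsq x * (u2 x)\<^sup>2)"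
      "integrable lborel (\<lambda>x. ((u1 x)\<^sup>2)\<^sup>2)" "integrable lborel (\<lambda>x. ((u2 x)\<^sup>2)\<^sup>2)"
      "integrable lborel (\<lambda>x. (u1 x)\<^sup>2 * (u2 x)\<^sup>2)"
  shows "integrable lborel (edens g1 \<epsilon> (cplx u1))" "integrable lborel (edens g2 \<epsilon> (cplx u2))"
    "2 * \<epsilon>\<^sup>2 * ((LINT x|lborel. edens g1 \<epsilon> (cplx u1) x) + (LINT x|lborel. edens g2 \<epsilon> (cplx u2) x)
       + g / (2 * \<epsilon>\<^sup>2) * (LINT x|lborel. (cmod ((cplx u1) x))\<^sup>2 * (cmod ((cplx u2) x))\<^sup>2))
     = \<epsilon>\<^sup>2 * ((LINT x|lborel. grad_norm_sq (cplx u1) x) + (LINT x|lborel. grad_norm_sq (cplx u2) x))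
       + (LINT x|lborel. nsq x * ((u1 x)\<^sup>2 + (u2 x)\<^sup>2) + Q ((u1 x)\<^sup>2) ((u2 x)\<^sup>2))"
proof -
  have e: "edens gj \<epsilon> (cplx u) = (\<lambda>x. (1 / 2) * grad_norm_sq (cplx u) x
      + (1 / (2 * \<epsilon>\<^sup>2)) * (nsq x * (u x)\<^sup>2) + (gj / (4 * \<epsilon>\<^sup>2)) * ((u x)\<^sup>2)\<^sup>2)" for gj u
    by (auto simp: edens_def fun_eq_iff)
  show "integrable lborel (edens g1 \<epsilon> (cplx u1))" "integrable lborel (edens g2 \<epsilon> (cplx u2))"
    unfolding e by (intro Bochner_Integration.integrable_add integrable_mult_right gr i)+
  have E: "(LINT x|lborel. edens gj \<epsilon> (cplx u) x) = (1 / 2) * (LINT x|lborel. grad_norm_sq (cplx u) x)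
      + (1 / (2 * \<epsilon>\<^sup>2)) * (LINT x|lborel. nsq x * (u x)\<^sup>2) + (gj / (4 * \<epsilon>\<^sup>2)) * (LINT x|lborel. ((u x)\<^sup>2)\<^sup>2)"
    if "integrable lborel (grad_norm_sq (cplx u))" "integrable lborel (\<lambda>x. nsq x * (u x)\<^sup>2)"
      "integrable lborel (\<lambda>x. ((u x)\<^sup>2)\<^sup>2)" for gj u
    unfolding e using that by simp
  have q: "(\<lambda>x. nsq x * ((u1 x)\<^sup>2 + (u2 x)\<^sup>2) + Q ((u1 x)\<^sup>2) ((u2 x)\<^sup>2)) = (\<lambda>x. nsq x * (u1 x)\<^sup>2 + nsq x * (u2 x)\<^sup>2
      + ((g1 / 2) * ((u1 x)\<^sup>2)\<^sup>2 + (g2 / 2) * ((u2 x)\<^sup>2)\<^sup>2 + g * ((u1 x)\<^sup>2 * (u2 x)\<^sup>2)))"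
    by (auto simp: fun_eq_iff Q_def algebra_simps)
  have R: "(LINT x|lborel. nsq x * ((u1 x)\<^sup>2 + (u2 x)\<^sup>2) + Q ((u1 x)\<^sup>2) ((u2 x)\<^sup>2))
     = (LINT x|lborel. nsq x * (u1 x)\<^sup>2) + (LINT x|lborel. nsq x * (u2 x)\<^sup>2)
      + ((g1 / 2) * (LINT x|lborel. ((u1 x)\<^sup>2)\<^sup>2) + (g2 / 2) * (LINT x|lborel. ((u2 x)\<^sup>2)\<^sup>2) + g * (LINT x|lborel. (u1 x)\<^sup>2 * (u2 x)\<^sup>2))"
    unfolding q using i by simp
  have c: "(LINT x|lborel. (cmod ((cplx u1) x))\<^sup>2 * (cmod ((cplx u2) x))\<^sup>2)
    = (LINT x|lborel. (u1 x)\<^sup>2 * (u2 x)\<^sup>2)" by simp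
  have "\<epsilon>\<^sup>2 \<noteq> 0" using \<epsilon> by simp
  then show "2 * \<epsilon>\<^sup>2 * ((LINT x|lborel. edens g1 \<epsilon> (cplx u1) x) + (LINT x|lborel. edens g2 \<epsilon> (cplx u2) x)
       + g / (2 * \<epsilon>\<^sup>2) * (LINT x|lborel. (cmod ((cplx u1) x))\<^sup>2 * (cmod ((cplx u2) x))\<^sup>2))
     = \<epsilon>\<^sup>2 * ((LINT x|lborel. grad_norm_sq (cplx u1) x) + (LINT x|lborel. grad_norm_sq (cplx u2) x))
       + (LINT x|lborel. nsq x * ((u1 x)\<^sup>2 + (u2 x)\<^sup>2) + Q ((u1 x)\<^sup>2) ((u2 x)\<^sup>2))"
    unfolding c R E[OF gr(1) i(1,3)] E[OF gr(2) i(2,4)] by (rule scale_identity)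
qed

definition energy_control :: "real \<Rightarrow> real \<Rightarrow> (real^2 \<Rightarrow> real) \<Rightarrow> (real^2 \<Rightarrow> real) \<Rightarrow> bool" where
  "energy_control M \<epsilon> \<eta>1 \<eta>2 \<longleftrightarrow> finite_energy \<eta>1 \<eta>2 \<and>
     \<epsilon>\<^sup>2 * ((LINT x|lborel. gsq \<eta>1 x) + (LINT x|lborel. gsq \<eta>2 x)) \<le> M \<and>
     integrable lborel (\<lambda>x. ((\<eta>1 x)\<^sup>2 - A1 (nsq x))\<^sup>2) \<and> (LINT x|lborel. ((\<eta>1 x)\<^sup>2 - A1 (nsq x))\<^sup>2) \<le> M \<and>
     integrable lborel (\<lambda>x. ((\<eta>2 x)\<^sup>2 - A2 (nsq x))\<^sup>2) \<and> (LINT x|lborel. ((\<eta>2 x)\<^sup>2 - A2 (nsq x))\<^sup>2) \<le> M \<and>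
     integrable lborel (\<lambda>x. W1 (nsq x) * (\<eta>1 x)\<^sup>2) \<and> (LINT x|lborel. W1 (nsq x) * (\<eta>1 x)\<^sup>2) \<le> M \<and>
     integrable lborel (\<lambda>x. W2 (nsq x) * (\<eta>2 x)\<^sup>2) \<and> (LINT x|lborel. W2 (nsq x) * (\<eta>2 x)\<^sup>2) \<le> M \<and>
     \<bar>(LINT x|lborel. nsq x * ((\<eta>1 x)\<^sup>2 + (\<eta>2 x)\<^sup>2) + Q ((\<eta>1 x)\<^sup>2) ((\<eta>2 x)\<^sup>2)) - Ea\<bar> \<le> M"

text \<open>Minimality compares kinetic term plus defect of the solution with those of the
  competitor. The competitor lives where \<open>W1\<close> and \<open>W2\<close> vanish, so its
  defect is quadratic in the density error \<open>\<delta>\<close>. For the solution the kinetic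
  term, the quadratic form and the two weighted masses are all nonnegative, so each is bounded
  separately; \<open>1 / \<kappa>\<close> comes from the definiteness of \<open>Q\<close>.\<close>

lemma energy_control_from_competitor:
  fixes \<eta>1 \<eta>2 u1 u2 :: "real^2 \<Rightarrow> real"
  assumes sol: "sol \<epsilon> \<eta>1 \<eta>2 lam1 lam2"
    and \<kappa>: "0 < \<kappa>" "\<And>m n. \<kappa> * (m\<^sup>2 + n\<^sup>2) \<le> Q m n"
    and u: "continuous_on UNIV u1" "continuous_on UNIV u2" "cplx u1 \<in> H1" "cplx u2 \<in> H1"
     "(LINT x|lborel. (u1 x)\<^sup>2) = 1" "(LINT x|lborel. (u2 x)\<^sup>2) = 1"
     "integrable lborel (grad_norm_sq (cplx u1))" "integrable lborel (grad_norm_sq (cplx u2))"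
    and e1: "\<And>x. \<bar>(u1 x)\<^sup>2 - A1 (nsq x)\<bar> \<le> \<delta> * indicator {x. nsq x \<in> {0..s2}} x"
    and e2: "\<And>x. \<bar>(u2 x)\<^sup>2 - A2 (nsq x)\<bar> \<le> \<delta> * indicator {x. nsq x \<in> {s1..l2}} x"
    and M: "\<epsilon>\<^sup>2 * ((LINT x|lborel. grad_norm_sq (cplx u1) x) + (LINT x|lborel. grad_norm_sq (cplx u2) x))
       + 2 * (g1 + g2 + g) * \<delta>\<^sup>2 * (pi * l2) \<le> M"
  shows "energy_control (M * (1 + 1 / \<kappa>)) \<epsilon> \<eta>1 \<eta>2"
proof -
  note S = solD[OF sol]
  have \<delta>: "0 \<le> \<delta>" using e1[of 0] s_ord by (simp split: if_splits)
  have eH: "(cplx \<eta>1, cplx \<eta>2) \<in> space_H"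
    and min: "\<And>v1 v2. (v1, v2) \<in> space_H \<Longrightarrow>
       energy g1 g2 g \<epsilon> (cplx \<eta>1) (cplx \<eta>2) \<le> energy g1 g2 g \<epsilon> v1 v2"
    using sol by (auto simp: sol_def positive_minimizer_def)
  have z1: "u1 x = 0" if "nsq x > s2" for x using e1[of x] that A_zero(1)[of "nsq x"] by simp
  have z2: "u2 x = 0" if "nsq x \<notin> {s1..l2}" for x using e2[of x] that A_zero(2,3)[of "nsq x"] by (cases "nsq x < s1") auto
  have z: "u1 x = 0" "u2 x = 0" if "nsq x > l2" for x using z1[of x] z2[of x] that s_ord by auto
  have cont: "integrable lborel h" if "continuous_on UNIV h" "\<And>x. nsq x > l2 \<Longrightarrow> h x = 0" for h :: "real^2 \<Rightarrow> real"
    using integrable_continuous_compact_support that by blast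
  have iu: "integrable lborel (\<lambda>x. (u1 x)\<^sup>2)" "integrable lborel (\<lambda>x. (u2 x)\<^sup>2)"
    "integrable lborel (\<lambda>x. nsq x * (u1 x)\<^sup>2)" "integrable lborel (\<lambda>x. nsq x * (u2 x)\<^sup>2)"
    "integrable lborel (\<lambda>x. ((u1 x)\<^sup>2)\<^sup>2)" "integrable lborel (\<lambda>x. ((u2 x)\<^sup>2)\<^sup>2)"
    "integrable lborel (\<lambda>x. (u1 x)\<^sup>2 * (u2 x)\<^sup>2)"
    by (rule cont; use z in \<open>auto intro!: continuous_intros u\<close>)+
  have uH: "(cplx u1, cplx u2) \<in> space_H"
    using u(3-6) iu(3,4) by (auto simp: space_H_def L2_norm_def)
  note T = energy_real_form[OF S(1) u(7,8) iu(3-7)]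
  have \<eta>H: "cplx \<eta>1 \<in> H1" "cplx \<eta>2 \<in> H1" using eH by (auto simp: space_H_def)
  have iv: "integrable lborel (\<lambda>x. (cmod ((cplx u1) x))\<^sup>2 * (cmod ((cplx u2) x))\<^sup>2)"
    using iu(7) by simp
  note E = energy_le_real[OF g_pos S(1) \<eta>H T(1,2) iv min[OF uH]]
  have [measurable]: "\<eta>1 \<in> borel_measurable borel" "\<eta>2 \<in> borel_measurable borel"
    using C_k_continuous S(4,5) by (auto intro: borel_measurable_continuous_onI)
  note gm[measurable] = grad_norm_sq_measurable[OF \<eta>H(1)] grad_norm_sq_measurable[OF \<eta>H(2)]
  have p1: "integrable lborel (grad_norm_sq (cplx \<eta>1))" "integrable lborel (\<lambda>x. nsq x * (\<eta>1 x)\<^sup>2)"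
    "integrable lborel (\<lambda>x. ((\<eta>1 x)\<^sup>2)\<^sup>2)"
    by (rule edens_parts[OF E(1) g_pos(1) S(1)]; measurable)+
  have p2: "integrable lborel (grad_norm_sq (cplx \<eta>2))" "integrable lborel (\<lambda>x. nsq x * (\<eta>2 x)\<^sup>2)"
    "integrable lborel (\<lambda>x. ((\<eta>2 x)\<^sup>2)\<^sup>2)"
    by (rule edens_parts[OF E(2) g_pos(2) S(1)]; measurable)+
  have p3: "integrable lborel (\<lambda>x. (\<eta>1 x)\<^sup>2 * (\<eta>2 x)\<^sup>2)" using E(3) by simp
  have p4: "integrable lborel (\<lambda>x. (\<eta>1 x)\<^sup>2)" "integrable lborel (\<lambda>x. (\<eta>2 x)\<^sup>2)"
    using \<eta>H by (auto simp: H1_def L2_def)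
  have p5: "(LINT x|lborel. (\<eta>1 x)\<^sup>2) = 1" "(LINT x|lborel. (\<eta>2 x)\<^sup>2) = 1"
    using eH by (auto simp: space_H_def L2_norm_def)
  have gm': "gsq \<eta>1 \<in> borel_measurable borel" "gsq \<eta>2 \<in> borel_measurable borel"
    using gsq_continuous S(4,5) by (auto intro: borel_measurable_continuous_onI)
  have gi: "integrable lborel (gsq \<eta>1)" "integrable lborel (gsq \<eta>2)"
    using p1(1) p2(1) AE_grad_norm_sq[OF S(4)] AE_grad_norm_sq[OF S(5)] gm gm'
    by (auto simp: integrable_cong_AE[of "grad_norm_sq (cplx \<eta>1)" lborel "gsq \<eta>1"]
        integrable_cong_AE[of "grad_norm_sq (cplx \<eta>2)" lborel "gsq \<eta>2"])
  have gI: "(LINT x|lborel. grad_norm_sq (cplx \<eta>1) x) = (LINT x|lborel. gsq \<eta>1 x)"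
    "(LINT x|lborel. grad_norm_sq (cplx \<eta>2) x) = (LINT x|lborel. gsq \<eta>2 x)"
    using AE_grad_norm_sq[OF S(4)] AE_grad_norm_sq[OF S(5)] gm gm' by (auto intro!: integral_cong_AE)
  note F = energy_real_form[OF S(1) p1(1) p2(1) p1(2) p2(2) p1(3) p2(3) p3]
  note D\<eta> = defect_integral[OF p4 p1(2) p2(2) p1(3) p2(3) p3 p5]
  note Du = defect_integral[OF iu(1,2,3,4,5,6,7) u(5,6)]
  define K where "K = \<epsilon>\<^sup>2 * ((LINT x|lborel. gsq \<eta>1 x) + (LINT x|lborel. gsq \<eta>2 x))"
  define I where "I = (LINT x|lborel. defect (nsq x) ((\<eta>1 x)\<^sup>2) ((\<eta>2 x)\<^sup>2))"
  define Ku where "Ku = \<epsilon>\<^sup>2 * ((LINT x|lborel. grad_norm_sq (cplx u1) x) + (LINT x|lborel. grad_norm_sq (cplx u2) x))"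
  define Iu where "Iu = (LINT x|lborel. defect (nsq x) ((u1 x)\<^sup>2) ((u2 x)\<^sup>2))"
  have "K + (Ea + I) \<le> Ku + (Ea + Iu)"
  proof -
    have "2 * \<epsilon>\<^sup>2 * ((LINT x|lborel. edens g1 \<epsilon> (cplx \<eta>1) x) + (LINT x|lborel. edens g2 \<epsilon> (cplx \<eta>2) x)
       + g / (2 * \<epsilon>\<^sup>2) * (LINT x|lborel. (cmod ((cplx \<eta>1) x))\<^sup>2 * (cmod ((cplx \<eta>2) x))\<^sup>2))
     \<le> 2 * \<epsilon>\<^sup>2 * ((LINT x|lborel. edens g1 \<epsilon> (cplx u1) x) + (LINT x|lborel. edens g2 \<epsilon> (cplx u2) x)
       + g / (2 * \<epsilon>\<^sup>2) * (LINT x|lborel. (cmod ((cplx u1) x))\<^sup>2 * (cmod ((cplx u2) x))\<^sup>2))"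
      by (rule mult_left_mono[OF E(4)]) simp
    then show ?thesis unfolding T(3) F(3) D\<eta>(3) Du(3) gI K_def I_def Ku_def Iu_def .
  qed
  moreover have "Iu \<le> 2 * (g1 + g2 + g) * \<delta>\<^sup>2 * (pi * l2)"
  proof -
    have l0: "0 \<le> l2" using s_ord by linarith
    have ind: "integrable lborel (indicator {x::real^2. nsq x \<le> l2} :: _ \<Rightarrow> real)"
      "(LINT x|lborel. indicator {x::real^2. nsq x \<le> l2} x) = pi * l2"
    proof -
      have *: "(\<lambda>x::real^2. indicator {x. nsq x \<le> l2} x) = (\<lambda>x. indicator {..l2} (nsq x) :: real)"
        by (auto simp: fun_eq_iff indicator_def)
      have **: "(\<lambda>s. indicator {0..} s * indicator {..l2} s) = (indicator {0..l2} :: real \<Rightarrow> real)"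
        by (auto simp: fun_eq_iff indicator_def)
      show "integrable lborel (indicator {x::real^2. nsq x \<le> l2} :: _ \<Rightarrow> real)"
        unfolding * by (subst integrable_norm_square_iff) (use l0 in \<open>auto simp: **\<close>)
      show "(LINT x|lborel. indicator {x::real^2. nsq x \<le> l2} x) = pi * l2"
        unfolding * by (subst integral_norm_square) (use l0 in \<open>auto simp: **\<close>)
    qed
    have "defect (nsq x) ((u1 x)\<^sup>2) ((u2 x)\<^sup>2) \<le> (2 * (g1 + g2 + g) * \<delta>\<^sup>2) * indicator {x::real^2. nsq x \<le> l2} x" for x
    proof -
      have w1: "W1 (nsq x) * (u1 x)\<^sup>2 = 0" using W1_eq(1)[of "nsq x"] z1[of x] by (cases "nsq x \<le> s2") auto
      have w2: "W2 (nsq x) * (u2 x)\<^sup>2 = 0" using W2_eq(2)[of "nsq x"] z2[of x] by (cases "nsq x \<in> {s1..l2}") auto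
      define m n where "m = (u1 x)\<^sup>2 - A1 (nsq x)" and "n = (u2 x)\<^sup>2 - A2 (nsq x)"
      define d where "d = \<delta> * indicator {x::real^2. nsq x \<le> l2} x"
      have "indicator {x. nsq x \<in> {0..s2}} x \<le> (indicator {x::real^2. nsq x \<le> l2} x :: real)"
        "indicator {x. nsq x \<in> {s1..l2}} x \<le> (indicator {x::real^2. nsq x \<le> l2} x :: real)"
        using s_ord by (auto simp: indicator_def)
      then have md: "\<bar>m\<bar> \<le> d" "\<bar>n\<bar> \<le> d"
        unfolding m_def n_def d_def using order_trans[OF e1[of x] mult_left_mono[OF _ \<delta>]] order_trans[OF e2[of x] mult_left_mono[OF _ \<delta>]] by blast+
      have sq: "m\<^sup>2 \<le> d\<^sup>2" "n\<^sup>2 \<le> d\<^sup>2" using md by (auto simp: power2_le_iff_abs_le)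
      have "m * n \<le> d\<^sup>2" using sum_squares_bound[of m n] sq by linarith
      then have h: "g1 * m\<^sup>2 \<le> g1 * d\<^sup>2" "g2 * n\<^sup>2 \<le> g2 * d\<^sup>2" "g * (m * n) \<le> g * d\<^sup>2" "0 \<le> g1 * d\<^sup>2" "0 \<le> g2 * d\<^sup>2"
        using sq g_pos by (auto intro!: mult_left_mono)
      have "Q m n = g1 * m\<^sup>2 / 2 + g2 * n\<^sup>2 / 2 + g * (m * n)" by (simp add: Q_def)
      also have "\<dots> \<le> g1 * d\<^sup>2 + g2 * d\<^sup>2 + g * d\<^sup>2" using h by linarith
      also have "\<dots> \<le> 2 * (g1 + g2 + g) * d\<^sup>2" using g_pos by (simp add: algebra_simps)
      finally have "defect (nsq x) ((u1 x)\<^sup>2) ((u2 x)\<^sup>2) \<le> 2 * (g1 + g2 + g) * d\<^sup>2"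
        unfolding defect_def w1 w2 m_def n_def by simp
      moreover have "d\<^sup>2 = \<delta>\<^sup>2 * indicator {x::real^2. nsq x \<le> l2} x" by (simp add: d_def power_mult_distrib indicator_def)
      ultimately show ?thesis by simp
    qed
    then have "Iu \<le> (LINT x|lborel. (2 * (g1 + g2 + g) * \<delta>\<^sup>2) * indicator {x::real^2. nsq x \<le> l2} x)"
      unfolding Iu_def by (intro integral_mono Du(2) integrable_mult_right ind)
    then show ?thesis using ind(2) by simp
  qed
  ultimately have KI: "K + I \<le> M" using M unfolding Ku_def by linarith
  have K0: "0 \<le> K" unfolding K_def by (intro mult_nonneg_nonneg add_nonneg_nonneg integral_nonneg_AE) (auto simp: gsq_nonneg)
  define dd where "dd x = defect (nsq x) ((\<eta>1 x)\<^sup>2) ((\<eta>2 x)\<^sup>2)" for x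
  have idd: "integrable lborel dd" unfolding dd_def[abs_def] by (rule D\<eta>(2))
  have Idd: "(LINT x|lborel. dd x) = I" by (simp add: dd_def I_def)
  have low: "\<kappa> * (((\<eta>1 x)\<^sup>2 - A1 (nsq x))\<^sup>2 + ((\<eta>2 x)\<^sup>2 - A2 (nsq x))\<^sup>2) + W1 (nsq x) * (\<eta>1 x)\<^sup>2 + W2 (nsq x) * (\<eta>2 x)\<^sup>2 \<le> dd x" for x
    unfolding dd_def defect_def using \<kappa>(2) by simp
  have w0: "0 \<le> W1 (nsq x) * (\<eta>1 x)\<^sup>2" "0 \<le> W2 (nsq x) * (\<eta>2 x)\<^sup>2" for x using W_nonneg by auto
  have q0: "0 \<le> \<kappa> * ((\<eta>1 x)\<^sup>2 - A1 (nsq x))\<^sup>2" "0 \<le> \<kappa> * ((\<eta>2 x)\<^sup>2 - A2 (nsq x))\<^sup>2" for x using \<kappa> by auto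
  have dd0: "0 \<le> dd x" for x using low[of x] w0[of x] q0[of x] by (simp add: distrib_left)
  have I0: "0 \<le> I" unfolding Idd[symmetric] by (rule integral_nonneg_AE) (use dd0 in auto)
  have [measurable]: "A1 \<in> borel_measurable borel" "A2 \<in> borel_measurable borel"
    using A_continuous by (auto intro: borel_measurable_continuous_onI)
  have [measurable]: "W1 \<in> borel_measurable borel" "W2 \<in> borel_measurable borel"
    unfolding W1_def[abs_def] W2_def[abs_def] by measurable
  have w: "W1 (nsq x) * (\<eta>1 x)\<^sup>2 \<le> 1 * dd x" "W2 (nsq x) * (\<eta>2 x)\<^sup>2 \<le> 1 * dd x" for x
    using low[of x] w0[of x] q0[of x] by (simp_all add: distrib_left)
  have q: "((\<eta>1 x)\<^sup>2 - A1 (nsq x))\<^sup>2 \<le> (1 / \<kappa>) * dd x" "((\<eta>2 x)\<^sup>2 - A2 (nsq x))\<^sup>2 \<le> (1 / \<kappa>) * dd x" for x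
  proof -
    have "\<kappa> * ((\<eta>1 x)\<^sup>2 - A1 (nsq x))\<^sup>2 \<le> dd x" "\<kappa> * ((\<eta>2 x)\<^sup>2 - A2 (nsq x))\<^sup>2 \<le> dd x"
      using low[of x] w0[of x] q0[of x] unfolding distrib_left by linarith+
    then show "((\<eta>1 x)\<^sup>2 - A1 (nsq x))\<^sup>2 \<le> (1 / \<kappa>) * dd x" "((\<eta>2 x)\<^sup>2 - A2 (nsq x))\<^sup>2 \<le> (1 / \<kappa>) * dd x"
      using \<kappa>(1) by (simp_all add: pos_le_divide_eq mult.commute)
  qed
  have mm: "(\<lambda>x. W1 (nsq x) * (\<eta>1 x)\<^sup>2) \<in> borel_measurable borel" "(\<lambda>x. W2 (nsq x) * (\<eta>2 x)\<^sup>2) \<in> borel_measurable borel"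
    "(\<lambda>x. ((\<eta>1 x)\<^sup>2 - A1 (nsq x))\<^sup>2) \<in> borel_measurable borel" "(\<lambda>x. ((\<eta>2 x)\<^sup>2 - A2 (nsq x))\<^sup>2) \<in> borel_measurable borel"
    by measurable
  note B1 = integrable_between[OF idd mm(1) w0(1) w(1)] and B2 = integrable_between[OF idd mm(2) w0(2) w(2)]
  note B3 = integrable_between[OF idd mm(3) zero_le_power2 q(1)] and B4 = integrable_between[OF idd mm(4) zero_le_power2 q(2)]
  have M0: "0 \<le> M" using K0 I0 KI by linarith
  have M1: "M \<le> M * (1 + 1 / \<kappa>)" using M0 \<kappa> by (simp add: distrib_left)
  have M2: "1 / \<kappa> * I \<le> M * (1 + 1 / \<kappa>)"
  proof -
    have "1 / \<kappa> * I \<le> 1 / \<kappa> * M" using KI K0 \<kappa> by (intro mult_left_mono) auto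
    also have "\<dots> \<le> M * (1 + 1 / \<kappa>)" using M0 by (simp add: distrib_left)
    finally show ?thesis .
  qed
  show ?thesis
    unfolding energy_control_def finite_energy_def
    using gi p1 p2 p3 p4 p5 B1 B2 B3 B4 M1 M2 KI K0 I0 D\<eta>(3) unfolding Idd K_def[symmetric] I_def[symmetric]
    by (intro conjI) (assumption | linarith)+
qed

text \<open>With density errors O(\<epsilon>) the defect of the competitor is O(\<epsilon>^2), so
  the rate is decided by its Dirichlet integral, which is of order
  \<open>\<bar>ln \<epsilon>\<bar>\<close>.\<close>

lemma energy_bound:
  "\<exists>C>0. \<forall>\<^sub>F \<epsilon> in at_right 0. \<forall>\<eta>1 \<eta>2 lam1 lam2. sol \<epsilon> \<eta>1 \<eta>2 lam1 lam2 \<longrightarrow> energy_control (C * (\<epsilon>\<^sup>2 * \<bar>ln \<epsilon>\<bar>)) \<epsilon> \<eta>1 \<eta>2"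
proof -
  obtain \<kappa> where \<kappa>: "0 < \<kappa>" "\<And>m n. \<kappa> * (m\<^sup>2 + n\<^sup>2) \<le> Q m n" using Q_pos by blast
  obtain C1 e1 where C1: "C1 > 0" "e1 > 0" and t1: "\<And>\<epsilon>. 0 < \<epsilon> \<Longrightarrow> \<epsilon> < e1 \<Longrightarrow> \<exists>u. competitor A1 {0..s2} C1 \<epsilon> u"
    using A1_trial by blast
  obtain C2 e2 where C2: "C2 > 0" "e2 > 0" and t2: "\<And>\<epsilon>. 0 < \<epsilon> \<Longrightarrow> \<epsilon> < e2 \<Longrightarrow> \<exists>u. competitor A2 {s1..l2} C2 \<epsilon> u"
    using A2_trial by blast
  define c where "c = max C1 C2"
  define B where "B = 2 * c + 2 * (g1 + g2 + g) * c\<^sup>2 * (pi * l2)"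
  have c0: "0 < c" using C1 by (simp add: c_def)
  have B0: "0 < B" unfolding B_def using c0 g_pos s_ord by (intro add_pos_nonneg) auto
  \<comment> \<open>Below \<open>exp (- 1)\<close> one has
    \<open>1 \<le> \<bar>ln \<epsilon>\<bar>\<close>, so that plain \<epsilon>^2 is
    absorbed.\<close>
  define e where "e = min (min e1 e2) (exp (- 1))"
  have e0: "0 < e" using C1 C2 by (simp add: e_def)
  have main: "energy_control ((B * (1 + 1 / \<kappa>)) * (\<epsilon>\<^sup>2 * \<bar>ln \<epsilon>\<bar>)) \<epsilon> \<eta>1 \<eta>2"
    if \<epsilon>: "0 < \<epsilon>" "\<epsilon> < e" and s: "sol \<epsilon> \<eta>1 \<eta>2 lam1 lam2" for \<epsilon> \<eta>1 \<eta>2 lam1 lam2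
  proof -
    have "\<epsilon> < e1" "\<epsilon> < e2" "\<epsilon> < exp (- 1)" using \<epsilon> by (auto simp: e_def)
    then have "ln \<epsilon> < ln (exp (- 1))" using \<epsilon>(1) by (subst ln_less_cancel_iff) auto
    then have ln1: "1 \<le> \<bar>ln \<epsilon>\<bar>" by simp
    obtain u1 where u1: "continuous_on UNIV u1" "cplx u1 \<in> H1" "(LINT x|lborel. (u1 x)\<^sup>2) = 1"
      "integrable lborel (grad_norm_sq (cplx u1))" "(LINT x|lborel. grad_norm_sq (cplx u1) x) \<le> C1 * \<bar>ln \<epsilon>\<bar>"
      "\<And>x. \<bar>(u1 x)\<^sup>2 - A1 (nsq x)\<bar> \<le> C1 * \<epsilon> * indicator {x. nsq x \<in> {0..s2}} x"
      using t1[OF \<epsilon>(1) \<open>\<epsilon> < e1\<close>] unfolding competitor_def by blast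
    obtain u2 where u2: "continuous_on UNIV u2" "cplx u2 \<in> H1" "(LINT x|lborel. (u2 x)\<^sup>2) = 1"
      "integrable lborel (grad_norm_sq (cplx u2))" "(LINT x|lborel. grad_norm_sq (cplx u2) x) \<le> C2 * \<bar>ln \<epsilon>\<bar>"
      "\<And>x. \<bar>(u2 x)\<^sup>2 - A2 (nsq x)\<bar> \<le> C2 * \<epsilon> * indicator {x. nsq x \<in> {s1..l2}} x"
      using t2[OF \<epsilon>(1) \<open>\<epsilon> < e2\<close>] unfolding competitor_def by blast
    have i1: "\<bar>(u1 x)\<^sup>2 - A1 (nsq x)\<bar> \<le> (c * \<epsilon>) * indicator {x. nsq x \<in> {0..s2}} x" for x
      using u1(6)[of x] by (rule order_trans) (use \<epsilon> in \<open>auto simp: c_def intro!: mult_right_mono\<close>)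
    have i2: "\<bar>(u2 x)\<^sup>2 - A2 (nsq x)\<bar> \<le> (c * \<epsilon>) * indicator {x. nsq x \<in> {s1..l2}} x" for x
      using u2(6)[of x] by (rule order_trans) (use \<epsilon> in \<open>auto simp: c_def intro!: mult_right_mono\<close>)
    have "energy_control ((B * (\<epsilon>\<^sup>2 * \<bar>ln \<epsilon>\<bar>)) * (1 + 1 / \<kappa>)) \<epsilon> \<eta>1 \<eta>2"
    proof (rule energy_control_from_competitor[OF s \<kappa> u1(1) u2(1) u1(2) u2(2) u1(3) u2(3) u1(4) u2(4) i1 i2])
      have k1: "(LINT x|lborel. grad_norm_sq (cplx u1) x) \<le> c * \<bar>ln \<epsilon>\<bar>"
        using u1(5) by (rule order_trans) (auto simp: c_def intro!: mult_right_mono)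
      have k2: "(LINT x|lborel. grad_norm_sq (cplx u2) x) \<le> c * \<bar>ln \<epsilon>\<bar>"
        using u2(5) by (rule order_trans) (auto simp: c_def intro!: mult_right_mono)
      have "\<epsilon>\<^sup>2 * ((LINT x|lborel. grad_norm_sq (cplx u1) x) + (LINT x|lborel. grad_norm_sq (cplx u2) x))
        \<le> \<epsilon>\<^sup>2 * (2 * c * \<bar>ln \<epsilon>\<bar>)" using k1 k2 by (intro mult_left_mono) auto
      then have "\<epsilon>\<^sup>2 * ((LINT x|lborel. grad_norm_sq (cplx u1) x) + (LINT x|lborel. grad_norm_sq (cplx u2) x))
        \<le> 2 * c * (\<epsilon>\<^sup>2 * \<bar>ln \<epsilon>\<bar>)" by (simp only: mult_ac)
      moreover have "2 * (g1 + g2 + g) * (c * \<epsilon>)\<^sup>2 * (pi * l2) \<le> (2 * (g1 + g2 + g) * c\<^sup>2 * (pi * l2)) * (\<epsilon>\<^sup>2 * \<bar>ln \<epsilon>\<bar>)"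
      proof -
        have "0 \<le> 2 * (g1 + g2 + g) * c\<^sup>2 * (pi * l2)" using g_pos s_ord by auto
        moreover have "\<epsilon>\<^sup>2 * 1 \<le> \<epsilon>\<^sup>2 * \<bar>ln \<epsilon>\<bar>" using ln1 by (intro mult_left_mono) auto
        ultimately have "(2 * (g1 + g2 + g) * c\<^sup>2 * (pi * l2)) * (\<epsilon>\<^sup>2 * 1) \<le> (2 * (g1 + g2 + g) * c\<^sup>2 * (pi * l2)) * (\<epsilon>\<^sup>2 * \<bar>ln \<epsilon>\<bar>)"
          by (rule mult_left_mono[rotated])
        then show ?thesis by (simp add: power_mult_distrib mult_ac)
      qed
      ultimately show "\<epsilon>\<^sup>2 * ((LINT x|lborel. grad_norm_sq (cplx u1) x) + (LINT x|lborel. grad_norm_sq (cplx u2) x))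
        + 2 * (g1 + g2 + g) * (c * \<epsilon>)\<^sup>2 * (pi * l2) \<le> B * (\<epsilon>\<^sup>2 * \<bar>ln \<epsilon>\<bar>)"
        unfolding B_def distrib_right by (rule add_mono)
    qed
    then show ?thesis by (simp add: mult_ac)
  qed
  have "\<forall>\<^sub>F \<epsilon> in at_right 0. \<forall>\<eta>1 \<eta>2 lam1 lam2. sol \<epsilon> \<eta>1 \<eta>2 lam1 lam2 \<longrightarrow> energy_control ((B * (1 + 1 / \<kappa>)) * (\<epsilon>\<^sup>2 * \<bar>ln \<epsilon>\<bar>)) \<epsilon> \<eta>1 \<eta>2"
    unfolding eventually_at_right_field using main e0 by blast
  moreover have "0 < B * (1 + 1 / \<kappa>)" using B0 \<kappa> by (intro mult_pos_pos add_pos_pos) auto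
  ultimately show ?thesis by blast
qed

end

section \<open>Multipliers and Pohozaev's identity\<close>

lemma partial_deriv_sq_le_gsq: "(partial_deriv i u x)\<^sup>2 \<le> gsq u x"
  unfolding gsq_def by (rule member_le_sum) auto

text \<open>The flux \<open>u * partial_deriv i u\<close> is bounded by the integrable
  \<open>u\<^sup>2 + gsq u\<close>, so no boundary term arises at infinity.\<close>

lemma Green_identity:
  assumes u: "C_k 2 u" and i: "integrable lborel (\<lambda>x. (u x)\<^sup>2)" "integrable lborel (gsq u)"
    "integrable lborel (\<lambda>x. u x * laplacian u x)"
  shows "(LINT x|lborel. u x * laplacian u x) = - (LINT x|lborel. gsq u x)"
proof -
  let ?F = "\<lambda>i x. u x * partial_deriv i u x"
  let ?D = "\<lambda>i x. (partial_deriv i u x)\<^sup>2 + u x * partial_deriv i (partial_deriv i u) x"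
  have s: "(\<Sum>i\<in>UNIV. ?D i x) = gsq u x + u x * laplacian u x" for x
    by (simp add: sum.distrib gsq_def laplacian_def sum_distrib_left)
  have "(LINT x|lborel. (\<Sum>i\<in>UNIV. ?D i x)) = 0"
  proof (rule integral_divergence_zero[where F="?F" and w="\<lambda>x. (u x)\<^sup>2 + gsq u x"])
    show "has_axis_deriv (?F i) (?D i x) i x" for i x
      using DERIV_mult[OF C_k_2D(6)[OF u, where i=i and x=x] C_k_2D(7)[OF u, where i=i and j=i and x=x]]
      by (simp add: power2_eq_square algebra_simps)
    show "\<bar>?F i x\<bar> \<le> (1 + norm x) * ((u x)\<^sup>2 + gsq u x)" for i x
    proof -
      have "2 * (\<bar>u x\<bar> * \<bar>partial_deriv i u x\<bar>) \<le> (u x)\<^sup>2 + (partial_deriv i u x)\<^sup>2"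
        using sum_squares_bound[of "\<bar>u x\<bar>" "\<bar>partial_deriv i u x\<bar>"] by simp
      then have "\<bar>?F i x\<bar> \<le> 1 * ((u x)\<^sup>2 + gsq u x)"
      proof -
        have *: "2 * t \<le> a + b \<Longrightarrow> b \<le> c \<Longrightarrow> 0 \<le> a \<Longrightarrow> 0 \<le> c \<Longrightarrow> t \<le> a + c" for t a b c :: real by linarith
        assume "2 * (\<bar>u x\<bar> * \<bar>partial_deriv i u x\<bar>) \<le> (u x)\<^sup>2 + (partial_deriv i u x)\<^sup>2"
        then show ?thesis unfolding abs_mult mult_1 by (rule *[OF _ partial_deriv_sq_le_gsq zero_le_power2 gsq_nonneg])
      qed
      also have "\<dots> \<le> (1 + norm x) * ((u x)\<^sup>2 + gsq u x)" by (intro mult_right_mono) (auto simp: gsq_nonneg)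
      finally show ?thesis .
    qed
    show "integrable lborel (\<lambda>x. \<Sum>i\<in>UNIV. ?D i x)" unfolding s using i by simp
  qed (use i C_k_2D[OF u] in \<open>auto intro!: continuous_intros\<close>)
  then show ?thesis unfolding s using i by simp
qed

text \<open>Pohozaev's identity for the radial vector field \<open>X = f (\<bar>x\<bar>\<^sup>2) x\<close>: the stress tensor contracted with \<open>X\<close>.\<close>

definition rad_dot :: "(real^2 \<Rightarrow> real) \<Rightarrow> real^2 \<Rightarrow> real" where
  "rad_dot u x = (\<Sum>k\<in>UNIV. x $ k * partial_deriv k u x)"

definition stress :: "(real \<Rightarrow> real) \<Rightarrow> (real^2 \<Rightarrow> real) \<Rightarrow> 2 \<Rightarrow> real^2 \<Rightarrow> real" where
  "stress f u j x = f (nsq x) * (rad_dot u x * partial_deriv j u x - gsq u x * x $ j / 2)"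

definition stress' :: "(real \<Rightarrow> real) \<Rightarrow> (real \<Rightarrow> real) \<Rightarrow> (real^2 \<Rightarrow> real) \<Rightarrow> 2 \<Rightarrow> real^2 \<Rightarrow> real" where
  "stress' f f' u j x = f' (nsq x) * (2 * x $ j) * (rad_dot u x * partial_deriv j u x - gsq u x * x $ j / 2)
    + f (nsq x) * ((partial_deriv j u x + (\<Sum>k\<in>UNIV. x $ k * partial_deriv j (partial_deriv k u) x)) * partial_deriv j u x
       + rad_dot u x * partial_deriv j (partial_deriv j u) x
       - ((\<Sum>k\<in>UNIV. 2 * partial_deriv k u x * partial_deriv j (partial_deriv k u) x) * x $ j + gsq u x) / 2)"

lemma has_axis_deriv_component: "has_axis_deriv (\<lambda>x. x $ k) (if k = j then 1 else 0) j x"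
  by (auto simp: axis_def intro!: derivative_eq_intros)

lemma has_axis_deriv_rad_dot:
  assumes u: "C_k 2 u"
  shows "has_axis_deriv (rad_dot u) (partial_deriv j u x + (\<Sum>k\<in>UNIV. x $ k * partial_deriv j (partial_deriv k u) x)) j x"
proof -
  have "has_axis_deriv (\<lambda>x. \<Sum>k\<in>UNIV. x $ k * partial_deriv k u x)
     (\<Sum>k\<in>UNIV. (if k = j then partial_deriv k u x else 0) + partial_deriv j (partial_deriv k u) x * x $ k) j x"
  proof (rule DERIV_sum)
    fix k
    show "has_axis_deriv (\<lambda>x. x $ k * partial_deriv k u x)
       ((if k = j then partial_deriv k u x else 0) + partial_deriv j (partial_deriv k u) x * x $ k) j x"
      using DERIV_mult[OF has_axis_deriv_component[where k=k and j=j and x=x] C_k_2D(7)[OF u, where i=k and j=j and x=x]]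
      by (elim DERIV_cong) simp
  qed
  then show ?thesis
    unfolding rad_dot_def[abs_def] by (elim DERIV_cong) (simp add: sum.distrib mult.commute)
qed

lemma has_axis_deriv_gsq:
  assumes u: "C_k 2 u"
  shows "has_axis_deriv (gsq u) (\<Sum>k\<in>UNIV. 2 * partial_deriv k u x * partial_deriv j (partial_deriv k u) x) j x"
proof -
  have *: "has_axis_deriv (\<lambda>x. (partial_deriv k u x)\<^sup>2) (2 * partial_deriv k u x * partial_deriv j (partial_deriv k u) x) j x" for k
    using DERIV_power[OF C_k_2D(7)[OF u, where i=k and j=j and x=x], of 2] by (simp add: mult_ac)
  then show ?thesis
    unfolding gsq_def[abs_def] by (rule DERIV_sum)
qed

lemma has_axis_deriv_stress:
  assumes u: "C_k 2 u" and f: "\<And>s. (f has_real_derivative f' s) (at s)"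
  shows "has_axis_deriv (stress f u j) (stress' f f' u j x) j x"
proof -
  have "has_axis_deriv (\<lambda>x. rad_dot u x * partial_deriv j u x - gsq u x * x $ j / 2)
     ((partial_deriv j u x + (\<Sum>k\<in>UNIV. x $ k * partial_deriv j (partial_deriv k u) x)) * partial_deriv j u x
       + rad_dot u x * partial_deriv j (partial_deriv j u) x
       - ((\<Sum>k\<in>UNIV. 2 * partial_deriv k u x * partial_deriv j (partial_deriv k u) x) * x $ j + gsq u x) / 2) j x"
    using DERIV_diff[OF DERIV_mult[OF has_axis_deriv_rad_dot[OF u, where x=x and j=j] C_k_2D(7)[OF u, where i=j and j=j and x=x]]
        DERIV_cdivide[OF DERIV_mult[OF has_axis_deriv_gsq[OF u, where x=x and j=j] has_axis_deriv_component[where k=j and j=j and x=x]], where c=2]]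
    by (elim DERIV_cong) (simp add: mult.commute)
  from DERIV_mult[OF has_axis_deriv_radial[OF f, where x=x and i=j] this]
  show ?thesis unfolding stress_def[abs_def] stress'_def by (elim DERIV_cong) (simp add: mult_ac)
qed

text \<open>In the plane the contributions of \<open>f * gsq\<close> cancel, and so do the second
  derivatives outside the Laplacian, by their symmetry. Besides the Laplacian term the gradient
  survives only with the factor \<open>f'\<close>.\<close>

lemma stress_divergence:
  assumes u: "C_k 2 u"
  shows "(\<Sum>j\<in>UNIV. stress' f f' u j x)
    = 2 * f' (nsq x) * (rad_dot u x)\<^sup>2 - nsq x * f' (nsq x) * gsq u x
      + f (nsq x) * rad_dot u x * laplacian u x"
proof -
  define p1 p2 where "p1 = partial_deriv 1 u x" and "p2 = partial_deriv 2 u x"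
  define h where "h i j = partial_deriv i (partial_deriv j u) x" for i j
  have c: "h 2 1 = h 1 2" unfolding h_def by (rule partial_deriv_commute[OF u])
  have s: "nsq x = (x $ 1)\<^sup>2 + (x $ 2)\<^sup>2" by (simp add: norm_vec_def L2_set_def sum_2)
  show ?thesis
    unfolding stress'_def rad_dot_def gsq_def laplacian_def sum_2 h_def[symmetric] p1_def[symmetric] p2_def[symmetric] c
    unfolding s[symmetric]
    by (simp add: power2_eq_square field_simps s[unfolded power2_eq_square])
qed

lemma stress_continuous:
  assumes u: "C_k 2 u" and f: "continuous_on UNIV f" "continuous_on UNIV f'"
  shows "continuous_on UNIV (stress f u j)" "continuous_on UNIV (stress' f f' u j)"
proof -
  have r: "continuous_on UNIV (\<lambda>x::real^2. h (nsq x))" if "continuous_on UNIV h" for h :: "real \<Rightarrow> real"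
    by (rule continuous_on_compose2[OF that]) (auto intro!: continuous_intros)
  have rd: "continuous_on UNIV (rad_dot u)"
    unfolding rad_dot_def[abs_def] by (intro continuous_intros C_k_2D(4)[OF u])
  note c = r[OF f(1)] r[OF f(2)] rd gsq_continuous[OF u] C_k_2D(4,5)[OF u]
  show "continuous_on UNIV (stress f u j)" unfolding stress_def[abs_def] by (intro continuous_intros c) auto
  show "continuous_on UNIV (stress' f f' u j)" unfolding stress'_def[abs_def] by (intro continuous_intros c) auto
qed

lemma rad_dot_sq: "(rad_dot u x)\<^sup>2 \<le> nsq x * gsq u x"
proof -
  have s: "nsq x = (x $ 1)\<^sup>2 + (x $ 2)\<^sup>2" by (simp add: norm_vec_def L2_set_def sum_2)
  have "0 \<le> (x $ 1 * partial_deriv 2 u x - x $ 2 * partial_deriv 1 u x)\<^sup>2" by simp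
  then show ?thesis unfolding rad_dot_def gsq_def sum_2 s by (simp add: power2_eq_square algebra_simps)
qed

lemma stress_bound:
  assumes "\<And>s. 0 \<le> s \<Longrightarrow> \<bar>f s\<bar> \<le> B"
  shows "\<bar>stress f u j x\<bar> \<le> (1 + norm x) * (2 * B * gsq u x)"
proof -
  have B: "0 \<le> B" using assms[of 0] by linarith
  have r: "\<bar>rad_dot u x\<bar> \<le> norm x * sqrt (gsq u x)"
    using rad_dot_sq[of u x] real_sqrt_le_mono[of "(rad_dot u x)\<^sup>2" "nsq x * gsq u x"] by (simp add: real_sqrt_mult)
  have p: "\<bar>partial_deriv j u x\<bar> \<le> sqrt (gsq u x)"
    using real_sqrt_le_mono[OF partial_deriv_sq_le_gsq[of j u x]] by simp
  have "\<bar>rad_dot u x * partial_deriv j u x\<bar> \<le> (norm x * sqrt (gsq u x)) * sqrt (gsq u x)"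
    unfolding abs_mult using r p by (intro mult_mono) (auto simp: gsq_nonneg)
  also have "\<dots> = norm x * gsq u x" by (simp only: mult.assoc real_sqrt_mult_self abs_of_nonneg[OF gsq_nonneg])
  finally have 1: "\<bar>rad_dot u x * partial_deriv j u x\<bar> \<le> norm x * gsq u x" .
  have 2: "\<bar>gsq u x * x $ j / 2\<bar> \<le> norm x * gsq u x"
  proof -
    have "gsq u x * \<bar>x $ j\<bar> \<le> gsq u x * norm x" using abs_component_le_norm[of x j] by (intro mult_left_mono) (auto simp: gsq_nonneg)
    moreover have "0 \<le> gsq u x * \<bar>x $ j\<bar>" "\<bar>gsq u x * x $ j / 2\<bar> = gsq u x * \<bar>x $ j\<bar> / 2"
      by (simp_all add: abs_mult gsq_nonneg)
    ultimately show ?thesis by (simp only: mult.commute[of "norm x"])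
  qed
  have "\<bar>stress f u j x\<bar> \<le> B * (2 * (norm x * gsq u x))"
    unfolding stress_def abs_mult using 1 2 assms[of "nsq x"] B by (intro mult_mono) auto
  also have "\<dots> = norm x * (2 * B * gsq u x)" by simp
  also have "\<dots> \<le> (1 + norm x) * (2 * B * gsq u x)" using B by (intro mult_right_mono) (auto simp: gsq_nonneg)
  finally show ?thesis .
qed

lemma pressure_deriv_1d:
  fixes a m n :: "real \<Rightarrow> real"
  assumes "(a has_real_derivative a') (at t)" "(m has_real_derivative m') (at t)" "(n has_real_derivative n') (at t)"
  shows "((\<lambda>t. (a t - c) * m t + (a t - d) * n t + (p * (m t)\<^sup>2 / 2 + q * (n t)\<^sup>2 / 2 + r * m t * n t)) has_real_derivative
    (a' * m t + (a t - c) * m') + (a' * n t + (a t - d) * n') + (p * m t * m' + q * n t * n' + r * (m' * n t + m t * n'))) (at t)"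
  using assms by (auto intro!: derivative_eq_intros simp: algebra_simps)

section \<open>Identities for the multipliers\<close>

context tf_data
begin

text \<open>The analogue of \<open>press\<close> for the solution and its own multipliers. By the
  equations its gradient is \<open>2 * x * (\<eta>1\<^sup>2 + \<eta>2\<^sup>2)\<close> plus products
  of Laplacian and gradient, and the latter are exactly what the divergence of the stress leaves
  over.\<close>

definition pressure :: "real \<Rightarrow> real \<Rightarrow> (real^2 \<Rightarrow> real) \<Rightarrow> (real^2 \<Rightarrow> real) \<Rightarrow> real^2 \<Rightarrow> real" where
  "pressure lam1 lam2 \<eta>1 \<eta>2 x = (nsq x - lam1) * (\<eta>1 x)\<^sup>2 + (nsq x - lam2) * (\<eta>2 x)\<^sup>2 + Q ((\<eta>1 x)\<^sup>2) ((\<eta>2 x)\<^sup>2)"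

lemma finite_energy_integrable:
  assumes "finite_energy \<eta>1 \<eta>2"
  shows "integrable lborel (pressure lam1 lam2 \<eta>1 \<eta>2)"
    "integrable lborel (\<lambda>x. nsq x * ((\<eta>1 x)\<^sup>2 + (\<eta>2 x)\<^sup>2))"
    "integrable lborel (\<lambda>x. Q ((\<eta>1 x)\<^sup>2) ((\<eta>2 x)\<^sup>2))"
    "(LINT x|lborel. pressure lam1 lam2 \<eta>1 \<eta>2 x) = (LINT x|lborel. nsq x * ((\<eta>1 x)\<^sup>2 + (\<eta>2 x)\<^sup>2))
       - (lam1 + lam2) + (LINT x|lborel. Q ((\<eta>1 x)\<^sup>2) ((\<eta>2 x)\<^sup>2))"
proof -
  note i = assms[unfolded finite_energy_def]
  have p: "pressure lam1 lam2 \<eta>1 \<eta>2 = (\<lambda>x. nsq x * ((\<eta>1 x)\<^sup>2 + (\<eta>2 x)\<^sup>2) - (lam1 * (\<eta>1 x)\<^sup>2 + lam2 * (\<eta>2 x)\<^sup>2)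
      + Q ((\<eta>1 x)\<^sup>2) ((\<eta>2 x)\<^sup>2))"
    by (auto simp: pressure_def fun_eq_iff algebra_simps)
  show N: "integrable lborel (\<lambda>x. nsq x * ((\<eta>1 x)\<^sup>2 + (\<eta>2 x)\<^sup>2))"
    unfolding distrib_left using i by simp
  have q: "(\<lambda>x. Q ((\<eta>1 x)\<^sup>2) ((\<eta>2 x)\<^sup>2)) = (\<lambda>x. (g1 / 2) * ((\<eta>1 x)\<^sup>2)\<^sup>2 + (g2 / 2) * ((\<eta>2 x)\<^sup>2)\<^sup>2 + g * ((\<eta>1 x)\<^sup>2 * (\<eta>2 x)\<^sup>2))"
    by (auto simp: fun_eq_iff Q_def)
  show Qi: "integrable lborel (\<lambda>x. Q ((\<eta>1 x)\<^sup>2) ((\<eta>2 x)\<^sup>2))"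
    unfolding q using i by (intro Bochner_Integration.integrable_add integrable_mult_right) auto
  have li: "integrable lborel (\<lambda>x. lam1 * (\<eta>1 x)\<^sup>2 + lam2 * (\<eta>2 x)\<^sup>2)" using i by simp
  have lI: "(LINT x|lborel. lam1 * (\<eta>1 x)\<^sup>2 + lam2 * (\<eta>2 x)\<^sup>2) = lam1 + lam2" using i by simp
  show "integrable lborel (pressure lam1 lam2 \<eta>1 \<eta>2)" unfolding p by (intro Bochner_Integration.integrable_add Bochner_Integration.integrable_diff N Qi li)
  show "(LINT x|lborel. pressure lam1 lam2 \<eta>1 \<eta>2 x) = (LINT x|lborel. nsq x * ((\<eta>1 x)\<^sup>2 + (\<eta>2 x)\<^sup>2))
       - (lam1 + lam2) + (LINT x|lborel. Q ((\<eta>1 x)\<^sup>2) ((\<eta>2 x)\<^sup>2))"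
    unfolding p using N Qi li lI by simp
qed

text \<open>Each equation is tested with its own solution. Integrability of
  \<open>u * laplacian u\<close> is read off from the equation, where everything else has finite
  integral by the energy.\<close>

lemma multiplier_identity:
  assumes sol: "sol \<epsilon> \<eta>1 \<eta>2 lam1 lam2" and fe: "finite_energy \<eta>1 \<eta>2"
  shows "lam1 = \<epsilon>\<^sup>2 * (LINT x|lborel. gsq \<eta>1 x) + (LINT x|lborel. (nsq x + g1 * (\<eta>1 x)\<^sup>2 + g * (\<eta>2 x)\<^sup>2) * (\<eta>1 x)\<^sup>2)"
    and "lam2 = \<epsilon>\<^sup>2 * (LINT x|lborel. gsq \<eta>2 x) + (LINT x|lborel. (nsq x + g2 * (\<eta>2 x)\<^sup>2 + g * (\<eta>1 x)\<^sup>2) * (\<eta>2 x)\<^sup>2)"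
    and "integrable lborel (\<lambda>x. (nsq x + g1 * (\<eta>1 x)\<^sup>2 + g * (\<eta>2 x)\<^sup>2) * (\<eta>1 x)\<^sup>2)"
    and "integrable lborel (\<lambda>x. (nsq x + g2 * (\<eta>2 x)\<^sup>2 + g * (\<eta>1 x)\<^sup>2) * (\<eta>2 x)\<^sup>2)"
proof -
  note S = solD[OF sol] and i = fe[unfolded finite_energy_def]
  have *: "integrable lborel (\<lambda>x. (nsq x + a * (u x)\<^sup>2 + g * (v x)\<^sup>2) * (u x)\<^sup>2) \<and>
     lam = \<epsilon>\<^sup>2 * (LINT x|lborel. gsq u x) + (LINT x|lborel. (nsq x + a * (u x)\<^sup>2 + g * (v x)\<^sup>2) * (u x)\<^sup>2)"
    if u: "C_k 2 u" "integrable lborel (\<lambda>x. (u x)\<^sup>2)" "integrable lborel (gsq u)" "integrable lborel (\<lambda>x. nsq x * (u x)\<^sup>2)"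
      "integrable lborel (\<lambda>x. ((u x)\<^sup>2)\<^sup>2)" "integrable lborel (\<lambda>x. (u x)\<^sup>2 * (v x)\<^sup>2)" "(LINT x|lborel. (u x)\<^sup>2) = 1"
      and eq: "\<And>x. \<epsilon>\<^sup>2 * laplacian u x = u x * (nsq x + a * (u x)\<^sup>2 + g * (v x)\<^sup>2 - lam)" for u v a lam
  proof -
    let ?h = "\<lambda>x. (nsq x + a * (u x)\<^sup>2 + g * (v x)\<^sup>2) * (u x)\<^sup>2"
    have h: "?h = (\<lambda>x. nsq x * (u x)\<^sup>2 + a * ((u x)\<^sup>2)\<^sup>2 + g * ((u x)\<^sup>2 * (v x)\<^sup>2))"
      by (auto simp: fun_eq_iff algebra_simps power2_eq_square)
    have ih: "integrable lborel ?h" unfolding h using u by (intro Bochner_Integration.integrable_add integrable_mult_right) auto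
    have e: "\<epsilon>\<^sup>2 * (u x * laplacian u x) = ?h x - lam * (u x)\<^sup>2" for x
    proof -
      have "\<epsilon>\<^sup>2 * (u x * laplacian u x) = u x * (\<epsilon>\<^sup>2 * laplacian u x)" by simp
      also have "\<dots> = ?h x - lam * (u x)\<^sup>2" unfolding eq by (simp add: algebra_simps power2_eq_square)
      finally show ?thesis .
    qed
    have \<epsilon>: "\<epsilon>\<^sup>2 \<noteq> 0" using S(1) by simp
    have il: "integrable lborel (\<lambda>x. \<epsilon>\<^sup>2 * (u x * laplacian u x))" unfolding e using ih u by simp
    then have il': "integrable lborel (\<lambda>x. u x * laplacian u x)" using \<epsilon> by simp
    have "\<epsilon>\<^sup>2 * (LINT x|lborel. u x * laplacian u x) = (LINT x|lborel. ?h x) - lam"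
    proof -
      have "\<epsilon>\<^sup>2 * (LINT x|lborel. u x * laplacian u x) = (LINT x|lborel. \<epsilon>\<^sup>2 * (u x * laplacian u x))" by simp
      also have "\<dots> = (LINT x|lborel. ?h x) - lam" unfolding e using ih u by simp
      finally show ?thesis .
    qed
    then show ?thesis using Green_identity[OF u(1,2,3) il'] ih by simp
  qed
  have c: "integrable lborel (\<lambda>x. (\<eta>2 x)\<^sup>2 * (\<eta>1 x)\<^sup>2)" using i by (simp add: mult.commute)
  have 1: "integrable lborel (\<lambda>x. (nsq x + g1 * (\<eta>1 x)\<^sup>2 + g * (\<eta>2 x)\<^sup>2) * (\<eta>1 x)\<^sup>2) \<and>
     lam1 = \<epsilon>\<^sup>2 * (LINT x|lborel. gsq \<eta>1 x) + (LINT x|lborel. (nsq x + g1 * (\<eta>1 x)\<^sup>2 + g * (\<eta>2 x)\<^sup>2) * (\<eta>1 x)\<^sup>2)"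
    by (rule *) (use i S in auto)
  have 2: "integrable lborel (\<lambda>x. (nsq x + g2 * (\<eta>2 x)\<^sup>2 + g * (\<eta>1 x)\<^sup>2) * (\<eta>2 x)\<^sup>2) \<and>
     lam2 = \<epsilon>\<^sup>2 * (LINT x|lborel. gsq \<eta>2 x) + (LINT x|lborel. (nsq x + g2 * (\<eta>2 x)\<^sup>2 + g * (\<eta>1 x)\<^sup>2) * (\<eta>2 x)\<^sup>2)"
    by (rule *) (use i S c in auto)
  show "lam1 = \<epsilon>\<^sup>2 * (LINT x|lborel. gsq \<eta>1 x) + (LINT x|lborel. (nsq x + g1 * (\<eta>1 x)\<^sup>2 + g * (\<eta>2 x)\<^sup>2) * (\<eta>1 x)\<^sup>2)"
    "integrable lborel (\<lambda>x. (nsq x + g1 * (\<eta>1 x)\<^sup>2 + g * (\<eta>2 x)\<^sup>2) * (\<eta>1 x)\<^sup>2)" using 1 by auto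
  show "lam2 = \<epsilon>\<^sup>2 * (LINT x|lborel. gsq \<eta>2 x) + (LINT x|lborel. (nsq x + g2 * (\<eta>2 x)\<^sup>2 + g * (\<eta>1 x)\<^sup>2) * (\<eta>2 x)\<^sup>2)"
    "integrable lborel (\<lambda>x. (nsq x + g2 * (\<eta>2 x)\<^sup>2 + g * (\<eta>1 x)\<^sup>2) * (\<eta>2 x)\<^sup>2)" using 2 by auto
qed

lemma multiplier_sum:
  assumes sol: "sol \<epsilon> \<eta>1 \<eta>2 lam1 lam2" and fe: "finite_energy \<eta>1 \<eta>2"
  shows "lam1 + lam2 = \<epsilon>\<^sup>2 * ((LINT x|lborel. gsq \<eta>1 x) + (LINT x|lborel. gsq \<eta>2 x))
     + (LINT x|lborel. nsq x * ((\<eta>1 x)\<^sup>2 + (\<eta>2 x)\<^sup>2)) + 2 * (LINT x|lborel. Q ((\<eta>1 x)\<^sup>2) ((\<eta>2 x)\<^sup>2))"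
proof -
  note m = multiplier_identity[OF assms] and N = finite_energy_integrable[OF fe]
  have "(LINT x|lborel. (nsq x + g1 * (\<eta>1 x)\<^sup>2 + g * (\<eta>2 x)\<^sup>2) * (\<eta>1 x)\<^sup>2) + (LINT x|lborel. (nsq x + g2 * (\<eta>2 x)\<^sup>2 + g * (\<eta>1 x)\<^sup>2) * (\<eta>2 x)\<^sup>2)
    = (LINT x|lborel. (nsq x + g1 * (\<eta>1 x)\<^sup>2 + g * (\<eta>2 x)\<^sup>2) * (\<eta>1 x)\<^sup>2 + (nsq x + g2 * (\<eta>2 x)\<^sup>2 + g * (\<eta>1 x)\<^sup>2) * (\<eta>2 x)\<^sup>2)"
    by (rule Bochner_Integration.integral_add[symmetric]) (rule m)+
  also have "\<dots> = (LINT x|lborel. nsq x * ((\<eta>1 x)\<^sup>2 + (\<eta>2 x)\<^sup>2) + 2 * Q ((\<eta>1 x)\<^sup>2) ((\<eta>2 x)\<^sup>2))"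
    by (intro Bochner_Integration.integral_cong refl) (simp add: Q_def power2_eq_square algebra_simps)
  also have "\<dots> = (LINT x|lborel. nsq x * ((\<eta>1 x)\<^sup>2 + (\<eta>2 x)\<^sup>2)) + 2 * (LINT x|lborel. Q ((\<eta>1 x)\<^sup>2) ((\<eta>2 x)\<^sup>2))"
    using N by simp
  finally show ?thesis using m(1,2) by (simp add: distrib_left)
qed

text \<open>Divergence theorem for the stress of both components minus half the pressure along the
  field, where the Laplacian terms cancel. The factor \<open>f + s * f'\<close> is half the
  divergence of the field; the terms with \<open>f'\<close> and squared gradients are left as an
  error of the size of the kinetic energy.\<close>

lemma Pohozaev:
  assumes sol: "sol \<epsilon> \<eta>1 \<eta>2 lam1 lam2" and fe: "finite_energy \<eta>1 \<eta>2"
    and f: "\<And>s. (f has_real_derivative f' s) (at s)" "continuous_on UNIV f'"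
    and B: "\<And>s. 0 \<le> s \<Longrightarrow> \<bar>f s\<bar> \<le> B" "\<And>s. 0 \<le> s \<Longrightarrow> \<bar>s * f' s\<bar> \<le> B"
  shows "\<bar>(LINT x|lborel. (f (nsq x) + nsq x * f' (nsq x)) * pressure lam1 lam2 \<eta>1 \<eta>2 x
      + nsq x * f (nsq x) * ((\<eta>1 x)\<^sup>2 + (\<eta>2 x)\<^sup>2))\<bar>
    \<le> 3 * B * (\<epsilon>\<^sup>2 * ((LINT x|lborel. gsq \<eta>1 x) + (LINT x|lborel. gsq \<eta>2 x)))"
proof -
  note S = solD[OF sol] and i = fe[unfolded finite_energy_def] and N = finite_energy_integrable[OF fe]
  let ?P = "pressure lam1 lam2 \<eta>1 \<eta>2"
  define s where "s x = nsq x" for x :: "real^2"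
  have fc: "continuous_on UNIV f" using f(1) by (auto intro!: DERIV_continuous_on)
  have rc: "continuous_on UNIV (\<lambda>x::real^2. h (nsq x))" if "continuous_on UNIV h" for h :: "real \<Rightarrow> real"
    by (rule continuous_on_compose2[OF that]) (auto intro!: continuous_intros)
  define P' where "P' j x = 2 * x $ j * ((\<eta>1 x)\<^sup>2 + (\<eta>2 x)\<^sup>2)
     + 2 * (\<epsilon>\<^sup>2 * laplacian \<eta>1 x * partial_deriv j \<eta>1 x + \<epsilon>\<^sup>2 * laplacian \<eta>2 x * partial_deriv j \<eta>2 x)" for j x
  have dP: "has_axis_deriv ?P (P' j x) j x" for j x
  proof -
    note d1 = C_k_2D(6)[OF S(4), where i=j and x=x] and d2 = C_k_2D(6)[OF S(5), where i=j and x=x]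
    note q1 = DERIV_power[OF d1, of 2] and q2 = DERIV_power[OF d2, of 2]
    note r = has_axis_deriv_norm_square[where x=x and i=j]
    have "has_axis_deriv ?P ((2 * x $ j) * (\<eta>1 x)\<^sup>2 + (nsq x - lam1) * (2 * \<eta>1 x * partial_deriv j \<eta>1 x)
       + ((2 * x $ j) * (\<eta>2 x)\<^sup>2 + (nsq x - lam2) * (2 * \<eta>2 x * partial_deriv j \<eta>2 x))
       + (g1 * (\<eta>1 x)\<^sup>2 * (2 * \<eta>1 x * partial_deriv j \<eta>1 x) + g2 * (\<eta>2 x)\<^sup>2 * (2 * \<eta>2 x * partial_deriv j \<eta>2 x)
         + g * ((2 * \<eta>1 x * partial_deriv j \<eta>1 x) * (\<eta>2 x)\<^sup>2 + (\<eta>1 x)\<^sup>2 * (2 * \<eta>2 x * partial_deriv j \<eta>2 x)))) j x"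
      unfolding pressure_def[abs_def] Q_def
      using pressure_deriv_1d[OF r q1 q2, of lam1 lam2 g1 g2 g] by (elim DERIV_cong) (simp add: algebra_simps)
    then show ?thesis
      unfolding P'_def S(6,7) by (elim DERIV_cong) (simp add: power2_eq_square algebra_simps)
  qed
  have lc: "continuous_on UNIV (laplacian \<eta>1)" "continuous_on UNIV (laplacian \<eta>2)"
    unfolding laplacian_def[abs_def] by (intro continuous_intros C_k_2D(5)[OF S(4)] C_k_2D(5)[OF S(5)])+
  note C = C_k_2D(3,4)[OF S(4)] C_k_2D(3,4)[OF S(5)]
  have Pc: "continuous_on UNIV ?P" "continuous_on UNIV (P' j)" for j
    unfolding pressure_def[abs_def] P'_def[abs_def] Q_def by (intro continuous_intros C lc; simp)+
  define F where "F j x = \<epsilon>\<^sup>2 * stress f \<eta>1 j x + \<epsilon>\<^sup>2 * stress f \<eta>2 j x - (f (nsq x) * x $ j) * ?P x / 2" for j and x :: "real^2"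
  define D where "D j x = \<epsilon>\<^sup>2 * stress' f f' \<eta>1 j x + \<epsilon>\<^sup>2 * stress' f f' \<eta>2 j x
     - ((f' (nsq x) * (2 * x $ j) * x $ j + f (nsq x)) * ?P x + f (nsq x) * x $ j * P' j x) / 2" for j and x :: "real^2"
  define E where "E x = \<epsilon>\<^sup>2 * (2 * f' (s x) * (rad_dot \<eta>1 x)\<^sup>2 - s x * f' (s x) * gsq \<eta>1 x)
     + \<epsilon>\<^sup>2 * (2 * f' (s x) * (rad_dot \<eta>2 x)\<^sup>2 - s x * f' (s x) * gsq \<eta>2 x)" for x :: "real^2"
  define G where "G x = (f (s x) + s x * f' (s x)) * ?P x + s x * f (s x) * ((\<eta>1 x)\<^sup>2 + (\<eta>2 x)\<^sup>2)" for x
  have sumD: "(\<Sum>j\<in>UNIV. D j x) = E x - G x" for x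
  proof -
    have n: "s x = x $ 1 * x $ 1 + x $ 2 * x $ 2" by (simp add: s_def norm_vec_def L2_set_def sum_2 power2_eq_square)
    have "(\<Sum>j\<in>UNIV. D j x) = \<epsilon>\<^sup>2 * (\<Sum>j\<in>UNIV. stress' f f' \<eta>1 j x) + \<epsilon>\<^sup>2 * (\<Sum>j\<in>UNIV. stress' f f' \<eta>2 j x)
       - (\<Sum>j\<in>UNIV. ((f' (s x) * (2 * x $ j) * x $ j + f (s x)) * ?P x + f (s x) * x $ j * P' j x) / 2)"
      by (simp add: D_def s_def sum.distrib sum_subtractf sum_distrib_left)
    also have "(\<Sum>j\<in>UNIV. ((f' (s x) * (2 * x $ j) * x $ j + f (s x)) * ?P x + f (s x) * x $ j * P' j x) / 2)
      = (f (s x) + s x * f' (s x)) * ?P x + f (s x) * (s x * ((\<eta>1 x)\<^sup>2 + (\<eta>2 x)\<^sup>2)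
          + \<epsilon>\<^sup>2 * laplacian \<eta>1 x * rad_dot \<eta>1 x + \<epsilon>\<^sup>2 * laplacian \<eta>2 x * rad_dot \<eta>2 x)"
      unfolding sum_2 P'_def rad_dot_def n by (simp add: field_simps)
    finally show ?thesis
      unfolding stress_divergence[OF S(4)] stress_divergence[OF S(5)] s_def[symmetric] E_def G_def by (simp add: algebra_simps)
  qed
  \<comment> \<open>Cauchy-Schwarz, \<open>rad_dot_sq\<close>, bounds the term with
    \<open>rad_dot\<close> by \<open>2 * s * \<bar>f'\<bar> * gsq\<close>; together with the other
    term this makes the factor 3.\<close>
  have Eb: "\<bar>E x\<bar> \<le> 3 * B * \<epsilon>\<^sup>2 * (gsq \<eta>1 x + gsq \<eta>2 x)" for x
  proof -
    have b: "\<bar>2 * f' (s x) * (rad_dot u x)\<^sup>2 - s x * f' (s x) * gsq u x\<bar> \<le> 3 * B * gsq u x" for u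
    proof -
      have s0: "0 \<le> s x" by (simp add: s_def)
      have "\<bar>2 * f' (s x) * (rad_dot u x)\<^sup>2\<bar> = 2 * \<bar>f' (s x)\<bar> * (rad_dot u x)\<^sup>2" by (simp add: abs_mult)
      also have "\<dots> \<le> 2 * \<bar>f' (s x)\<bar> * (s x * gsq u x)" unfolding s_def by (intro mult_left_mono rad_dot_sq) auto
      also have "\<dots> = 2 * \<bar>s x * f' (s x)\<bar> * gsq u x" using s0 by (simp add: abs_mult)
      also have "\<dots> \<le> 2 * B * gsq u x" using B(2)[OF s0] by (intro mult_right_mono) (auto simp: gsq_nonneg)
      finally have 1: "\<bar>2 * f' (s x) * (rad_dot u x)\<^sup>2\<bar> \<le> 2 * B * gsq u x" .
      have "\<bar>s x * f' (s x) * gsq u x\<bar> \<le> B * gsq u x"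
        unfolding abs_mult[of _ "gsq u x"] using B(2)[OF s0] by (simp add: gsq_nonneg mult_right_mono)
      with 1 show ?thesis by linarith
    qed
    have "\<bar>E x\<bar> \<le> \<epsilon>\<^sup>2 * (3 * B * gsq \<eta>1 x) + \<epsilon>\<^sup>2 * (3 * B * gsq \<eta>2 x)"
      unfolding E_def using b[of \<eta>1] b[of \<eta>2] by (intro order_trans[OF abs_triangle_ineq] add_mono) (simp_all add: abs_mult mult_left_mono)
    then show ?thesis by (simp add: algebra_simps)
  qed
  have [measurable]: "f \<in> borel_measurable borel" "f' \<in> borel_measurable borel" "?P \<in> borel_measurable borel"
     "\<eta>1 \<in> borel_measurable borel" "\<eta>2 \<in> borel_measurable borel" "gsq \<eta>1 \<in> borel_measurable borel" "gsq \<eta>2 \<in> borel_measurable borel"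
    using fc f(2) Pc C gsq_continuous[OF S(4)] gsq_continuous[OF S(5)] by (auto intro: borel_measurable_continuous_onI)
  have "continuous_on UNIV (rad_dot u)" if "C_k 2 u" for u
    unfolding rad_dot_def[abs_def] by (intro continuous_intros C_k_2D(4)[OF that])
  then have [measurable]: "rad_dot \<eta>1 \<in> borel_measurable borel" "rad_dot \<eta>2 \<in> borel_measurable borel"
    using S(4,5) by (auto intro: borel_measurable_continuous_onI)
  have iE: "integrable lborel E"
  proof (rule Bochner_Integration.integrable_bound)
    show "integrable lborel (\<lambda>x. 3 * B * \<epsilon>\<^sup>2 * (gsq \<eta>1 x + gsq \<eta>2 x))" using i by simp
    show "AE x in lborel. norm (E x) \<le> norm (3 * B * \<epsilon>\<^sup>2 * (gsq \<eta>1 x + gsq \<eta>2 x))"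
      unfolding real_norm_def by (rule AE_I2, rule order_trans[OF Eb abs_ge_self])
    show "E \<in> borel_measurable lborel" unfolding E_def[abs_def] s_def by measurable
  qed
  have B0: "0 \<le> B" using B(1)[of 0] by linarith
  have iG: "integrable lborel G"
  proof (rule Bochner_Integration.integrable_bound)
    show "integrable lborel (\<lambda>x. 2 * B * \<bar>?P x\<bar> + B * (nsq x * ((\<eta>1 x)\<^sup>2 + (\<eta>2 x)\<^sup>2)))" using N(1)[of lam1 lam2] N(2) by simp
    show "AE x in lborel. norm (G x) \<le> norm (2 * B * \<bar>?P x\<bar> + B * (nsq x * ((\<eta>1 x)\<^sup>2 + (\<eta>2 x)\<^sup>2)))"
    proof (rule AE_I2)
      fix x
      have s0: "0 \<le> s x" by (simp add: s_def)
      have 1: "\<bar>(f (s x) + s x * f' (s x)) * ?P x\<bar> \<le> 2 * B * \<bar>?P x\<bar>"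
        unfolding abs_mult using B(1)[OF s0] B(2)[OF s0] by (intro mult_right_mono) auto
      have 2: "\<bar>s x * f (s x) * ((\<eta>1 x)\<^sup>2 + (\<eta>2 x)\<^sup>2)\<bar> \<le> B * (s x * ((\<eta>1 x)\<^sup>2 + (\<eta>2 x)\<^sup>2))"
      proof -
        have "\<bar>s x * f (s x) * ((\<eta>1 x)\<^sup>2 + (\<eta>2 x)\<^sup>2)\<bar> = \<bar>f (s x)\<bar> * (s x * ((\<eta>1 x)\<^sup>2 + (\<eta>2 x)\<^sup>2))"
          using s0 by (simp add: abs_mult)
        also have "\<dots> \<le> B * (s x * ((\<eta>1 x)\<^sup>2 + (\<eta>2 x)\<^sup>2))" using B(1) s0 by (intro mult_right_mono) auto
        finally show ?thesis .
      qed
      have "\<bar>G x\<bar> \<le> 2 * B * \<bar>?P x\<bar> + B * (s x * ((\<eta>1 x)\<^sup>2 + (\<eta>2 x)\<^sup>2))" unfolding G_def using 1 2 by linarith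
      then show "norm (G x) \<le> norm (2 * B * \<bar>?P x\<bar> + B * (nsq x * ((\<eta>1 x)\<^sup>2 + (\<eta>2 x)\<^sup>2)))"
        unfolding real_norm_def s_def by linarith
    qed
    show "G \<in> borel_measurable lborel" unfolding G_def[abs_def] s_def by measurable
  qed
  have "(LINT x|lborel. (\<Sum>j\<in>UNIV. D j x)) = 0"
  proof (rule integral_divergence_zero[where F=F and w="\<lambda>x. 2 * B * \<epsilon>\<^sup>2 * (gsq \<eta>1 x + gsq \<eta>2 x) + B * \<bar>?P x\<bar>"])
    show "has_axis_deriv (F j) (D j x) j x" for j x
    proof -
      have 1: "has_axis_deriv (\<lambda>x. f (nsq x) * x $ j) (f' (nsq x) * (2 * x $ j) * x $ j + f (nsq x)) j x"
        using DERIV_mult[OF has_axis_deriv_radial[OF f(1), where x=x and i=j] has_axis_deriv_component[where k=j and j=j and x=x]] by (elim DERIV_cong) simp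
      have 2: "has_axis_deriv (\<lambda>x. f (nsq x) * x $ j * ?P x / 2)
        (((f' (nsq x) * (2 * x $ j) * x $ j + f (nsq x)) * ?P x + f (nsq x) * x $ j * P' j x) / 2) j x"
        using DERIV_cdivide[OF DERIV_mult[OF 1 dP[where j=j and x=x]], where c=2] by (elim DERIV_cong) (simp add: mult.commute)
      show ?thesis
        unfolding F_def[abs_def] D_def
        by (intro DERIV_diff DERIV_add DERIV_cmult has_axis_deriv_stress[OF S(4) f(1)] has_axis_deriv_stress[OF S(5) f(1)] 2)
    qed
    show "continuous_on UNIV (F j)" for j
      unfolding F_def[abs_def] by (intro continuous_intros stress_continuous[OF S(4) fc f(2)] stress_continuous[OF S(5) fc f(2)] rc[OF fc] Pc) auto
    show "continuous_on UNIV (D j)" for j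
      unfolding D_def[abs_def] by (intro continuous_intros stress_continuous[OF S(4) fc f(2)] stress_continuous[OF S(5) fc f(2)] rc[OF fc] rc[OF f(2)] Pc) auto
    show "integrable lborel (\<lambda>x. 2 * B * \<epsilon>\<^sup>2 * (gsq \<eta>1 x + gsq \<eta>2 x) + B * \<bar>?P x\<bar>)"
      using i N(1)[of lam1 lam2] by simp
    show "integrable lborel (\<lambda>x. \<Sum>j\<in>UNIV. D j x)" unfolding sumD using iE iG by simp
    show "\<bar>F j x\<bar> \<le> (1 + norm x) * (2 * B * \<epsilon>\<^sup>2 * (gsq \<eta>1 x + gsq \<eta>2 x) + B * \<bar>?P x\<bar>)" for j x
    proof -
      have 1: "\<bar>\<epsilon>\<^sup>2 * stress f u j x\<bar> \<le> \<epsilon>\<^sup>2 * ((1 + norm x) * (2 * B * gsq u x))" for u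
        unfolding abs_mult using stress_bound[OF B(1), where u=u and j=j and x=x] by (simp add: mult_left_mono)
      have 2: "\<bar>(f (nsq x) * x $ j) * ?P x / 2\<bar> \<le> (B * (1 + norm x)) * \<bar>?P x\<bar>"
      proof -
        have "\<bar>f (nsq x) * x $ j\<bar> \<le> B * (1 + norm x)"
          unfolding abs_mult using B(1)[of "nsq x"] B0 abs_component_le_norm[of x j] by (intro mult_mono) auto
        then have le: "\<bar>f (nsq x) * x $ j\<bar> * \<bar>?P x\<bar> \<le> (B * (1 + norm x)) * \<bar>?P x\<bar>" by (rule mult_right_mono) simp
        have half: "0 \<le> y \<Longrightarrow> y \<le> z \<Longrightarrow> y / 2 \<le> z" for y z :: real by linarith
        have e: "\<bar>(f (nsq x) * x $ j) * ?P x / 2\<bar> = \<bar>f (nsq x) * x $ j\<bar> * \<bar>?P x\<bar> / 2" by (simp add: abs_mult)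
        show ?thesis unfolding e by (rule half[OF _ le]) simp
      qed
      have "\<bar>F j x\<bar> \<le> \<epsilon>\<^sup>2 * ((1 + norm x) * (2 * B * gsq \<eta>1 x)) + \<epsilon>\<^sup>2 * ((1 + norm x) * (2 * B * gsq \<eta>2 x)) + (B * (1 + norm x)) * \<bar>?P x\<bar>"
        unfolding F_def using 1[of \<eta>1] 1[of \<eta>2] 2 by linarith
      also have "\<dots> = (1 + norm x) * (2 * B * \<epsilon>\<^sup>2 * (gsq \<eta>1 x + gsq \<eta>2 x) + B * \<bar>?P x\<bar>)" by (simp add: algebra_simps)
      finally show ?thesis .
    qed
  qed
  then have "(LINT x|lborel. G x) = (LINT x|lborel. E x)" unfolding sumD using iE iG by simp
  moreover have "\<bar>LINT x|lborel. E x\<bar> \<le> (LINT x|lborel. 3 * B * \<epsilon>\<^sup>2 * (gsq \<eta>1 x + gsq \<eta>2 x))"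
  proof -
    have "\<bar>LINT x|lborel. E x\<bar> \<le> (LINT x|lborel. \<bar>E x\<bar>)" by (rule integral_abs_bound)
    also have "\<dots> \<le> (LINT x|lborel. 3 * B * \<epsilon>\<^sup>2 * (gsq \<eta>1 x + gsq \<eta>2 x))" by (rule integral_mono) (use iE i Eb in auto)
    finally show ?thesis .
  qed
  moreover have "(LINT x|lborel. 3 * B * \<epsilon>\<^sup>2 * (gsq \<eta>1 x + gsq \<eta>2 x)) = 3 * B * (\<epsilon>\<^sup>2 * ((LINT x|lborel. gsq \<eta>1 x) + (LINT x|lborel. gsq \<eta>2 x)))"
    using i by simp
  ultimately show ?thesis unfolding G_def s_def by (simp only:)
qed

end

section \<open>Barriers\<close>

text \<open>If \<open>c\<close> were negative, \<open>\<phi>'\<close> would be negative just to the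
  right of 0, and \<open>\<phi>\<close> would drop below its minimum.\<close>

lemma second_order_min:
  fixes \<phi> \<phi>' :: "real \<Rightarrow> real"
  assumes d: "0 < d" and \<phi>: "\<And>t. \<bar>t\<bar> < d \<Longrightarrow> (\<phi> has_real_derivative \<phi>' t) (at t)"
    and c: "(\<phi>' has_real_derivative c) (at 0)" and m: "\<And>t. \<bar>t\<bar> < d \<Longrightarrow> \<phi> 0 \<le> \<phi> t"
  shows "\<phi>' 0 = 0" "0 \<le> c"
proof -
  show z: "\<phi>' 0 = 0"
    by (rule DERIV_local_min[OF \<phi>[of 0] d]) (use d m in auto)
  show "0 \<le> c"
  proof (rule ccontr)
    assume "\<not> 0 \<le> c"
    then obtain e where e: "e > 0" "\<And>h. 0 < h \<Longrightarrow> h < e \<Longrightarrow> \<phi>' (0 + h) < \<phi>' 0"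
      using DERIV_neg_dec_right[OF c] by auto
    define t where "t = min d e / 2"
    have t: "0 < t" "t < d" "t < e" using d e by (auto simp: t_def)
    obtain z where zz: "0 < z" "z < t" "\<phi> t - \<phi> 0 = (t - 0) * \<phi>' z"
      using MVT2[OF t(1), of \<phi> \<phi>'] \<phi> t by auto
    have "\<phi>' z < 0" using e(2)[of z] zz t z by simp
    then have "t * \<phi>' z < 0" using t(1) by (simp add: mult_pos_neg)
    then have "\<phi> t < \<phi> 0" using zz(3) by simp
    then show False using m[of t] t by simp
  qed
qed

text \<open>The barrier is given through its restrictions \<open>U i\<close> to the axis lines at
  the touching point, so its derivatives are one-variable ones and \<open>second_order_min\<close>
  applies on each line.\<close>

lemma touch_above:
  assumes \<eta>: "C_k 2 \<eta>" and d: "0 < d"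
    and le: "\<And>i t. \<bar>t\<bar> < d \<Longrightarrow> \<eta> (P + t *\<^sub>R axis i 1) \<le> U i t" and eq: "\<And>i. U i 0 = \<eta> P"
    and U: "\<And>i t. \<bar>t\<bar> < d \<Longrightarrow> (U i has_real_derivative U' i t) (at t)" "\<And>i. (U' i has_real_derivative c i) (at 0)"
  shows "laplacian \<eta> P \<le> (\<Sum>i\<in>UNIV. c i)"
proof -
  have "0 \<le> c i - partial_deriv i (partial_deriv i \<eta>) P" for i
  proof (rule second_order_min(2)[OF d, where \<phi>="\<lambda>t. U i t - \<eta> (P + t *\<^sub>R axis i 1)"
        and \<phi>'="\<lambda>t. U' i t - partial_deriv i \<eta> (P + t *\<^sub>R axis i 1)"])
    show "((\<lambda>t. U i t - \<eta> (P + t *\<^sub>R axis i 1)) has_real_derivative U' i t - partial_deriv i \<eta> (P + t *\<^sub>R axis i 1)) (at t)"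
      if "\<bar>t\<bar> < d" for t
      by (rule DERIV_diff[OF U(1)[OF that] has_axis_deriv_shift[OF C_k_2D(6)[OF \<eta>]]])
    show "((\<lambda>t. U' i t - partial_deriv i \<eta> (P + t *\<^sub>R axis i 1)) has_real_derivative c i - partial_deriv i (partial_deriv i \<eta>) P) (at 0)"
      by (rule DERIV_diff[OF U(2) C_k_2D(7)[OF \<eta>]])
    show "U i 0 - \<eta> (P + 0 *\<^sub>R axis i 1) \<le> U i t - \<eta> (P + t *\<^sub>R axis i 1)" if "\<bar>t\<bar> < d" for t
      using le[OF that, of i] eq[of i] by simp
  qed
  then show ?thesis unfolding laplacian_def by (intro sum_mono) (simp add: diff_ge_0_iff_ge)
qed

lemma touch_below:
  assumes \<eta>: "C_k 2 \<eta>" and d: "0 < d"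
    and le: "\<And>i t. \<bar>t\<bar> < d \<Longrightarrow> U i t \<le> \<eta> (P + t *\<^sub>R axis i 1)" and eq: "\<And>i. U i 0 = \<eta> P"
    and U: "\<And>i t. \<bar>t\<bar> < d \<Longrightarrow> (U i has_real_derivative U' i t) (at t)" "\<And>i. (U' i has_real_derivative c i) (at 0)"
  shows "(\<Sum>i\<in>UNIV. c i) \<le> laplacian \<eta> P"
proof -
  have "0 \<le> partial_deriv i (partial_deriv i \<eta>) P - c i" for i
  proof (rule second_order_min(2)[OF d, where \<phi>="\<lambda>t. \<eta> (P + t *\<^sub>R axis i 1) - U i t"
        and \<phi>'="\<lambda>t. partial_deriv i \<eta> (P + t *\<^sub>R axis i 1) - U' i t"])
    show "((\<lambda>t. \<eta> (P + t *\<^sub>R axis i 1) - U i t) has_real_derivative partial_deriv i \<eta> (P + t *\<^sub>R axis i 1) - U' i t) (at t)"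
      if "\<bar>t\<bar> < d" for t
      by (rule DERIV_diff[OF has_axis_deriv_shift[OF C_k_2D(6)[OF \<eta>]] U(1)[OF that]])
    show "((\<lambda>t. partial_deriv i \<eta> (P + t *\<^sub>R axis i 1) - U' i t) has_real_derivative partial_deriv i (partial_deriv i \<eta>) P - c i) (at 0)"
      by (rule DERIV_diff[OF C_k_2D(7)[OF \<eta>] U(2)])
    show "\<eta> (P + 0 *\<^sub>R axis i 1) - U i 0 \<le> \<eta> (P + t *\<^sub>R axis i 1) - U i t" if "\<bar>t\<bar> < d" for t
      using le[OF that, of i] eq[of i] by simp
  qed
  then show ?thesis unfolding laplacian_def by (intro sum_mono) (simp add: diff_ge_0_iff_ge)
qed

lemma axis_in_ball:
  assumes "\<bar>t\<bar> < \<rho> - dist x0 P"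
  shows "P + t *\<^sub>R axis i (1::real) \<in> ball x0 \<rho>"
proof -
  have "dist x0 (P + t *\<^sub>R axis i (1::real)) \<le> dist x0 P + dist P (P + t *\<^sub>R axis i (1::real))" by (rule dist_triangle)
  also have "dist P (P + t *\<^sub>R axis i (1::real)) = \<bar>t\<bar>" by (simp add: dist_norm)
  finally show ?thesis using assms by simp
qed

text \<open>A paraboloid that is 1 at the centre, positive exactly in the ball and 0 on the sphere;
  the barriers on balls are built from it.\<close>

definition hat :: "real^2 \<Rightarrow> real \<Rightarrow> real^2 \<Rightarrow> real" where
  "hat x0 \<rho> x = 1 - (norm (x - x0))\<^sup>2 / \<rho>\<^sup>2"

lemma hat_axis: "hat x0 \<rho> (P + t *\<^sub>R axis i 1) = 1 - ((norm (P - x0))\<^sup>2 + 2 * t * (P - x0) $ i + t\<^sup>2) / \<rho>\<^sup>2"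
proof -
  have "P + t *\<^sub>R axis i 1 - x0 = (P - x0) + t *\<^sub>R axis i 1" by simp
  then show ?thesis unfolding hat_def by (simp only: norm_square_axis)
qed

lemma hat_pos:
  assumes "0 < \<rho>" shows "0 < hat x0 \<rho> x \<longleftrightarrow> x \<in> ball x0 \<rho>"
proof -
  have "0 < hat x0 \<rho> x \<longleftrightarrow> (norm (x - x0))\<^sup>2 < \<rho>\<^sup>2" using assms by (simp add: hat_def)
  also have "\<dots> \<longleftrightarrow> norm (x - x0) < \<rho>" using assms by (smt (verit) norm_ge_zero power2_less_imp_less power_strict_mono zero_less_numeral)
  finally show ?thesis by (simp add: dist_norm norm_minus_commute)
qed

lemma hat_simps: "hat x0 \<rho> x0 = 1" "hat x0 \<rho> x \<le> 1" "continuous_on S (hat x0 \<rho>)"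
  by (auto simp: hat_def[abs_def] divide_inverse intro!: continuous_intros)

lemma sum_component_square: "(\<Sum>i\<in>UNIV. ((x::real^2) $ i)\<^sup>2) = nsq x"
  by (simp add: norm_vec_def L2_set_def sum_nonneg)

lemma attains_max_on_cball:
  fixes f :: "real^2 \<Rightarrow> real"
  assumes "0 < \<rho>" "continuous_on (cball x0 \<rho>) f"
  obtains P where "P \<in> cball x0 \<rho>" "\<And>x. x \<in> cball x0 \<rho> \<Longrightarrow> f x \<le> f P"
proof -
  have "cball x0 \<rho> \<noteq> {}" using assms(1) by auto
  then show thesis using continuous_attains_sup[OF compact_cball _ assms(2)] that by blast
qed

text \<open>A local Keller--Osserman bound: the barrier \<open>m / hat\<close> blows up on the sphere, so no boundary values enter.\<close>

lemma local_upper_bound: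
  assumes \<eta>: "C_k 2 \<eta>" "\<And>x. 0 < \<eta> x" and pos: "0 < \<rho>" "0 < \<gamma>"
    and sub: "\<And>x. x \<in> ball x0 \<rho> \<Longrightarrow> \<eta> x * (\<gamma> * (\<eta> x)\<^sup>2 - b) \<le> \<epsilon>\<^sup>2 * laplacian \<eta> x"
  shows "\<gamma> * (\<eta> x0)\<^sup>2 \<le> max b 0 + 8 * \<epsilon>\<^sup>2 / \<rho>\<^sup>2"
proof -
  let ?w = "hat x0 \<rho>"
  have c: "continuous_on (cball x0 \<rho>) (\<lambda>x. \<eta> x * ?w x)"
    by (intro continuous_intros hat_simps continuous_on_subset[OF C_k_2D(3)[OF \<eta>(1)]]) auto
  \<comment> \<open>At a maximum point \<open>P\<close> of \<open>\<eta> * hat\<close> the function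
    \<open>m / hat\<close> touches \<open>\<eta>\<close> from above; as \<open>hat\<close> vanishes
    on the sphere, \<open>P\<close> is interior.\<close>
  obtain P where P: "P \<in> cball x0 \<rho>" "\<And>x. x \<in> cball x0 \<rho> \<Longrightarrow> \<eta> x * ?w x \<le> \<eta> P * ?w P"
    using attains_max_on_cball[OF pos(1) c] by blast
  define m where "m = \<eta> P * ?w P"
  have m: "\<eta> x0 \<le> m" using P(2)[of x0] pos by (simp add: m_def hat_simps)
  have m0: "0 < m" using m \<eta>(2)[of x0] by linarith
  then have wP: "0 < ?w P" using \<eta>(2)[of P] by (simp add: m_def zero_less_mult_iff)
  then have Pb: "P \<in> ball x0 \<rho>" using hat_pos pos by blast
  define d where "d = \<rho> - dist x0 P"
  have d: "0 < d" using Pb by (simp add: d_def)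
  define y where "y = P - x0"
  define W where "W i t = 1 - (nsq y + 2 * t * y $ i + t\<^sup>2) / \<rho>\<^sup>2" for i t
  have WP: "W i t = ?w (P + t *\<^sub>R axis i 1)" for i t unfolding W_def y_def hat_axis by simp
  have W0: "W i 0 = ?w P" for i by (simp add: WP)
  have Wpos: "0 < W i t" if "\<bar>t\<bar> < d" for i t
    unfolding WP using axis_in_ball[of t \<rho> x0 P i] that hat_pos[OF pos(1)] by (simp add: d_def)
  have dW: "(W i has_real_derivative - ((2 * y $ i + 2 * t) / \<rho>\<^sup>2)) (at t)" for i t
    unfolding W_def using pos by (auto intro!: derivative_eq_intros simp: power2_eq_square field_simps)
  have "laplacian \<eta> P \<le> (\<Sum>i\<in>UNIV. m * (2 / \<rho>\<^sup>2 / (?w P)\<^sup>2 + 2 * (2 * y $ i / \<rho>\<^sup>2)\<^sup>2 / (?w P) ^ 3))"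
  proof (rule touch_above[OF \<eta>(1) d, where U="\<lambda>i t. m / W i t" and U'="\<lambda>i t. m * ((2 * y $ i + 2 * t) / \<rho>\<^sup>2) / (W i t)\<^sup>2"])
    fix i t assume t: "\<bar>t\<bar> < d"
    have "\<eta> (P + t *\<^sub>R axis i 1) * W i t \<le> m"
      unfolding WP m_def using axis_in_ball[of t \<rho> x0 P i] t by (intro P(2)) (auto simp: d_def less_imp_le)
    then show "\<eta> (P + t *\<^sub>R axis i 1) \<le> m / W i t" using Wpos[OF t, of i] by (simp add: pos_le_divide_eq)
    show "((\<lambda>t. m / W i t) has_real_derivative m * ((2 * y $ i + 2 * t) / \<rho>\<^sup>2) / (W i t)\<^sup>2) (at t)"
      using Wpos[OF t, of i] by (auto intro!: derivative_eq_intros dW simp: power2_eq_square)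
  next
    fix i
    show "m / W i 0 = \<eta> P" unfolding W0 m_def using wP by simp
    define w where "w = ?w P"
    have w: "W i 0 = w" "0 < w" using wP W0 by (auto simp: w_def)
    show "((\<lambda>t. m * ((2 * y $ i + 2 * t) / \<rho>\<^sup>2) / (W i t)\<^sup>2) has_real_derivative
        m * (2 / \<rho>\<^sup>2 / (?w P)\<^sup>2 + 2 * (2 * y $ i / \<rho>\<^sup>2)\<^sup>2 / (?w P) ^ 3)) (at 0)"
      unfolding w_def[symmetric]
      by (rule derivative_eq_intros dW refl | use w pos in force)+
        (use w pos in \<open>simp add: field_simps power2_eq_square power3_eq_cube\<close>)
  qed
  also have "(\<Sum>i\<in>UNIV. m * (2 / \<rho>\<^sup>2 / (?w P)\<^sup>2 + 2 * (2 * y $ i / \<rho>\<^sup>2)\<^sup>2 / (?w P) ^ 3))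
    = \<eta> P * ((4 * ?w P + 8 * (1 - ?w P)) / (\<rho>\<^sup>2 * (?w P)\<^sup>2))"
  proof -
    define w where "w = ?w P"
    have w: "0 < w" "nsq y = \<rho>\<^sup>2 * (1 - w)" using wP pos by (auto simp: w_def hat_def y_def)
    have "(\<Sum>i\<in>UNIV. m * (2 / \<rho>\<^sup>2 / w\<^sup>2 + 2 * (2 * y $ i / \<rho>\<^sup>2)\<^sup>2 / w ^ 3))
      = (\<Sum>i\<in>(UNIV::2 set). m * (2 / \<rho>\<^sup>2 / w\<^sup>2)) + (m * (8 / \<rho>\<^sup>2 / \<rho>\<^sup>2 / w ^ 3)) * (\<Sum>i\<in>UNIV. (y $ i)\<^sup>2)"
      unfolding sum_distrib_left sum.distrib[symmetric]
      by (intro sum.cong refl) (simp add: power_divide power_mult_distrib power2_eq_square algebra_simps)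
    also have "\<dots> = m * (4 / \<rho>\<^sup>2 / w\<^sup>2) + (m * (8 / \<rho>\<^sup>2 / \<rho>\<^sup>2 / w ^ 3)) * (\<rho>\<^sup>2 * (1 - w))"
      unfolding sum_component_square w(2) by simp
    also have "\<dots> = \<eta> P * ((4 * w + 8 * (1 - w)) / (\<rho>\<^sup>2 * w\<^sup>2))"
      unfolding m_def w_def[symmetric] using w(1) pos by (simp add: field_simps power2_eq_square power3_eq_cube)
    finally show ?thesis unfolding w_def .
  qed
  also have "\<dots> \<le> \<eta> P * (8 / (\<rho>\<^sup>2 * (?w P)\<^sup>2))"
    using \<eta>(2)[of P] wP pos by (intro mult_left_mono divide_right_mono) auto
  finally have "\<epsilon>\<^sup>2 * laplacian \<eta> P \<le> \<epsilon>\<^sup>2 * (\<eta> P * (8 / (\<rho>\<^sup>2 * (?w P)\<^sup>2)))" by (rule mult_left_mono) simp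
  then have "\<eta> P * (\<gamma> * (\<eta> P)\<^sup>2 - b) \<le> \<eta> P * (\<epsilon>\<^sup>2 * (8 / (\<rho>\<^sup>2 * (?w P)\<^sup>2)))" using sub[OF Pb] by (simp add: mult_ac)
  then have 1: "\<gamma> * (\<eta> P)\<^sup>2 - b \<le> \<epsilon>\<^sup>2 * (8 / (\<rho>\<^sup>2 * (?w P)\<^sup>2))" using \<eta>(2)[of P] by (simp only: mult_le_cancel_left_pos)
  \<comment> \<open>Multiplying by the square of \<open>hat\<close> turns the bound at
    \<open>P\<close> into one for \<open>m\<close>, which dominates the value at the centre.\<close>
  have w2: "0 < (?w P)\<^sup>2" "(?w P)\<^sup>2 \<le> 1" using wP hat_simps(2)[of x0 \<rho> P] by (auto simp: power_le_one)
  have "\<gamma> * m\<^sup>2 - b * (?w P)\<^sup>2 = (\<gamma> * (\<eta> P)\<^sup>2 - b) * (?w P)\<^sup>2" by (simp add: m_def power_mult_distrib algebra_simps)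
  also have "\<dots> \<le> (\<epsilon>\<^sup>2 * (8 / (\<rho>\<^sup>2 * (?w P)\<^sup>2))) * (?w P)\<^sup>2" using 1 w2 by (intro mult_right_mono) auto
  also have "\<dots> = 8 * \<epsilon>\<^sup>2 / \<rho>\<^sup>2" using w2 by simp
  finally have 2: "\<gamma> * m\<^sup>2 \<le> b * (?w P)\<^sup>2 + 8 * \<epsilon>\<^sup>2 / \<rho>\<^sup>2" by linarith
  have "b * (?w P)\<^sup>2 \<le> max b 0 * (?w P)\<^sup>2" using w2 by (intro mult_right_mono) auto
  also have "\<dots> \<le> max b 0 * 1" using w2 by (intro mult_left_mono) auto
  finally have 3: "b * (?w P)\<^sup>2 \<le> max b 0" by simp
  have "\<gamma> * (\<eta> x0)\<^sup>2 \<le> \<gamma> * m\<^sup>2" using m \<eta>(2)[of x0] pos by (intro mult_left_mono power_mono) auto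
  then show ?thesis using 2 3 by linarith
qed

text \<open>The barrier from below is the square of \<open>hat\<close> over \<open>v\<close>; it
  vanishes on the sphere, so again no boundary values enter. The square matters:
  \<open>1 - 2 * w \<ge> - w\<^sup>2\<close> bounds its Laplacian from below by
  \<open>- 8 / \<rho>\<^sup>2\<close> times the barrier itself, and at the touching point the common
  factor \<open>\<eta>\<close> can be divided out.\<close>

lemma local_lower_bound:
  assumes \<eta>: "C_k 2 \<eta>" "\<And>x. 0 < \<eta> x" and pos: "0 < \<rho>" "0 < \<gamma>"
    and sup: "\<And>x. x \<in> ball x0 \<rho> \<Longrightarrow> \<epsilon>\<^sup>2 * laplacian \<eta> x \<le> \<eta> x * (\<gamma> * (\<eta> x)\<^sup>2 - b)"
  shows "b - 8 * \<epsilon>\<^sup>2 / \<rho>\<^sup>2 \<le> \<gamma> * (\<eta> x0)\<^sup>2"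
proof -
  let ?w = "hat x0 \<rho>"
  have ne: "\<eta> x \<noteq> 0" for x using \<eta>(2)[of x] by simp
  have c: "continuous_on (cball x0 \<rho>) (\<lambda>x. (max 0 (?w x))\<^sup>2 / \<eta> x)"
    by (intro continuous_intros hat_simps continuous_on_subset[OF C_k_2D(3)[OF \<eta>(1)]]) (auto simp: ne)
  obtain P where P: "P \<in> cball x0 \<rho>" "\<And>x. x \<in> cball x0 \<rho> \<Longrightarrow> (max 0 (?w x))\<^sup>2 / \<eta> x \<le> (max 0 (?w P))\<^sup>2 / \<eta> P"
    using attains_max_on_cball[OF pos(1) c] by blast
  define v where "v = (max 0 (?w P))\<^sup>2 / \<eta> P"
  have v: "1 / \<eta> x0 \<le> v" using P(2)[of x0] pos by (simp add: v_def hat_simps)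
  moreover have "0 < 1 / \<eta> x0" using \<eta>(2) by simp
  ultimately have v0: "0 < v" by linarith
  have wP: "0 < ?w P"
  proof (rule ccontr)
    assume "\<not> 0 < ?w P"
    then have "max 0 (?w P) = 0" by simp
    then show False using v0 by (simp add: v_def)
  qed
  then have Pb: "P \<in> ball x0 \<rho>" using hat_pos pos by blast
  have v_eq: "v = (?w P)\<^sup>2 / \<eta> P" using wP by (simp add: v_def)
  then have "v * \<eta> P = (?w P)\<^sup>2" using ne by simp
  then have \<eta>P: "\<eta> P = (?w P)\<^sup>2 / v" using v0 by (simp add: eq_divide_eq mult.commute)
  define d where "d = \<rho> - dist x0 P"
  have d: "0 < d" using Pb by (simp add: d_def)
  define y where "y = P - x0"
  define W where "W i t = 1 - (nsq y + 2 * t * y $ i + t\<^sup>2) / \<rho>\<^sup>2" for i t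
  have WP: "W i t = ?w (P + t *\<^sub>R axis i 1)" for i t unfolding W_def y_def hat_axis by simp
  have W0: "W i 0 = ?w P" for i by (simp add: WP)
  have Wpos: "0 < W i t" if "\<bar>t\<bar> < d" for i t
    unfolding WP using axis_in_ball[of t \<rho> x0 P i] that hat_pos[OF pos(1)] by (simp add: d_def)
  have dW: "(W i has_real_derivative - ((2 * y $ i + 2 * t) / \<rho>\<^sup>2)) (at t)" for i t
    unfolding W_def using pos by (auto intro!: derivative_eq_intros simp: power2_eq_square field_simps)
  have "(\<Sum>i\<in>UNIV. (2 * (2 * y $ i / \<rho>\<^sup>2)\<^sup>2 - 4 * ?w P / \<rho>\<^sup>2) / v) \<le> laplacian \<eta> P"
  proof (rule touch_below[OF \<eta>(1) d, where U="\<lambda>i t. (W i t)\<^sup>2 / v" and U'="\<lambda>i t. 2 * W i t * (- ((2 * y $ i + 2 * t) / \<rho>\<^sup>2)) / v"])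
    fix i t assume t: "\<bar>t\<bar> < d"
    have "(max 0 (W i t))\<^sup>2 / \<eta> (P + t *\<^sub>R axis i 1) \<le> v"
      unfolding WP v_def using axis_in_ball[of t \<rho> x0 P i] t by (intro P(2)) (auto simp: d_def less_imp_le)
    then show "(W i t)\<^sup>2 / v \<le> \<eta> (P + t *\<^sub>R axis i 1)"
      using Wpos[OF t, of i] v0 \<eta>(2)[of "P + t *\<^sub>R axis i 1"] by (simp add: pos_divide_le_eq mult.commute)
    show "((\<lambda>t. (W i t)\<^sup>2 / v) has_real_derivative 2 * W i t * (- ((2 * y $ i + 2 * t) / \<rho>\<^sup>2)) / v) (at t)"
      using v0 by (auto intro!: derivative_eq_intros dW)
  next
    fix i
    show "(W i 0)\<^sup>2 / v = \<eta> P" unfolding W0 \<eta>P by simp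
    define w where "w = ?w P"
    have w: "W i 0 = w" using W0 by (auto simp: w_def)
    show "((\<lambda>t. 2 * W i t * (- ((2 * y $ i + 2 * t) / \<rho>\<^sup>2)) / v) has_real_derivative (2 * (2 * y $ i / \<rho>\<^sup>2)\<^sup>2 - 4 * ?w P / \<rho>\<^sup>2) / v) (at 0)"
      unfolding w_def[symmetric]
      by (rule derivative_eq_intros dW refl | use pos v0 in force)+
        (use w pos v0 in \<open>simp add: field_simps power2_eq_square\<close>)
  qed
  moreover have "(\<Sum>i\<in>UNIV. (2 * (2 * y $ i / \<rho>\<^sup>2)\<^sup>2 - 4 * ?w P / \<rho>\<^sup>2) / v) = (8 * (1 - 2 * ?w P)) / (\<rho>\<^sup>2 * v)"
  proof -
    define w where "w = ?w P"
    have w: "nsq y = \<rho>\<^sup>2 * (1 - w)" using pos by (auto simp: w_def hat_def y_def)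
    have "(\<Sum>i\<in>UNIV. (2 * (2 * y $ i / \<rho>\<^sup>2)\<^sup>2 - 4 * w / \<rho>\<^sup>2) / v)
      = (8 / \<rho>\<^sup>2 / \<rho>\<^sup>2 / v) * (\<Sum>i\<in>UNIV. (y $ i)\<^sup>2) - (\<Sum>i\<in>(UNIV::2 set). 4 * w / \<rho>\<^sup>2 / v)"
      unfolding sum_distrib_left sum_subtractf[symmetric]
      by (intro sum.cong refl) (simp add: power_divide power_mult_distrib power2_eq_square diff_divide_distrib)
    also have "\<dots> = (8 / \<rho>\<^sup>2 / \<rho>\<^sup>2 / v) * (\<rho>\<^sup>2 * (1 - w)) - 8 * w / \<rho>\<^sup>2 / v"
      unfolding sum_component_square w by simp
    also have "\<dots> = (8 * (1 - 2 * w)) / (\<rho>\<^sup>2 * v)"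
      using pos v0 by (simp add: field_simps)
    finally show ?thesis unfolding w_def .
  qed
  moreover have "- (8 / \<rho>\<^sup>2) * \<eta> P \<le> (8 * (1 - 2 * ?w P)) / (\<rho>\<^sup>2 * v)"
  proof -
    have "- (?w P)\<^sup>2 \<le> 1 - 2 * ?w P" using zero_le_power2[of "1 - ?w P"] by (simp add: power2_diff)
    then have "8 * (- (?w P)\<^sup>2) / (\<rho>\<^sup>2 * v) \<le> 8 * (1 - 2 * ?w P) / (\<rho>\<^sup>2 * v)"
      using v0 by (intro divide_right_mono mult_left_mono) auto
    then show ?thesis unfolding \<eta>P by simp
  qed
  ultimately have "- (8 / \<rho>\<^sup>2) * \<eta> P \<le> laplacian \<eta> P" by linarith
  then have "\<epsilon>\<^sup>2 * (- (8 / \<rho>\<^sup>2) * \<eta> P) \<le> \<epsilon>\<^sup>2 * laplacian \<eta> P" by (rule mult_left_mono) simp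
  then have "\<eta> P * (- (8 * \<epsilon>\<^sup>2 / \<rho>\<^sup>2)) \<le> \<eta> P * (\<gamma> * (\<eta> P)\<^sup>2 - b)" using sup[OF Pb] by (simp add: mult_ac)
  then have "- (8 * \<epsilon>\<^sup>2 / \<rho>\<^sup>2) \<le> \<gamma> * (\<eta> P)\<^sup>2 - b" using \<eta>(2)[of P] by (simp only: mult_le_cancel_left_pos)
  moreover have "\<gamma> * (\<eta> P)\<^sup>2 \<le> \<gamma> * (\<eta> x0)\<^sup>2"
  proof -
    have "(?w P)\<^sup>2 \<le> 1" using wP hat_simps(2)[of x0 \<rho> P] by (auto simp: power_le_one)
    then have "\<eta> P \<le> 1 / v" unfolding \<eta>P using v0 by (intro divide_right_mono) auto
    also have "1 / v \<le> \<eta> x0" using v v0 \<eta>(2)[of x0] by (simp add: pos_divide_le_eq mult.commute)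
    finally show ?thesis using \<eta>(2)[of P] pos by (intro mult_left_mono power_mono) auto
  qed
  ultimately show ?thesis by linarith
qed

text \<open>Comparison with \<open>m * |x - x0|\<^sup>2 / \<rho>\<^sup>2\<close>, which is
  \<open>m\<close> on the sphere, 0 at the centre, and has Laplacian
  \<open>4 * m / \<rho>\<^sup>2\<close>. A positive excess over it has an interior maximum, where
  \<open>k * \<eta>\<close> is at most \<open>\<epsilon>\<^sup>2\<close> times this
  Laplacian.\<close>

lemma local_decay:
  assumes \<eta>: "C_k 2 \<eta>" and pos: "0 < \<rho>" "0 < k"
    and sub: "\<And>x. x \<in> ball x0 \<rho> \<Longrightarrow> k * \<eta> x \<le> \<epsilon>\<^sup>2 * laplacian \<eta> x"
    and m: "\<And>x. x \<in> cball x0 \<rho> \<Longrightarrow> \<eta> x \<le> m" "0 \<le> m"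
  shows "\<eta> x0 \<le> 4 * \<epsilon>\<^sup>2 / (k * \<rho>\<^sup>2) * m"
proof (rule ccontr)
  assume n: "\<not> ?thesis"
  have r0: "0 \<le> 4 * \<epsilon>\<^sup>2 / (k * \<rho>\<^sup>2) * m" using pos m by simp
  let ?\<psi> = "\<lambda>x. m * (1 - hat x0 \<rho> x)"
  have c: "continuous_on (cball x0 \<rho>) (\<lambda>x. \<eta> x - ?\<psi> x)"
    by (intro continuous_intros hat_simps continuous_on_subset[OF C_k_2D(3)[OF \<eta>]]) auto
  obtain P where P: "P \<in> cball x0 \<rho>" "\<And>x. x \<in> cball x0 \<rho> \<Longrightarrow> \<eta> x - ?\<psi> x \<le> \<eta> P - ?\<psi> P"
    using attains_max_on_cball[OF pos(1) c] by blast
  define M where "M = \<eta> P - ?\<psi> P"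
  have M: "\<eta> x0 \<le> M" using P(2)[of x0] pos by (simp add: M_def hat_simps)
  then have M0: "0 < M" using n r0 by linarith
  have Pb: "P \<in> ball x0 \<rho>"
  proof (rule ccontr)
    assume "P \<notin> ball x0 \<rho>"
    then have "hat x0 \<rho> P \<le> 0" using hat_pos[OF pos(1)] by (meson not_le)
    then have "m * 1 \<le> ?\<psi> P" using m(2) by (intro mult_left_mono) auto
    then show False using m(1)[OF P(1)] M0 by (simp add: M_def)
  qed
  define d where "d = \<rho> - dist x0 P"
  have d: "0 < d" using Pb by (simp add: d_def)
  define y where "y = P - x0"
  define U where "U i t = M + m * ((nsq y + 2 * t * y $ i + t\<^sup>2) / \<rho>\<^sup>2)" for i t
  have UP: "U i t = M + ?\<psi> (P + t *\<^sub>R axis i 1)" for i t unfolding U_def y_def hat_axis by simp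
  have "laplacian \<eta> P \<le> (\<Sum>i\<in>(UNIV::2 set). m * 2 / \<rho>\<^sup>2)"
  proof (rule touch_above[OF \<eta> d, where U=U and U'="\<lambda>i t. m * ((2 * y $ i + 2 * t) / \<rho>\<^sup>2)"])
    fix i t assume t: "\<bar>t\<bar> < d"
    show "\<eta> (P + t *\<^sub>R axis i 1) \<le> U i t"
      unfolding UP M_def using P(2)[of "P + t *\<^sub>R axis i 1"] axis_in_ball[of t \<rho> x0 P i] t by (auto simp: d_def less_imp_le)
  next
    show "U i 0 = \<eta> P" for i unfolding UP by (simp add: M_def)
    show "(U i has_real_derivative m * ((2 * y $ i + 2 * t) / \<rho>\<^sup>2)) (at t)" for i t
      unfolding U_def using pos by (auto intro!: derivative_eq_intros simp: field_simps power2_eq_square)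
    show "((\<lambda>t. m * ((2 * y $ i + 2 * t) / \<rho>\<^sup>2)) has_real_derivative m * 2 / \<rho>\<^sup>2) (at 0)" for i
      using pos by (auto intro!: derivative_eq_intros simp: field_simps)
  qed
  also have "\<dots> = 4 * m / \<rho>\<^sup>2" by simp
  finally have "\<epsilon>\<^sup>2 * laplacian \<eta> P \<le> \<epsilon>\<^sup>2 * (4 * m / \<rho>\<^sup>2)" by (rule mult_left_mono) simp
  then have "k * \<eta> P \<le> \<epsilon>\<^sup>2 * (4 * m / \<rho>\<^sup>2)" using sub[OF Pb] by linarith
  then have "\<eta> P \<le> 4 * \<epsilon>\<^sup>2 / (k * \<rho>\<^sup>2) * m" using pos by (simp add: field_simps)
  moreover have "M \<le> \<eta> P" unfolding M_def using m(2) hat_simps(2)[of x0 \<rho> P] by simp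
  ultimately show False using n M by linarith
qed

text \<open>The part \<open>\<alpha> + \<beta> * |x|\<^sup>2\<close> carries a branch of the
  profile, which is affine in \<open>|x|\<^sup>2\<close>; the part centred at \<open>x0\<close> is
  the barrier. Comparing \<open>\<eta>\<^sup>2\<close> instead of \<open>\<eta>\<close> with it
  keeps the comparison function a polynomial.\<close>

definition quad :: "real \<Rightarrow> real \<Rightarrow> real \<Rightarrow> real^2 \<Rightarrow> real^2 \<Rightarrow> real" where
  "quad \<alpha> \<beta> k x0 x = \<alpha> + \<beta> * nsq x + k * (norm (x - x0))\<^sup>2"

lemma quad_axis:
  "quad \<alpha> \<beta> k x0 (P + t *\<^sub>R axis i 1) = \<alpha> + \<beta> * (nsq P + 2 * t * P $ i + t\<^sup>2) + k * ((norm (P - x0))\<^sup>2 + 2 * t * (P - x0) $ i + t\<^sup>2)"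
proof -
  have "P + t *\<^sub>R axis i 1 - x0 = (P - x0) + t *\<^sub>R axis i 1" by simp
  then show ?thesis unfolding quad_def by (simp only: norm_square_axis)
qed

text \<open>At a touching point of \<open>\<eta>\<^sup>2\<close> with a quadratic from below, the gradient of \<open>\<eta>\<close> is that of the quadratic, hence
  bounded; this controls the term \<open>\<bar>\<nabla>\<eta>\<bar>\<^sup>2\<close> that separates the Laplacian of \<open>\<eta>\<^sup>2\<close> from \<open>2 \<eta> \<Delta>\<eta>\<close>.\<close>

lemma square_touch:
  assumes \<eta>: "C_k 2 \<eta>" "\<And>x. 0 < \<eta> x" and P: "P \<in> ball x0 \<rho>"
  shows "(\<And>x. x \<in> ball x0 \<rho> \<Longrightarrow> (\<eta> x)\<^sup>2 - quad \<alpha> \<beta> k x0 x \<le> (\<eta> P)\<^sup>2 - quad \<alpha> \<beta> k x0 P) \<Longrightarrow>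
      2 * \<eta> P * laplacian \<eta> P \<le> 4 * \<beta> + 4 * k"
    and "(\<And>x. x \<in> ball x0 \<rho> \<Longrightarrow> (\<eta> P)\<^sup>2 - quad \<alpha> \<beta> k x0 P \<le> (\<eta> x)\<^sup>2 - quad \<alpha> \<beta> k x0 x) \<Longrightarrow>
      4 * \<beta> + 4 * k - (2 * \<bar>\<beta>\<bar> * norm P + 2 * \<bar>k\<bar> * norm (P - x0))\<^sup>2 / (2 * (\<eta> P)\<^sup>2) \<le> 2 * \<eta> P * laplacian \<eta> P"
proof -
  define d where "d = \<rho> - dist x0 P"
  have d: "0 < d" using P by (simp add: d_def)
  have inb: "P + t *\<^sub>R axis i 1 \<in> ball x0 \<rho>" if "\<bar>t\<bar> < d" for i t using axis_in_ball[of t \<rho> x0 P i] that by (simp add: d_def)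
  define p h where "p i = partial_deriv i \<eta> P" and "h i = partial_deriv i (partial_deriv i \<eta>) P" for i
  define q where "q i = 2 * \<beta> * P $ i + 2 * k * (P - x0) $ i" for i
  define N where "N i t = (\<eta> (P + t *\<^sub>R axis i 1))\<^sup>2" for i t
  define N' where "N' i t = 2 * (\<eta> (P + t *\<^sub>R axis i 1) * partial_deriv i \<eta> (P + t *\<^sub>R axis i 1))" for i t
  have dN: "(N i has_real_derivative N' i t) (at t)" for i t
    using DERIV_power[OF has_axis_deriv_shift[where f=\<eta> and f'="partial_deriv i \<eta>" and i=i and x=P and t=t, OF C_k_2D(6)[OF \<eta>(1)]], of 2]
    unfolding N_def[abs_def] N'_def by (simp add: mult_ac)
  have dN': "(N' i has_real_derivative 2 * (p i)\<^sup>2 + 2 * \<eta> P * h i) (at 0)" for i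
    unfolding N'_def[abs_def]
    by (rule DERIV_cong[OF DERIV_cmult[OF DERIV_mult[OF C_k_2D(6)[OF \<eta>(1), where i=i and x=P] C_k_2D(7)[OF \<eta>(1), where i=i and j=i and x=P]]]])
      (simp add: p_def h_def power2_eq_square algebra_simps)
  define U where "U i t = \<alpha> + \<beta> * (nsq P + 2 * t * P $ i + t\<^sup>2) + k * ((norm (P - x0))\<^sup>2 + 2 * t * (P - x0) $ i + t\<^sup>2)" for i t
  define U' where "U' i t = q i + (2 * \<beta> + 2 * k) * t" for i t
  have UP: "U i t = quad \<alpha> \<beta> k x0 (P + t *\<^sub>R axis i 1)" for i t unfolding quad_axis U_def by simp
  have dU: "(U i has_real_derivative U' i t) (at t)" for i t
    unfolding U_def U'_def q_def by (auto intro!: derivative_eq_intros simp: algebra_simps)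
  have dU': "(U' i has_real_derivative 2 * \<beta> + 2 * k) (at 0)" for i
    unfolding U'_def by (auto intro!: derivative_eq_intros)
  have N0: "N' i 0 = 2 * \<eta> P * p i" "U' i 0 = q i" for i by (simp_all add: N'_def p_def U'_def)
  have lap: "laplacian \<eta> P = h 1 + h 2" by (simp add: laplacian_def sum_2 h_def)
  show "2 * \<eta> P * laplacian \<eta> P \<le> 4 * \<beta> + 4 * k"
    if max: "\<And>x. x \<in> ball x0 \<rho> \<Longrightarrow> (\<eta> x)\<^sup>2 - quad \<alpha> \<beta> k x0 x \<le> (\<eta> P)\<^sup>2 - quad \<alpha> \<beta> k x0 P"
  proof -
    have "0 \<le> (2 * \<beta> + 2 * k) - (2 * (p i)\<^sup>2 + 2 * \<eta> P * h i)" for i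
    proof (rule second_order_min(2)[OF d DERIV_diff[OF dU dN] DERIV_diff[OF dU' dN']])
      show "U i 0 - N i 0 \<le> U i t - N i t" if "\<bar>t\<bar> < d" for t
        using max[OF inb[OF that, of i]] unfolding UP N_def by simp
    qed
    then have "2 * \<eta> P * h i \<le> 2 * \<beta> + 2 * k" for i using zero_le_power2[of "p i"] by (smt (verit))
    from this[of 1] this[of 2] show ?thesis unfolding lap by (simp add: distrib_left)
  qed
  show "4 * \<beta> + 4 * k - (2 * \<bar>\<beta>\<bar> * norm P + 2 * \<bar>k\<bar> * norm (P - x0))\<^sup>2 / (2 * (\<eta> P)\<^sup>2) \<le> 2 * \<eta> P * laplacian \<eta> P"
    if min: "\<And>x. x \<in> ball x0 \<rho> \<Longrightarrow> (\<eta> P)\<^sup>2 - quad \<alpha> \<beta> k x0 P \<le> (\<eta> x)\<^sup>2 - quad \<alpha> \<beta> k x0 x"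
  proof -
    have m: "N i 0 - U i 0 \<le> N i t - U i t" if "\<bar>t\<bar> < d" for i t
      using min[OF inb[OF that, of i]] unfolding UP N_def by simp
    have g: "2 * \<eta> P * p i = q i" for i
      using second_order_min(1)[OF d DERIV_diff[OF dN dU] DERIV_diff[OF dN' dU'] m, of i] N0[of i] by simp
    have l: "0 \<le> (2 * (p i)\<^sup>2 + 2 * \<eta> P * h i) - (2 * \<beta> + 2 * k)" for i
      by (rule second_order_min(2)[OF d DERIV_diff[OF dN dU] DERIV_diff[OF dN' dU'] m])
    have pq: "(p i)\<^sup>2 = (q i)\<^sup>2 / (4 * (\<eta> P)\<^sup>2)" for i
      unfolding g[symmetric] using \<eta>(2)[of P] by (simp add: power_mult_distrib)
    define z where "z = (2 * \<beta>) *\<^sub>R P + (2 * k) *\<^sub>R (P - x0)"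
    have "(q 1)\<^sup>2 + (q 2)\<^sup>2 = nsq z" by (simp add: sum_component_square[symmetric] sum_2 z_def q_def)
    also have "norm z \<le> norm ((2 * \<beta>) *\<^sub>R P) + norm ((2 * k) *\<^sub>R (P - x0))" unfolding z_def by (rule norm_triangle_ineq)
    then have "nsq z \<le> (2 * \<bar>\<beta>\<bar> * norm P + 2 * \<bar>k\<bar> * norm (P - x0))\<^sup>2"
      by (intro power_mono) (auto simp: abs_mult)
    finally have q2: "(q 1)\<^sup>2 + (q 2)\<^sup>2 \<le> (2 * \<bar>\<beta>\<bar> * norm P + 2 * \<bar>k\<bar> * norm (P - x0))\<^sup>2" .
    have "2 * (p 1)\<^sup>2 + 2 * (p 2)\<^sup>2 = ((q 1)\<^sup>2 + (q 2)\<^sup>2) / (2 * (\<eta> P)\<^sup>2)"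
      unfolding pq using \<eta>(2)[of P] by (simp add: field_simps)
    also have "\<dots> \<le> (2 * \<bar>\<beta>\<bar> * norm P + 2 * \<bar>k\<bar> * norm (P - x0))\<^sup>2 / (2 * (\<eta> P)\<^sup>2)" using q2 by (rule divide_right_mono) simp
    finally show ?thesis using l[of 1] l[of 2] unfolding lap by (simp add: distrib_left)
  qed
qed

text \<open>Bound for \<open>2 * \<eta> * laplacian \<eta>\<close> at a touching point as in
  \<open>square_touch\<close>, when \<open>norm P \<le> R\<close>, the distance to the centre is at
  most \<open>\<rho>\<close> and \<open>\<eta>\<^sup>2 \<ge> c\<close>, divided by
  \<open>2 * c\<close>.\<close>

definition touch_const :: "real \<Rightarrow> real \<Rightarrow> real \<Rightarrow> real \<Rightarrow> real \<Rightarrow> real" where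
  "touch_const b k R \<rho> c = (4 * b + 4 * k + (2 * b * R + 2 * k * \<rho>)\<^sup>2 / (2 * c)) / (2 * c)"

lemma touch_const_mono:
  assumes "0 \<le> b" "b \<le> b'" "0 \<le> k" "k \<le> k'" "0 \<le> R" "0 \<le> \<rho>" "0 < c"
  shows "touch_const b k R \<rho> c \<le> touch_const b' k' R \<rho> c" "0 \<le> touch_const b k R \<rho> c"
proof -
  define X X' where "X = 2 * b * R + 2 * k * \<rho>" and "X' = 2 * b' * R + 2 * k' * \<rho>"
  have 1: "b * R \<le> b' * R" "k * \<rho> \<le> k' * \<rho>" using assms by (auto intro: mult_right_mono)
  have 0: "0 \<le> b * R" "0 \<le> k * \<rho>" using assms by auto
  have X: "0 \<le> X" "X \<le> X'" using 0 1 unfolding X_def X'_def by auto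
  have sq: "X\<^sup>2 \<le> X'\<^sup>2" using X(2,1) by (rule power_mono)
  have c2: "0 \<le> 2 * c" using assms(7) by simp
  have "X\<^sup>2 / (2 * c) \<le> X'\<^sup>2 / (2 * c)" using sq c2 by (rule divide_right_mono)
  then have "4 * b + 4 * k + X\<^sup>2 / (2 * c) \<le> 4 * b' + 4 * k' + X'\<^sup>2 / (2 * c)"
    using assms(2,4) by (intro add_mono) auto
  then show "touch_const b k R \<rho> c \<le> touch_const b' k' R \<rho> c"
    unfolding touch_const_def X_def[symmetric] X'_def[symmetric] using c2 by (rule divide_right_mono)
  have "0 \<le> X\<^sup>2 / (2 * c)" using c2 by (intro divide_nonneg_nonneg) auto
  then have "0 \<le> 4 * b + 4 * k + X\<^sup>2 / (2 * c)" using assms(1,3) by (intro add_nonneg_nonneg) auto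
  then show "0 \<le> touch_const b k R \<rho> c"
    unfolding touch_const_def X_def[symmetric] using c2 by (rule divide_nonneg_nonneg)
qed

text \<open>At an interior positive maximum \<open>2 * \<eta>\<^sup>2 * h = 2 * \<epsilon>\<^sup>2 *
  \<eta> * laplacian \<eta>\<close> is bounded above by O(\<epsilon>^2), and the lower bound
  \<open>c\<close> on \<open>\<eta>\<^sup>2\<close> carries this over to the reaction term
  \<open>h\<close>. What this means for the errors is left open, since for coupled components
  \<open>h\<close> involves both of them.\<close>

lemma interior_step_max:
  assumes \<eta>: "C_k 2 \<eta>" "\<And>x. 0 < \<eta> x" and pos: "0 < \<rho>" "0 < c" "0 \<le> k" "0 \<le> R"
    and n: "\<And>x. x \<in> ball x0 \<rho> \<Longrightarrow> c \<le> (\<eta> x)\<^sup>2"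
    and eq: "\<And>x. x \<in> ball x0 \<rho> \<Longrightarrow> \<epsilon>\<^sup>2 * laplacian \<eta> x = \<eta> x * h x"
    and bd: "\<And>x. x \<in> cball x0 \<rho> \<Longrightarrow> x \<notin> ball x0 \<rho> \<Longrightarrow> (\<eta> x)\<^sup>2 - quad \<alpha> \<beta> k x0 x \<le> 0"
  shows "(\<forall>x\<in>cball x0 \<rho>. (\<eta> x)\<^sup>2 - quad \<alpha> \<beta> k x0 x \<le> 0) \<or>
    (\<exists>P\<in>ball x0 \<rho>. (\<forall>x\<in>cball x0 \<rho>. (\<eta> x)\<^sup>2 - quad \<alpha> \<beta> k x0 x \<le> (\<eta> P)\<^sup>2 - quad \<alpha> \<beta> k x0 P) \<and>
       0 < (\<eta> P)\<^sup>2 - quad \<alpha> \<beta> k x0 P \<and> h P \<le> \<epsilon>\<^sup>2 * touch_const \<bar>\<beta>\<bar> k R \<rho> c)"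
proof -
  let ?f = "\<lambda>x. (\<eta> x)\<^sup>2 - quad \<alpha> \<beta> k x0 x"
  have c: "continuous_on (cball x0 \<rho>) ?f"
    unfolding quad_def by (intro continuous_intros continuous_on_subset[OF C_k_2D(3)[OF \<eta>(1)]]) auto
  obtain P where P: "P \<in> cball x0 \<rho>" "\<And>x. x \<in> cball x0 \<rho> \<Longrightarrow> ?f x \<le> ?f P"
    using attains_max_on_cball[OF pos(1) c] by blast
  show ?thesis
  proof (cases "?f P \<le> 0")
    case True
    then show ?thesis using P(2) by (meson order_trans)
  next
    case False
    then have Pb: "P \<in> ball x0 \<rho>" using bd[OF P(1)] by blast
    have le: "2 * \<eta> P * laplacian \<eta> P \<le> 4 * \<beta> + 4 * k"
      by (rule square_touch(1)[OF \<eta> Pb, where \<alpha>=\<alpha> and \<beta>=\<beta> and k=k]) (use P(2) in auto)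
    have "\<epsilon>\<^sup>2 * (2 * \<eta> P * laplacian \<eta> P) \<le> \<epsilon>\<^sup>2 * (4 * \<bar>\<beta>\<bar> + 4 * k + (2 * \<bar>\<beta>\<bar> * R + 2 * k * \<rho>)\<^sup>2 / (2 * c))"
    proof (rule mult_left_mono)
      have "0 \<le> (2 * \<bar>\<beta>\<bar> * R + 2 * k * \<rho>)\<^sup>2 / (2 * c)" using pos by simp
      then show "2 * \<eta> P * laplacian \<eta> P \<le> 4 * \<bar>\<beta>\<bar> + 4 * k + (2 * \<bar>\<beta>\<bar> * R + 2 * k * \<rho>)\<^sup>2 / (2 * c)"
        using le abs_ge_self[of \<beta>] by linarith
    qed simp
    moreover have "\<epsilon>\<^sup>2 * (2 * \<eta> P * laplacian \<eta> P) = 2 * (\<eta> P)\<^sup>2 * h P"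
      using eq[OF Pb] by (simp add: power2_eq_square)
    moreover have "\<epsilon>\<^sup>2 * (4 * \<bar>\<beta>\<bar> + 4 * k + (2 * \<bar>\<beta>\<bar> * R + 2 * k * \<rho>)\<^sup>2 / (2 * c)) = (2 * c) * (\<epsilon>\<^sup>2 * touch_const \<bar>\<beta>\<bar> k R \<rho> c)"
      using pos by (simp add: touch_const_def)
    ultimately have 1: "2 * (\<eta> P)\<^sup>2 * h P \<le> (2 * c) * (\<epsilon>\<^sup>2 * touch_const \<bar>\<beta>\<bar> k R \<rho> c)" by linarith
    have "h P \<le> \<epsilon>\<^sup>2 * touch_const \<bar>\<beta>\<bar> k R \<rho> c"
    proof (rule ccontr)
      assume "\<not> ?thesis"
      moreover have t0: "0 \<le> \<epsilon>\<^sup>2 * touch_const \<bar>\<beta>\<bar> k R \<rho> c" using touch_const_mono(2)[of "\<bar>\<beta>\<bar>" "\<bar>\<beta>\<bar>" k k R \<rho> c] pos by simp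
      ultimately have "(2 * c) * (\<epsilon>\<^sup>2 * touch_const \<bar>\<beta>\<bar> k R \<rho> c) < (2 * c) * h P" "0 \<le> h P" using pos by auto
      moreover have "(2 * c) * h P \<le> 2 * (\<eta> P)\<^sup>2 * h P" using n[OF Pb] \<open>0 \<le> h P\<close> by (intro mult_right_mono) auto
      ultimately show False using 1 by linarith
    qed
    then show ?thesis using Pb P(2) False by (intro disjI2 bexI[of _ P]) auto
  qed
qed

text \<open>The mirror image for minima. Here the squared gradient works against the bound and is
  controlled through \<open>R\<close> and \<open>c\<close>.\<close>

lemma interior_step_min:
  assumes \<eta>: "C_k 2 \<eta>" "\<And>x. 0 < \<eta> x" and pos: "0 < \<rho>" "0 < c" "0 \<le> k" "0 \<le> R"
    and n: "\<And>x. x \<in> ball x0 \<rho> \<Longrightarrow> c \<le> (\<eta> x)\<^sup>2" and R: "\<And>x. x \<in> ball x0 \<rho> \<Longrightarrow> norm x \<le> R"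
    and eq: "\<And>x. x \<in> ball x0 \<rho> \<Longrightarrow> \<epsilon>\<^sup>2 * laplacian \<eta> x = \<eta> x * h x"
    and bd: "\<And>x. x \<in> cball x0 \<rho> \<Longrightarrow> x \<notin> ball x0 \<rho> \<Longrightarrow> 0 \<le> (\<eta> x)\<^sup>2 - quad \<alpha> \<beta> (- k) x0 x"
  shows "(\<forall>x\<in>cball x0 \<rho>. 0 \<le> (\<eta> x)\<^sup>2 - quad \<alpha> \<beta> (- k) x0 x) \<or>
    (\<exists>P\<in>ball x0 \<rho>. (\<forall>x\<in>cball x0 \<rho>. (\<eta> P)\<^sup>2 - quad \<alpha> \<beta> (- k) x0 P \<le> (\<eta> x)\<^sup>2 - quad \<alpha> \<beta> (- k) x0 x) \<and>
       (\<eta> P)\<^sup>2 - quad \<alpha> \<beta> (- k) x0 P < 0 \<and> - (\<epsilon>\<^sup>2 * touch_const \<bar>\<beta>\<bar> k R \<rho> c) \<le> h P)"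
proof -
  let ?f = "\<lambda>x. quad \<alpha> \<beta> (- k) x0 x - (\<eta> x)\<^sup>2"
  have c: "continuous_on (cball x0 \<rho>) ?f"
    unfolding quad_def by (intro continuous_intros continuous_on_subset[OF C_k_2D(3)[OF \<eta>(1)]]) auto
  obtain P where P: "P \<in> cball x0 \<rho>" "\<And>x. x \<in> cball x0 \<rho> \<Longrightarrow> ?f x \<le> ?f P"
    using attains_max_on_cball[OF pos(1) c] by blast
  show ?thesis
  proof (cases "?f P \<le> 0")
    case True
    have "0 \<le> (\<eta> x)\<^sup>2 - quad \<alpha> \<beta> (- k) x0 x" if "x \<in> cball x0 \<rho>" for x using P(2)[OF that] True by linarith
    then show ?thesis by blast
  next
    case False
    then have Pb: "P \<in> ball x0 \<rho>" using bd[OF P(1)] by linarith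
    have 0: "4 * \<beta> + 4 * (- k) - (2 * \<bar>\<beta>\<bar> * norm P + 2 * \<bar>- k\<bar> * norm (P - x0))\<^sup>2 / (2 * (\<eta> P)\<^sup>2) \<le> 2 * \<eta> P * laplacian \<eta> P"
    proof (rule square_touch(2)[OF \<eta> Pb, where \<alpha>=\<alpha> and \<beta>=\<beta> and k="- k"])
      show "(\<eta> P)\<^sup>2 - quad \<alpha> \<beta> (- k) x0 P \<le> (\<eta> x)\<^sup>2 - quad \<alpha> \<beta> (- k) x0 x" if "x \<in> ball x0 \<rho>" for x
        using P(2)[of x] that by auto
    qed
    have "norm (P - x0) \<le> \<rho>" using Pb by (simp add: dist_norm norm_minus_commute)
    then have "(2 * \<bar>\<beta>\<bar> * norm P + 2 * \<bar>- k\<bar> * norm (P - x0))\<^sup>2 \<le> (2 * \<bar>\<beta>\<bar> * R + 2 * k * \<rho>)\<^sup>2"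
      using pos R[OF Pb] by (intro power_mono add_mono) (auto intro: mult_left_mono)
    then have "(2 * \<bar>\<beta>\<bar> * norm P + 2 * \<bar>- k\<bar> * norm (P - x0))\<^sup>2 / (2 * (\<eta> P)\<^sup>2) \<le> (2 * \<bar>\<beta>\<bar> * R + 2 * k * \<rho>)\<^sup>2 / (2 * c)"
      using n[OF Pb] pos by (intro frac_le) auto
    with 0 have "- (4 * \<bar>\<beta>\<bar> + 4 * k + (2 * \<bar>\<beta>\<bar> * R + 2 * k * \<rho>)\<^sup>2 / (2 * c)) \<le> 2 * \<eta> P * laplacian \<eta> P" by linarith
    then have "\<epsilon>\<^sup>2 * - (4 * \<bar>\<beta>\<bar> + 4 * k + (2 * \<bar>\<beta>\<bar> * R + 2 * k * \<rho>)\<^sup>2 / (2 * c)) \<le> \<epsilon>\<^sup>2 * (2 * \<eta> P * laplacian \<eta> P)"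
      by (rule mult_left_mono) simp
    moreover have "\<epsilon>\<^sup>2 * (2 * \<eta> P * laplacian \<eta> P) = 2 * (\<eta> P)\<^sup>2 * h P"
      using eq[OF Pb] by (simp add: power2_eq_square)
    moreover have "\<epsilon>\<^sup>2 * - (4 * \<bar>\<beta>\<bar> + 4 * k + (2 * \<bar>\<beta>\<bar> * R + 2 * k * \<rho>)\<^sup>2 / (2 * c)) = - ((2 * c) * (\<epsilon>\<^sup>2 * touch_const \<bar>\<beta>\<bar> k R \<rho> c))"
    proof -
      have "4 * \<bar>\<beta>\<bar> + 4 * k + (2 * \<bar>\<beta>\<bar> * R + 2 * k * \<rho>)\<^sup>2 / (2 * c) = (2 * c) * touch_const \<bar>\<beta>\<bar> k R \<rho> c"
        using pos by (simp add: touch_const_def)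
      then show ?thesis by (simp only: mult_minus_right mult.left_commute)
    qed
    ultimately have 1: "- ((2 * c) * (\<epsilon>\<^sup>2 * touch_const \<bar>\<beta>\<bar> k R \<rho> c)) \<le> 2 * (\<eta> P)\<^sup>2 * h P" by linarith
    have "- (\<epsilon>\<^sup>2 * touch_const \<bar>\<beta>\<bar> k R \<rho> c) \<le> h P"
    proof (rule ccontr)
      assume "\<not> ?thesis"
      moreover have t0: "0 \<le> \<epsilon>\<^sup>2 * touch_const \<bar>\<beta>\<bar> k R \<rho> c" using touch_const_mono(2)[of "\<bar>\<beta>\<bar>" "\<bar>\<beta>\<bar>" k k R \<rho> c] pos by simp
      ultimately have h: "\<epsilon>\<^sup>2 * touch_const \<bar>\<beta>\<bar> k R \<rho> c < - h P" "0 \<le> - h P" by auto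
      have "(2 * c) * (\<epsilon>\<^sup>2 * touch_const \<bar>\<beta>\<bar> k R \<rho> c) < (2 * c) * (- h P)" using h pos by (intro mult_strict_left_mono) auto
      moreover have "(2 * c) * (- h P) \<le> 2 * (\<eta> P)\<^sup>2 * (- h P)" using n[OF Pb] h by (intro mult_right_mono) auto
      ultimately show False using 1 by simp
    qed
    moreover have "(\<eta> P)\<^sup>2 - quad \<alpha> \<beta> (- k) x0 P \<le> (\<eta> x)\<^sup>2 - quad \<alpha> \<beta> (- k) x0 x" if "x \<in> cball x0 \<rho>" for x
      using P(2)[OF that] by linarith
    moreover have "(\<eta> P)\<^sup>2 - quad \<alpha> \<beta> (- k) x0 P < 0" using False by linarith
    ultimately show ?thesis using Pb by blast
  qed
qed

lemma quad_scaled: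
  assumes "0 < \<rho>"
  shows "quad \<alpha> \<beta> (\<sigma> / \<rho>\<^sup>2) x0 x = \<alpha> + \<beta> * nsq x + \<sigma> * (1 - hat x0 \<rho> x)"
    "x \<in> cball x0 \<rho> \<Longrightarrow> x \<notin> ball x0 \<rho> \<Longrightarrow> 1 - hat x0 \<rho> x = 1" "0 \<le> 1 - hat x0 \<rho> x" "1 - hat x0 \<rho> x0 = 0"
proof -
  show "quad \<alpha> \<beta> (\<sigma> / \<rho>\<^sup>2) x0 x = \<alpha> + \<beta> * nsq x + \<sigma> * (1 - hat x0 \<rho> x)" by (simp add: quad_def hat_def)
  show "1 - hat x0 \<rho> x = 1" if "x \<in> cball x0 \<rho>" "x \<notin> ball x0 \<rho>"
  proof -
    have "norm (x - x0) = \<rho>" using that by (simp add: dist_norm norm_minus_commute)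
    then show ?thesis using assms by (simp add: hat_def)
  qed
  show "0 \<le> 1 - hat x0 \<rho> x" "1 - hat x0 \<rho> x0 = 0" using hat_simps by auto
qed

text \<open>Where the other component enters only through a small \<open>q\<close>, the reaction
  term is the deviation \<open>D\<close> itself up to \<open>q\<close>. A barrier of height 1 beats
  the a priori bound on the sphere, and a fixed radius \<open>\<rho>\<close> leaves an error of
  order \<epsilon>^2 instead of \<epsilon>^(2/3).\<close>

lemma interior_single:
  assumes \<eta>: "C_k 2 \<eta>" "\<And>x. 0 < \<eta> x" and pos: "0 < \<rho>" "0 < \<gamma>" "0 < c" "0 \<le> R" "0 \<le> \<kappa>"
    and n: "\<And>x. x \<in> cball x0 \<rho> \<Longrightarrow> c \<le> (\<eta> x)\<^sup>2" and R: "\<And>x. x \<in> cball x0 \<rho> \<Longrightarrow> norm x \<le> R"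
    and eq: "\<And>x. x \<in> cball x0 \<rho> \<Longrightarrow> \<epsilon>\<^sup>2 * laplacian \<eta> x = \<eta> x * (\<gamma> * (\<eta> x)\<^sup>2 + nsq x - lam + q x)"
    and q: "\<And>x. x \<in> cball x0 \<rho> \<Longrightarrow> \<bar>q x\<bar> \<le> \<kappa>"
    and \<sigma>: "\<And>x. x \<in> cball x0 \<rho> \<Longrightarrow> \<bar>\<gamma> * (\<eta> x)\<^sup>2 + nsq x - lam\<bar> \<le> 1"
  shows "\<bar>\<gamma> * (\<eta> x0)\<^sup>2 + nsq x0 - lam\<bar> \<le> \<kappa> + \<epsilon>\<^sup>2 * touch_const (1 / \<gamma>) (1 / \<gamma> / \<rho>\<^sup>2) R \<rho> c"
proof -
  define D where "D x = \<gamma> * (\<eta> x)\<^sup>2 + nsq x - lam" for x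
  let ?K = "touch_const (1 / \<gamma>) (1 / \<gamma> / \<rho>\<^sup>2) R \<rho> c"
  have K0: "0 \<le> \<epsilon>\<^sup>2 * ?K" using touch_const_mono(2)[of "1 / \<gamma>" "1 / \<gamma>" "1 / \<gamma> / \<rho>\<^sup>2" "1 / \<gamma> / \<rho>\<^sup>2" R \<rho> c] pos by simp
  have b: "\<bar>- (1 / \<gamma>)\<bar> = 1 / \<gamma>" using pos by simp
  have fp: "\<gamma> * ((\<eta> x)\<^sup>2 - quad (lam / \<gamma>) (- (1 / \<gamma>)) (1 / \<gamma> / \<rho>\<^sup>2) x0 x) = D x - (1 - hat x0 \<rho> x)" for x
    unfolding quad_scaled(1)[OF pos(1)] D_def using pos by (simp add: field_simps)
  have fm: "\<gamma> * ((\<eta> x)\<^sup>2 - quad (lam / \<gamma>) (- (1 / \<gamma>)) (- (1 / \<gamma> / \<rho>\<^sup>2)) x0 x) = D x + (1 - hat x0 \<rho> x)" for x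
  proof -
    have m: "- (1 / \<gamma> / \<rho>\<^sup>2) = - (1 / \<gamma>) / \<rho>\<^sup>2" by simp
    show ?thesis unfolding m quad_scaled(1)[OF pos(1)] D_def using pos by (simp add: field_simps)
  qed
  have sg: "0 \<le> y \<longleftrightarrow> 0 \<le> \<gamma> * y" "y \<le> 0 \<longleftrightarrow> \<gamma> * y \<le> 0" "y \<le> z \<longleftrightarrow> \<gamma> * y \<le> \<gamma> * z" for y z
    using pos by (auto simp: zero_le_mult_iff mult_le_0_iff)
  have max_step: "y \<le> \<kappa> + K" if "z + u \<le> K" "y - w \<le> z - v" "0 \<le> v" "w = 0" "\<bar>u\<bar> \<le> \<kappa>"
    for y z u v w K :: real using that by linarith
  have up: "D x0 \<le> \<kappa> + \<epsilon>\<^sup>2 * ?K"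
  proof -
    have k: "0 \<le> 1 / \<gamma> / \<rho>\<^sup>2" using pos by simp
    have "(\<forall>x\<in>cball x0 \<rho>. (\<eta> x)\<^sup>2 - quad (lam / \<gamma>) (- (1 / \<gamma>)) (1 / \<gamma> / \<rho>\<^sup>2) x0 x \<le> 0) \<or>
     (\<exists>P\<in>ball x0 \<rho>. (\<forall>x\<in>cball x0 \<rho>. (\<eta> x)\<^sup>2 - quad (lam / \<gamma>) (- (1 / \<gamma>)) (1 / \<gamma> / \<rho>\<^sup>2) x0 x \<le> (\<eta> P)\<^sup>2 - quad (lam / \<gamma>) (- (1 / \<gamma>)) (1 / \<gamma> / \<rho>\<^sup>2) x0 P) \<and>
       0 < (\<eta> P)\<^sup>2 - quad (lam / \<gamma>) (- (1 / \<gamma>)) (1 / \<gamma> / \<rho>\<^sup>2) x0 P \<and> D P + q P \<le> \<epsilon>\<^sup>2 * touch_const \<bar>- (1 / \<gamma>)\<bar> (1 / \<gamma> / \<rho>\<^sup>2) R \<rho> c)"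
    proof (rule interior_step_max[OF \<eta> pos(1,3) k pos(4)])
      fix x assume x: "x \<in> cball x0 \<rho>" "x \<notin> ball x0 \<rho>"
      show "(\<eta> x)\<^sup>2 - quad (lam / \<gamma>) (- (1 / \<gamma>)) (1 / \<gamma> / \<rho>\<^sup>2) x0 x \<le> 0"
        using sg(2)[THEN iffD2, of "(\<eta> x)\<^sup>2 - quad (lam / \<gamma>) (- (1 / \<gamma>)) (1 / \<gamma> / \<rho>\<^sup>2) x0 x"] \<sigma>[OF x(1)]
        unfolding fp quad_scaled(2)[OF pos(1) x] by (simp add: D_def)
    qed (use n eq in \<open>auto simp: D_def\<close>)
    then show ?thesis
    proof (elim disjE bexE conjE)
      assume "\<forall>x\<in>cball x0 \<rho>. (\<eta> x)\<^sup>2 - quad (lam / \<gamma>) (- (1 / \<gamma>)) (1 / \<gamma> / \<rho>\<^sup>2) x0 x \<le> 0"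
      then have "(\<eta> x0)\<^sup>2 - quad (lam / \<gamma>) (- (1 / \<gamma>)) (1 / \<gamma> / \<rho>\<^sup>2) x0 x0 \<le> 0" using pos by simp
      then have "D x0 - (1 - hat x0 \<rho> x0) \<le> 0" unfolding fp[symmetric] by (rule sg(2)[THEN iffD1])
      then show ?thesis using quad_scaled(4)[OF pos(1)] K0 pos by simp
    next
      fix P assume P: "P \<in> ball x0 \<rho>" "\<forall>x\<in>cball x0 \<rho>. (\<eta> x)\<^sup>2 - quad (lam / \<gamma>) (- (1 / \<gamma>)) (1 / \<gamma> / \<rho>\<^sup>2) x0 x \<le> (\<eta> P)\<^sup>2 - quad (lam / \<gamma>) (- (1 / \<gamma>)) (1 / \<gamma> / \<rho>\<^sup>2) x0 P"
        "D P + q P \<le> \<epsilon>\<^sup>2 * touch_const \<bar>- (1 / \<gamma>)\<bar> (1 / \<gamma> / \<rho>\<^sup>2) R \<rho> c"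
      have "(\<eta> x0)\<^sup>2 - quad (lam / \<gamma>) (- (1 / \<gamma>)) (1 / \<gamma> / \<rho>\<^sup>2) x0 x0 \<le> (\<eta> P)\<^sup>2 - quad (lam / \<gamma>) (- (1 / \<gamma>)) (1 / \<gamma> / \<rho>\<^sup>2) x0 P"
        using P(2) pos by simp
      then have "D x0 - (1 - hat x0 \<rho> x0) \<le> D P - (1 - hat x0 \<rho> P)" unfolding fp[symmetric] by (rule sg(3)[THEN iffD1])
      moreover have "\<bar>q P\<bar> \<le> \<kappa>" using q P(1) by simp
      ultimately show ?thesis
        using max_step[OF P(3)[unfolded b] _ quad_scaled(3)[OF pos(1), of x0 P] quad_scaled(4)[OF pos(1), of x0]] by blast
    qed
  qed
  have min_step: "- (\<kappa> + K) \<le> y" if "- K \<le> z + u" "z + v \<le> y + w" "0 \<le> v" "w = 0" "\<bar>u\<bar> \<le> \<kappa>"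
    for y z u v w K :: real using that by linarith
  have lo: "- (\<kappa> + \<epsilon>\<^sup>2 * ?K) \<le> D x0"
  proof -
    have k: "0 \<le> 1 / \<gamma> / \<rho>\<^sup>2" using pos by simp
    have "(\<forall>x\<in>cball x0 \<rho>. 0 \<le> (\<eta> x)\<^sup>2 - quad (lam / \<gamma>) (- (1 / \<gamma>)) (- (1 / \<gamma> / \<rho>\<^sup>2)) x0 x) \<or>
     (\<exists>P\<in>ball x0 \<rho>. (\<forall>x\<in>cball x0 \<rho>. (\<eta> P)\<^sup>2 - quad (lam / \<gamma>) (- (1 / \<gamma>)) (- (1 / \<gamma> / \<rho>\<^sup>2)) x0 P \<le> (\<eta> x)\<^sup>2 - quad (lam / \<gamma>) (- (1 / \<gamma>)) (- (1 / \<gamma> / \<rho>\<^sup>2)) x0 x) \<and>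
       (\<eta> P)\<^sup>2 - quad (lam / \<gamma>) (- (1 / \<gamma>)) (- (1 / \<gamma> / \<rho>\<^sup>2)) x0 P < 0 \<and> - (\<epsilon>\<^sup>2 * touch_const \<bar>- (1 / \<gamma>)\<bar> (1 / \<gamma> / \<rho>\<^sup>2) R \<rho> c) \<le> D P + q P)"
    proof (rule interior_step_min[OF \<eta> pos(1,3) k pos(4)])
      fix x assume x: "x \<in> cball x0 \<rho>" "x \<notin> ball x0 \<rho>"
      show "0 \<le> (\<eta> x)\<^sup>2 - quad (lam / \<gamma>) (- (1 / \<gamma>)) (- (1 / \<gamma> / \<rho>\<^sup>2)) x0 x"
        using sg(1)[THEN iffD2, of "(\<eta> x)\<^sup>2 - quad (lam / \<gamma>) (- (1 / \<gamma>)) (- (1 / \<gamma> / \<rho>\<^sup>2)) x0 x"] \<sigma>[OF x(1)]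
        unfolding fm quad_scaled(2)[OF pos(1) x] by (simp add: D_def)
    qed (use n eq R in \<open>auto simp: D_def\<close>)
    then show ?thesis
    proof (elim disjE bexE conjE)
      assume "\<forall>x\<in>cball x0 \<rho>. 0 \<le> (\<eta> x)\<^sup>2 - quad (lam / \<gamma>) (- (1 / \<gamma>)) (- (1 / \<gamma> / \<rho>\<^sup>2)) x0 x"
      then have "0 \<le> (\<eta> x0)\<^sup>2 - quad (lam / \<gamma>) (- (1 / \<gamma>)) (- (1 / \<gamma> / \<rho>\<^sup>2)) x0 x0" using pos by simp
      then have "0 \<le> D x0 + (1 - hat x0 \<rho> x0)" unfolding fm[symmetric] by (rule sg(1)[THEN iffD1])
      then show ?thesis using quad_scaled(4)[OF pos(1)] K0 pos by simp
    next
      fix P assume P: "P \<in> ball x0 \<rho>" "\<forall>x\<in>cball x0 \<rho>. (\<eta> P)\<^sup>2 - quad (lam / \<gamma>) (- (1 / \<gamma>)) (- (1 / \<gamma> / \<rho>\<^sup>2)) x0 P \<le> (\<eta> x)\<^sup>2 - quad (lam / \<gamma>) (- (1 / \<gamma>)) (- (1 / \<gamma> / \<rho>\<^sup>2)) x0 x"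
        "- (\<epsilon>\<^sup>2 * touch_const \<bar>- (1 / \<gamma>)\<bar> (1 / \<gamma> / \<rho>\<^sup>2) R \<rho> c) \<le> D P + q P"
      have "(\<eta> P)\<^sup>2 - quad (lam / \<gamma>) (- (1 / \<gamma>)) (- (1 / \<gamma> / \<rho>\<^sup>2)) x0 P \<le> (\<eta> x0)\<^sup>2 - quad (lam / \<gamma>) (- (1 / \<gamma>)) (- (1 / \<gamma> / \<rho>\<^sup>2)) x0 x0"
        using P(2) pos by simp
      then have "D P + (1 - hat x0 \<rho> P) \<le> D x0 + (1 - hat x0 \<rho> x0)" unfolding fm[symmetric] by (rule sg(3)[THEN iffD1])
      moreover have "\<bar>q P\<bar> \<le> \<kappa>" using q P(1) by simp
      ultimately show ?thesis
        using min_step[OF P(3)[unfolded b] _ quad_scaled(3)[OF pos(1), of x0 P] quad_scaled(4)[OF pos(1), of x0]] by blast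
    qed
  qed
  show ?thesis using up lo unfolding D_def by linarith
qed

text \<open>In the region of coexistence the system is competitive, and at touching points the deviations
  \<open>S\<close> of \<open>\<eta>1\<^sup>2\<close> from above and \<open>T\<close> of \<open>\<eta>2\<^sup>2\<close> from below satisfy \<open>\<gamma>1 S \<le> g T + E\<close> and \<open>\<gamma>2 T \<le> g S + E\<close>;
  the condition \<open>g\<^sup>2 < \<gamma>1 \<gamma>2\<close> closes the loop.\<close>

lemma contraction_pair:
  fixes \<gamma>1 \<gamma>2 g S T E :: real
  assumes "0 < \<gamma>1" "0 < \<gamma>2" "0 < g" "g\<^sup>2 < \<gamma>1 * \<gamma>2" "\<gamma>1 * S \<le> g * T + E" "\<gamma>2 * T \<le> g * S + E"
  shows "S \<le> (\<gamma>2 + g) * E / (\<gamma>1 * \<gamma>2 - g\<^sup>2)" "T \<le> (\<gamma>1 + g) * E / (\<gamma>1 * \<gamma>2 - g\<^sup>2)"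
proof -
  have "\<gamma>2 * (\<gamma>1 * S) \<le> \<gamma>2 * (g * T + E)" "g * (\<gamma>2 * T) \<le> g * (g * S + E)"
    using assms by (auto intro!: mult_left_mono)
  then have "(\<gamma>1 * \<gamma>2 - g\<^sup>2) * S \<le> (\<gamma>2 + g) * E" by (simp add: algebra_simps power2_eq_square)
  then show "S \<le> (\<gamma>2 + g) * E / (\<gamma>1 * \<gamma>2 - g\<^sup>2)" using assms(4) by (simp add: pos_le_divide_eq mult.commute)
  have "\<gamma>1 * (\<gamma>2 * T) \<le> \<gamma>1 * (g * S + E)" "g * (\<gamma>1 * S) \<le> g * (g * T + E)"
    using assms by (auto intro!: mult_left_mono)
  then have "(\<gamma>1 * \<gamma>2 - g\<^sup>2) * T \<le> (\<gamma>1 + g) * E" by (simp add: algebra_simps power2_eq_square)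
  then show "T \<le> (\<gamma>1 + g) * E / (\<gamma>1 * \<gamma>2 - g\<^sup>2)" using assms(4) by (simp add: pos_le_divide_eq mult.commute)
qed

text \<open>The heights \<open>\<alpha>1\<close>, \<open>\<alpha>2\<close> are at least 1 to beat
  the a priori bounds on the sphere. They are tied by
  \<open>g * \<alpha>2 \<le> \<gamma>1 * \<alpha>1\<close> and
  \<open>g * \<alpha>1 \<le> \<gamma>2 * \<alpha>2\<close>, so that at either touching point the
  paraboloid terms of the two barriers combine with a sign that allows them to be dropped; such
  heights exist since \<open>g\<^sup>2 < \<gamma>1 * \<gamma>2\<close>.\<close>

lemma interior_pair:
  assumes \<eta>1: "C_k 2 \<eta>1" "\<And>x. 0 < \<eta>1 x" and \<eta>2: "C_k 2 \<eta>2" "\<And>x. 0 < \<eta>2 x"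
    and pos: "0 < \<rho>" "0 < c" "0 \<le> R" and \<gamma>: "0 < \<gamma>1" "0 < \<gamma>2" "0 < g" "g\<^sup>2 < \<gamma>1 * \<gamma>2"
    and al: "1 \<le> \<alpha>1" "1 \<le> \<alpha>2" "g * \<alpha>2 \<le> \<gamma>1 * \<alpha>1" "g * \<alpha>1 \<le> \<gamma>2 * \<alpha>2" "\<alpha>1 \<le> A" "\<alpha>2 \<le> A"
    and n: "\<And>x. x \<in> cball x0 \<rho> \<Longrightarrow> c \<le> (\<eta>1 x)\<^sup>2" "\<And>x. x \<in> cball x0 \<rho> \<Longrightarrow> c \<le> (\<eta>2 x)\<^sup>2"
    and R: "\<And>x. x \<in> cball x0 \<rho> \<Longrightarrow> norm x \<le> R"
    and D: "\<And>x. D1 x = (\<eta>1 x)\<^sup>2 - (p1 + b1 * nsq x)" "\<And>x. D2 x = (\<eta>2 x)\<^sup>2 - (p2 + b2 * nsq x)"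
    and b: "\<bar>b1\<bar> \<le> b" "\<bar>b2\<bar> \<le> b"
    and eq1: "\<And>x. x \<in> cball x0 \<rho> \<Longrightarrow> \<epsilon>\<^sup>2 * laplacian \<eta>1 x = \<eta>1 x * (\<gamma>1 * D1 x + g * D2 x - \<delta>1)"
    and eq2: "\<And>x. x \<in> cball x0 \<rho> \<Longrightarrow> \<epsilon>\<^sup>2 * laplacian \<eta>2 x = \<eta>2 x * (\<gamma>2 * D2 x + g * D1 x - \<delta>2)"
    and \<sigma>: "\<And>x. x \<in> cball x0 \<rho> \<Longrightarrow> \<bar>D1 x\<bar> \<le> 1" "\<And>x. x \<in> cball x0 \<rho> \<Longrightarrow> \<bar>D2 x\<bar> \<le> 1"
    and E: "E = \<bar>\<delta>1\<bar> + \<bar>\<delta>2\<bar> + \<epsilon>\<^sup>2 * touch_const b (A / \<rho>\<^sup>2) R \<rho> c"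
  shows "D1 x0 \<le> (\<gamma>2 + g) * E / (\<gamma>1 * \<gamma>2 - g\<^sup>2)" "- D2 x0 \<le> (\<gamma>1 + g) * E / (\<gamma>1 * \<gamma>2 - g\<^sup>2)"
proof -
  let ?\<psi> = "\<lambda>x. 1 - hat x0 \<rho> x"
  let ?f1 = "\<lambda>x. (\<eta>1 x)\<^sup>2 - quad p1 b1 (\<alpha>1 / \<rho>\<^sup>2) x0 x"
  let ?f2 = "\<lambda>x. (\<eta>2 x)\<^sup>2 - quad p2 b2 (- (\<alpha>2 / \<rho>\<^sup>2)) x0 x"
  have f1: "?f1 x = D1 x - \<alpha>1 * ?\<psi> x" for x unfolding quad_scaled(1)[OF pos(1)] D by simp
  have f2: "?f2 x = D2 x + \<alpha>2 * ?\<psi> x" for x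
    using quad_scaled(1)[OF pos(1), of p2 b2 "- \<alpha>2" x0 x] by (simp add: D)
  note \<psi> = quad_scaled(2)[OF pos(1)] quad_scaled(3)[OF pos(1), of x0] quad_scaled(4)[OF pos(1), of x0]
  have k: "0 \<le> \<alpha>1 / \<rho>\<^sup>2" "0 \<le> \<alpha>2 / \<rho>\<^sup>2" "\<alpha>1 / \<rho>\<^sup>2 \<le> A / \<rho>\<^sup>2" "\<alpha>2 / \<rho>\<^sup>2 \<le> A / \<rho>\<^sup>2"
    using al by (auto intro!: divide_right_mono)
  have tc: "touch_const \<bar>b1\<bar> (\<alpha>1 / \<rho>\<^sup>2) R \<rho> c \<le> touch_const b (A / \<rho>\<^sup>2) R \<rho> c"
    "touch_const \<bar>b2\<bar> (\<alpha>2 / \<rho>\<^sup>2) R \<rho> c \<le> touch_const b (A / \<rho>\<^sup>2) R \<rho> c"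
    using touch_const_mono(1)[of _ b _ "A / \<rho>\<^sup>2" R \<rho> c] b k pos by auto
  have tE: "\<epsilon>\<^sup>2 * touch_const \<bar>b1\<bar> (\<alpha>1 / \<rho>\<^sup>2) R \<rho> c + \<bar>\<delta>1\<bar> \<le> E" "\<epsilon>\<^sup>2 * touch_const \<bar>b2\<bar> (\<alpha>2 / \<rho>\<^sup>2) R \<rho> c + \<bar>\<delta>2\<bar> \<le> E"
    unfolding E using mult_left_mono[OF tc(1), of "\<epsilon>\<^sup>2"] mult_left_mono[OF tc(2), of "\<epsilon>\<^sup>2"] by auto
  have "0 \<le> touch_const b (A / \<rho>\<^sup>2) R \<rho> c"
    using touch_const_mono(2)[of b b "A / \<rho>\<^sup>2" "A / \<rho>\<^sup>2" R \<rho> c] b(1) k pos by simp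
  then have E0: "0 \<le> E" unfolding E by simp
  obtain S where S: "0 \<le> S" "\<And>x. x \<in> cball x0 \<rho> \<Longrightarrow> D1 x - \<alpha>1 * ?\<psi> x \<le> S"
    "S = 0 \<or> (\<exists>P\<in>ball x0 \<rho>. D1 P - \<alpha>1 * ?\<psi> P = S \<and> \<gamma>1 * D1 P + g * D2 P - \<delta>1 \<le> \<epsilon>\<^sup>2 * touch_const \<bar>b1\<bar> (\<alpha>1 / \<rho>\<^sup>2) R \<rho> c)"
  proof -
    have bd: "?f1 x \<le> 0" if x: "x \<in> cball x0 \<rho>" "x \<notin> ball x0 \<rho>" for x
      unfolding f1 \<psi>(1)[OF x] using \<sigma>(1)[OF x(1)] al(1) by linarith
    have "(\<forall>x\<in>cball x0 \<rho>. ?f1 x \<le> 0) \<or> (\<exists>P\<in>ball x0 \<rho>. (\<forall>x\<in>cball x0 \<rho>. ?f1 x \<le> ?f1 P) \<and> 0 < ?f1 P \<and>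
        \<gamma>1 * D1 P + g * D2 P - \<delta>1 \<le> \<epsilon>\<^sup>2 * touch_const \<bar>b1\<bar> (\<alpha>1 / \<rho>\<^sup>2) R \<rho> c)"
      by (rule interior_step_max[OF \<eta>1 pos(1,2) k(1) pos(3) _ _ bd]) (use n(1) eq1 in auto)
    then show thesis
    proof (elim disjE bexE conjE)
      assume a: "\<forall>x\<in>cball x0 \<rho>. ?f1 x \<le> 0"
      show thesis by (rule that[of 0]) (use a in \<open>auto simp: f1\<close>)
    next
      fix P assume P: "P \<in> ball x0 \<rho>" "\<forall>x\<in>cball x0 \<rho>. ?f1 x \<le> ?f1 P" "0 < ?f1 P"
        "\<gamma>1 * D1 P + g * D2 P - \<delta>1 \<le> \<epsilon>\<^sup>2 * touch_const \<bar>b1\<bar> (\<alpha>1 / \<rho>\<^sup>2) R \<rho> c"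
      show thesis by (rule that[of "?f1 P"]) (use P in \<open>auto simp: f1\<close>)
    qed
  qed
  obtain T where T: "0 \<le> T" "\<And>x. x \<in> cball x0 \<rho> \<Longrightarrow> - T \<le> D2 x + \<alpha>2 * ?\<psi> x"
    "T = 0 \<or> (\<exists>P\<in>ball x0 \<rho>. D2 P + \<alpha>2 * ?\<psi> P = - T \<and> - (\<epsilon>\<^sup>2 * touch_const \<bar>b2\<bar> (\<alpha>2 / \<rho>\<^sup>2) R \<rho> c) \<le> \<gamma>2 * D2 P + g * D1 P - \<delta>2)"
  proof -
    have bd: "0 \<le> ?f2 x" if x: "x \<in> cball x0 \<rho>" "x \<notin> ball x0 \<rho>" for x
      unfolding f2 \<psi>(1)[OF x] using \<sigma>(2)[OF x(1)] al(2) by linarith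
    have "(\<forall>x\<in>cball x0 \<rho>. 0 \<le> ?f2 x) \<or> (\<exists>P\<in>ball x0 \<rho>. (\<forall>x\<in>cball x0 \<rho>. ?f2 P \<le> ?f2 x) \<and> ?f2 P < 0 \<and>
        - (\<epsilon>\<^sup>2 * touch_const \<bar>b2\<bar> (\<alpha>2 / \<rho>\<^sup>2) R \<rho> c) \<le> \<gamma>2 * D2 P + g * D1 P - \<delta>2)"
      by (rule interior_step_min[OF \<eta>2 pos(1,2) k(2) pos(3) _ _ _ bd]) (use n(2) eq2 R in auto)
    then show thesis
    proof (elim disjE bexE conjE)
      assume a: "\<forall>x\<in>cball x0 \<rho>. 0 \<le> ?f2 x"
      show thesis by (rule that[of 0]) (use a in \<open>auto simp: f2\<close>)
    next
      fix P assume P: "P \<in> ball x0 \<rho>" "\<forall>x\<in>cball x0 \<rho>. ?f2 P \<le> ?f2 x" "?f2 P < 0"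
        "- (\<epsilon>\<^sup>2 * touch_const \<bar>b2\<bar> (\<alpha>2 / \<rho>\<^sup>2) R \<rho> c) \<le> \<gamma>2 * D2 P + g * D1 P - \<delta>2"
      show thesis
      proof (rule that[of "- (D2 P + \<alpha>2 * ?\<psi> P)"])
        show "0 \<le> - (D2 P + \<alpha>2 * ?\<psi> P)" using P(3) unfolding f2 by linarith
        show "- (- (D2 P + \<alpha>2 * ?\<psi> P)) \<le> D2 x + \<alpha>2 * ?\<psi> x" if "x \<in> cball x0 \<rho>" for x
          using bspec[OF P(2) that] unfolding f2 by linarith
        show "- (D2 P + \<alpha>2 * ?\<psi> P) = 0 \<or> (\<exists>Pa\<in>ball x0 \<rho>. D2 Pa + \<alpha>2 * ?\<psi> Pa = - (- (D2 P + \<alpha>2 * ?\<psi> P)) \<and>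
            - (\<epsilon>\<^sup>2 * touch_const \<bar>b2\<bar> (\<alpha>2 / \<rho>\<^sup>2) R \<rho> c) \<le> \<gamma>2 * D2 Pa + g * D1 Pa - \<delta>2)"
          using P(1,4) by (intro disjI2 bexI[of _ P] conjI) linarith+
      qed
    qed
  qed
  have ST: "\<gamma>1 * S \<le> g * T + E"
    using S(3)
  proof (elim disjE bexE conjE)
    assume "S = 0"
    then show ?thesis using T(1) E0 \<gamma> by simp
  next
    fix P assume P: "P \<in> ball x0 \<rho>" "D1 P - \<alpha>1 * ?\<psi> P = S"
      "\<gamma>1 * D1 P + g * D2 P - \<delta>1 \<le> \<epsilon>\<^sup>2 * touch_const \<bar>b1\<bar> (\<alpha>1 / \<rho>\<^sup>2) R \<rho> c"
    have d1: "D1 P = S + \<alpha>1 * ?\<psi> P" using P(2) by simp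
    have "- T - \<alpha>2 * ?\<psi> P \<le> D2 P" using T(2)[of P] P(1) by auto
    then have "g * (- T - \<alpha>2 * ?\<psi> P) \<le> g * D2 P" using \<gamma> by (intro mult_left_mono) auto
    moreover have "(g * \<alpha>2) * ?\<psi> P \<le> (\<gamma>1 * \<alpha>1) * ?\<psi> P" using al(3) \<psi>(2) by (rule mult_right_mono)
    ultimately show ?thesis using P(3) tE(1) unfolding d1 by (simp add: algebra_simps)
  qed
  have TS: "\<gamma>2 * T \<le> g * S + E"
    using T(3)
  proof (elim disjE bexE conjE)
    assume "T = 0"
    then show ?thesis using S(1) E0 \<gamma> by simp
  next
    fix P assume P: "P \<in> ball x0 \<rho>" "D2 P + \<alpha>2 * ?\<psi> P = - T"
      "- (\<epsilon>\<^sup>2 * touch_const \<bar>b2\<bar> (\<alpha>2 / \<rho>\<^sup>2) R \<rho> c) \<le> \<gamma>2 * D2 P + g * D1 P - \<delta>2"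
    have d2: "D2 P = - T - \<alpha>2 * ?\<psi> P" using P(2) by simp
    have "D1 P \<le> S + \<alpha>1 * ?\<psi> P" using S(2)[of P] P(1) by auto
    then have "g * D1 P \<le> g * (S + \<alpha>1 * ?\<psi> P)" using \<gamma> by (intro mult_left_mono) auto
    moreover have "(g * \<alpha>1) * ?\<psi> P \<le> (\<gamma>2 * \<alpha>2) * ?\<psi> P" using al(4) \<psi>(2) by (rule mult_right_mono)
    ultimately show ?thesis using P(3) tE(2) unfolding d2 by (simp add: algebra_simps)
  qed
  note ct = contraction_pair[OF \<gamma> ST TS]
  have "x0 \<in> cball x0 \<rho>" using pos by simp
  then have "D1 x0 \<le> S" "- D2 x0 \<le> T" using S(2)[of x0] T(2)[of x0] \<psi>(3) by auto
  then show "D1 x0 \<le> (\<gamma>2 + g) * E / (\<gamma>1 * \<gamma>2 - g\<^sup>2)" "- D2 x0 \<le> (\<gamma>1 + g) * E / (\<gamma>1 * \<gamma>2 - g\<^sup>2)"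
    using ct by linarith+
qed

text \<open>The same loop, now with barriers on balls of radius \<open>e = \<epsilon>\<^bsup>2/3\<^esup>\<close>, where \<open>\<epsilon>\<^sup>2 / e\<^sup>2 = e\<close> balances the variation
  of the profile; no lower bound on \<open>\<eta>1\<close>, \<open>\<eta>2\<close> is needed, so it works up to and across the interfaces.\<close>

lemma uniform_pair:
  assumes \<eta>1: "C_k 2 \<eta>1" "\<And>x. 0 < \<eta>1 x" and \<eta>2: "C_k 2 \<eta>2" "\<And>x. 0 < \<eta>2 x"
    and e: "0 < e" "\<epsilon>\<^sup>2 = e ^ 3" and \<gamma>: "0 < \<gamma>1" "0 < \<gamma>2" "0 < g" "g\<^sup>2 < \<gamma>1 * \<gamma>2"
    and a0: "\<And>x. 0 \<le> p1 x" "\<And>x. 0 \<le> p2 x" and am: "\<And>x. p2 x \<le> Am"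
    and lip: "\<And>x y. y \<in> ball x e \<Longrightarrow> p1 y \<le> p1 x + La * e" and La: "0 \<le> La"
    and w1: "\<And>x. m1 \<le> nsq x + \<gamma>1 * p1 x + g * p2 x"
    and w2: "\<And>x. 0 < p2 x \<Longrightarrow> nsq x + \<gamma>2 * p2 x + g * p1 x = m2"
    and Lv: "\<And>x y. 0 < p2 x \<Longrightarrow> y \<in> ball x e \<Longrightarrow> nsq y \<le> nsq x + Lv * e" "0 \<le> Lv"
    and eq1: "\<And>x. \<epsilon>\<^sup>2 * laplacian \<eta>1 x = \<eta>1 x * (nsq x + \<gamma>1 * (\<eta>1 x)\<^sup>2 + g * (\<eta>2 x)\<^sup>2 - lam1)"
    and eq2: "\<And>x. \<epsilon>\<^sup>2 * laplacian \<eta>2 x = \<eta>2 x * (nsq x + \<gamma>2 * (\<eta>2 x)\<^sup>2 + g * (\<eta>1 x)\<^sup>2 - lam2)"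
    and \<delta>: "\<bar>lam1 - m1\<bar> \<le> d * e" "\<bar>lam2 - m2\<bar> \<le> d * e" "0 \<le> d"
    and E: "E = (\<gamma>1 * La + g * La + Lv + d + 8) * e"
  shows "(\<eta>1 x)\<^sup>2 - p1 x \<le> (\<gamma>2 + g) * E / (\<gamma>1 * \<gamma>2 - g\<^sup>2)" "p2 x - (\<eta>2 x)\<^sup>2 \<le> (\<gamma>1 + g) * E / (\<gamma>1 * \<gamma>2 - g\<^sup>2)"
proof -
  have r: "8 * \<epsilon>\<^sup>2 / e\<^sup>2 = 8 * e" using e by (simp add: power2_eq_square power3_eq_cube)
  define c where "c = \<gamma>1 * La + g * La + Lv + d + 8"
  have parts: "0 \<le> \<gamma>1 * La * e" "0 \<le> g * La * e" "0 \<le> Lv * e" "0 \<le> d * e" "0 \<le> 8 * e" using \<gamma> La Lv(2) \<delta>(3) e by auto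
  have Eeq: "E = \<gamma>1 * La * e + g * La * e + Lv * e + d * e + 8 * e" unfolding E by (simp add: algebra_simps)
  \<comment> \<open>The lower error of \<open>\<eta>2\<close> is bounded a priori, since
    \<open>\<eta>2\<^sup>2 \<ge> 0\<close> and \<open>p2 \<le> Am\<close>, so its supremum exists.
    For the upper error of \<open>\<eta>1\<close> no such bound is known; it is controlled by
    \<open>T\<close> through \<open>S\<close>.\<close>
  define T where "T = (SUP x. max 0 (p2 x - (\<eta>2 x)\<^sup>2))"
  have bdd: "bdd_above (range (\<lambda>x. max 0 (p2 x - (\<eta>2 x)\<^sup>2)))"
  proof (rule bdd_aboveI2)
    show "max 0 (p2 x - (\<eta>2 x)\<^sup>2) \<le> max 0 Am" for x using am[of x] zero_le_power2[of "\<eta>2 x"] by linarith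
  qed
  have T: "max 0 (p2 x - (\<eta>2 x)\<^sup>2) \<le> T" for x unfolding T_def by (rule cSUP_upper[OF _ bdd]) simp
  have T0: "0 \<le> T" using T[of 0] by linarith
  define S where "S = (g * T + E) / \<gamma>1"
  have S\<gamma>: "\<gamma>1 * S = g * T + E" using \<gamma> by (simp add: S_def)
  have up: "(\<eta>1 x)\<^sup>2 - p1 x \<le> S" for x
  proof -
    define b where "b = \<gamma>1 * p1 x + \<gamma>1 * La * e + g * T + d * e"
    have b0: "0 \<le> b" unfolding b_def using parts T0 \<gamma> a0(1)[of x] by auto
    have "\<gamma>1 * (\<eta>1 x)\<^sup>2 \<le> max b 0 + 8 * \<epsilon>\<^sup>2 / e\<^sup>2"
    proof (rule local_upper_bound[OF \<eta>1 e(1) \<gamma>(1)])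
      fix y assume y: "y \<in> ball x e"
      have 1: "\<gamma>1 * p1 y \<le> \<gamma>1 * (p1 x + La * e)" using lip[OF y] \<gamma> by (intro mult_left_mono) auto
      have 2: "g * (p2 y - T) \<le> g * (\<eta>2 y)\<^sup>2" using T[of y] \<gamma> by (intro mult_left_mono) auto
      have "\<gamma>1 * (\<eta>1 y)\<^sup>2 - b \<le> nsq y + \<gamma>1 * (\<eta>1 y)\<^sup>2 + g * (\<eta>2 y)\<^sup>2 - lam1"
        using 1 2 w1[of y] \<delta>(1) unfolding b_def by (simp add: algebra_simps abs_le_iff)
      then show "\<eta>1 y * (\<gamma>1 * (\<eta>1 y)\<^sup>2 - b) \<le> \<epsilon>\<^sup>2 * laplacian \<eta>1 y"
        unfolding eq1 using \<eta>1(2)[of y] by (intro mult_left_mono) auto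
    qed
    then have "\<gamma>1 * ((\<eta>1 x)\<^sup>2 - p1 x) \<le> g * T + E"
      unfolding r Eeq using b0 parts by (simp add: b_def right_diff_distrib)
    then show ?thesis unfolding S_def using \<gamma> by (simp add: pos_le_divide_eq mult.commute)
  qed
  have S0: "0 \<le> S" unfolding S_def using T0 parts \<gamma> Eeq by auto
  have "T \<le> (g * S + E) / \<gamma>2"
    unfolding T_def
  proof (rule cSUP_least)
    fix x :: "real^2"
    have rhs: "0 \<le> (g * S + E) / \<gamma>2" using S0 parts \<gamma> Eeq by auto
    show "max 0 (p2 x - (\<eta>2 x)\<^sup>2) \<le> (g * S + E) / \<gamma>2"
    proof (cases "0 < p2 x")
      case True
      define b where "b = \<gamma>2 * p2 x - (d * e + Lv * e + g * La * e + g * S)"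
      have "b - 8 * \<epsilon>\<^sup>2 / e\<^sup>2 \<le> \<gamma>2 * (\<eta>2 x)\<^sup>2"
      proof (rule local_lower_bound[OF \<eta>2 e(1) \<gamma>(2)])
        fix y assume y: "y \<in> ball x e"
        have "(\<eta>1 y)\<^sup>2 \<le> p1 x + La * e + S" using lip[OF y] up[of y] by linarith
        then have "g * (\<eta>1 y)\<^sup>2 \<le> g * (p1 x + La * e + S)" using \<gamma> by (intro mult_left_mono) auto
        then have "nsq y + \<gamma>2 * (\<eta>2 y)\<^sup>2 + g * (\<eta>1 y)\<^sup>2 - lam2 \<le> \<gamma>2 * (\<eta>2 y)\<^sup>2 - b"
          using w2[OF True] Lv(1)[OF True y] \<delta>(2) unfolding b_def by (simp add: algebra_simps abs_le_iff)
        then show "\<epsilon>\<^sup>2 * laplacian \<eta>2 y \<le> \<eta>2 y * (\<gamma>2 * (\<eta>2 y)\<^sup>2 - b)"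
          unfolding eq2 using \<eta>2(2)[of y] by (intro mult_left_mono) auto
      qed
      then have "\<gamma>2 * (p2 x - (\<eta>2 x)\<^sup>2) \<le> g * S + E"
        unfolding r Eeq using parts by (simp add: b_def right_diff_distrib)
      then show ?thesis using rhs \<gamma> by (simp add: pos_le_divide_eq mult.commute)
    next
      case False
      then have "max 0 (p2 x - (\<eta>2 x)\<^sup>2) = 0" using a0(2)[of x] by simp
      then show ?thesis using rhs by simp
    qed
  qed simp
  then have T\<gamma>: "\<gamma>2 * T \<le> g * S + E" using \<gamma> by (simp add: pos_le_divide_eq mult.commute)
  note ct = contraction_pair[OF \<gamma> eq_refl[OF S\<gamma>] T\<gamma>]
  show "(\<eta>1 x)\<^sup>2 - p1 x \<le> (\<gamma>2 + g) * E / (\<gamma>1 * \<gamma>2 - g\<^sup>2)" using up[of x] ct(1) by linarith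
  show "p2 x - (\<eta>2 x)\<^sup>2 \<le> (\<gamma>1 + g) * E / (\<gamma>1 * \<gamma>2 - g\<^sup>2)" using T[of x] ct(2) by linarith
qed

section \<open>Convergence to the profile\<close>

text \<open>Young's inequality with a free weight \<open>t\<close>. If the squared errors have
  integral at most \<open>M\<close>, the choice \<open>t = sqrt M\<close> makes both terms of order
  \<open>sqrt M\<close>.\<close>

lemma weighted_product_le:
  fixes c1 c2 d1 d2 a t :: real
  assumes "0 \<le> c1" "0 \<le> c2" "0 \<le> a" "0 < t" and d: "d = d1 \<or> d = d2"
  shows "\<bar>(c1 * d1 + c2 * d2) * (d + a)\<bar> \<le> (c1 + c2) * ((1 + 1 / t) * (d1\<^sup>2 + d2\<^sup>2) + t * a\<^sup>2)"
proof -
  define m where "m = max \<bar>d1\<bar> \<bar>d2\<bar>"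
  have m0: "0 \<le> m" by (simp add: m_def)
  have "m = \<bar>d1\<bar> \<or> m = \<bar>d2\<bar>" by (auto simp: m_def max_def)
  then have m2: "m\<^sup>2 \<le> d1\<^sup>2 + d2\<^sup>2" by (elim disjE) simp_all
  have "\<bar>c1 * d1 + c2 * d2\<bar> \<le> c1 * \<bar>d1\<bar> + c2 * \<bar>d2\<bar>"
    using abs_triangle_ineq[of "c1 * d1" "c2 * d2"] assms(1,2) by (simp add: abs_mult)
  also have "\<dots> \<le> c1 * m + c2 * m" using assms(1,2) by (intro add_mono mult_left_mono) (auto simp: m_def)
  finally have 1: "\<bar>c1 * d1 + c2 * d2\<bar> \<le> (c1 + c2) * m" by (simp add: distrib_right)
  have 2: "\<bar>d + a\<bar> \<le> m + a" using d assms(3) by (auto simp: m_def)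
  have "0 \<le> (m - t * a)\<^sup>2 / t + m * a" using assms m0 by simp
  also have "(m - t * a)\<^sup>2 / t + m * a = m\<^sup>2 / t + t * a\<^sup>2 - m * a"
    using assms(4) by (simp add: power2_eq_square field_simps)
  finally have ma: "m * a \<le> m\<^sup>2 / t + t * a\<^sup>2" by simp
  have "\<bar>(c1 * d1 + c2 * d2) * (d + a)\<bar> \<le> (c1 + c2) * m * (m + a)"
    unfolding abs_mult using 1 2 m0 assms(1,2) by (intro mult_mono) auto
  also have "\<dots> = (c1 + c2) * (m\<^sup>2 + m * a)" by (simp add: algebra_simps power2_eq_square)
  also have "\<dots> \<le> (c1 + c2) * ((1 + 1 / t) * m\<^sup>2 + t * a\<^sup>2)"
    using ma assms(1,2) by (intro mult_left_mono) (auto simp: distrib_right)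
  also have "\<dots> \<le> (c1 + c2) * ((1 + 1 / t) * (d1\<^sup>2 + d2\<^sup>2) + t * a\<^sup>2)"
    using m2 assms(1,2,4) by (intro mult_left_mono add_mono) auto
  finally show ?thesis .
qed

lemma abs_diff_sqrt_le:
  assumes "0 \<le> h" "0 \<le> a"
  shows "\<bar>h - sqrt a\<bar> \<le> sqrt \<bar>h\<^sup>2 - a\<bar>"
    "0 < a \<Longrightarrow> \<bar>h - sqrt a\<bar> \<le> \<bar>h\<^sup>2 - a\<bar> / sqrt a"
proof -
  have e: "\<bar>h\<^sup>2 - a\<bar> = \<bar>h - sqrt a\<bar> * (h + sqrt a)"
  proof -
    have "h\<^sup>2 - a = (h - sqrt a) * (h + sqrt a)" using assms by (simp add: algebra_simps power2_eq_square)
    then show ?thesis using assms by (simp add: abs_mult)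
  qed
  have "\<bar>h - sqrt a\<bar> * \<bar>h - sqrt a\<bar> \<le> \<bar>h - sqrt a\<bar> * (h + sqrt a)"
    using assms by (intro mult_left_mono) (auto simp: abs_le_iff)
  then show "\<bar>h - sqrt a\<bar> \<le> sqrt \<bar>h\<^sup>2 - a\<bar>"
    unfolding e by (intro real_le_rsqrt) (simp add: power2_eq_square)
  assume a: "0 < a"
  have "\<bar>h - sqrt a\<bar> * sqrt a \<le> \<bar>h - sqrt a\<bar> * (h + sqrt a)"
    using assms by (intro mult_left_mono) auto
  then show "\<bar>h - sqrt a\<bar> \<le> \<bar>h\<^sup>2 - a\<bar> / sqrt a" unfolding e using a by (simp add: pos_le_divide_eq)
qed

text \<open>On a ball of radius \<open>e\<close> the lemma \<open>local_decay\<close> gains the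
  factor \<open>4 * \<epsilon>\<^sup>2 / (8 * e * e\<^sup>2) = 1 / 2\<close>, which fixes the
  constant 8 in \<open>sub\<close>. Halving at every step \<open>e\<close> beyond
  \<open>R + L * e\<close> gives the rate \<open>ln 2\<close>; the factor
  \<open>2 powr (L + 1)\<close> pays for the first layer and for rounding the number of steps
  down.\<close>

lemma exp_decay:
  assumes \<eta>: "C_k 2 \<eta>" and e: "0 < e" "\<epsilon>\<^sup>2 = e ^ 3"
    and sub: "\<And>y. R + L * e \<le> norm y \<Longrightarrow> 8 * e * \<eta> y \<le> \<epsilon>\<^sup>2 * laplacian \<eta> y"
    and m: "\<And>y. R \<le> norm y \<Longrightarrow> \<eta> y \<le> m" "0 \<le> m" and L: "0 \<le> L" and x: "R \<le> norm x"
  shows "\<eta> x \<le> m * 2 powr (L + 1) * exp (- ln 2 * ((norm x - R) / e))"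
proof -
  have step: "R + (L + real n) * e \<le> norm x \<longrightarrow> \<eta> x \<le> m / 2 ^ n" for x n
  proof (induction n arbitrary: x)
    case 0
    have "0 \<le> L * e" using L e by simp
    then show ?case using m(1)[of x] by simp
  next
    case (Suc n)
    show ?case
    proof
      assume x: "R + (L + real (Suc n)) * e \<le> norm x"
      have y: "R + (L + real n) * e \<le> norm y" if "y \<in> cball x e" for y
      proof -
        have "norm x \<le> norm y + e" using that norm_triangle_ineq2[of x y] by (simp add: dist_norm)
        then show ?thesis using x by (simp add: algebra_simps)
      qed
      have k: "0 < 8 * e" using e by simp
      have "\<eta> x \<le> 4 * \<epsilon>\<^sup>2 / (8 * e * e\<^sup>2) * (m / 2 ^ n)"
      proof (rule local_decay[OF \<eta> e(1) k])
        show "8 * e * \<eta> z \<le> \<epsilon>\<^sup>2 * laplacian \<eta> z" if "z \<in> ball x e" for z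
        proof (rule sub)
          have "0 \<le> real n * e" using e by simp
          moreover have "R + (L + real n) * e \<le> norm z" using y that by auto
          ultimately show "R + L * e \<le> norm z" by (simp add: algebra_simps)
        qed
        show "\<eta> z \<le> m / 2 ^ n" if "z \<in> cball x e" for z using Suc.IH[of z] y[OF that] by blast
        show "0 \<le> m / 2 ^ n" using m by simp
      qed
      also have "4 * \<epsilon>\<^sup>2 / (8 * e * e\<^sup>2) = 1 / 2" using e by (simp add: power2_eq_square power3_eq_cube)
      finally show "\<eta> x \<le> m / 2 ^ Suc n" by simp
    qed
  qed
  define t where "t = (norm x - R) / e"
  have t: "norm x = R + t * e" "0 \<le> t" using e x by (simp_all add: t_def)
  have r: "m * 2 powr (L + 1) * exp (- ln 2 * t) = m * 2 powr (L + 1 - t)"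
    by (simp add: powr_def exp_add[symmetric] algebra_simps)
  have "\<eta> x \<le> m * 2 powr (L + 1 - t)"
  proof (cases "t < L")
    case True
    have "m * 1 \<le> m * 2 powr (L + 1 - t)" using m(2) True by (intro mult_left_mono ge_one_powr_ge_zero) auto
    then show ?thesis using m(1)[OF x] by simp
  next
    case False
    define n where "n = nat \<lfloor>t - L\<rfloor>"
    have n: "real n \<le> t - L" "t - L \<le> real n + 1" unfolding n_def using False by linarith+
    have "(L + real n) * e \<le> t * e" using n e by (intro mult_right_mono) auto
    then have "\<eta> x \<le> m / 2 ^ n" using step[of n x] t by simp
    also have "\<dots> = m * 2 powr (- real n)" by (simp add: powr_minus powr_realpow divide_inverse)
    also have "\<dots> \<le> m * 2 powr (L + 1 - t)" using n m(2) by (intro mult_left_mono powr_mono) auto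
    finally show ?thesis .
  qed
  then show ?thesis unfolding r[symmetric] by (simp only: t_def)
qed

section \<open>From the energy excess to uniform closeness\<close>

context tf_data
begin

text \<open>After subtraction of the limiting multiplier there remain the kinetic term and the
  weighted mass, both at most \<open>M\<close>, and a term linear in the density errors; the latter
  costs \<open>sqrt M\<close> by Young's inequality.\<close>

lemma multiplier_rough:
  assumes sol: "sol \<epsilon> \<eta>1 \<eta>2 lam1 lam2" and ec: "energy_control M \<epsilon> \<eta>1 \<eta>2" and M: "0 < M" "M \<le> 1"
  shows "\<bar>lam1 - l1\<bar> \<le> (2 + (g1 + g2) * (4 + L * l2)) * sqrt M" "\<bar>lam2 - l2\<bar> \<le> (2 + 2 * g2 * (4 + L * l2)) * sqrt M"
proof -
  note c = ec[unfolded energy_control_def]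
  have fe: "finite_energy \<eta>1 \<eta>2" using c by blast
  note mi = multiplier_identity[OF sol fe] and i = fe[unfolded finite_energy_def]
  define t where "t = sqrt M"
  have t: "0 < t" "M = t * t" "M \<le> t"
    using M by (simp_all add: t_def) (metis M mult_left_le real_sqrt_ge_0_iff real_sqrt_le_1_iff real_sqrt_mult_self abs_of_pos less_imp_le)
  let ?D1 = "\<lambda>x. (\<eta>1 x)\<^sup>2 - A1 (nsq x)" and ?D2 = "\<lambda>x. (\<eta>2 x)\<^sup>2 - A2 (nsq x)"
  have Ll: "0 \<le> L * l2" using L_ge(5) s_ord by simp
  have est: "\<bar>lam - l\<bar> \<le> (2 + (c1 + c2) * (4 + L * l2)) * sqrt M"
    if lam: "lam = \<epsilon>\<^sup>2 * K + (LINT x|lborel. (nsq x + c1 * (\<eta>1 x)\<^sup>2 + c2 * (\<eta>2 x)\<^sup>2) * n x)"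
      and il: "integrable lborel (\<lambda>x. (nsq x + c1 * (\<eta>1 x)\<^sup>2 + c2 * (\<eta>2 x)\<^sup>2) * n x)"
      and K: "0 \<le> \<epsilon>\<^sup>2 * K" "\<epsilon>\<^sup>2 * K \<le> M"
      and n: "integrable lborel n" "(LINT x|lborel. n x) = 1" "\<And>x. 0 \<le> n x"
      and a: "integrable lborel (\<lambda>x. A (nsq x))" "(LINT x|lborel. A (nsq x)) = 1"
        "\<And>s. 0 \<le> A s" "\<And>s. 0 \<le> s \<Longrightarrow> A s \<le> L * l2" "continuous_on UNIV A"
      and d: "(\<lambda>x. n x - A (nsq x)) = ?D1 \<or> (\<lambda>x. n x - A (nsq x)) = ?D2"
      and W: "\<And>s. W s = s + c1 * A1 s + c2 * A2 s - l" "\<And>s. 0 \<le> W s"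
        "integrable lborel (\<lambda>x. W (nsq x) * n x)" "(LINT x|lborel. W (nsq x) * n x) \<le> M"
      and cc: "0 \<le> c1" "0 \<le> c2"
    for lam l c1 c2 K n A W
  proof -
    let ?A = "\<lambda>x. A (nsq x)"
    let ?T = "\<lambda>x. (c1 * ?D1 x + c2 * ?D2 x) * n x"
    let ?G = "\<lambda>x. (c1 + c2) * ((1 + 1 / t) * ((?D1 x)\<^sup>2 + (?D2 x)\<^sup>2) + t * (L * l2 * ?A x))"
    have eq: "(nsq x + c1 * (\<eta>1 x)\<^sup>2 + c2 * (\<eta>2 x)\<^sup>2) * n x - l * n x = W (nsq x) * n x + ?T x" for x
      unfolding W(1) by (simp add: algebra_simps)
    have iT: "integrable lborel ?T"
    proof -
      have "?T = (\<lambda>x. ((nsq x + c1 * (\<eta>1 x)\<^sup>2 + c2 * (\<eta>2 x)\<^sup>2) * n x - l * n x) - W (nsq x) * n x)" using eq by (simp add: fun_eq_iff)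
      then show ?thesis using il n W(3) by simp
    qed
    have iG: "integrable lborel ?G" using c a(1) by simp
    have TG: "\<bar>?T x\<bar> \<le> ?G x" for x
    proof -
      have dd: "n x - ?A x = ?D1 x \<or> n x - ?A x = ?D2 x" using d by (auto simp: fun_eq_iff)
      have "(?A x)\<^sup>2 \<le> L * l2 * ?A x" unfolding power2_eq_square using a(3,4) by (intro mult_right_mono) auto
      then have "(c1 + c2) * ((1 + 1 / t) * ((?D1 x)\<^sup>2 + (?D2 x)\<^sup>2) + t * (?A x)\<^sup>2) \<le> ?G x"
        using t cc by (intro mult_left_mono add_left_mono) auto
      moreover have "\<bar>?T x\<bar> \<le> (c1 + c2) * ((1 + 1 / t) * ((?D1 x)\<^sup>2 + (?D2 x)\<^sup>2) + t * (?A x)\<^sup>2)"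
        using weighted_product_le[OF cc a(3)[of "nsq x"] t(1) dd] by simp
      ultimately show ?thesis by (rule order_trans[rotated])
    qed
    have "(LINT x|lborel. ?G x) = (c1 + c2) * ((1 + 1 / t) * ((LINT x|lborel. (?D1 x)\<^sup>2) + (LINT x|lborel. (?D2 x)\<^sup>2)) + t * (L * l2 * (LINT x|lborel. ?A x)))"
      using c a(1) by simp
    also have "\<dots> \<le> (c1 + c2) * ((1 + 1 / t) * (M + M) + t * (L * l2 * 1))"
      using c a(2) t cc Ll by (intro mult_left_mono add_mono) auto
    also have "\<dots> = (c1 + c2) * (2 * M + 2 * t + t * (L * l2))" using t(1) unfolding t(2) by (simp add: field_simps)
    also have "\<dots> \<le> (c1 + c2) * (2 * t + 2 * t + t * (L * l2))" using t(3) cc by (intro mult_left_mono) auto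
    also have "\<dots> = (c1 + c2) * (4 + L * l2) * t" by (simp add: algebra_simps)
    finally have G: "(LINT x|lborel. ?G x) \<le> (c1 + c2) * (4 + L * l2) * t" .
    have T: "\<bar>LINT x|lborel. ?T x\<bar> \<le> (LINT x|lborel. ?G x)"
    proof -
      have "\<bar>LINT x|lborel. ?T x\<bar> \<le> (LINT x|lborel. \<bar>?T x\<bar>)" by (rule integral_abs_bound)
      also have "\<dots> \<le> (LINT x|lborel. ?G x)" using iT by (intro integral_mono iG TG) auto
      finally show ?thesis .
    qed
    have "(LINT x|lborel. (nsq x + c1 * (\<eta>1 x)\<^sup>2 + c2 * (\<eta>2 x)\<^sup>2) * n x) - l * (LINT x|lborel. n x)
      = (LINT x|lborel. (nsq x + c1 * (\<eta>1 x)\<^sup>2 + c2 * (\<eta>2 x)\<^sup>2) * n x - l * n x)" using il n by simp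
    also have "\<dots> = (LINT x|lborel. W (nsq x) * n x) + (LINT x|lborel. ?T x)"
      unfolding eq using iT W(3) by simp
    finally have "lam - l = \<epsilon>\<^sup>2 * K + (LINT x|lborel. W (nsq x) * n x) + (LINT x|lborel. ?T x)" using lam n(2) by simp
    moreover have "0 \<le> (LINT x|lborel. W (nsq x) * n x)" using W(2) n(3) by (intro Bochner_Integration.integral_nonneg) auto
    ultimately have "\<bar>lam - l\<bar> \<le> 2 * t + (c1 + c2) * (4 + L * l2) * t" using K W(4) T G t(3) by linarith
    then show ?thesis unfolding t_def by (simp add: algebra_simps)
  qed
  have gs: "0 \<le> (LINT x|lborel. gsq u x)" for u by (intro Bochner_Integration.integral_nonneg gsq_nonneg)
  have K: "\<epsilon>\<^sup>2 * (LINT x|lborel. gsq \<eta>1 x) \<le> M" "\<epsilon>\<^sup>2 * (LINT x|lborel. gsq \<eta>2 x) \<le> M"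
    using c mult_nonneg_nonneg[OF zero_le_power2[of \<epsilon>] gs[of \<eta>1]] mult_nonneg_nonneg[OF zero_le_power2[of \<epsilon>] gs[of \<eta>2]]
    by (auto simp: distrib_left)
  have sw: "(\<lambda>x. (nsq x + g2 * (\<eta>2 x)\<^sup>2 + g * (\<eta>1 x)\<^sup>2) * (\<eta>2 x)\<^sup>2) = (\<lambda>x. (nsq x + g * (\<eta>1 x)\<^sup>2 + g2 * (\<eta>2 x)\<^sup>2) * (\<eta>2 x)\<^sup>2)"
    by (simp add: fun_eq_iff)
  note mi2 = mi(2,4)[unfolded sw]
  have r: "0 \<le> (4 + L * l2) * sqrt M" using L_ge s_ord M by simp
  have "\<bar>lam1 - l1\<bar> \<le> (2 + (g1 + g) * (4 + L * l2)) * sqrt M"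
    by (rule est[where K="LINT x|lborel. gsq \<eta>1 x" and n="\<lambda>x. (\<eta>1 x)\<^sup>2" and A=A1 and W=W1])
      (use mi(1,3) K gs i c mass A_nonneg A_upper A_continuous W_nonneg g_pos in \<open>auto simp: W1_def\<close>)
  also have "\<dots> \<le> (2 + (g1 + g2) * (4 + L * l2)) * sqrt M"
    using mult_right_mono[OF less_imp_le[OF g_less] r] by (simp add: algebra_simps)
  finally show "\<bar>lam1 - l1\<bar> \<le> (2 + (g1 + g2) * (4 + L * l2)) * sqrt M" .
  have "\<bar>lam2 - l2\<bar> \<le> (2 + (g + g2) * (4 + L * l2)) * sqrt M"
    by (rule est[where K="LINT x|lborel. gsq \<eta>2 x" and n="\<lambda>x. (\<eta>2 x)\<^sup>2" and A=A2 and W=W2])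
      (use mi2 K gs i c mass A_nonneg A_upper A_continuous W_nonneg g_pos in \<open>auto simp: W2_def\<close>)
  also have "\<dots> \<le> (2 + 2 * g2 * (4 + L * l2)) * sqrt M"
    using mult_right_mono[OF less_imp_le[OF g_less] r] by (simp add: algebra_simps)
  finally show "\<bar>lam2 - l2\<bar> \<le> (2 + 2 * g2 * (4 + L * l2)) * sqrt M" .
qed


text \<open>Bounds the growth of \<open>|x|\<^sup>2\<close> per unit length along steps of length at
  most 1 that start in the disc of radius \<open>sqrt l2\<close>.\<close>

definition ext where "ext = 2 * sqrt l2 + 1"

lemma norm_square_le_add:
  assumes "norm (x - y) \<le> e" "e \<le> 1" "nsq x \<le> l2" shows "nsq y \<le> nsq x + ext * e"
proof -
  have x: "norm x \<le> sqrt l2" using assms(3) by (rule real_le_rsqrt)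
  have e: "0 \<le> e" using assms(1) norm_ge_zero[of "x - y"] by linarith
  have "norm y \<le> norm x + e" using norm_triangle_ineq2[of y x] assms(1) norm_minus_commute[of y x] by linarith
  then have "nsq y \<le> (norm x + e)\<^sup>2" by (intro power_mono) auto
  also have "\<dots> = nsq x + (2 * norm x + e) * e" by (simp add: power2_eq_square algebra_simps)
  also have "\<dots> \<le> nsq x + ext * e"
    unfolding ext_def using x assms(2) e by (intro add_left_mono mult_right_mono) auto
  finally show ?thesis .
qed

text \<open>The square of the norm has unbounded slope, but the profile has compact support: either
  the point of smaller norm lies in the disc of radius \<open>sqrt l2\<close>, or the density
  vanishes at both points.\<close>

lemma A_lipschitz_norm:
  assumes "norm (x - y) \<le> e" "e \<le> 1"
  shows "\<bar>A1 (nsq x) - A1 (nsq y)\<bar> \<le> L * ext * e" "\<bar>A2 (nsq x) - A2 (nsq y)\<bar> \<le> L * ext * e"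
proof -
  have e: "0 \<le> e" using assms(1) norm_ge_zero[of "x - y"] by linarith
  have p: "0 \<le> L * ext * e" using L_ge s_ord e by (simp add: ext_def)
  have *: "\<bar>A (nsq x) - A (nsq y)\<bar> \<le> L * ext * e"
    if A: "\<And>s t. \<bar>A s - A t\<bar> \<le> L * \<bar>s - t\<bar>" "\<And>s. l2 \<le> s \<Longrightarrow> A s = 0" "norm (x - y) \<le> e" "norm x \<le> norm y"
    for A and x y :: "real^2"
  proof (cases "nsq x \<le> l2")
    case True
    have "nsq x \<le> nsq y" using A(4) by (intro power_mono) auto
    then have "\<bar>nsq x - nsq y\<bar> \<le> ext * e" using norm_square_le_add[OF A(3) assms(2) True] by linarith
    then have "L * \<bar>nsq x - nsq y\<bar> \<le> L * (ext * e)" using L_ge(5) by (intro mult_left_mono) auto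
    then show ?thesis using A(1)[of "nsq x" "nsq y"] by (simp add: mult.assoc)
  next
    case False
    have "nsq x \<le> nsq y" using A(4) by (intro power_mono) auto
    then have "l2 \<le> nsq x" "l2 \<le> nsq y" using False by linarith+
    then have "A (nsq x) = 0" "A (nsq y) = 0" using A(2) by blast+
    then show ?thesis using p by simp
  qed
  have z: "\<And>s. l2 \<le> s \<Longrightarrow> A1 s = 0" "\<And>s. l2 \<le> s \<Longrightarrow> A2 s = 0" using A_zero s_ord by auto
  have s: "norm (y - x) \<le> e" using assms(1) norm_minus_commute[of y x] by simp
  show "\<bar>A1 (nsq x) - A1 (nsq y)\<bar> \<le> L * ext * e"
    using *[OF A_lipschitz(1) z(1) assms(1)] *[OF A_lipschitz(1) z(1) s] by (cases "norm x \<le> norm y") (auto simp: abs_minus_commute)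
  show "\<bar>A2 (nsq x) - A2 (nsq y)\<bar> \<le> L * ext * e"
    using *[OF A_lipschitz(2) z(2) assms(1)] *[OF A_lipschitz(2) z(2) s] by (cases "norm x \<le> norm y") (auto simp: abs_minus_commute)
qed

text \<open>\<open>uniform_pair\<close> bounds the first density from above and the second from
  below; its use with exchanged components supplies the other two one-sided bounds. \<open>C\<close>
  is the largest of the four constants, as \<open>g1 < g2\<close>.\<close>

lemma uniform_profile:
  assumes sol: "sol \<epsilon> \<eta>1 \<eta>2 lam1 lam2" and e: "0 < e" "e \<le> 1" "\<epsilon>\<^sup>2 = e ^ 3"
    and \<delta>: "\<bar>lam1 - l1\<bar> \<le> e" "\<bar>lam2 - l2\<bar> \<le> e"
    and C: "C = (g2 + g) * ((g2 + g) * L * ext + ext + 9) / (g1 * g2 - g\<^sup>2)"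
  shows "\<bar>(\<eta>1 x)\<^sup>2 - A1 (nsq x)\<bar> \<le> C * e" "\<bar>(\<eta>2 x)\<^sup>2 - A2 (nsq x)\<bar> \<le> C * e"
proof -
  note S = solD[OF sol]
  have La: "0 \<le> L * ext" "0 \<le> ext" using L_ge s_ord by (auto simp: ext_def)
  have g12: "g1 < g2" using g1_less g_less by simp
  have d: "\<bar>lam1 - l1\<bar> \<le> 1 * e" "\<bar>lam2 - l2\<bar> \<le> 1 * e" "(0::real) \<le> 1" using \<delta> by auto
  have b: "norm (x - y) \<le> e" if "y \<in> ball x e" for x y :: "real^2" using that by (simp add: dist_norm)
  have lip: "A1 (nsq y) \<le> A1 (nsq x) + L * ext * e" "A2 (nsq y) \<le> A2 (nsq x) + L * ext * e"
    if "y \<in> ball x e" for x y :: "real^2"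
    using A_lipschitz_norm[OF b[OF that] e(2)] by (simp_all add: abs_le_iff)
  have pos: "s < l2" if "0 < A1 s \<or> 0 < A2 s" for s
    using that A_zero(1)[of s] A_zero(3)[of s] s_ord by (rule_tac ccontr) auto
  have Lv: "nsq y \<le> nsq x + ext * e" if "0 < A1 (nsq x) \<or> 0 < A2 (nsq x)" "y \<in> ball x e" for x y :: "real^2"
    by (rule norm_square_le_add[OF b[OF that(2)] e(2)]) (use pos[OF that(1)] in simp)
  have w: "l1 \<le> s + g1 * A1 s + g * A2 s" "l2 \<le> s + g2 * A2 s + g * A1 s" for s
    using W_nonneg[of s] by (simp_all add: W1_def W2_def)
  have w0: "0 < A1 s \<Longrightarrow> s + g1 * A1 s + g * A2 s = l1" "0 < A2 s \<Longrightarrow> s + g2 * A2 s + g * A1 s = l2" for s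
    using WA_zero[of s] by (auto simp: W1_def W2_def)
  have det: "g\<^sup>2 < g2 * g1" using g_det by (simp add: mult.commute)
  let ?E1 = "(g1 * (L * ext) + g * (L * ext) + ext + 1 + 8) * e"
  let ?E2 = "(g2 * (L * ext) + g * (L * ext) + ext + 1 + 8) * e"
  have am: "A1 (nsq x) \<le> L * l2" "A2 (nsq x) \<le> L * l2" for x :: "real^2" using A_upper by auto
  have Lv1: "nsq y \<le> nsq x + ext * e" if "0 < A1 (nsq x)" "y \<in> ball x e" for x y :: "real^2" using Lv that by blast
  have Lv2: "nsq y \<le> nsq x + ext * e" if "0 < A2 (nsq x)" "y \<in> ball x e" for x y :: "real^2" using Lv that by blast
  note p1 = uniform_pair[where ?p1.0="\<lambda>x. A1 (nsq x)" and ?p2.0="\<lambda>x. A2 (nsq x)" and x=x,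
      OF S(4,2,5,3) e(1,3) g_pos g_det A_nonneg am(2) lip(1) La(1) w(1) w0(2) Lv2 La(2) S(6,7) d refl]
  note p2 = uniform_pair[where ?p1.0="\<lambda>x. A2 (nsq x)" and ?p2.0="\<lambda>x. A1 (nsq x)" and x=x,
      OF S(5,3,4,2) e(1,3) g_pos(2,1,3) det A_nonneg(2,1) am(1) lip(2) La(1) w(2) w0(1) Lv1 La(2) S(7,6) d(2,1,3) refl]
  define E1 E2 where "E1 = ?E1" and "E2 = ?E2"
  have gg: "0 < g1 * g2 - g\<^sup>2" "g1 * g2 - g\<^sup>2 = g2 * g1 - g\<^sup>2" using g_det by (simp_all add: mult.commute)
  note p = p1[folded E1_def] p2[folded E2_def, folded gg(2)]
  have le: "g1 * (L * ext) \<le> g2 * (L * ext)" using g12 La(1) by (intro mult_right_mono) auto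
  have "0 \<le> g1 * (L * ext)" "0 \<le> g * (L * ext)" using g_pos La(1) by auto
  then have E: "0 \<le> E1" "E1 \<le> E2" unfolding E1_def E2_def using La(2) e(1) le
    by (auto intro!: mult_right_mono mult_nonneg_nonneg)
  have C': "C * e = (g2 + g) * E2 / (g1 * g2 - g\<^sup>2)" unfolding C E2_def by (simp add: algebra_simps)
  have k: "a * b / (g1 * g2 - g\<^sup>2) \<le> C * e" if "0 \<le> a" "a \<le> g2 + g" "0 \<le> b" "b \<le> E2" for a b
    unfolding C' using that gg(1) by (intro divide_right_mono mult_mono) auto
  have "0 \<le> g2 + g" "0 \<le> g1 + g" "g1 + g \<le> g2 + g" using g_pos g12 by auto
  then have b: "(g2 + g) * E1 / (g1 * g2 - g\<^sup>2) \<le> C * e" "(g1 + g) * E1 / (g1 * g2 - g\<^sup>2) \<le> C * e"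
    "(g1 + g) * E2 / (g1 * g2 - g\<^sup>2) \<le> C * e" "(g2 + g) * E2 / (g1 * g2 - g\<^sup>2) \<le> C * e"
    using E by (auto intro!: k)
  have ab: "\<bar>u - v\<bar> \<le> c" if "u - v \<le> x" "v - u \<le> y" "x \<le> c" "y \<le> c" for u v x y c :: real using that by linarith
  show "\<bar>(\<eta>1 x)\<^sup>2 - A1 (nsq x)\<bar> \<le> C * e" by (rule ab[OF p(1) p(4) b(1) b(4)])
  show "\<bar>(\<eta>2 x)\<^sup>2 - A2 (nsq x)\<bar> \<le> C * e" by (rule ab[OF p(3) p(2) b(3) b(2)])
qed

text \<open>Interface between the energy argument and the sharp estimates: minimality enters the
  latter only through this predicate.\<close>

definition close :: "real \<Rightarrow> real \<Rightarrow> (real^2 \<Rightarrow> real) \<Rightarrow> (real^2 \<Rightarrow> real) \<Rightarrow> real \<Rightarrow> real \<Rightarrow> bool" where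
  "close C \<epsilon> \<eta>1 \<eta>2 lam1 lam2 \<longleftrightarrow> sol \<epsilon> \<eta>1 \<eta>2 lam1 lam2 \<and> energy_control (C * (\<epsilon>\<^sup>2 * \<bar>ln \<epsilon>\<bar>)) \<epsilon> \<eta>1 \<eta>2 \<and>
     \<bar>lam1 - l1\<bar> \<le> C * \<epsilon> powr (2/3) \<and> \<bar>lam2 - l2\<bar> \<le> C * \<epsilon> powr (2/3) \<and>
     (\<forall>x. \<bar>(\<eta>1 x)\<^sup>2 - A1 (nsq x)\<bar> \<le> C * \<epsilon> powr (2/3)) \<and> (\<forall>x. \<bar>(\<eta>2 x)\<^sup>2 - A2 (nsq x)\<bar> \<le> C * \<epsilon> powr (2/3))"

lemma energy_control_mono: "energy_control M \<epsilon> \<eta>1 \<eta>2 \<Longrightarrow> M \<le> M' \<Longrightarrow> energy_control M' \<epsilon> \<eta>1 \<eta>2"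
  unfolding energy_control_def by auto

lemma powr_two_thirds: "0 < \<epsilon> \<Longrightarrow> \<epsilon>\<^sup>2 = (\<epsilon> powr (2/3)) ^ 3" for \<epsilon> :: real
  by (subst powr_power) (auto simp: powr_numeral)

lemma close_eventually: "\<exists>C>0. \<forall>\<^sub>F \<epsilon> in at_right 0. \<forall>\<eta>1 \<eta>2 lam1 lam2. sol \<epsilon> \<eta>1 \<eta>2 lam1 lam2 \<longrightarrow> close C \<epsilon> \<eta>1 \<eta>2 lam1 lam2"
proof -
  obtain C0 where C0: "0 < C0" and eb: "\<forall>\<^sub>F \<epsilon> in at_right 0. \<forall>\<eta>1 \<eta>2 lam1 lam2. sol \<epsilon> \<eta>1 \<eta>2 lam1 lam2 \<longrightarrow> energy_control (C0 * (\<epsilon>\<^sup>2 * \<bar>ln \<epsilon>\<bar>)) \<epsilon> \<eta>1 \<eta>2"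
    using energy_bound by blast
  define c where "c = 2 + 2 * g2 * (4 + L * l2)"
  define C1 where "C1 = (g2 + g) * ((g2 + g) * L * ext + ext + 9) / (g1 * g2 - g\<^sup>2)"
  have c: "0 < c" using g_pos L_ge(5) s_ord by (simp add: c_def add_pos_nonneg)
  \<comment> \<open>The rough multiplier error is of order
    \<open>\<epsilon> * sqrt \<bar>ln \<epsilon>\<bar>\<close>, hence below the radius
    \<epsilon>^(2/3) of the barrier balls.\<close>
  have 1: "\<forall>\<^sub>F \<epsilon> in at_right 0. c * sqrt (C0 * (\<epsilon>\<^sup>2 * \<bar>ln \<epsilon>\<bar>)) \<le> \<epsilon> powr (2/3)" using C0 c by real_asymp
  have 2: "\<forall>\<^sub>F \<epsilon> in at_right 0. C0 * (\<epsilon>\<^sup>2 * \<bar>ln \<epsilon>\<bar>) \<le> 1" using C0 by real_asymp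
  have 3: "\<forall>\<^sub>F \<epsilon> in at_right 0. 0 < \<epsilon> \<and> \<epsilon> < (1::real)" 
    by (subst eventually_at_right_field) (auto intro: exI[of _ 1])
  define C where "C = max C0 (max 1 C1)"
  have Cge: "C0 \<le> C" "1 \<le> C" "C1 \<le> C" by (auto simp: C_def)
  show ?thesis
  proof (intro exI[of _ C] conjI)
    show "0 < C" using Cge C0 by linarith
    show "\<forall>\<^sub>F \<epsilon> in at_right 0. \<forall>\<eta>1 \<eta>2 lam1 lam2. sol \<epsilon> \<eta>1 \<eta>2 lam1 lam2 \<longrightarrow> close C \<epsilon> \<eta>1 \<eta>2 lam1 lam2"
      using eb 1 2 3
    proof eventually_elim
      case (elim \<epsilon>)
      show ?case
      proof (intro allI impI)
        fix \<eta>1 \<eta>2 lam1 lam2 assume sol: "sol \<epsilon> \<eta>1 \<eta>2 lam1 lam2"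
        define M where "M = C0 * (\<epsilon>\<^sup>2 * \<bar>ln \<epsilon>\<bar>)"
        define e where "e = \<epsilon> powr (2/3)"
        have e: "0 < e" "e \<le> 1" "\<epsilon>\<^sup>2 = e ^ 3" using elim(4) powr_two_thirds[of \<epsilon>] powr_mono2[of "2/3" \<epsilon> 1] by (auto simp: e_def)
        have ec: "energy_control M \<epsilon> \<eta>1 \<eta>2" unfolding M_def using elim(1) sol by blast
        have "ln \<epsilon> \<noteq> 0" using elim(4) by simp
        then have "0 < M" unfolding M_def using elim(4) C0 by (intro mult_pos_pos) auto
        then have M: "0 < M" "M \<le> 1" using elim(3) by (auto simp: M_def)
        have "(g1 + g2) * (4 + L * l2) \<le> 2 * g2 * (4 + L * l2)" using g1_less g_less L_ge(5) s_ord by (intro mult_right_mono) auto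
        then have "(2 + (g1 + g2) * (4 + L * l2)) * sqrt M \<le> c * sqrt M" using M by (intro mult_right_mono) (auto simp: c_def)
        then have \<delta>: "\<bar>lam1 - l1\<bar> \<le> e" "\<bar>lam2 - l2\<bar> \<le> e"
          using multiplier_rough[OF sol ec M] elim(2) by (auto simp: M_def c_def e_def)
        note u = uniform_profile[OF sol e \<delta> C1_def]
        have m: "e \<le> C * e" "C1 * e \<le> C * e" "M \<le> C * (\<epsilon>\<^sup>2 * \<bar>ln \<epsilon>\<bar>)"
          using Cge e mult_right_mono[OF Cge(2), of e] unfolding M_def by (auto intro!: mult_right_mono)
        show "close C \<epsilon> \<eta>1 \<eta>2 lam1 lam2"
          unfolding close_def e_def[symmetric]
          using sol energy_control_mono[OF ec m(3)] order_trans[OF \<delta>(1) m(1)] order_trans[OF \<delta>(2) m(1)] order_trans[OF u(1) m(2)] order_trans[OF u(2) m(2)]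
          by blast
      qed
    qed
  qed
qed


section \<open>Uniform, relative and exponential bounds\<close>

lemma closeD:
  assumes "close C \<epsilon> \<eta>1 \<eta>2 lam1 lam2"
  shows "sol \<epsilon> \<eta>1 \<eta>2 lam1 lam2" "\<bar>lam1 - l1\<bar> \<le> C * \<epsilon> powr (2/3)" "\<bar>lam2 - l2\<bar> \<le> C * \<epsilon> powr (2/3)"
    "\<bar>(\<eta>1 x)\<^sup>2 - A1 (nsq x)\<bar> \<le> C * \<epsilon> powr (2/3)" "\<bar>(\<eta>2 x)\<^sup>2 - A2 (nsq x)\<bar> \<le> C * \<epsilon> powr (2/3)"
  using assms unfolding close_def by blast+

lemma potential_ge:
  assumes "close C \<epsilon> \<eta>1 \<eta>2 lam1 lam2"
  shows "W1 (nsq x) - (g1 + g + 1) * C * \<epsilon> powr (2/3) \<le> nsq x + g1 * (\<eta>1 x)\<^sup>2 + g * (\<eta>2 x)\<^sup>2 - lam1"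
    "W2 (nsq x) - (g2 + g + 1) * C * \<epsilon> powr (2/3) \<le> nsq x + g2 * (\<eta>2 x)\<^sup>2 + g * (\<eta>1 x)\<^sup>2 - lam2"
proof -
  define d where "d = C * \<epsilon> powr (2/3)"
  note c = closeD[OF assms, folded d_def]
  have 1: "g1 * (A1 (nsq x) - d) \<le> g1 * (\<eta>1 x)\<^sup>2" "g * (A1 (nsq x) - d) \<le> g * (\<eta>1 x)\<^sup>2"
    "g2 * (A2 (nsq x) - d) \<le> g2 * (\<eta>2 x)\<^sup>2" "g * (A2 (nsq x) - d) \<le> g * (\<eta>2 x)\<^sup>2"
    using c(4,5)[of x] g_pos by (auto intro!: mult_left_mono simp: abs_le_iff)
  show "W1 (nsq x) - (g1 + g + 1) * C * \<epsilon> powr (2/3) \<le> nsq x + g1 * (\<eta>1 x)\<^sup>2 + g * (\<eta>2 x)\<^sup>2 - lam1"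
    "W2 (nsq x) - (g2 + g + 1) * C * \<epsilon> powr (2/3) \<le> nsq x + g2 * (\<eta>2 x)\<^sup>2 + g * (\<eta>1 x)\<^sup>2 - lam2"
    using 1 c(2,3) unfolding mult.assoc[of _ C] d_def[symmetric] W1_def W2_def by (simp_all add: algebra_simps abs_le_iff)
qed

lemma powr_third: "0 < \<epsilon> \<Longrightarrow> sqrt (\<epsilon> powr (2/3)) = \<epsilon> powr (1/3)" "0 < \<epsilon> \<Longrightarrow> \<epsilon> powr (2/3) = \<epsilon> powr (1/3) * \<epsilon> powr (1/3)" for \<epsilon> :: real
  by (simp_all add: powr_half_sqrt[symmetric] powr_powr powr_add[symmetric])

lemma sup_estimate:
  assumes "close C \<epsilon> \<eta>1 \<eta>2 lam1 lam2"
  shows "\<bar>\<eta>1 x - sqrt (A1 (nsq x))\<bar> \<le> sqrt C * \<epsilon> powr (1/3)" "\<bar>\<eta>2 x - sqrt (A2 (nsq x))\<bar> \<le> sqrt C * \<epsilon> powr (1/3)"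
proof -
  note c = closeD[OF assms] and S = solD[OF closeD(1)[OF assms]]
  have "sqrt \<bar>(\<eta>1 x)\<^sup>2 - A1 (nsq x)\<bar> \<le> sqrt C * \<epsilon> powr (1/3)" "sqrt \<bar>(\<eta>2 x)\<^sup>2 - A2 (nsq x)\<bar> \<le> sqrt C * \<epsilon> powr (1/3)"
    unfolding powr_third(1)[OF S(1), symmetric] real_sqrt_mult[symmetric] using c(4,5) by (auto intro!: real_sqrt_le_mono)
  then show "\<bar>\<eta>1 x - sqrt (A1 (nsq x))\<bar> \<le> sqrt C * \<epsilon> powr (1/3)" "\<bar>\<eta>2 x - sqrt (A2 (nsq x))\<bar> \<le> sqrt C * \<epsilon> powr (1/3)"
    using abs_diff_sqrt_le(1)[OF less_imp_le[OF S(2)] A_nonneg(1), of x "nsq x"] abs_diff_sqrt_le(1)[OF less_imp_le[OF S(3)] A_nonneg(2), of x "nsq x"]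
    by linarith+
qed

text \<open>At distance \<epsilon>^(1/3) from an edge the density is at least of order
  \<epsilon>^(1/3), so an absolute error \<epsilon>^(2/3) of the density is a relative error
  \<epsilon>^(1/3).\<close>

lemma relative_from_absolute:
  assumes "0 < \<epsilon>" "0 < C" "0 < c" "0 \<le> h" "\<bar>h\<^sup>2 - a\<bar> \<le> C * \<epsilon> powr (2/3)" "c * \<epsilon> powr (1/3) \<le> a"
  shows "\<bar>h - sqrt a\<bar> \<le> C / c * \<epsilon> powr (1/3) * sqrt a"
proof -
  let ?p = "\<epsilon> powr (1/3)"
  have "0 < c * ?p" using assms by simp
  then have a: "0 < a" using assms(6) by linarith
  have "\<bar>h - sqrt a\<bar> \<le> \<bar>h\<^sup>2 - a\<bar> / sqrt a" using abs_diff_sqrt_le(2)[OF assms(4) _ a] a by simp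
  also have "\<dots> \<le> (C / c * ?p * a) / sqrt a"
  proof (rule divide_right_mono)
    have "C * \<epsilon> powr (2/3) = C / c * ?p * (c * ?p)" using assms by (simp add: powr_third(2))
    also have "\<dots> \<le> C / c * ?p * a" using assms by (intro mult_left_mono) auto
    finally show "\<bar>h\<^sup>2 - a\<bar> \<le> C / c * ?p * a" using assms(5) by linarith
  qed (use a in simp)
  also have "\<dots> = C / c * ?p * sqrt a" using a by (simp only: times_divide_eq_right[symmetric] real_div_sqrt less_imp_le)
  finally show ?thesis .
qed

definition slope where "slope = min (min (1 / g1) k1) (min k2 (1 / g2))"

lemma slope: "0 < slope" "slope \<le> 1 / g1" "slope \<le> k1" "slope \<le> k2" "slope \<le> 1 / g2"
  using g_pos k_pos by (auto simp: slope_def)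

lemma A_lower:
  "s \<le> s2 \<Longrightarrow> slope * (s2 - s) \<le> A1 s"
  "s1 \<le> s \<Longrightarrow> s \<le> l2 \<Longrightarrow> t \<le> s - s1 \<Longrightarrow> t \<le> l2 - s \<Longrightarrow> 0 \<le> t \<Longrightarrow> slope * t \<le> A2 s"
proof -
  assume s: "s \<le> s2"
  have "slope * (s2 - s) \<le> (1 / g1) * (l1 - s)" using s slope l_order g_pos by (intro mult_mono) auto
  moreover have "slope * (s2 - s) \<le> k1 * (s2 - s)" using s slope by (intro mult_right_mono) auto
  ultimately show "slope * (s2 - s) \<le> A1 s" unfolding A1_min by simp
next
  assume s: "s1 \<le> s" "s \<le> l2" "t \<le> s - s1" "t \<le> l2 - s" "0 \<le> t"
  have "slope * t \<le> (1 / g2) * (l2 - s)" using s slope g_pos by (intro mult_mono) auto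
  moreover have "slope * t \<le> k2 * (s - s1)" using s slope k_pos by (intro mult_mono) auto
  ultimately show "slope * t \<le> A2 s" unfolding A2_min by simp
qed

lemma diff_square_ge:
  fixes r R t :: real
  assumes "0 \<le> r" "0 \<le> t" "r + t \<le> R" shows "R * t \<le> R\<^sup>2 - r\<^sup>2"
proof -
  have "R * t \<le> (R + r) * (R - r)" using assms by (intro mult_mono) auto
  also have "\<dots> = R\<^sup>2 - r\<^sup>2" by (simp add: power2_eq_square algebra_simps)
  finally show ?thesis .
qed

lemma relative_estimate:
  assumes cl: "close C \<epsilon> \<eta>1 \<eta>2 lam1 lam2" and C: "0 < C"
  shows "norm x \<le> sqrt s2 - \<epsilon> powr (1/3) \<Longrightarrow>
      \<bar>\<eta>1 x - sqrt (A1 (nsq x))\<bar> \<le> C / (slope * sqrt s1) * \<epsilon> powr (1/3) * sqrt (A1 (nsq x))"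
    "sqrt s1 + \<epsilon> powr (1/3) \<le> norm x \<Longrightarrow> norm x \<le> sqrt l2 - \<epsilon> powr (1/3) \<Longrightarrow>
      \<bar>\<eta>2 x - sqrt (A2 (nsq x))\<bar> \<le> C / (slope * sqrt s1) * \<epsilon> powr (1/3) * sqrt (A2 (nsq x))"
proof -
  note c = closeD[OF cl] and S = solD[OF closeD(1)[OF cl]]
  define t where "t = \<epsilon> powr (1/3)"
  have t: "0 < t" using S(1) by (simp add: t_def)
  have k: "0 < slope * sqrt s1" using slope s_ord by simp
  have sq: "(sqrt s1)\<^sup>2 = s1" "(sqrt s2)\<^sup>2 = s2" "(sqrt l2)\<^sup>2 = l2" "sqrt s1 \<le> sqrt s2" "sqrt s1 \<le> sqrt l2" using s_ord by auto
  have mt: "sqrt s1 * t \<le> y * t" if "sqrt s1 \<le> y" for y using that t by (intro mult_right_mono) auto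
  show "\<bar>\<eta>1 x - sqrt (A1 (nsq x))\<bar> \<le> C / (slope * sqrt s1) * \<epsilon> powr (1/3) * sqrt (A1 (nsq x))" if x: "norm x \<le> sqrt s2 - \<epsilon> powr (1/3)"
  proof (rule relative_from_absolute[OF S(1) C k less_imp_le[OF S(2)] c(4)])
    have d: "sqrt s1 * t \<le> s2 - nsq x"
      by (rule order_trans[OF mt[OF sq(4)] diff_square_ge[of "norm x" t "sqrt s2", unfolded sq]]) (use x t in \<open>auto simp: t_def\<close>)
    have "0 \<le> sqrt s1 * t" using t s_ord by simp
    then have "slope * (s2 - nsq x) \<le> A1 (nsq x)" using d by (intro A_lower(1)) linarith
    moreover have "slope * (sqrt s1 * t) \<le> slope * (s2 - nsq x)" using d slope by (intro mult_left_mono) auto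
    ultimately show "slope * sqrt s1 * \<epsilon> powr (1/3) \<le> A1 (nsq x)" unfolding t_def by (simp add: mult.assoc)
  qed
  show "\<bar>\<eta>2 x - sqrt (A2 (nsq x))\<bar> \<le> C / (slope * sqrt s1) * \<epsilon> powr (1/3) * sqrt (A2 (nsq x))"
    if x: "sqrt s1 + \<epsilon> powr (1/3) \<le> norm x" "norm x \<le> sqrt l2 - \<epsilon> powr (1/3)"
  proof (rule relative_from_absolute[OF S(1) C k less_imp_le[OF S(3)] c(5)])
    have "sqrt s1 \<le> norm x" using x t unfolding t_def by linarith
    then have 1: "sqrt s1 * t \<le> nsq x - s1"
      by (intro order_trans[OF mt diff_square_ge[of "sqrt s1" t "norm x", unfolded sq]]) (use x t s_ord in \<open>auto simp: t_def\<close>)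
    have 2: "sqrt s1 * t \<le> l2 - nsq x"
      by (rule order_trans[OF mt[OF sq(5)] diff_square_ge[of "norm x" t "sqrt l2", unfolded sq]]) (use x t in \<open>auto simp: t_def\<close>)
    have 0: "0 \<le> sqrt s1 * t" using t s_ord by simp
    have "slope * (sqrt s1 * t) \<le> A2 (nsq x)" using 0 1 2 by (intro A_lower(2)) linarith+
    then show "slope * sqrt s1 * \<epsilon> powr (1/3) \<le> A2 (nsq x)" unfolding t_def by (simp add: mult.assoc)
  qed
qed

text \<open>At distance \<open>(8 + B) / (w * R) * e\<close> beyond the edge the growth of the
  potential has reached \<open>(8 + B) * e\<close>: the part \<open>B * e\<close> makes up for the
  loss in \<open>potential_ge\<close>, and \<open>8 * e\<close> is what \<open>exp_decay\<close>
  asks for.\<close>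

lemma decay_constant:
  assumes e: "0 < e" and R: "0 < R" and w: "0 < w" and y: "R + (8 + B) / (w * R) * e \<le> norm y" and B: "0 \<le> B"
  shows "R \<le> norm y" "(8 + B) * e \<le> w * (nsq y - R\<^sup>2)"
proof -
  have t: "0 \<le> (8 + B) / (w * R) * e" using e R w B by (intro mult_nonneg_nonneg divide_nonneg_nonneg) auto
  then show "R \<le> norm y" using y by linarith
  have "R * ((8 + B) / (w * R) * e) \<le> norm y * ((8 + B) / (w * R) * e)" using t \<open>R \<le> norm y\<close> by (intro mult_right_mono)
  also have "\<dots> \<le> nsq y - R\<^sup>2" using R by (intro diff_square_ge t y) auto
  finally have "w * (R * ((8 + B) / (w * R) * e)) \<le> w * (nsq y - R\<^sup>2)" using w by (intro mult_left_mono) auto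
  moreover have "w * (R * ((8 + B) / (w * R) * e)) = (8 + B) * e" using w R by (simp add: field_simps)
  ultimately show "(8 + B) * e \<le> w * (nsq y - R\<^sup>2)" by linarith
qed

lemma decay_estimate:
  assumes C: "0 < C"
  shows "\<exists>C'>0. \<forall>\<epsilon> \<eta>1 \<eta>2 lam1 lam2. close C \<epsilon> \<eta>1 \<eta>2 lam1 lam2 \<longrightarrow>
    (\<forall>x. sqrt s2 \<le> norm x \<longrightarrow> \<eta>1 x \<le> C' * \<epsilon> powr (1/3) * exp (- ln 2 * ((norm x - sqrt s2) / \<epsilon> powr (2/3)))) \<and>
    (\<forall>x. sqrt l2 \<le> norm x \<longrightarrow> \<eta>2 x \<le> C' * \<epsilon> powr (1/3) * exp (- ln 2 * ((norm x - sqrt l2) / \<epsilon> powr (2/3))))"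
proof -
  define w where "w = 1 - g / g2"
  have w: "0 < w" using g_less g_pos by (simp add: w_def)
  have sq: "(sqrt s2)\<^sup>2 = s2" "(sqrt l2)\<^sup>2 = l2" "0 < sqrt s2" "0 < sqrt l2" using s_ord by auto
  define B1 B2 where "B1 = (g1 + g + 1) * C" and "B2 = (g2 + g + 1) * C"
  have B: "0 \<le> B1" "0 \<le> B2" using g_pos C by (auto simp: B1_def B2_def)
  define L1 L2 where "L1 = (8 + B1) / (w * sqrt s2)" and "L2 = (8 + B2) / (1 * sqrt l2)"
  have L12: "0 \<le> L1" "0 \<le> L2" using B w s_ord by (auto simp: L1_def L2_def)
  define C' where "C' = sqrt C * 2 powr (max L1 L2 + 1)"
  have C'0: "0 < C'" using C by (simp add: C'_def)
  have "(\<forall>x. sqrt s2 \<le> norm x \<longrightarrow> \<eta>1 x \<le> C' * \<epsilon> powr (1/3) * exp (- ln 2 * ((norm x - sqrt s2) / \<epsilon> powr (2/3)))) \<and>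
    (\<forall>x. sqrt l2 \<le> norm x \<longrightarrow> \<eta>2 x \<le> C' * \<epsilon> powr (1/3) * exp (- ln 2 * ((norm x - sqrt l2) / \<epsilon> powr (2/3))))"
    if cl: "close C \<epsilon> \<eta>1 \<eta>2 lam1 lam2" for \<epsilon> \<eta>1 \<eta>2 lam1 lam2
  proof -
    note S = solD[OF closeD(1)[OF cl]] and pot = potential_ge[OF cl]
    define e where "e = \<epsilon> powr (2/3)"
    have e: "0 < e" "\<epsilon>\<^sup>2 = e ^ 3" using S(1) powr_two_thirds by (auto simp: e_def)
    have m0: "0 \<le> sqrt C * \<epsilon> powr (1/3)" using C by simp
    have mono: "sqrt C * \<epsilon> powr (1/3) * 2 powr (l + 1) * E \<le> C' * \<epsilon> powr (1/3) * E" if "l \<le> max L1 L2" "0 \<le> E" for l E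
    proof -
      have "2 powr (l + 1) \<le> 2 powr (max L1 L2 + 1)" using that by (intro powr_mono) auto
      then have "sqrt C * \<epsilon> powr (1/3) * 2 powr (l + 1) * E \<le> sqrt C * \<epsilon> powr (1/3) * 2 powr (max L1 L2 + 1) * E"
        using m0 that by (intro mult_right_mono mult_left_mono) auto
      then show ?thesis by (simp add: C'_def mult_ac)
    qed
    have 1: "\<eta>1 x \<le> sqrt C * \<epsilon> powr (1/3) * 2 powr (L1 + 1) * exp (- ln 2 * ((norm x - sqrt s2) / e))" if x: "sqrt s2 \<le> norm x" for x
    proof (rule exp_decay[OF S(4) e _ _ m0 L12(1) x])
      fix y :: "real^2" assume y: "sqrt s2 + L1 * e \<le> norm y"
      note k = decay_constant[OF e(1) sq(3) w y[unfolded L1_def] B(1)]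
      have "s2 \<le> nsq y" using power_mono[OF k(1), of 2] sq by simp
      then have "(8 + B1) * e \<le> W1 (nsq y)" using W_ge(1)[of "nsq y"] k(2) unfolding sq w_def by simp
      then have "8 * e \<le> nsq y + g1 * (\<eta>1 y)\<^sup>2 + g * (\<eta>2 y)\<^sup>2 - lam1" using pot(1)[of y, folded e_def B1_def] unfolding distrib_right by linarith
      then show "8 * e * \<eta>1 y \<le> \<epsilon>\<^sup>2 * laplacian \<eta>1 y" unfolding S(6) mult.commute[of "8 * e"]
        using S(2)[of y] by (intro mult_left_mono) auto
    next
      fix y :: "real^2" assume y: "sqrt s2 \<le> norm y"
      have "s2 \<le> nsq y" using power_mono[OF y, of 2] sq by simp
      then show "\<eta>1 y \<le> sqrt C * \<epsilon> powr (1/3)" using sup_estimate(1)[OF cl, of y] A_zero(1)[of "nsq y"] by simp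
    qed
    have 2: "\<eta>2 x \<le> sqrt C * \<epsilon> powr (1/3) * 2 powr (L2 + 1) * exp (- ln 2 * ((norm x - sqrt l2) / e))" if x: "sqrt l2 \<le> norm x" for x
    proof (rule exp_decay[OF S(5) e _ _ m0 L12(2) x])
      fix y :: "real^2" assume y: "sqrt l2 + L2 * e \<le> norm y"
      note k = decay_constant[OF e(1) sq(4) zero_less_one y[unfolded L2_def] B(2)]
      have "0 \<le> sqrt l2" using sq by simp
      then have "l2 \<le> nsq y" using power_mono[OF k(1), of 2] unfolding sq by simp
      then have "(8 + B2) * e \<le> W2 (nsq y)" using W_ge(2)[of "nsq y"] k(2) unfolding sq by simp
      then have "8 * e \<le> nsq y + g2 * (\<eta>2 y)\<^sup>2 + g * (\<eta>1 y)\<^sup>2 - lam2" using pot(2)[of y, folded e_def B2_def] unfolding distrib_right by linarith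
      then show "8 * e * \<eta>2 y \<le> \<epsilon>\<^sup>2 * laplacian \<eta>2 y" unfolding S(7) mult.commute[of "8 * e"]
        using S(3)[of y] by (intro mult_left_mono) auto
    next
      fix y :: "real^2" assume y: "sqrt l2 \<le> norm y"
      have "0 \<le> sqrt l2" using sq by simp
      then have "l2 \<le> nsq y" using power_mono[OF y, of 2] unfolding sq by simp
      then show "\<eta>2 y \<le> sqrt C * \<epsilon> powr (1/3)" using sup_estimate(2)[OF cl, of y] A_zero(3)[of "nsq y"] by simp
    qed
    show ?thesis
      using order_trans[OF 1 mono[of L1]] order_trans[OF 2 mono[of L2]] unfolding e_def by simp
  qed
  then show ?thesis using C'0 by blast
qed

text \<open>On a ball of fixed radius where \<open>W1\<close>, or \<open>W2\<close>, is at least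
  \<open>w\<close> the potential of that component stays above \<open>w / 2\<close> and the
  component is at most 1, so a single use of \<open>local_decay\<close> already gives
  \<epsilon>^2.\<close>

lemma small_component:
  assumes C: "0 < C" and w: "0 < w" and \<rho>: "0 < \<rho>"
  shows "\<forall>\<^sub>F \<epsilon> in at_right 0. \<forall>\<eta>1 \<eta>2 lam1 lam2. close C \<epsilon> \<eta>1 \<eta>2 lam1 lam2 \<longrightarrow>
    (\<forall>x. (\<forall>y\<in>cball x \<rho>. w \<le> W1 (nsq y)) \<longrightarrow> \<eta>1 x \<le> 8 / (w * \<rho>\<^sup>2) * \<epsilon>\<^sup>2) \<and>
    (\<forall>x. (\<forall>y\<in>cball x \<rho>. w \<le> W2 (nsq y)) \<longrightarrow> \<eta>2 x \<le> 8 / (w * \<rho>\<^sup>2) * \<epsilon>\<^sup>2)"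
proof -
  have k0: "0 < g1 + g + 1" "0 < g2 + g + 1" using g_pos by auto
  have "\<forall>\<^sub>F \<epsilon> in at_right 0. (g1 + g + 1) * C * \<epsilon> powr (2/3) \<le> w / 2" "\<forall>\<^sub>F \<epsilon> in at_right 0. (g2 + g + 1) * C * \<epsilon> powr (2/3) \<le> w / 2"
    "\<forall>\<^sub>F \<epsilon> in at_right 0. C * \<epsilon> powr (2/3) \<le> 1"
    using k0 w C by real_asymp+
  then show ?thesis
  proof eventually_elim
    case (elim \<epsilon>)
    have "(\<forall>x. (\<forall>y\<in>cball x \<rho>. w \<le> W1 (nsq y)) \<longrightarrow> \<eta>1 x \<le> 8 / (w * \<rho>\<^sup>2) * \<epsilon>\<^sup>2) \<and>
      (\<forall>x. (\<forall>y\<in>cball x \<rho>. w \<le> W2 (nsq y)) \<longrightarrow> \<eta>2 x \<le> 8 / (w * \<rho>\<^sup>2) * \<epsilon>\<^sup>2)"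
      if cl: "close C \<epsilon> \<eta>1 \<eta>2 lam1 lam2" for \<eta>1 \<eta>2 lam1 lam2
    proof -
      note c = closeD[OF cl] and S = solD[OF closeD(1)[OF cl]] and pot = potential_ge[OF cl]
      have w2: "0 < w / 2" using w by simp
      have *: "\<eta> x \<le> 8 / (w * \<rho>\<^sup>2) * \<epsilon>\<^sup>2"
        if \<eta>: "C_k 2 \<eta>" "\<And>x. 0 < \<eta> x" "\<And>y. \<epsilon>\<^sup>2 * laplacian \<eta> y = \<eta> y * q y" and q: "\<And>y. y \<in> cball x \<rho> \<Longrightarrow> w / 2 \<le> q y"
          and n: "\<And>y. y \<in> cball x \<rho> \<Longrightarrow> (\<eta> y)\<^sup>2 \<le> 1" for \<eta> q x
      proof -
        have "\<eta> x \<le> 4 * \<epsilon>\<^sup>2 / (w / 2 * \<rho>\<^sup>2) * 1"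
        proof (rule local_decay[OF \<eta>(1) \<rho> w2])
          show "w / 2 * \<eta> y \<le> \<epsilon>\<^sup>2 * laplacian \<eta> y" if "y \<in> ball x \<rho>" for y
            unfolding \<eta>(3) mult.commute[of "w / 2"] using q[of y] that \<eta>(2)[of y] by (intro mult_left_mono) auto
          show "\<eta> y \<le> 1" if "y \<in> cball x \<rho>" for y using n[OF that] \<eta>(2)[of y] by (simp add: abs_square_le_1)
        qed simp
        then show ?thesis by (simp add: field_simps)
      qed
      have "\<eta>1 x \<le> 8 / (w * \<rho>\<^sup>2) * \<epsilon>\<^sup>2" if x: "\<forall>y\<in>cball x \<rho>. w \<le> W1 (nsq y)" for x
      proof (rule *[OF S(4,2,6)])
        fix y assume y: "y \<in> cball x \<rho>"
        show "w / 2 \<le> nsq y + g1 * (\<eta>1 y)\<^sup>2 + g * (\<eta>2 y)\<^sup>2 - lam1" using bspec[OF x y] pot(1)[of y] elim(1) by linarith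
        have "A1 (nsq y) = 0" using bspec[OF x y] w WA_zero(1)[of "nsq y"] by auto
        then show "(\<eta>1 y)\<^sup>2 \<le> 1" using c(4)[of y] elim(3) by simp
      qed
      moreover have "\<eta>2 x \<le> 8 / (w * \<rho>\<^sup>2) * \<epsilon>\<^sup>2" if x: "\<forall>y\<in>cball x \<rho>. w \<le> W2 (nsq y)" for x
      proof (rule *[OF S(5,3,7)])
        fix y assume y: "y \<in> cball x \<rho>"
        show "w / 2 \<le> nsq y + g2 * (\<eta>2 y)\<^sup>2 + g * (\<eta>1 y)\<^sup>2 - lam2" using bspec[OF x y] pot(2)[of y] elim(2) by linarith
        have "A2 (nsq y) = 0" using bspec[OF x y] w WA_zero(2)[of "nsq y"] by auto
        then show "(\<eta>2 y)\<^sup>2 \<le> 1" using c(5)[of y] elim(3) by simp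
      qed
      ultimately show ?thesis by blast
    qed
    then show ?case by blast
  qed
qed

end

section \<open>Estimates away from the interfaces\<close>

context tf_data
begin

text \<open>The density is compared with the multiplier \<open>lam1\<close> or \<open>lam2\<close>
  of the solution, not with its limit. This keeps the error at \<epsilon>^2 before the multipliers
  are known to that order, so the predicate can be used to determine them.\<close>

definition one_phase :: "real \<Rightarrow> real \<Rightarrow> real \<Rightarrow> real \<Rightarrow> (real^2 \<Rightarrow> real) \<Rightarrow> (real^2 \<Rightarrow> real) \<Rightarrow> real \<Rightarrow> real \<Rightarrow> bool" where
  "one_phase r B c m \<eta>1 \<eta>2 lam1 lam2 \<longleftrightarrow>
    (\<forall>x. norm x \<le> B \<longrightarrow> (\<forall>y\<in>cball x r. c \<le> A1 (nsq y) \<and> c \<le> W2 (nsq y)) \<longrightarrow>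
       \<bar>g1 * (\<eta>1 x)\<^sup>2 + nsq x - lam1\<bar> \<le> m \<and> \<eta>2 x \<le> m) \<and>
    (\<forall>x. norm x \<le> B \<longrightarrow> (\<forall>y\<in>cball x r. c \<le> A2 (nsq y) \<and> c \<le> W1 (nsq y)) \<longrightarrow>
       \<bar>g2 * (\<eta>2 x)\<^sup>2 + nsq x - lam2\<bar> \<le> m \<and> \<eta>1 x \<le> m)"

definition two_phase :: "real \<Rightarrow> real \<Rightarrow> real \<Rightarrow> real \<Rightarrow> (real^2 \<Rightarrow> real) \<Rightarrow> (real^2 \<Rightarrow> real) \<Rightarrow> bool" where
  "two_phase r B c m \<eta>1 \<eta>2 \<longleftrightarrow>
    (\<forall>x. norm x \<le> B \<longrightarrow> (\<forall>y\<in>cball x r. c \<le> A1 (nsq y) \<and> c \<le> A2 (nsq y)) \<longrightarrow>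
       \<bar>(\<eta>1 x)\<^sup>2 - A1 (nsq x)\<bar> \<le> m \<and> \<bar>(\<eta>2 x)\<^sup>2 - A2 (nsq x)\<bar> \<le> m)"

text \<open>The radius is spent twice: balls of radius \<open>\<rho>\<close> about the points of
  \<open>cball x \<rho>\<close> make the absent component O(\<epsilon>^2) there, and then
  \<open>interior_single\<close> is applied on \<open>cball x \<rho>\<close>. The absent component
  enters squared, which is well within O(\<epsilon>^2).\<close>

lemma interior_one:
  assumes C: "0 < C" and c: "0 < c" and \<rho>: "0 < \<rho>" and B: "0 \<le> B"
  shows "\<exists>C'>0. \<forall>\<^sub>F \<epsilon> in at_right 0. \<forall>\<eta>1 \<eta>2 lam1 lam2. close C \<epsilon> \<eta>1 \<eta>2 lam1 lam2 \<longrightarrow>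
    one_phase (2 * \<rho>) B c (C' * \<epsilon>\<^sup>2) \<eta>1 \<eta>2 lam1 lam2"
proof -
  define K where "K = 8 / (c * \<rho>\<^sup>2)"
  define T where "T \<gamma> = touch_const (1 / \<gamma>) (1 / \<gamma> / \<rho>\<^sup>2) (B + \<rho>) \<rho> (c / 2)" for \<gamma>
  define C' where "C' = g * K\<^sup>2 + T g1 + T g2 + K"
  have K: "0 < K" using c \<rho> by (simp add: K_def)
  have T: "0 \<le> T \<gamma>" if "0 < \<gamma>" for \<gamma>
    unfolding T_def by (rule touch_const_mono(2)[where b'="1 / \<gamma>" and k'="1 / \<gamma> / \<rho>\<^sup>2"]) (use that c \<rho> B in auto)
  have gK: "0 \<le> g * K\<^sup>2" using g_pos by simp
  have C': "0 < C'" "K \<le> C'" "g * K\<^sup>2 + T g1 \<le> C'" "g * K\<^sup>2 + T g2 \<le> C'"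
    unfolding C'_def using K T[OF g_pos(1)] T[OF g_pos(2)] gK by linarith+
  have k0: "0 < g1 + 1" "0 < g2 + 1" using g_pos by auto
  have "\<forall>\<^sub>F \<epsilon> in at_right 0. (g1 + 1) * (C * \<epsilon> powr (2/3)) \<le> 1" "\<forall>\<^sub>F \<epsilon> in at_right 0. (g2 + 1) * (C * \<epsilon> powr (2/3)) \<le> 1"
    "\<forall>\<^sub>F \<epsilon> in at_right 0. C * \<epsilon> powr (2/3) \<le> c / 2" "\<forall>\<^sub>F \<epsilon> in at_right 0. \<epsilon>\<^sup>2 \<le> (1::real)"
    using k0 c C by real_asymp+
  moreover note small_component[OF C c \<rho>]
  ultimately have "\<forall>\<^sub>F \<epsilon> in at_right 0. \<forall>\<eta>1 \<eta>2 lam1 lam2. close C \<epsilon> \<eta>1 \<eta>2 lam1 lam2 \<longrightarrow>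
    one_phase (2 * \<rho>) B c (C' * \<epsilon>\<^sup>2) \<eta>1 \<eta>2 lam1 lam2"
  proof eventually_elim
    case (elim \<epsilon>)
    have core: "\<bar>\<gamma> * (u x)\<^sup>2 + nsq x - lam\<bar> \<le> C' * \<epsilon>\<^sup>2 \<and> v x \<le> C' * \<epsilon>\<^sup>2"
      if x: "norm x \<le> B" and u: "C_k 2 u" "\<And>x. 0 < u x" "\<And>x. 0 < v x"
        and eq: "\<And>x. \<epsilon>\<^sup>2 * laplacian u x = u x * (nsq x + \<gamma> * (u x)\<^sup>2 + g * (v x)\<^sup>2 - lam)"
        and \<gamma>: "0 < \<gamma>" "(\<gamma> + 1) * (C * \<epsilon> powr (2/3)) \<le> 1" "g * K\<^sup>2 + T \<gamma> \<le> C'"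
        and A: "\<And>y. y \<in> cball x (2 * \<rho>) \<Longrightarrow> c \<le> A (nsq y)" "\<And>y. y \<in> cball x (2 * \<rho>) \<Longrightarrow> nsq y + \<gamma> * A (nsq y) = l"
        and n: "\<And>y. \<bar>(u y)\<^sup>2 - A (nsq y)\<bar> \<le> C * \<epsilon> powr (2/3)"
        and v: "\<And>y. y \<in> cball x \<rho> \<Longrightarrow> v y \<le> K * \<epsilon>\<^sup>2" and \<delta>: "\<bar>lam - l\<bar> \<le> C * \<epsilon> powr (2/3)"
      for x u v \<gamma> lam l A
    proof -
      have sub: "y \<in> cball x (2 * \<rho>)" if "y \<in> cball x \<rho>" for y using that \<rho> by auto
      have c2: "0 < c / 2" "0 \<le> B + \<rho>" "0 \<le> g * K\<^sup>2 * \<epsilon>\<^sup>2" using c B \<rho> g_pos by auto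
      have "\<bar>\<gamma> * (u x)\<^sup>2 + nsq x - lam\<bar> \<le> g * K\<^sup>2 * \<epsilon>\<^sup>2 + \<epsilon>\<^sup>2 * touch_const (1 / \<gamma>) (1 / \<gamma> / \<rho>\<^sup>2) (B + \<rho>) \<rho> (c / 2)"
      proof (rule interior_single[OF u(1,2) \<rho> \<gamma>(1) c2, where q="\<lambda>x. g * (v x)\<^sup>2"])
        fix y assume y: "y \<in> cball x \<rho>"
        show "c / 2 \<le> (u y)\<^sup>2" using A(1)[OF sub[OF y]] n[of y] elim(3) by linarith
        show "norm y \<le> B + \<rho>" using x y norm_triangle_ineq2[of y x] norm_minus_commute[of y x] by (simp add: dist_norm)
        show "\<epsilon>\<^sup>2 * laplacian u y = u y * (\<gamma> * (u y)\<^sup>2 + nsq y - lam + g * (v y)\<^sup>2)" unfolding eq by (simp add: algebra_simps)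
        have "(v y)\<^sup>2 \<le> (K * \<epsilon>\<^sup>2)\<^sup>2" using v[OF y] u(3)[of y] by (intro power_mono) auto
        also have "\<dots> = K\<^sup>2 * (\<epsilon>\<^sup>2 * \<epsilon>\<^sup>2)" by (simp add: power2_eq_square)
        also have "\<dots> \<le> K\<^sup>2 * (\<epsilon>\<^sup>2 * 1)" using elim(4) by (intro mult_left_mono) auto
        finally have "g * (v y)\<^sup>2 \<le> g * (K\<^sup>2 * \<epsilon>\<^sup>2)" using g_pos by (intro mult_left_mono) auto
        then show "\<bar>g * (v y)\<^sup>2\<bar> \<le> g * K\<^sup>2 * \<epsilon>\<^sup>2" using g_pos by (simp add: mult.assoc)
        have "\<bar>\<gamma> * ((u y)\<^sup>2 - A (nsq y))\<bar> \<le> \<gamma> * (C * \<epsilon> powr (2/3))"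
          unfolding abs_mult using n[of y] \<gamma>(1) by (simp add: mult_left_mono)
        moreover have "\<gamma> * (u y)\<^sup>2 + nsq y - lam = \<gamma> * ((u y)\<^sup>2 - A (nsq y)) - (lam - l)"
          using A(2)[OF sub[OF y]] by (simp add: algebra_simps)
        ultimately show "\<bar>\<gamma> * (u y)\<^sup>2 + nsq y - lam\<bar> \<le> 1" using \<delta> \<gamma>(2) unfolding distrib_right by linarith
      qed
      also have "\<dots> = (g * K\<^sup>2 + T \<gamma>) * \<epsilon>\<^sup>2" by (simp add: T_def algebra_simps)
      also have "\<dots> \<le> C' * \<epsilon>\<^sup>2" using \<gamma>(3) by (intro mult_right_mono) auto
      finally have 1: "\<bar>\<gamma> * (u x)\<^sup>2 + nsq x - lam\<bar> \<le> C' * \<epsilon>\<^sup>2" .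
      have "K * \<epsilon>\<^sup>2 \<le> C' * \<epsilon>\<^sup>2" using C'(2) by (intro mult_right_mono) auto
      then show ?thesis using 1 v[of x] \<rho> by simp
    qed
    show ?case
      unfolding one_phase_def
    proof (intro allI impI conjI)
      fix \<eta>1 \<eta>2 lam1 lam2 and x :: "real^2" assume cl: "close C \<epsilon> \<eta>1 \<eta>2 lam1 lam2" and x: "norm x \<le> B"
        and h: "\<forall>y\<in>cball x (2 * \<rho>). c \<le> A1 (nsq y) \<and> c \<le> W2 (nsq y)"
      note d = closeD[OF cl] and S = solD[OF closeD(1)[OF cl]]
      have e: "nsq y + g1 * A1 (nsq y) = l1" if "y \<in> cball x (2 * \<rho>)" for y
        using bspec[OF h that] WA_zero[of "nsq y"] c by (auto simp: W1_def)
      have v: "\<eta>2 y \<le> K * \<epsilon>\<^sup>2" if y: "y \<in> cball x \<rho>" for y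
      proof -
        have "z \<in> cball x (2 * \<rho>)" if "z \<in> cball y \<rho>" for z using y that dist_triangle[of x z y] by simp
        then show ?thesis using elim(5) cl h unfolding K_def by blast
      qed
      have "\<bar>g1 * (\<eta>1 x)\<^sup>2 + nsq x - lam1\<bar> \<le> C' * \<epsilon>\<^sup>2 \<and> \<eta>2 x \<le> C' * \<epsilon>\<^sup>2"
        by (rule core[OF x S(4,2,3,6) g_pos(1) elim(1) C'(3) _ e d(4) v d(2)]) (use h in auto)
      then show "\<bar>g1 * (\<eta>1 x)\<^sup>2 + nsq x - lam1\<bar> \<le> C' * \<epsilon>\<^sup>2" "\<eta>2 x \<le> C' * \<epsilon>\<^sup>2" by auto
    next
      fix \<eta>1 \<eta>2 lam1 lam2 and x :: "real^2" assume cl: "close C \<epsilon> \<eta>1 \<eta>2 lam1 lam2" and x: "norm x \<le> B"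
        and h: "\<forall>y\<in>cball x (2 * \<rho>). c \<le> A2 (nsq y) \<and> c \<le> W1 (nsq y)"
      note d = closeD[OF cl] and S = solD[OF closeD(1)[OF cl]]
      have e: "nsq y + g2 * A2 (nsq y) = l2" if "y \<in> cball x (2 * \<rho>)" for y
        using bspec[OF h that] WA_zero[of "nsq y"] c by (auto simp: W2_def)
      have v: "\<eta>1 y \<le> K * \<epsilon>\<^sup>2" if y: "y \<in> cball x \<rho>" for y
      proof -
        have "z \<in> cball x (2 * \<rho>)" if "z \<in> cball y \<rho>" for z using y that dist_triangle[of x z y] by simp
        then show ?thesis using elim(5) cl h unfolding K_def by blast
      qed
      have "\<bar>g2 * (\<eta>2 x)\<^sup>2 + nsq x - lam2\<bar> \<le> C' * \<epsilon>\<^sup>2 \<and> \<eta>1 x \<le> C' * \<epsilon>\<^sup>2"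
        by (rule core[OF x S(5,3,2,7) g_pos(2) elim(2) C'(4) _ e d(5) v d(3)]) (use h in auto)
      then show "\<bar>g2 * (\<eta>2 x)\<^sup>2 + nsq x - lam2\<bar> \<le> C' * \<epsilon>\<^sup>2" "\<eta>1 x \<le> C' * \<epsilon>\<^sup>2" by auto
    qed
  qed
  then show ?thesis using C' by blast
qed

text \<open>Where both densities are positive the profile is affine in \<open>|x|\<^sup>2\<close>,
  and the reaction terms are linear in the deviations up to the errors of the multipliers, which
  stay explicit in the bound.\<close>

lemma interior_two:
  assumes C: "0 < C" and c: "0 < c" and \<rho>: "0 < \<rho>" and B: "0 \<le> B"
  shows "\<exists>C'>0. \<forall>\<^sub>F \<epsilon> in at_right 0. \<forall>\<eta>1 \<eta>2 lam1 lam2. close C \<epsilon> \<eta>1 \<eta>2 lam1 lam2 \<longrightarrow>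
    two_phase \<rho> B c (C' * (\<epsilon>\<^sup>2 + \<bar>lam1 - l1\<bar> + \<bar>lam2 - l2\<bar>)) \<eta>1 \<eta>2"
proof -
  define b where "b = max k1 k2"
  define T where "T = touch_const b (g / g1 / \<rho>\<^sup>2) (B + \<rho>) \<rho> (c / 2)"
  have T: "0 \<le> T"
    unfolding T_def by (rule touch_const_mono(2)[where b'=b and k'="g / g1 / \<rho>\<^sup>2"]) (use k_pos g_pos c \<rho> B in \<open>auto simp: b_def\<close>)
  define P where "P = (g2 + g) / (g1 * g2 - g\<^sup>2)"
  have gg: "0 < g1 * g2 - g\<^sup>2" "g1 * g2 - g\<^sup>2 = g2 * g1 - g\<^sup>2" using g_det by (simp_all add: mult.commute)
  have P: "0 < P" unfolding P_def using gg(1) g_pos by (intro divide_pos_pos) auto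
  have c2: "0 < c / 2" "0 \<le> B + \<rho>" using c B \<rho> by auto
  have det: "g\<^sup>2 < g2 * g1" using g_det by (simp add: mult.commute)
  \<comment> \<open>Heights of the barriers: \<open>g / g1\<close> for the first component and 1 for
    the second. Then \<open>g * 1 = g1 * (g / g1)\<close>, and \<open>g * (g / g1) \<le> g2\<close>
    is the determinant condition.\<close>
  have \<alpha>: "1 \<le> g / g1" "(1::real) \<le> 1" "g * 1 \<le> g1 * (g / g1)" "g * (g / g1) \<le> g2 * 1" "g / g1 \<le> g / g1"
    using g_pos g1_less g_det by (auto simp: field_simps power2_eq_square)
  have bk: "\<bar>- k1\<bar> \<le> b" "\<bar>k2\<bar> \<le> b" using k_pos by (auto simp: b_def)
  have "\<forall>\<^sub>F \<epsilon> in at_right 0. C * \<epsilon> powr (2/3) \<le> 1" "\<forall>\<^sub>F \<epsilon> in at_right 0. C * \<epsilon> powr (2/3) \<le> c / 2" using c C by real_asymp+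
  then have "\<forall>\<^sub>F \<epsilon> in at_right 0. \<forall>\<eta>1 \<eta>2 lam1 lam2. close C \<epsilon> \<eta>1 \<eta>2 lam1 lam2 \<longrightarrow>
    two_phase \<rho> B c (P * (1 + T) * (\<epsilon>\<^sup>2 + \<bar>lam1 - l1\<bar> + \<bar>lam2 - l2\<bar>)) \<eta>1 \<eta>2"
  proof eventually_elim
    case (elim \<epsilon>)
    show ?case
      unfolding two_phase_def
    proof (intro allI impI)
      fix \<eta>1 \<eta>2 lam1 lam2 and x :: "real^2" assume cl: "close C \<epsilon> \<eta>1 \<eta>2 lam1 lam2" and x: "norm x \<le> B"
        and h: "\<forall>y\<in>cball x \<rho>. c \<le> A1 (nsq y) \<and> c \<le> A2 (nsq y)"
      note d = closeD[OF cl] and S = solD[OF closeD(1)[OF cl]]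
      define D1 D2 where "D1 y = (\<eta>1 y)\<^sup>2 - (k1 * s2 + (- k1) * nsq y)" and "D2 y = (\<eta>2 y)\<^sup>2 - (- (k2 * s1) + k2 * nsq y)" for y
      have aff: "A1 (nsq y) = k1 * s2 + (- k1) * nsq y" "A2 (nsq y) = - (k2 * s1) + k2 * nsq y"
        and W: "W1 (nsq y) = 0" "W2 (nsq y) = 0" if y: "y \<in> cball x \<rho>" for y
      proof -
        have p: "0 < A1 (nsq y)" "0 < A2 (nsq y)" using bspec[OF h y] c by auto
        then have "s1 < nsq y" "nsq y < s2" using A_zero(1)[of "nsq y"] A_zero(2)[of "nsq y"] by force+
        then show "A1 (nsq y) = k1 * s2 + (- k1) * nsq y" "A2 (nsq y) = - (k2 * s1) + k2 * nsq y"
          by (simp_all add: A1_def A2_def algebra_simps)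
        show "W1 (nsq y) = 0" "W2 (nsq y) = 0" using p WA_zero[of "nsq y"] by auto
      qed
      have D: "D1 y = (\<eta>1 y)\<^sup>2 - A1 (nsq y)" "D2 y = (\<eta>2 y)\<^sup>2 - A2 (nsq y)" if "y \<in> cball x \<rho>" for y
        using aff[OF that] by (simp_all add: D1_def D2_def)
      have n: "c / 2 \<le> (\<eta>1 y)\<^sup>2" "c / 2 \<le> (\<eta>2 y)\<^sup>2" if y: "y \<in> cball x \<rho>" for y
        using bspec[OF h y] d(4,5)[of y] elim(2) by linarith+
      have R: "norm y \<le> B + \<rho>" if "y \<in> cball x \<rho>" for y
        using x that norm_triangle_ineq2[of y x] norm_minus_commute[of y x] by (simp add: dist_norm)
      have s: "\<bar>D1 y\<bar> \<le> 1" "\<bar>D2 y\<bar> \<le> 1" if y: "y \<in> cball x \<rho>" for y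
        unfolding D[OF y] using d(4,5)[of y] elim(1) by linarith+
      have e1: "\<epsilon>\<^sup>2 * laplacian \<eta>1 y = \<eta>1 y * (g1 * D1 y + g * D2 y - (lam1 - l1))" if y: "y \<in> cball x \<rho>" for y
        unfolding S(6) D[OF y] using W(1)[OF y] unfolding W1_def by (intro arg_cong[where f="(*) (\<eta>1 y)"]) (simp add: algebra_simps)
      have e2: "\<epsilon>\<^sup>2 * laplacian \<eta>2 y = \<eta>2 y * (g2 * D2 y + g * D1 y - (lam2 - l2))" if y: "y \<in> cball x \<rho>" for y
        unfolding S(7) D[OF y] using W(2)[OF y] unfolding W2_def by (intro arg_cong[where f="(*) (\<eta>2 y)"]) (simp add: algebra_simps)
      define E where "E = \<bar>lam1 - l1\<bar> + \<bar>lam2 - l2\<bar> + \<epsilon>\<^sup>2 * T"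
      have E': "E = \<bar>lam2 - l2\<bar> + \<bar>lam1 - l1\<bar> + \<epsilon>\<^sup>2 * T" by (simp add: E_def)
      have p: "D1 x \<le> (g2 + g) * E / (g1 * g2 - g\<^sup>2)" "- D2 x \<le> (g1 + g) * E / (g1 * g2 - g\<^sup>2)"
        by (rule interior_pair[OF S(4,2,5,3) \<rho> c2 g_pos g_det \<alpha>(1,2,3,4,5,1) n R D1_def D2_def bk e1 e2 s E_def[unfolded T_def]]; assumption)+
      have q: "D2 x \<le> (g1 + g) * E / (g2 * g1 - g\<^sup>2)" "- D1 x \<le> (g2 + g) * E / (g2 * g1 - g\<^sup>2)"
        by (rule interior_pair[OF S(5,3,4,2) \<rho> c2 g_pos(2,1,3) det \<alpha>(2,1,4,3,1,5) n(2,1) R D2_def D1_def bk(2,1) e2 e1 s(2,1) E'[unfolded T_def]]; assumption)+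
      have E0: "0 \<le> E" using T by (simp add: E_def)
      define Y where "Y = P * (1 + T) * (\<epsilon>\<^sup>2 + \<bar>lam1 - l1\<bar> + \<bar>lam2 - l2\<bar>)"
      have "E \<le> (1 + T) * (\<epsilon>\<^sup>2 + \<bar>lam1 - l1\<bar> + \<bar>lam2 - l2\<bar>)"
      proof -
        have "(1 + T) * (\<epsilon>\<^sup>2 + \<bar>lam1 - l1\<bar> + \<bar>lam2 - l2\<bar>) = E + \<epsilon>\<^sup>2 + T * (\<bar>lam1 - l1\<bar> + \<bar>lam2 - l2\<bar>)"
          unfolding E_def by (simp add: algebra_simps)
        then show ?thesis using T by simp
      qed
      then have "P * E \<le> Y" unfolding Y_def mult.assoc[of P] using P by (intro mult_left_mono) auto
      moreover have "(g2 + g) * E / (g1 * g2 - g\<^sup>2) = P * E" by (simp add: P_def)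
      moreover have "(g1 + g) * E / (g1 * g2 - g\<^sup>2) \<le> (g2 + g) * E / (g1 * g2 - g\<^sup>2)"
        using E0 gg(1) g1_less g_less by (intro divide_right_mono mult_right_mono) auto
      ultimately have Y: "(g2 + g) * E / (g1 * g2 - g\<^sup>2) \<le> Y" "(g1 + g) * E / (g1 * g2 - g\<^sup>2) \<le> Y" by linarith+
      have "\<bar>D1 x\<bar> \<le> Y" "\<bar>D2 x\<bar> \<le> Y" using p q[folded gg(2)] Y unfolding abs_le_iff by (meson order_trans)+
      then show "\<bar>(\<eta>1 x)\<^sup>2 - A1 (nsq x)\<bar> \<le> P * (1 + T) * (\<epsilon>\<^sup>2 + \<bar>lam1 - l1\<bar> + \<bar>lam2 - l2\<bar>) \<and>
         \<bar>(\<eta>2 x)\<^sup>2 - A2 (nsq x)\<bar> \<le> P * (1 + T) * (\<epsilon>\<^sup>2 + \<bar>lam1 - l1\<bar> + \<bar>lam2 - l2\<bar>)"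
        unfolding Y_def using D[of x] \<rho> by simp
    qed
  qed
  moreover have "0 < P * (1 + T)" using P T by simp
  ultimately show ?thesis by blast
qed

end

section \<open>Sharp multipliers\<close>

lemma DERIV_glue:
  fixes p q :: "real \<Rightarrow> real"
  assumes "(p has_real_derivative D) (at a)" "(q has_real_derivative D) (at a)" "p a = q a"
  shows "((\<lambda>s. if s \<le> a then p s else q s) has_real_derivative D) (at a)"
proof -
  let ?f = "\<lambda>s. if s \<le> a then p s else q s"
  have "((\<lambda>s. (?f s - ?f a) / (s - a)) \<longlongrightarrow> D) (at a)"
  proof (rule filterlim_split_at)
    have "((\<lambda>s. (p s - p a) / (s - a)) \<longlongrightarrow> D) (at_left a)"
      using assms(1) unfolding has_field_derivative_iff by (rule filterlim_mono) (auto simp: at_le)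
    then show "((\<lambda>s. (?f s - ?f a) / (s - a)) \<longlongrightarrow> D) (at_left a)"
      by (rule Lim_transform_eventually) (auto simp: eventually_at_filter)
    have "((\<lambda>s. (q s - q a) / (s - a)) \<longlongrightarrow> D) (at_right a)"
      using assms(2) unfolding has_field_derivative_iff by (rule filterlim_mono) (auto simp: at_le)
    then show "((\<lambda>s. (?f s - ?f a) / (s - a)) \<longlongrightarrow> D) (at_right a)"
      by (rule Lim_transform_eventually) (auto simp: eventually_at_filter assms(3))
  qed
  then show ?thesis unfolding has_field_derivative_iff .
qed

lemma DERIV_if_le:
  fixes p q :: "real \<Rightarrow> real"
  assumes "\<And>s. s \<le> a \<Longrightarrow> (p has_real_derivative p' s) (at s)" "\<And>s. a \<le> s \<Longrightarrow> (q has_real_derivative q' s) (at s)"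
    and "p a = q a" "p' a = q' a"
  shows "((\<lambda>s. if s \<le> a then p s else q s) has_real_derivative (if s \<le> a then p' s else q' s)) (at s)"
proof (rule linorder_cases[of s a])
  assume s: "s < a"
  have "((\<lambda>s. if s \<le> a then p s else q s) has_real_derivative p' s) (at s)"
    by (rule has_field_derivative_transform_within_open[OF assms(1), where S="{..<a}"]) (use s in auto)
  then show ?thesis using s by simp
next
  assume s: "a < s"
  have "((\<lambda>s. if s \<le> a then p s else q s) has_real_derivative q' s) (at s)"
    by (rule has_field_derivative_transform_within_open[OF assms(2), where S="{a<..}"]) (use s in auto)
  then show ?thesis using s by simp
next
  assume s: "s = a"
  show ?thesis using DERIV_glue[where p=p and q=q and D="p' a" and a=a] assms(1)[of a] assms(2)[of a] assms(3,4) s by simp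
qed

section \<open>Two relations for the multipliers\<close>

context tf_data
begin

text \<open>Complementarity and unit masses give \<open>N + 2 * Q = l1 + l2\<close> for the
  integrals of potential and interaction, and the virial identity gives
  \<open>N = Q\<close>.\<close>

lemma Ea_eq: "3 * Ea = 2 * (l1 + l2)"
proof -
  let ?N = "\<lambda>x::real^2. nsq x * (A1 (nsq x) + A2 (nsq x))" and ?Q = "\<lambda>x::real^2. Q (A1 (nsq x)) (A2 (nsq x))"
  have "?N x + 2 * ?Q x = l1 * A1 (nsq x) + l2 * A2 (nsq x)" for x
    using WA_zero[of "nsq x"] unfolding W1_def W2_def Q_def by (simp add: algebra_simps power2_eq_square)
  then have 1: "(LINT x|lborel. ?N x + 2 * ?Q x) = (LINT x|lborel. l1 * A1 (nsq x) + l2 * A2 (nsq x))" by simp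
  have 2: "(LINT x|lborel. ?N x + 2 * ?Q x) = (LINT x|lborel. ?N x) + 2 * (LINT x|lborel. ?Q x)" using tf_virial(1,2) by simp
  have 3: "(LINT x|lborel. l1 * A1 (nsq x) + l2 * A2 (nsq x)) = l1 + l2" using mass by simp
  have 4: "Ea = (LINT x|lborel. ?N x) + (LINT x|lborel. ?Q x)" unfolding Ea_def using tf_virial(1,2) by simp
  have "3 * Ea = 2 * l" if "a = b" "a = n + 2 * q" "b = l" "Ea = n + q" "n = q" for a b n q l using that by linarith
  from this[OF 1 2 3 4 tf_virial(3)] show ?thesis .
qed

text \<open>Testing the equations, the Pohozaev identity for the field \<open>x\<close> and the
  energy give three relations among the sum of the multipliers, the potential integral and the
  interaction integral. Their remainders are linear in the kinetic energy and the excess;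
  eliminating the two integrals leaves a multiple of \<open>Ea\<close>.\<close>

lemma multiplier_sum_sharp:
  assumes cl: "close C \<epsilon> \<eta>1 \<eta>2 lam1 lam2"
  shows "\<bar>(lam1 + lam2) - (l1 + l2)\<bar> \<le> 5 * (C * (\<epsilon>\<^sup>2 * \<bar>ln \<epsilon>\<bar>))"
proof -
  define M where "M = C * (\<epsilon>\<^sup>2 * \<bar>ln \<epsilon>\<bar>)"
  have sol: "sol \<epsilon> \<eta>1 \<eta>2 lam1 lam2" and ec: "energy_control M \<epsilon> \<eta>1 \<eta>2" using cl unfolding close_def M_def by auto
  have fe: "finite_energy \<eta>1 \<eta>2" using ec unfolding energy_control_def by blast
  note N = finite_energy_integrable[OF fe]
  define K where "K = \<epsilon>\<^sup>2 * ((LINT x|lborel. gsq \<eta>1 x) + (LINT x|lborel. gsq \<eta>2 x))"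
  have gs: "0 \<le> (LINT x|lborel. gsq u x)" for u by (intro Bochner_Integration.integral_nonneg gsq_nonneg)
  have K: "0 \<le> K" "K \<le> M" using ec gs unfolding K_def energy_control_def by auto
  let ?N = "LINT x|lborel. nsq x * ((\<eta>1 x)\<^sup>2 + (\<eta>2 x)\<^sup>2)" and ?Q = "LINT x|lborel. Q ((\<eta>1 x)\<^sup>2) ((\<eta>2 x)\<^sup>2)"
  have 1: "lam1 + lam2 = K + ?N + 2 * ?Q" unfolding K_def by (rule multiplier_sum[OF sol fe])
  have P: "\<bar>LINT x|lborel. (1 + nsq x * 0) * pressure lam1 lam2 \<eta>1 \<eta>2 x + nsq x * 1 * ((\<eta>1 x)\<^sup>2 + (\<eta>2 x)\<^sup>2)\<bar> \<le> 3 * 1 * K"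
    unfolding K_def by (rule Pohozaev[OF sol fe]) auto
  have "(LINT x|lborel. pressure lam1 lam2 \<eta>1 \<eta>2 x + nsq x * ((\<eta>1 x)\<^sup>2 + (\<eta>2 x)\<^sup>2)) = 2 * ?N + ?Q - (lam1 + lam2)"
    using N(1)[of lam1 lam2] N(2,4) by simp
  with P have 2: "\<bar>2 * ?N + ?Q - (lam1 + lam2)\<bar> \<le> 3 * K" by simp
  have "(LINT x|lborel. nsq x * ((\<eta>1 x)\<^sup>2 + (\<eta>2 x)\<^sup>2) + Q ((\<eta>1 x)\<^sup>2) ((\<eta>2 x)\<^sup>2)) = ?N + ?Q" using N(2,3) by simp
  then have 3: "\<bar>?N + ?Q - Ea\<bar> \<le> M" using ec unfolding energy_control_def by simp
  have "\<bar>lam - l\<bar> \<le> 5 * M" if "lam = K + n + 2 * q" "\<bar>2 * n + q - lam\<bar> \<le> 3 * K" "\<bar>n + q - E\<bar> \<le> M" "3 * E = 2 * l" for lam l n q E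
    using that K by linarith
  from this[OF 1 2 3 Ea_eq] show ?thesis unfolding M_def .
qed

text \<open>Up to the factor \<open>2 / s0\<close>, half the divergence of the field in
  \<open>Pohozaev_cone\<close>.\<close>

definition cone :: "real \<Rightarrow> real \<Rightarrow> real" where "cone s0 s = max 0 (1 - s / s0)"

lemma cone: "0 < s0 \<Longrightarrow> 0 \<le> s \<Longrightarrow> cone s0 s \<le> 1" "0 \<le> cone s0 s" "0 < s0 \<Longrightarrow> s0 \<le> s \<Longrightarrow> cone s0 s = 0"
  "0 < s0 \<Longrightarrow> s \<le> s0 \<Longrightarrow> cone s0 s = 1 - s / s0" "continuous_on S (cone s0)"
  by (auto simp: cone_def[abs_def] divide_inverse intro!: continuous_intros) (auto simp: divide_simps)

text \<open>The multiplier of the field \<open>f(|x|\<^sup>2) x\<close> is \<open>1 / |x|\<^sup>2\<close> outside a ball, where it is divergence free in the plane.\<close>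

lemma Pohozaev_cone:
  assumes sol: "sol \<epsilon> \<eta>1 \<eta>2 lam1 lam2" and fe: "finite_energy \<eta>1 \<eta>2" and s0: "0 < s0"
    and Y: "\<And>x. Y x = 2 * cone s0 (nsq x) / s0 * pressure lam1 lam2 \<eta>1 \<eta>2 x - (cone s0 (nsq x))\<^sup>2 * ((\<eta>1 x)\<^sup>2 + (\<eta>2 x)\<^sup>2)"
  shows "integrable lborel Y"
    "\<bar>2 + (LINT x|lborel. Y x)\<bar> \<le> 6 / s0 * (\<epsilon>\<^sup>2 * ((LINT x|lborel. gsq \<eta>1 x) + (LINT x|lborel. gsq \<eta>2 x)))"
proof -
  note S = solD[OF sol] and i = fe[unfolded finite_energy_def]
  note c = C_k_2D(3)[OF S(4)] C_k_2D(3)[OF S(5)]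
  have Yc: "continuous_on UNIV Y"
    unfolding Y[abs_def] pressure_def Q_def
    by (intro continuous_intros continuous_on_compose2[OF cone(5)] c) (use s0 in auto)
  show iY: "integrable lborel Y"
  proof (rule integrable_continuous_compact_support[OF Yc, where c=s0])
    fix x :: "real^2" assume "s0 < nsq x"
    then have "cone s0 (nsq x) = 0" using s0 by (intro cone(3)) auto
    then show "Y x = 0" by (simp add: Y)
  qed
  \<comment> \<open>Inside the disc the function \<open>1 / s\<close> is continued by its tangent at
    \<open>s0\<close>, which removes the singularity at the origin and keeps the field continuously
    differentiable.\<close>
  define f where "f s = (if s \<le> s0 then (2 * s0 - s) / s0\<^sup>2 else 1 / s)" for s
  define f' where "f' s = (if s \<le> s0 then - 1 / s0\<^sup>2 else - 1 / s\<^sup>2)" for s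
  have d: "(f has_real_derivative f' s) (at s)" for s
    unfolding f_def[abs_def] f'_def
  proof (rule DERIV_if_le)
    show "((\<lambda>s. (2 * s0 - s) / s0\<^sup>2) has_real_derivative - 1 / s0\<^sup>2) (at s)" for s
    proof -
      have "((\<lambda>s. (2 * s0 - s) / s0\<^sup>2) has_real_derivative (0 - 1) / s0\<^sup>2) (at s)"
        by (intro DERIV_cdivide DERIV_diff DERIV_const DERIV_ident)
      then show ?thesis by simp
    qed
    show "((\<lambda>s. 1 / s) has_real_derivative - 1 / s\<^sup>2) (at s)" if "s0 \<le> s" for s
    proof -
      have "s \<noteq> 0" using that s0 by simp
      from DERIV_inverse[OF this] show ?thesis by (simp add: inverse_eq_divide power_divide numeral_2_eq_2)
    qed
    show "(2 * s0 - s0) / s0\<^sup>2 = 1 / s0" using s0 by (simp add: power2_eq_square)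
  qed simp
  have f'c: "continuous_on UNIV f'"
  proof -
    have "f' = (\<lambda>s. - 1 / (max s s0)\<^sup>2)" by (auto simp: f'_def fun_eq_iff max_def)
    moreover have "continuous_on UNIV (\<lambda>s. - 1 / (max s s0)\<^sup>2)" using s0 by (intro continuous_intros) (auto simp: max_def)
    ultimately show ?thesis by simp
  qed
  have B1: "\<bar>f s\<bar> \<le> 2 / s0" if s: "0 \<le> s" for s
  proof (cases "s \<le> s0")
    case True
    have "(2 * s0 - s) / s0\<^sup>2 \<le> 2 * s0 / s0\<^sup>2" using s by (intro divide_right_mono) auto
    then show ?thesis using True s s0 by (simp add: f_def power2_eq_square)
  next
    case False
    have "1 / s \<le> 1 / s0" using False s0 by (intro divide_left_mono) auto
    moreover have "1 / s0 \<le> 2 / s0" using s0 by (intro divide_right_mono) auto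
    ultimately show ?thesis using False s by (simp add: f_def)
  qed
  have B2: "\<bar>s * f' s\<bar> \<le> 2 / s0" if s: "0 \<le> s" for s
  proof (cases "s \<le> s0")
    case True
    have "s / s0\<^sup>2 \<le> 2 * s0 / s0\<^sup>2" using True s0 s by (intro divide_right_mono) auto
    then show ?thesis using True s s0 by (simp add: f'_def power2_eq_square abs_mult)
  next
    case False
    have "1 / s \<le> 1 / s0" using False s0 by (intro divide_left_mono) auto
    moreover have "1 / s0 \<le> 2 / s0" using s0 by (intro divide_right_mono) auto
    moreover have "\<bar>s * f' s\<bar> = 1 / s" using False s s0 by (simp add: f'_def power2_eq_square abs_mult)
    ultimately show ?thesis by linarith
  qed
  \<comment> \<open>Outside the disc \<open>s * f s = 1\<close>, which yields the total mass 2, and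
    the coefficient of the pressure vanishes; all the rest is supported in the disc.\<close>
  have e: "f s + s * f' s = 2 * cone s0 s / s0" "s * f s = 1 - (cone s0 s)\<^sup>2" if "0 \<le> s" for s
  proof -
    have "f s + s * f' s = 2 * cone s0 s / s0 \<and> s * f s = 1 - (cone s0 s)\<^sup>2"
    proof (cases "s \<le> s0")
      case True
      then show ?thesis using s0 by (simp add: f_def f'_def cone(4) power2_eq_square field_simps)
    next
      case False
      then show ?thesis using s0 cone(3)[of s0 s] by (simp add: f_def f'_def power2_eq_square)
    qed
    then show "f s + s * f' s = 2 * cone s0 s / s0" "s * f s = 1 - (cone s0 s)\<^sup>2" by auto
  qed
  have X: "(f (nsq x) + nsq x * f' (nsq x)) * pressure lam1 lam2 \<eta>1 \<eta>2 x + nsq x * f (nsq x) * ((\<eta>1 x)\<^sup>2 + (\<eta>2 x)\<^sup>2)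
    = ((\<eta>1 x)\<^sup>2 + (\<eta>2 x)\<^sup>2) + Y x" for x
    unfolding Y e[OF zero_le_power2] left_diff_distrib by simp
  have "(LINT x|lborel. ((\<eta>1 x)\<^sup>2 + (\<eta>2 x)\<^sup>2) + Y x) = 2 + (LINT x|lborel. Y x)"
    using i iY by simp
  then show "\<bar>2 + (LINT x|lborel. Y x)\<bar> \<le> 6 / s0 * (\<epsilon>\<^sup>2 * ((LINT x|lborel. gsq \<eta>1 x) + (LINT x|lborel. gsq \<eta>2 x)))"
    using Pohozaev[OF sol fe d f'c B1 B2] unfolding X by simp
qed

text \<open>The integrand is the derivative in \<open>s\<close> of
  \<open>(1 - s / s0)\<^sup>2 * (lam - s)\<^sup>2 / (2 * g1)\<close>, so only the value at the
  origin remains, independent of \<open>s0\<close>.\<close>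

lemma cone_integral:
  assumes s0: "0 < s0" and h: "\<And>s. h s = - (2 * cone s0 s / s0 * ((lam - s)\<^sup>2 / (2 * g1))) - (cone s0 s)\<^sup>2 * ((lam - s) / g1)"
  shows "integrable lborel (\<lambda>x::real^2. h (nsq x))" "(LINT x|lborel. h (nsq x)) = - (pi * lam\<^sup>2 / (2 * g1))"
proof -
  define H where "H s = (1 - s / s0)\<^sup>2 * (lam - s)\<^sup>2 / (2 * g1)" for s
  have hc: "continuous_on UNIV h" unfolding h[abs_def] using g_pos s0 by (intro continuous_intros cone(5)) auto
  have h0: "h s = 0" if "s > s0" for s using that s0 cone(3)[of s0 s] by (simp add: h)
  have d: "(H has_real_derivative h s) (at s)" if "s \<in> {0<..<s0} - {}" for s
  proof -
    have "(H has_real_derivative (((0 - 1 / s0) * (1 - s / s0) + (0 - 1 / s0) * (1 - s / s0)) * ((lam - s) * (lam - s))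
        + ((0 - 1) * (lam - s) + (0 - 1) * (lam - s)) * ((1 - s / s0) * (1 - s / s0))) / (2 * g1)) (at s)"
      unfolding H_def power2_eq_square by (intro DERIV_cdivide DERIV_mult DERIV_diff DERIV_const DERIV_ident)
    moreover have e: "(((0 - 1 / s0) * u + (0 - 1 / s0) * u) * (v * v) + ((0 - 1) * v + (0 - 1) * v) * (u * u)) / (2 * g1)
        = - (2 * u / s0 * (v\<^sup>2 / (2 * g1))) - u\<^sup>2 * (v / g1)" for u v
      using s0 g_pos by (simp add: field_simps power2_eq_square)
    moreover have "cone s0 s = 1 - s / s0" using cone(4)[OF s0, of s] that by simp
    ultimately show ?thesis unfolding h e[symmetric] by simp
  qed
  have Hc: "continuous_on {0..s0} H" unfolding H_def using s0 g_pos by (intro continuous_intros) auto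
  note I = integral_norm_square_FTC[OF less_imp_le[OF s0] finite.emptyI hc h0 Hc d]
  show "integrable lborel (\<lambda>x::real^2. h (nsq x))" by (rule I(1)) auto
  have "H s0 = 0" "H 0 = lam\<^sup>2 / (2 * g1)" using s0 by (simp_all add: H_def)
  then show "(LINT x|lborel. h (nsq x)) = - (pi * lam\<^sup>2 / (2 * g1))" using I(2) by simp
qed


text \<open>Completing the square in \<open>n1\<close>: up to a multiple of \<open>n2\<close> the
  pressure is minimal at the one-phase density \<open>(lam1 - s) / g1\<close>, hence its error is
  quadratic in the deviation \<open>t\<close>. The density term is linear in \<open>t\<close>, and
  this fixes the order \<open>m\<close>.\<close>

lemma core_pressure:
  fixes n1 n2 s lam1 lam2 m K u s0 :: real
  assumes m: "\<bar>g1 * n1 + s - lam1\<bar> \<le> m" "0 \<le> n2" "n2 \<le> m\<^sup>2" "0 \<le> m" "m \<le> 1"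
    and K: "\<bar>s - lam2 + g2 * n2 / 2 + g * n1\<bar> \<le> K" and s0: "0 < s0" and u: "0 \<le> u" "u \<le> 1"
  shows "\<bar>(2 * u / s0 * ((s - lam1) * n1 + (s - lam2) * n2 + Q n1 n2) - u\<^sup>2 * (n1 + n2))
      - (- (2 * u / s0 * ((lam1 - s)\<^sup>2 / (2 * g1))) - u\<^sup>2 * ((lam1 - s) / g1))\<bar>
    \<le> (2 / s0 * (1 / (2 * g1) + K) + 1 / g1 + 1) * m"
proof -
  define t where "t = g1 * n1 + s - lam1"
  have n1: "n1 = (t + (lam1 - s)) / g1" using g_pos by (simp add: t_def)
  have m2: "m\<^sup>2 \<le> m" using m(4,5) by (simp add: power2_eq_square mult_left_le)
  define R where "R = t\<^sup>2 / (2 * g1) + n2 * (s - lam2 + g2 * n2 / 2 + g * n1)"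
  have P: "(s - lam1) * n1 + (s - lam2) * n2 + Q n1 n2 = - ((lam1 - s)\<^sup>2 / (2 * g1)) + R"
  proof -
    have "(s - lam1) * n1 + g1 * n1\<^sup>2 / 2 = - ((lam1 - s)\<^sup>2 / (2 * g1)) + t\<^sup>2 / (2 * g1)"
      unfolding n1 using g_pos by (simp add: field_simps power2_eq_square)
    then show ?thesis unfolding R_def Q_def by (simp add: algebra_simps power2_eq_square)
  qed
  have t: "\<bar>t\<bar> \<le> m" using m(1) by (simp add: t_def)
  have "t\<^sup>2 \<le> m" using power_mono[OF t, of 2] m2 by simp
  then have "t\<^sup>2 / (2 * g1) \<le> m / (2 * g1)" using g_pos by (intro divide_right_mono) auto
  moreover have "0 \<le> t\<^sup>2 / (2 * g1)" using g_pos by simp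
  moreover have "\<bar>n2 * (s - lam2 + g2 * n2 / 2 + g * n1)\<bar> \<le> m * K"
    unfolding abs_mult using m m2 K by (intro mult_mono) auto
  ultimately have "\<bar>R\<bar> \<le> m / (2 * g1) + m * K" unfolding R_def abs_le_iff by linarith
  also have "\<dots> = (1 / (2 * g1) + K) * m" by (simp add: algebra_simps)
  finally have R: "\<bar>R\<bar> \<le> (1 / (2 * g1) + K) * m" .
  have e: "(2 * u / s0 * ((s - lam1) * n1 + (s - lam2) * n2 + Q n1 n2) - u\<^sup>2 * (n1 + n2))
      - (- (2 * u / s0 * ((lam1 - s)\<^sup>2 / (2 * g1))) - u\<^sup>2 * ((lam1 - s) / g1)) = 2 / s0 * (u * R) - u\<^sup>2 * (t / g1 + n2)"
  proof -
    have "n1 = t / g1 + (lam1 - s) / g1" unfolding n1 by (simp add: add_divide_distrib)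
    then have a: "u\<^sup>2 * (n1 + n2) = u\<^sup>2 * ((lam1 - s) / g1) + u\<^sup>2 * (t / g1 + n2)" by (simp add: distrib_left)
    have b: "2 * u / s0 * (- ((lam1 - s)\<^sup>2 / (2 * g1)) + R) = - (2 * u / s0 * ((lam1 - s)\<^sup>2 / (2 * g1))) + 2 / s0 * (u * R)"
      by (simp only: distrib_left mult_minus_right) simp
    show ?thesis unfolding P a b by (simp only: diff_conv_add_uminus minus_add_distrib minus_minus add_ac)
  qed
  have 1: "\<bar>2 / s0 * (u * R)\<bar> \<le> 2 / s0 * (1 / (2 * g1) + K) * m"
  proof -
    have "u * \<bar>R\<bar> \<le> 1 * \<bar>R\<bar>" using u by (intro mult_right_mono) auto
    then have "\<bar>u * R\<bar> \<le> (1 / (2 * g1) + K) * m" using R u by (simp add: abs_mult)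
    then have "2 / s0 * \<bar>u * R\<bar> \<le> 2 / s0 * ((1 / (2 * g1) + K) * m)" using s0 by (intro mult_left_mono) auto
    moreover have "\<bar>2 / s0 * (u * R)\<bar> = 2 / s0 * \<bar>u * R\<bar>" using s0 unfolding abs_mult[of "2 / s0"] by simp
    ultimately show ?thesis by (simp only: mult.assoc)
  qed
  have 2: "\<bar>u\<^sup>2 * (t / g1 + n2)\<bar> \<le> (1 / g1 + 1) * m"
  proof -
    have "\<bar>t / g1\<bar> \<le> 1 / g1 * m" using t g_pos by (simp add: abs_divide divide_right_mono)
    then have tn: "\<bar>t / g1 + n2\<bar> \<le> (1 / g1 + 1) * m" using m(2,3) m2 unfolding distrib_right by linarith
    have "u\<^sup>2 \<le> 1" using u by (simp add: power_le_one)
    then have "u\<^sup>2 * \<bar>t / g1 + n2\<bar> \<le> 1 * \<bar>t / g1 + n2\<bar>" by (rule mult_right_mono) simp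
    then show ?thesis using tn by (simp add: abs_mult)
  qed
  have "\<bar>a - b\<bar> \<le> (A + B + 1) * m" if "\<bar>a\<bar> \<le> A * m" "\<bar>b\<bar> \<le> (B + 1) * m" for a b A B :: real
    using that by (simp add: distrib_right)
  from this[OF 1 2] show ?thesis unfolding e .
qed

text \<open>The integrand is compared with that of \<open>cone_integral\<close>. Both vanish outside
  the disc of squared radius \<open>s0\<close>, so the pointwise error is multiplied by the area of
  this disc.\<close>

lemma core_error:
  assumes sol: "sol \<epsilon> \<eta>1 \<eta>2 lam1 lam2" and fe: "finite_energy \<eta>1 \<eta>2" and s0: "0 < s0" and m: "0 \<le> m" "m \<le> 1"
    and core: "\<And>x. nsq x \<le> s0 \<Longrightarrow> \<bar>g1 * (\<eta>1 x)\<^sup>2 + nsq x - lam1\<bar> \<le> m"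
      "\<And>x. nsq x \<le> s0 \<Longrightarrow> \<eta>2 x \<le> m"
      "\<And>x. nsq x \<le> s0 \<Longrightarrow> \<bar>nsq x - lam2 + g2 * (\<eta>2 x)\<^sup>2 / 2 + g * (\<eta>1 x)\<^sup>2\<bar> \<le> K"
    and Y: "\<And>x. Y x = 2 * cone s0 (nsq x) / s0 * pressure lam1 lam2 \<eta>1 \<eta>2 x - (cone s0 (nsq x))\<^sup>2 * ((\<eta>1 x)\<^sup>2 + (\<eta>2 x)\<^sup>2)"
  shows "\<bar>(LINT x|lborel. Y x) + pi * lam1\<^sup>2 / (2 * g1)\<bar>
    \<le> (2 / s0 * (1 / (2 * g1) + K) + 1 / g1 + 1) * m * measure lborel (cball (0::real^2) (sqrt s0))"
proof -
  define h where "h s = - (2 * cone s0 s / s0 * ((lam1 - s)\<^sup>2 / (2 * g1))) - (cone s0 s)\<^sup>2 * ((lam1 - s) / g1)" for s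
  note I = cone_integral[OF s0 h_def] and iY = Pohozaev_cone(1)[OF sol fe s0 Y]
  let ?h = "\<lambda>x::real^2. h (nsq x)" and ?B = "cball (0::real^2) (sqrt s0)"
  define K3 where "K3 = (2 / s0 * (1 / (2 * g1) + K) + 1 / g1 + 1) * m"
  have b: "\<bar>Y x - ?h x\<bar> \<le> K3 * indicator ?B x" for x
  proof (cases "nsq x \<le> s0")
    case True
    then have x: "x \<in> ?B" by (simp add: real_le_rsqrt)
    have "(\<eta>2 x)\<^sup>2 \<le> m\<^sup>2" using core(2)[OF True] solD(3)[OF sol, of x] by (intro power_mono) auto
    from core_pressure[OF core(1)[OF True] zero_le_power2 this m core(3)[OF True] s0 cone(2) cone(1)[OF s0 zero_le_power2]]
    show ?thesis using x unfolding Y h_def pressure_def K3_def by simp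
  next
    case False
    then have "cone s0 (nsq x) = 0" using s0 by (intro cone(3)) auto
    then have "Y x = 0" "?h x = 0" by (simp_all add: Y h_def)
    moreover have "x \<notin> ?B"
    proof
      assume "x \<in> ?B"
      then have "nsq x \<le> (sqrt s0)\<^sup>2" by (intro power_mono) auto
      then show False using False s0 by simp
    qed
    ultimately show ?thesis by simp
  qed
  have B: "integrable lborel (\<lambda>x. K3 * indicator ?B x)"
    by (intro integrable_mult_right integrable_real_indicator emeasure_bounded_finite) auto
  have "(LINT x|lborel. Y x) + pi * lam1\<^sup>2 / (2 * g1) = (LINT x|lborel. Y x - ?h x)" using I iY by simp
  also have "\<bar>\<dots>\<bar> \<le> (LINT x|lborel. \<bar>Y x - ?h x\<bar>)" by (rule integral_abs_bound)
  also have "\<dots> \<le> (LINT x|lborel. K3 * indicator ?B x)" using iY I(1) B by (intro integral_mono b) auto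
  also have "\<dots> = K3 * measure lborel ?B" by simp
  finally show ?thesis unfolding K3_def .
qed

text \<open>In the core the solution is nearly the one-phase density with multiplier
  \<open>lam1\<close>, so the Pohozaev identity for the cone field reads
  \<open>pi * lam1\<^sup>2 / (2 * g1) = 2\<close> up to its error, and \<open>l1\<close> solves this
  equation exactly. The second multiplier follows from the sum.\<close>

lemma multiplier_sharp:
  assumes C: "0 < C"
  shows "\<exists>C'>0. \<forall>\<^sub>F \<epsilon> in at_right 0. \<forall>\<eta>1 \<eta>2 lam1 lam2. close C \<epsilon> \<eta>1 \<eta>2 lam1 lam2 \<longrightarrow>
    \<bar>lam1 - l1\<bar> \<le> C' * (\<bar>ln \<epsilon>\<bar> * \<epsilon>\<^sup>2) \<and> \<bar>lam2 - l2\<bar> \<le> C' * (\<bar>ln \<epsilon>\<bar> * \<epsilon>\<^sup>2)"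
proof -
  \<comment> \<open>A point with \<open>norm x \<le> sqrt s0 = sqrt s1 / 2\<close> and a ball of
    radius \<open>2 * \<rho> = sqrt s1 / 4\<close> about it reach at most
    \<open>3 / 4 * sqrt s1\<close>. There \<open>|y|\<^sup>2 \<le> 9 / 16 * s1\<close>, which leaves
    the \<open>7 / 16 * s1\<close> in \<open>c\<close>.\<close>
  define s0 where "s0 = s1 / 4"
  define \<rho> where "\<rho> = sqrt s1 / 8"
  define c where "c = min (slope * (s2 - s1)) ((g / g1 - 1) * (7 / 16 * s1))"
  have s0: "0 < s0" "sqrt s0 = sqrt s1 / 2" using s_ord by (auto simp: s0_def real_sqrt_divide)
  have gg: "0 < g / g1 - 1" using g_pos g1_less by simp
  have c0: "0 < c" unfolding c_def using slope(1) s_ord gg by simp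
  have \<rho>: "0 < \<rho>" using s_ord by (simp add: \<rho>_def)
  have B: "0 \<le> sqrt s1" using s_ord by simp
  obtain C1 where C1: "0 < C1" and ev: "\<forall>\<^sub>F \<epsilon> in at_right 0. \<forall>\<eta>1 \<eta>2 lam1 lam2. close C \<epsilon> \<eta>1 \<eta>2 lam1 lam2 \<longrightarrow>
    one_phase (2 * \<rho>) (sqrt s1) c (C1 * \<epsilon>\<^sup>2) \<eta>1 \<eta>2 lam1 lam2"
    using interior_one[OF C c0 \<rho> B] by blast
  have inner: "c \<le> A1 (nsq y) \<and> c \<le> W2 (nsq y)" if x: "nsq x \<le> s0" and y: "y \<in> cball x (2 * \<rho>)" for x y :: "real^2"
  proof -
    have "norm x \<le> sqrt s1 / 2" using real_le_rsqrt[OF x] s0(2) by simp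
    then have "norm y \<le> 3 / 4 * sqrt s1" using y norm_triangle_ineq2[of y x] norm_minus_commute[of y x] by (simp add: dist_norm \<rho>_def)
    then have "nsq y \<le> (3 / 4 * sqrt s1)\<^sup>2" by (intro power_mono) auto
    then have ys: "nsq y \<le> 9 / 16 * s1" using s_ord by (simp add: power_mult_distrib power_divide)
    then have y1: "nsq y \<le> s1" using s_ord by linarith
    have "slope * (s2 - s1) \<le> slope * (s2 - nsq y)" using y1 slope(1) by (intro mult_left_mono) auto
    also have "\<dots> \<le> A1 (nsq y)" using y1 s_ord by (intro A_lower(1)) linarith
    finally have 1: "c \<le> A1 (nsq y)" by (simp add: c_def)
    have "(g / g1 - 1) * (7 / 16 * s1) \<le> (g / g1 - 1) * (s1 - nsq y)" using ys gg by (intro mult_left_mono) auto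
    moreover have "c \<le> (g / g1 - 1) * (7 / 16 * s1)" unfolding c_def by (rule min.cobounded2)
    ultimately have "c \<le> W2 (nsq y)" using W2_eq(1)[OF y1] by linarith
    with 1 show ?thesis by simp
  qed
  define K where "K = s1 + l2 + 1 + g2 + g * (L * l2 + 1)"
  define V where "V = measure lborel (cball (0::real^2) (sqrt s0))"
  define K3 where "K3 = (2 / s0 * (1 / (2 * g1) + K) + 1 / g1 + 1)"
  define K4 where "K4 = 6 / s0 * C + K3 * C1 * V"
  define K5 where "K5 = 2 * g1 / pi * K4 / l1"
  have V: "0 \<le> V" by (simp add: V_def)
  have l1: "0 < l1" using l_order s_ord by linarith
  have K: "0 \<le> K" using s_ord g_pos L_ge(5) by (simp add: K_def)
  have K3: "0 \<le> K3" using K s0 g_pos by (simp add: K3_def)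
  have K4: "0 \<le> K4" using K3 V C C1 s0 by (simp add: K4_def)
  have K5: "0 \<le> K5" using K4 l1 g_pos by (simp add: K5_def)
  have "\<forall>\<^sub>F \<epsilon> in at_right 0. C * \<epsilon> powr (2/3) \<le> min 1 l1" "\<forall>\<^sub>F \<epsilon> in at_right 0. C1 * \<epsilon>\<^sup>2 \<le> 1" "\<forall>\<^sub>F \<epsilon> in at_right 0. 1 \<le> \<bar>ln (\<epsilon>::real)\<bar>"
    using C C1 l1 by real_asymp+
  with ev have "\<forall>\<^sub>F \<epsilon> in at_right 0. \<forall>\<eta>1 \<eta>2 lam1 lam2. close C \<epsilon> \<eta>1 \<eta>2 lam1 lam2 \<longrightarrow>
    \<bar>lam1 - l1\<bar> \<le> (K5 + 5 * C) * (\<bar>ln \<epsilon>\<bar> * \<epsilon>\<^sup>2) \<and> \<bar>lam2 - l2\<bar> \<le> (K5 + 5 * C) * (\<bar>ln \<epsilon>\<bar> * \<epsilon>\<^sup>2)"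
  proof eventually_elim
    case (elim \<epsilon>)
    show ?case
    proof (intro allI impI)
      fix \<eta>1 \<eta>2 lam1 lam2 assume cl: "close C \<epsilon> \<eta>1 \<eta>2 lam1 lam2"
      note d = closeD[OF cl] and S = solD[OF closeD(1)[OF cl]]
      have em: "C * \<epsilon> powr (2/3) \<le> 1" "C * \<epsilon> powr (2/3) \<le> l1" using elim(2) by auto
      define q where "q = \<bar>ln \<epsilon>\<bar> * \<epsilon>\<^sup>2"
      have q: "0 \<le> q" "\<epsilon>\<^sup>2 \<le> q" using elim(4) mult_right_mono[of 1 "\<bar>ln \<epsilon>\<bar>" "\<epsilon>\<^sup>2"] by (auto simp: q_def)
      have ec: "energy_control (C * q) \<epsilon> \<eta>1 \<eta>2" using cl unfolding close_def q_def by (simp add: mult.commute)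
      then have fe: "finite_energy \<eta>1 \<eta>2" unfolding energy_control_def by blast
      define Y where "Y x = 2 * cone s0 (nsq x) / s0 * pressure lam1 lam2 \<eta>1 \<eta>2 x - (cone s0 (nsq x))\<^sup>2 * ((\<eta>1 x)\<^sup>2 + (\<eta>2 x)\<^sup>2)" for x
      have m: "0 \<le> C1 * \<epsilon>\<^sup>2" "C1 * \<epsilon>\<^sup>2 \<le> 1" using C1 elim(3) by auto
      have core: "\<bar>g1 * (\<eta>1 x)\<^sup>2 + nsq x - lam1\<bar> \<le> C1 * \<epsilon>\<^sup>2 \<and> \<eta>2 x \<le> C1 * \<epsilon>\<^sup>2" if x: "nsq x \<le> s0" for x
      proof -
        have "norm x \<le> sqrt s1" using real_le_rsqrt[OF x] s0(2) B by linarith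
        then show ?thesis using elim(1)[rule_format, OF cl, unfolded one_phase_def] inner[OF x] by blast
      qed
      have bd: "\<bar>nsq x - lam2 + g2 * (\<eta>2 x)\<^sup>2 / 2 + g * (\<eta>1 x)\<^sup>2\<bar> \<le> K" if x: "nsq x \<le> s0" for x
      proof -
        have n1: "(\<eta>1 x)\<^sup>2 \<le> L * l2 + 1" using d(4)[of x] A_upper(1)[OF zero_le_power2, of "norm x"] em by linarith
        have "\<eta>2 x \<le> 1" using core[OF x] m by simp
        then have n2: "(\<eta>2 x)\<^sup>2 \<le> 1" using S(3)[of x] by (simp add: power_le_one less_imp_le)
        have "g * (\<eta>1 x)\<^sup>2 \<le> g * (L * l2 + 1)" "g2 * (\<eta>2 x)\<^sup>2 \<le> g2 * 1" using n1 n2 g_pos by (auto intro!: mult_left_mono)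
        moreover have "0 \<le> g * (\<eta>1 x)\<^sup>2" "0 \<le> g2 * (\<eta>2 x)\<^sup>2" using g_pos by auto
        moreover have "\<bar>lam2 - l2\<bar> \<le> 1" using d(3) em by linarith
        moreover have "nsq x \<le> s1" "0 \<le> nsq x" using x s_ord by (auto simp: s0_def)
        moreover have "\<bar>s - lam + a / 2 + b\<bar> \<le> s' + l + 1 + a' + b'" if "b \<le> b'" "a \<le> a' * 1" "0 \<le> b" "0 \<le> a" "\<bar>lam - l\<bar> \<le> 1" "s \<le> s'" "0 \<le> s" "0 < l"
          for s lam a b s' l a' b' :: real using that by linarith
        moreover have "0 < l2" using s_ord by linarith
        ultimately show ?thesis unfolding K_def by blast
      qed
      have e1: "\<bar>(LINT x|lborel. Y x) + pi * lam1\<^sup>2 / (2 * g1)\<bar> \<le> K3 * (C1 * \<epsilon>\<^sup>2) * V"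
        unfolding K3_def V_def by (rule core_error[OF d(1) fe s0(1) m _ _ bd Y_def]) (use core in auto)
      also have "\<dots> = (K3 * C1 * V) * \<epsilon>\<^sup>2" by simp
      also have "\<dots> \<le> (K3 * C1 * V) * q" using q K3 C1 V by (intro mult_left_mono) auto
      finally have 1: "\<bar>(LINT x|lborel. Y x) + pi * lam1\<^sup>2 / (2 * g1)\<bar> \<le> (K3 * C1 * V) * q" .
      have "\<bar>2 + (LINT x|lborel. Y x)\<bar> \<le> 6 / s0 * (\<epsilon>\<^sup>2 * ((LINT x|lborel. gsq \<eta>1 x) + (LINT x|lborel. gsq \<eta>2 x)))"
        by (rule Pohozaev_cone(2)[OF d(1) fe s0(1) Y_def])
      also have "\<dots> \<le> 6 / s0 * (C * q)" using ec s0 unfolding energy_control_def by (intro mult_left_mono) auto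
      finally have 2: "\<bar>2 + (LINT x|lborel. Y x)\<bar> \<le> (6 / s0 * C) * q" by (simp only: mult.assoc)
      have "\<bar>pi * lam1\<^sup>2 / (2 * g1) - 2\<bar> \<le> K4 * q"
      proof -
        have "\<bar>p - 2\<bar> \<le> (a + b) * q" if "\<bar>y + p\<bar> \<le> b * q" "\<bar>2 + y\<bar> \<le> a * q" for y p a b :: real
          using that unfolding distrib_right by linarith
        from this[OF 1 2] show ?thesis unfolding K4_def .
      qed
      moreover have "lam1\<^sup>2 - l1\<^sup>2 = 2 * g1 / pi * (pi * lam1\<^sup>2 / (2 * g1) - 2)"
        unfolding l1_sq using g_pos by (simp add: field_simps)
      moreover have "\<bar>k * y\<bar> \<le> k * z" if "\<bar>y\<bar> \<le> z" "0 \<le> k" for k y z :: real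
        using that by (simp add: abs_mult mult_left_mono)
      moreover have "0 \<le> 2 * g1 / pi" using g_pos by simp
      ultimately have "\<bar>lam1\<^sup>2 - l1\<^sup>2\<bar> \<le> 2 * g1 / pi * (K4 * q)" by metis
      moreover have "\<bar>lam1\<^sup>2 - l1\<^sup>2\<bar> = \<bar>lam1 - l1\<bar> * (lam1 + l1)"
      proof -
        have "0 \<le> lam1" using d(2) em by linarith
        moreover have "lam1\<^sup>2 - l1\<^sup>2 = (lam1 - l1) * (lam1 + l1)" by (simp add: power2_eq_square algebra_simps)
        ultimately show ?thesis using l1 by (simp add: abs_mult)
      qed
      moreover have "\<bar>lam1 - l1\<bar> * l1 \<le> \<bar>lam1 - l1\<bar> * (lam1 + l1)" using d(2) em by (intro mult_left_mono) linarith+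
      ultimately have "\<bar>lam1 - l1\<bar> * l1 \<le> 2 * g1 / pi * (K4 * q)" by linarith
      then have "\<bar>lam1 - l1\<bar> \<le> 2 * g1 / pi * (K4 * q) / l1" using l1 by (simp only: pos_le_divide_eq)
      also have "\<dots> = K5 * q" by (simp add: K5_def)
      finally have 3: "\<bar>lam1 - l1\<bar> \<le> K5 * q" .
      have 4: "\<bar>(lam1 + lam2) - (l1 + l2)\<bar> \<le> (5 * C) * q" using multiplier_sum_sharp[OF cl] by (simp add: q_def mult_ac)
      have 5: "0 \<le> (5 * C) * q" using C q by simp
      have "\<bar>lam1 - l1\<bar> \<le> (K5 + 5 * C) * q" "\<bar>lam2 - l2\<bar> \<le> (K5 + 5 * C) * q"
        using 3 4 5 unfolding distrib_right[of K5] by linarith+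
      then show "\<bar>lam1 - l1\<bar> \<le> (K5 + 5 * C) * (\<bar>ln \<epsilon>\<bar> * \<epsilon>\<^sup>2) \<and> \<bar>lam2 - l2\<bar> \<le> (K5 + 5 * C) * (\<bar>ln \<epsilon>\<bar> * \<epsilon>\<^sup>2)"
        unfolding q_def by blast
    qed
  qed
  moreover have "0 < K5 + 5 * C" using K5 C by simp
  ultimately show ?thesis by blast
qed

end

section \<open>Asymptotics\<close>

text \<open>\<open>max F G\<close> has a positive minimum on \<open>K\<close>. With half of it as
  \<open>c\<close>, the open sets where \<open>F\<close> or \<open>G\<close> exceeds
  \<open>c\<close> cover \<open>K\<close>, and a Lebesgue number of this cover gives the
  radius.\<close>

lemma compact_alternative:
  fixes F G :: "real^2 \<Rightarrow> real"
  assumes K: "compact K" and c: "continuous_on UNIV F" "continuous_on UNIV G" and p: "\<And>x. x \<in> K \<Longrightarrow> 0 < F x \<or> 0 < G x"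
  shows "\<exists>c>0. \<exists>\<rho>>0. \<forall>x\<in>K. (\<forall>y\<in>cball x \<rho>. c \<le> F y) \<or> (\<forall>y\<in>cball x \<rho>. c \<le> G y)"
proof (cases "K = {}")
  case False
  have "continuous_on K (\<lambda>x. max (F x) (G x))" using c by (intro continuous_intros) (auto intro: continuous_on_subset)
  then obtain z where z: "z \<in> K" "\<And>x. x \<in> K \<Longrightarrow> max (F z) (G z) \<le> max (F x) (G x)"
    using continuous_attains_inf[OF K False] by blast
  define c where "c = max (F z) (G z) / 2"
  have c0: "0 < c" using p[OF z(1)] by (auto simp: c_def)
  have "K \<subseteq> \<Union>{{x. c < F x}, {x. c < G x}}"
  proof
    fix x assume "x \<in> K"
    then have "c < max (F x) (G x)" using z(2)[of x] c0 unfolding c_def by linarith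
    then show "x \<in> \<Union>{{x. c < F x}, {x. c < G x}}" by auto
  qed
  moreover have "open U" if "U \<in> {{x. c < F x}, {x. c < G x}}" for U
    using that open_Collect_less[OF continuous_on_const c(1)] open_Collect_less[OF continuous_on_const c(2)] by auto
  ultimately obtain e where e: "0 < e" "\<And>x. x \<in> K \<Longrightarrow> \<exists>U\<in>{{x. c < F x}, {x. c < G x}}. ball x e \<subseteq> U"
    using Heine_Borel_lemma[OF K] by blast
  have "(\<forall>y\<in>cball x (e / 2). c \<le> F y) \<or> (\<forall>y\<in>cball x (e / 2). c \<le> G y)" if "x \<in> K" for x
  proof -
    have "cball x (e / 2) \<subseteq> ball x e" using e(1) by auto
    then show ?thesis using e(2)[OF that] by fastforce
  qed
  then show ?thesis using c0 e(1) by (intro exI[of _ c] exI[of _ "e / 2"] conjI) auto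
qed (auto intro: exI[of _ 1])

context tf_data
begin

text \<open>Off the three circles, for each component either the density or the corresponding
  \<open>W1\<close>, \<open>W2\<close> is positive, which leaves four cases: coexistence, one
  component alone (twice), and neither. The logarithm enters through the multipliers alone; the
  barriers contribute O(\<epsilon>^2).\<close>

lemma compact_estimate:
  assumes C: "0 < C" and K: "compact K" and avoid: "\<And>x. x \<in> K \<Longrightarrow> nsq x \<notin> {s1, s2, l2}"
  shows "\<exists>C'>0. \<forall>\<^sub>F \<epsilon> in at_right 0. \<forall>\<eta>1 \<eta>2 lam1 lam2. close C \<epsilon> \<eta>1 \<eta>2 lam1 lam2 \<longrightarrow>
    (\<forall>x\<in>K. \<bar>\<eta>1 x - sqrt (A1 (nsq x))\<bar> \<le> C' * (\<bar>ln \<epsilon>\<bar> * \<epsilon>\<^sup>2) \<and> \<bar>\<eta>2 x - sqrt (A2 (nsq x))\<bar> \<le> C' * (\<bar>ln \<epsilon>\<bar> * \<epsilon>\<^sup>2))"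
    (is "\<exists>C'>0. eventually (?P C') _")
proof -
  have ns: "continuous_on UNIV (\<lambda>x::real^2. A (nsq x))" if "continuous_on UNIV A" for A :: "real \<Rightarrow> real"
    by (rule continuous_on_compose2[OF that]) (auto intro!: continuous_intros)
  have Wc: "continuous_on UNIV W1" "continuous_on UNIV W2"
    unfolding W1_def[abs_def] W2_def[abs_def] by (intro continuous_intros A_continuous)+
  have w: "0 < 1 - g / g2" "0 < g / g1 - 1" using g_less g1_less g_pos by auto
  have "\<exists>c>0. \<exists>\<rho>>0. \<forall>x\<in>K. (\<forall>y\<in>cball x \<rho>. c \<le> A1 (nsq y)) \<or> (\<forall>y\<in>cball x \<rho>. c \<le> W1 (nsq y))"
  proof (rule compact_alternative[OF K ns[OF A_continuous(1)] ns[OF Wc(1)]])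
    fix x assume x: "x \<in> K"
    show "0 < A1 (nsq x) \<or> 0 < W1 (nsq x)"
    proof (cases "nsq x < s2")
      case True
      then have "0 < slope * (s2 - nsq x)" using slope(1) by simp
      then show ?thesis using A_lower(1)[of "nsq x"] True by auto
    next
      case False
      then have s: "s2 < nsq x" using avoid[OF x] by auto
      then have "0 < (1 - g / g2) * (nsq x - s2)" using w by simp
      then show ?thesis using W_ge(1)[of "nsq x"] s by auto
    qed
  qed
  then obtain c1 \<rho>1 where 1: "0 < c1" "0 < \<rho>1" "\<And>x. x \<in> K \<Longrightarrow> (\<forall>y\<in>cball x \<rho>1. c1 \<le> A1 (nsq y)) \<or> (\<forall>y\<in>cball x \<rho>1. c1 \<le> W1 (nsq y))"
    by blast
  have "\<exists>c>0. \<exists>\<rho>>0. \<forall>x\<in>K. (\<forall>y\<in>cball x \<rho>. c \<le> A2 (nsq y)) \<or> (\<forall>y\<in>cball x \<rho>. c \<le> W2 (nsq y))"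
  proof (rule compact_alternative[OF K ns[OF A_continuous(2)] ns[OF Wc(2)]])
    fix x assume x: "x \<in> K"
    consider "nsq x < s1" | "s1 < nsq x" "nsq x < l2" | "l2 < nsq x" using avoid[OF x] by fastforce
    then show "0 < A2 (nsq x) \<or> 0 < W2 (nsq x)"
    proof cases
      case 1
      then show ?thesis using W2_eq(1)[of "nsq x"] w(2) by simp
    next
      case 2
      define t where "t = min (nsq x - s1) (l2 - nsq x)"
      have "0 < slope * t" using 2 slope(1) by (simp add: t_def)
      moreover have "slope * t \<le> A2 (nsq x)" using 2 by (intro A_lower(2)) (auto simp: t_def)
      ultimately show ?thesis by simp
    next
      case 3
      then show ?thesis using W_ge(2)[of "nsq x"] by auto
    qed
  qed
  then obtain c2 \<rho>2 where 2: "0 < c2" "0 < \<rho>2" "\<And>x. x \<in> K \<Longrightarrow> (\<forall>y\<in>cball x \<rho>2. c2 \<le> A2 (nsq y)) \<or> (\<forall>y\<in>cball x \<rho>2. c2 \<le> W2 (nsq y))"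
    by blast
  \<comment> \<open>Half the radius, since \<open>interior_one\<close> works with balls of radius
    \<open>2 * \<rho>\<close>.\<close>
  define c \<rho> where "c = min c1 c2" and "\<rho> = min \<rho>1 \<rho>2 / 2"
  have c: "0 < c" "0 < 2 * \<rho>" "0 < \<rho>" using 1 2 by (auto simp: c_def \<rho>_def)
  have sub: "cball x (2 * \<rho>) \<subseteq> cball x \<rho>1" "cball x (2 * \<rho>) \<subseteq> cball x \<rho>2" for x :: "real^2" by (auto simp: \<rho>_def)
  have alt: "(\<forall>y\<in>cball x (2 * \<rho>). c \<le> A1 (nsq y)) \<or> (\<forall>y\<in>cball x (2 * \<rho>). c \<le> W1 (nsq y))"
    "(\<forall>y\<in>cball x (2 * \<rho>). c \<le> A2 (nsq y)) \<or> (\<forall>y\<in>cball x (2 * \<rho>). c \<le> W2 (nsq y))" if x: "x \<in> K" for x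
    using 1(3)[OF x] 2(3)[OF x] sub[of x] unfolding c_def by (meson min.coboundedI1 min.coboundedI2 subsetD)+
  obtain B where B: "0 \<le> B" "\<And>x. x \<in> K \<Longrightarrow> norm x \<le> B"
    using compact_imp_bounded[OF K] unfolding bounded_pos by (meson less_imp_le)
  from interior_one[OF C c(1,3) B(1)] obtain C1 where C1: "0 < C1" and
    ev1: "\<forall>\<^sub>F \<epsilon> in at_right 0. \<forall>\<eta>1 \<eta>2 lam1 lam2. close C \<epsilon> \<eta>1 \<eta>2 lam1 lam2 \<longrightarrow>
      one_phase (2 * \<rho>) B c (C1 * \<epsilon>\<^sup>2) \<eta>1 \<eta>2 lam1 lam2" by blast
  from interior_two[OF C c(1,2) B(1)] obtain C2 where C2: "0 < C2" and
    ev2: "\<forall>\<^sub>F \<epsilon> in at_right 0. \<forall>\<eta>1 \<eta>2 lam1 lam2. close C \<epsilon> \<eta>1 \<eta>2 lam1 lam2 \<longrightarrow>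
      two_phase (2 * \<rho>) B c (C2 * (\<epsilon>\<^sup>2 + \<bar>lam1 - l1\<bar> + \<bar>lam2 - l2\<bar>)) \<eta>1 \<eta>2" by blast
  from multiplier_sharp[OF C] obtain C3 where C3: "0 < C3" and
    ev3: "\<forall>\<^sub>F \<epsilon> in at_right 0. \<forall>\<eta>1 \<eta>2 lam1 lam2. close C \<epsilon> \<eta>1 \<eta>2 lam1 lam2 \<longrightarrow>
      \<bar>lam1 - l1\<bar> \<le> C3 * (\<bar>ln \<epsilon>\<bar> * \<epsilon>\<^sup>2) \<and> \<bar>lam2 - l2\<bar> \<le> C3 * (\<bar>ln \<epsilon>\<bar> * \<epsilon>\<^sup>2)" by blast
  define C4 where "C4 = 8 / (c * (2 * \<rho>)\<^sup>2)"
  define D where "D = (C1 + C3) / g1 + (C1 + C3) / g2 + C2 * (1 + 2 * C3)"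
  define C' where "C' = C1 + C4 + D / sqrt c"
  have C4: "0 < C4" using c by (simp add: C4_def)
  have Dp: "0 < (C1 + C3) / g1" "0 < (C1 + C3) / g2" "0 < C2 * (1 + 2 * C3)" using C1 C2 C3 g_pos by auto
  have D: "0 < D" "(C1 + C3) / g1 \<le> D" "(C1 + C3) / g2 \<le> D" "C2 * (1 + 2 * C3) \<le> D" using Dp unfolding D_def by linarith+
  have "0 < D / sqrt c" using D(1) c by simp
  then have C': "0 < C'" "C1 \<le> C'" "C4 \<le> C'" "D / sqrt c \<le> C'" using C1 C4 unfolding C'_def by linarith+
  have "\<forall>\<^sub>F \<epsilon> in at_right 0. 1 \<le> \<bar>ln (\<epsilon>::real)\<bar>" by real_asymp
  with ev1 ev2 ev3 small_component[OF C c(1,2)]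
  have "eventually (?P C') (at_right 0)"
  proof eventually_elim
    case (elim \<epsilon>)
    show ?case
    proof (intro allI impI ballI)
      fix \<eta>1 \<eta>2 lam1 lam2 and x :: "real^2" assume cl: "close C \<epsilon> \<eta>1 \<eta>2 lam1 lam2" and x: "x \<in> K"
      note S = solD[OF closeD(1)[OF cl]]
      define q where "q = \<bar>ln \<epsilon>\<bar> * \<epsilon>\<^sup>2"
      have q: "0 \<le> q" "\<epsilon>\<^sup>2 \<le> q" using elim(5) mult_right_mono[of 1 "\<bar>ln \<epsilon>\<bar>" "\<epsilon>\<^sup>2"] by (auto simp: q_def)
      have \<delta>: "\<bar>lam1 - l1\<bar> \<le> C3 * q" "\<bar>lam2 - l2\<bar> \<le> C3 * q" using elim(3) cl unfolding q_def by blast+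
      have xx: "x \<in> cball x (2 * \<rho>)" using c by simp
      have large: "\<bar>h - sqrt a\<bar> \<le> C' * q" if h: "0 \<le> h" "c \<le> a" "\<bar>h\<^sup>2 - a\<bar> \<le> D * q" for h a
      proof -
        have "\<bar>h - sqrt a\<bar> \<le> \<bar>h\<^sup>2 - a\<bar> / sqrt a" using abs_diff_sqrt_le(2)[of h a] h c by simp
        also have "\<dots> \<le> (D * q) / sqrt c" using h c by (intro frac_le) auto
        also have "\<dots> = D / sqrt c * q" by simp
        also have "\<dots> \<le> C' * q" using C'(4) q by (intro mult_right_mono)
        finally show ?thesis .
      qed
      have small: "\<bar>h - sqrt 0\<bar> \<le> C' * q" if h: "0 < h" "h \<le> k * \<epsilon>\<^sup>2" "0 < k" "k \<le> C'" for h k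
      proof -
        have "k * \<epsilon>\<^sup>2 \<le> C' * q" using h q C' by (intro mult_mono) auto
        then show ?thesis using h by simp
      qed
      have Wz: "W1 (nsq x) = 0" if "\<forall>y\<in>cball x (2 * \<rho>). c \<le> A1 (nsq y)"
        using bspec[OF that xx] WA_zero(1)[of "nsq x"] c by auto
      have Wz2: "W2 (nsq x) = 0" if "\<forall>y\<in>cball x (2 * \<rho>). c \<le> A2 (nsq y)"
        using bspec[OF that xx] WA_zero(2)[of "nsq x"] c by auto
      have Az: "A1 (nsq x) = 0" if "\<forall>y\<in>cball x (2 * \<rho>). c \<le> W1 (nsq y)"
        using bspec[OF that xx] WA_zero(1)[of "nsq x"] c by auto
      have Az2: "A2 (nsq x) = 0" if "\<forall>y\<in>cball x (2 * \<rho>). c \<le> W2 (nsq y)"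
        using bspec[OF that xx] WA_zero(2)[of "nsq x"] c by auto
      have single: "\<bar>n - a\<bar> \<le> D * q" if "\<bar>\<gamma> * n + s - lam\<bar> \<le> C1 * \<epsilon>\<^sup>2" "\<bar>lam - l\<bar> \<le> C3 * q" "s + \<gamma> * a = l" "0 < \<gamma>" "(C1 + C3) / \<gamma> \<le> D"
        for \<gamma> n s lam l a :: real
      proof -
        have "C1 * \<epsilon>\<^sup>2 \<le> C1 * q" using q C1 by (intro mult_left_mono) auto
        then have "\<bar>\<gamma> * (n - a)\<bar> \<le> (C1 + C3) * q" using that(1,2,3) unfolding right_diff_distrib distrib_right by linarith
        then have "\<bar>n - a\<bar> \<le> (C1 + C3) * q / \<gamma>" using that(4) by (simp add: abs_mult pos_le_divide_eq mult.commute)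
        also have "\<dots> = (C1 + C3) / \<gamma> * q" by simp
        also have "\<dots> \<le> D * q" using that(5) q by (intro mult_right_mono)
        finally show ?thesis .
      qed
      have "\<bar>\<eta>1 x - sqrt (A1 (nsq x))\<bar> \<le> C' * q \<and> \<bar>\<eta>2 x - sqrt (A2 (nsq x))\<bar> \<le> C' * q"
        using alt[OF x]
      proof (elim disjE)
        assume h: "\<forall>y\<in>cball x (2 * \<rho>). c \<le> A1 (nsq y)" "\<forall>y\<in>cball x (2 * \<rho>). c \<le> A2 (nsq y)"
        then have n: "\<bar>(\<eta>1 x)\<^sup>2 - A1 (nsq x)\<bar> \<le> C2 * (\<epsilon>\<^sup>2 + \<bar>lam1 - l1\<bar> + \<bar>lam2 - l2\<bar>)"
          "\<bar>(\<eta>2 x)\<^sup>2 - A2 (nsq x)\<bar> \<le> C2 * (\<epsilon>\<^sup>2 + \<bar>lam1 - l1\<bar> + \<bar>lam2 - l2\<bar>)"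
          using elim(2)[rule_format, OF cl, unfolded two_phase_def] B(2)[OF x] by blast+
        have "C2 * (\<epsilon>\<^sup>2 + \<bar>lam1 - l1\<bar> + \<bar>lam2 - l2\<bar>) \<le> C2 * (q + C3 * q + C3 * q)" using q \<delta> C2 by (intro mult_left_mono) linarith+
        also have "\<dots> = C2 * (1 + 2 * C3) * q" by (simp add: algebra_simps)
        also have "\<dots> \<le> D * q" using D(4) q by (intro mult_right_mono)
        finally have "\<bar>(\<eta>1 x)\<^sup>2 - A1 (nsq x)\<bar> \<le> D * q" "\<bar>(\<eta>2 x)\<^sup>2 - A2 (nsq x)\<bar> \<le> D * q" using n by linarith+
        then show ?thesis using large[OF less_imp_le[OF S(2)] bspec[OF h(1) xx]] large[OF less_imp_le[OF S(3)] bspec[OF h(2) xx]] by blast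
      next
        assume h: "\<forall>y\<in>cball x (2 * \<rho>). c \<le> A1 (nsq y)" "\<forall>y\<in>cball x (2 * \<rho>). c \<le> W2 (nsq y)"
        then have n: "\<bar>g1 * (\<eta>1 x)\<^sup>2 + nsq x - lam1\<bar> \<le> C1 * \<epsilon>\<^sup>2" "\<eta>2 x \<le> C1 * \<epsilon>\<^sup>2"
          using elim(1)[rule_format, OF cl, unfolded one_phase_def] B(2)[OF x] by blast+
        have "nsq x + g1 * A1 (nsq x) = l1" using Wz[OF h(1)] Az2[OF h(2)] by (simp add: W1_def)
        from single[OF n(1) \<delta>(1) this g_pos(1) D(2)] show ?thesis
          using large[OF less_imp_le[OF S(2)] bspec[OF h(1) xx]] small[OF S(3) n(2) C1 C'(2)] unfolding Az2[OF h(2)] by blast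
      next
        assume h: "\<forall>y\<in>cball x (2 * \<rho>). c \<le> W1 (nsq y)" "\<forall>y\<in>cball x (2 * \<rho>). c \<le> A2 (nsq y)"
        then have n: "\<bar>g2 * (\<eta>2 x)\<^sup>2 + nsq x - lam2\<bar> \<le> C1 * \<epsilon>\<^sup>2" "\<eta>1 x \<le> C1 * \<epsilon>\<^sup>2"
          using elim(1)[rule_format, OF cl, unfolded one_phase_def] B(2)[OF x] by blast+
        have "nsq x + g2 * A2 (nsq x) = l2" using Wz2[OF h(2)] Az[OF h(1)] by (simp add: W2_def)
        from single[OF n(1) \<delta>(2) this g_pos(2) D(3)] show ?thesis
          using large[OF less_imp_le[OF S(3)] bspec[OF h(2) xx]] small[OF S(2) n(2) C1 C'(2)] unfolding Az[OF h(1)] by blast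
      next
        assume h: "\<forall>y\<in>cball x (2 * \<rho>). c \<le> W1 (nsq y)" "\<forall>y\<in>cball x (2 * \<rho>). c \<le> W2 (nsq y)"
        then have n: "\<eta>1 x \<le> C4 * \<epsilon>\<^sup>2" "\<eta>2 x \<le> C4 * \<epsilon>\<^sup>2" using elim(4) cl unfolding C4_def by blast+
        show ?thesis
          using small[OF S(2) n(1) C4 C'(3)] small[OF S(3) n(2) C4 C'(3)] unfolding Az[OF h(1)] Az2[OF h(2)] by blast
      qed
      then show "\<bar>\<eta>1 x - sqrt (A1 (nsq x))\<bar> \<le> C' * (\<bar>ln \<epsilon>\<bar> * \<epsilon>\<^sup>2) \<and> \<bar>\<eta>2 x - sqrt (A2 (nsq x))\<bar> \<le> C' * (\<bar>ln \<epsilon>\<bar> * \<epsilon>\<^sup>2)"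
        unfolding q_def .
    qed
  qed
  then show ?thesis using C'(1) by blast
qed

end

section \<open>Assembly of the estimates\<close>

lemma Linf_norm_le:
  fixes f :: "real^2 \<Rightarrow> real"
  assumes "continuous_on UNIV f" "\<And>x. x \<in> A \<Longrightarrow> \<bar>f x\<bar> \<le> c"
  shows "Linf_norm A f \<le> ereal c"
  unfolding Linf_norm_def
proof (rule esssup_I)
  have "f \<in> borel_measurable lborel" using borel_measurable_continuous_onI[OF assms(1)] by simp
  then have "(\<lambda>x. ereal \<bar>f x\<bar>) \<in> borel_measurable lborel" by simp
  then show "(\<lambda>x. ereal \<bar>f x\<bar>) \<in> borel_measurable (restrict_space lborel A)" by (rule measurable_restrict_space1)
  show "AE x in restrict_space lborel A. ereal \<bar>f x\<bar> \<le> ereal c" using assms(2) by (intro AE_I2) (simp add: space_restrict_space)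
qed

context tf_data
begin

definition estimates :: "real \<Rightarrow> real \<Rightarrow> (real^2 \<Rightarrow> real) \<Rightarrow> (real^2 \<Rightarrow> real) \<Rightarrow> real \<Rightarrow> real \<Rightarrow> bool" where
  "estimates C \<epsilon> \<eta>1 \<eta>2 lam1 lam2 \<longleftrightarrow>
     \<bar>lam1 - l1\<bar> \<le> C * \<bar>ln \<epsilon>\<bar> * \<epsilon>\<^sup>2 \<and> \<bar>lam2 - l2\<bar> \<le> C * \<bar>ln \<epsilon>\<bar> * \<epsilon>\<^sup>2 \<and>
     (\<forall>x. \<bar>\<eta>1 x - sqrt (A1 (nsq x))\<bar> \<le> C * \<epsilon> powr (1/3)) \<and>
     (\<forall>x. \<bar>\<eta>2 x - sqrt (A2 (nsq x))\<bar> \<le> C * \<epsilon> powr (1/3)) \<and>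
     (\<forall>x. norm x \<le> sqrt s2 - \<epsilon> powr (1/3) \<longrightarrow>
        \<bar>\<eta>1 x - sqrt (A1 (nsq x))\<bar> \<le> C * \<epsilon> powr (1/3) * sqrt (A1 (nsq x))) \<and>
     (\<forall>x. sqrt s1 + \<epsilon> powr (1/3) < norm x \<and> norm x \<le> sqrt l2 - \<epsilon> powr (1/3) \<longrightarrow>
        \<bar>\<eta>2 x - sqrt (A2 (nsq x))\<bar> \<le> C * \<epsilon> powr (1/3) * sqrt (A2 (nsq x))) \<and>
     (\<forall>x. norm x \<ge> sqrt s2 \<longrightarrow> \<eta>1 x \<le> C * \<epsilon> powr (1/3) * exp (- ln 2 * ((norm x - sqrt s2) / \<epsilon> powr (2/3)))) \<and>
     (\<forall>x. norm x \<ge> sqrt l2 \<longrightarrow> \<eta>2 x \<le> C * \<epsilon> powr (1/3) * exp (- ln 2 * ((norm x - sqrt l2) / \<epsilon> powr (2/3))))"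

lemma asymptotics: "\<exists>C>0. \<forall>\<^sub>F \<epsilon> in at_right 0. \<forall>\<eta>1 \<eta>2 lam1 lam2. sol \<epsilon> \<eta>1 \<eta>2 lam1 lam2 \<longrightarrow> estimates C \<epsilon> \<eta>1 \<eta>2 lam1 lam2"
proof -
  obtain K where K: "0 < K" and cl: "\<forall>\<^sub>F \<epsilon> in at_right 0. \<forall>\<eta>1 \<eta>2 lam1 lam2. sol \<epsilon> \<eta>1 \<eta>2 lam1 lam2 \<longrightarrow> close K \<epsilon> \<eta>1 \<eta>2 lam1 lam2"
    using close_eventually by blast
  obtain C1 where C1: "0 < C1" and mult: "\<forall>\<^sub>F \<epsilon> in at_right 0. \<forall>\<eta>1 \<eta>2 lam1 lam2. close K \<epsilon> \<eta>1 \<eta>2 lam1 lam2 \<longrightarrow>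
    \<bar>lam1 - l1\<bar> \<le> C1 * (\<bar>ln \<epsilon>\<bar> * \<epsilon>\<^sup>2) \<and> \<bar>lam2 - l2\<bar> \<le> C1 * (\<bar>ln \<epsilon>\<bar> * \<epsilon>\<^sup>2)"
    using multiplier_sharp[OF K] by blast
  from decay_estimate[OF K] obtain C2 where C2: "0 < C2" and decay: "\<And>\<epsilon> \<eta>1 \<eta>2 lam1 lam2. close K \<epsilon> \<eta>1 \<eta>2 lam1 lam2 \<Longrightarrow>
    (\<forall>x. sqrt s2 \<le> norm x \<longrightarrow> \<eta>1 x \<le> C2 * \<epsilon> powr (1/3) * exp (- ln 2 * ((norm x - sqrt s2) / \<epsilon> powr (2/3)))) \<and>
    (\<forall>x. sqrt l2 \<le> norm x \<longrightarrow> \<eta>2 x \<le> C2 * \<epsilon> powr (1/3) * exp (- ln 2 * ((norm x - sqrt l2) / \<epsilon> powr (2/3))))"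
    by blast
  define C3 where "C3 = K / (slope * sqrt s1)"
  have C3: "0 < C3" using K slope(1) s_ord by (simp add: C3_def)
  define C where "C = sqrt K + C1 + C2 + C3"
  have "0 < sqrt K" using K by simp
  then have C: "0 < C" "sqrt K \<le> C" "C1 \<le> C" "C2 \<le> C" "C3 \<le> C" using C1 C2 C3 unfolding C_def by linarith+
  have up: "y \<le> C * p" if "y \<le> k * p" "k \<le> C" "0 \<le> p" for y k p :: real
    using that mult_right_mono[of k C p] by linarith
  show ?thesis
  proof (intro exI[of _ C] conjI C(1))
    show "\<forall>\<^sub>F \<epsilon> in at_right 0. \<forall>\<eta>1 \<eta>2 lam1 lam2. sol \<epsilon> \<eta>1 \<eta>2 lam1 lam2 \<longrightarrow> estimates C \<epsilon> \<eta>1 \<eta>2 lam1 lam2"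
      using cl mult
    proof eventually_elim
      case (elim \<epsilon>)
      show ?case
      proof (intro allI impI)
        fix \<eta>1 \<eta>2 lam1 lam2 assume "sol \<epsilon> \<eta>1 \<eta>2 lam1 lam2"
        then have c: "close K \<epsilon> \<eta>1 \<eta>2 lam1 lam2" using elim(1) by blast
        note r = relative_estimate[OF c K, folded C3_def] and s = sup_estimate[OF c]
        have m: "\<bar>lam1 - l1\<bar> \<le> C1 * (\<bar>ln \<epsilon>\<bar> * \<epsilon>\<^sup>2)" "\<bar>lam2 - l2\<bar> \<le> C1 * (\<bar>ln \<epsilon>\<bar> * \<epsilon>\<^sup>2)" using elim(2) c by blast+
        note d = decay[OF c]
        show "estimates C \<epsilon> \<eta>1 \<eta>2 lam1 lam2"
          unfolding estimates_def mult.assoc[of C]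
          using up[OF m(1) C(3)] up[OF m(2) C(3)] up[OF s(1) C(2)] up[OF s(2) C(2)]
            up[OF r(1)[unfolded mult.assoc[of C3]] C(5)] up[OF r(2)[unfolded mult.assoc[of C3]] C(5)]
            up[OF d[unfolded mult.assoc[of C2], THEN conjunct1, rule_format] C(4)] up[OF d[unfolded mult.assoc[of C2], THEN conjunct2, rule_format] C(4)]
            A_nonneg by (intro conjI allI impI) simp_all
      qed
    qed
  qed
qed

end

text \<open>The balance identities are the limiting equations solved by Cramer's rule, with
  determinant factor \<open>\<Gamma>0\<close>. In \<open>area2\<close> both factors are multiples of
  the gap \<open>d\<close> between the two limiting multipliers, so their product is fixed by the
  square of \<open>d\<close>, that is, by the formula for \<open>lam20\<close>.\<close>

lemma profile_tf_data:
  fixes g1 g2 g :: real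
  assumes pos: "g1 > 0" "g2 > 0" "g > 0" and det: "g\<^sup>2 < g1 * g2"
    and G: "g > (g1 + sqrt (g1\<^sup>2 + 8 * g1 * g2)) / 4" and lt: "g1 < g2"
  shows "tf_data g1 g2 g (lam10 g1 g2 g) (lam20 g1 g2 g) (\<Gamma>2 g1 g2 g / (g1 * \<Gamma>0 g1 g2 g)) (- \<Gamma>1 g1 g2 g / (g2 * \<Gamma>0 g1 g2 g))
    ((R2_minus g1 g2 g)\<^sup>2) ((R1 g1 g2 g)\<^sup>2)"
proof -
  note R = radii[OF assms]
  define l d where "l = lam10 g1 g2 g" and "d = lam20 g1 g2 g - lam10 g1 g2 g"
  define h1 h2 h0 where "h1 = \<Gamma>1 g1 g2 g" and "h2 = \<Gamma>2 g1 g2 g" and "h0 = \<Gamma>0 g1 g2 g"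
  have h: "h1 < 0" "0 < h2" "0 < h0" using R by (auto simp: h1_def h2_def h0_def)
  have hd: "h1 = 1 - g / g1" "h2 = 1 - g / g2" "h0 = 1 - g\<^sup>2 / (g1 * g2)"
    by (simp_all add: h1_def h2_def h0_def \<Gamma>1_def \<Gamma>2_def \<Gamma>0_def)
  have l2: "lam20 g1 g2 g = l + d" by (simp add: l_def d_def)
  have s2: "h2 * (R1 g1 g2 g)\<^sup>2 = l - g / g2 * (l + d)" and s1: "h1 * (R2_minus g1 g2 g)\<^sup>2 = (l + d) - g / g1 * l"
    unfolding h1_def h2_def l2[symmetric] unfolding l_def by (rule R(5)[symmetric], rule R(6)[symmetric])
  have lsq: "l\<^sup>2 = 4 * g1 / pi"
    using pos by (simp add: l_def lam10_def \<Gamma>2_def field_simps add_pos_pos)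
  have dsq: "d\<^sup>2 = - h1 * h2 * (2 * g1 * g2 / (pi * g))"
  proof -
    have "d = sqrt (- h1 * h2) * sqrt (2 * g1 * g2 / (pi * g))"
      using pos by (simp add: d_def lam20_def h1_def h2_def \<Gamma>2_def power2_eq_square field_simps)
    moreover have "0 \<le> - h1 * h2" using h by (simp add: mult_nonpos_nonneg)
    ultimately show ?thesis using pos by (simp add: power_mult_distrib)
  qed
  have g1g: "g1 < g" using h(1) pos by (simp add: hd field_simps)
  have gg2: "g < g2" using h(2) pos by (simp add: hd field_simps)
  have area: "(l + d - (R2_minus g1 g2 g)\<^sup>2) * (l + d - (R1 g1 g2 g)\<^sup>2) = 2 * g2 / pi"
  proof -
    have 1: "h1 * (l + d - (R2_minus g1 g2 g)\<^sup>2) = - (g / g1) * d" unfolding right_diff_distrib s1 unfolding hd by (simp add: algebra_simps add_divide_distrib)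
    have 2: "h2 * (l + d - (R1 g1 g2 g)\<^sup>2) = d" unfolding right_diff_distrib s2 unfolding hd by (simp add: algebra_simps add_divide_distrib)
    have "(h1 * h2) * ((l + d - (R2_minus g1 g2 g)\<^sup>2) * (l + d - (R1 g1 g2 g)\<^sup>2)) = (- (g / g1) * d) * d"
      unfolding 1[symmetric] by (subst (3) 2[symmetric]) (simp only: mult_ac)
    also have "\<dots> = - (g / g1) * d\<^sup>2" by (simp add: power2_eq_square)
    also have "\<dots> = (h1 * h2) * (2 * g2 / pi)" unfolding dsq using pos by (simp add: field_simps)
    finally have e: "(h1 * h2) * ((l + d - (R2_minus g1 g2 g)\<^sup>2) * (l + d - (R1 g1 g2 g)\<^sup>2)) = (h1 * h2) * (2 * g2 / pi)" .
    have "h1 * h2 \<noteq> 0" using h by simp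
    then show ?thesis using mult_cancel_left[THEN iffD1, OF e] by blast
  qed
  have b1: "l - s = g1 * (h2 / (g1 * h0) * ((R1 g1 g2 g)\<^sup>2 - s)) + g * (- h1 / (g2 * h0) * (s - (R2_minus g1 g2 g)\<^sup>2))" for s
  proof -
    have e1: "g1 * (h2 / (g1 * h0) * ((R1 g1 g2 g)\<^sup>2 - s)) = (h2 * (R1 g1 g2 g)\<^sup>2 - h2 * s) / h0" using pos h by (simp add: field_simps)
    have e2: "g * (- h1 / (g2 * h0) * (s - (R2_minus g1 g2 g)\<^sup>2)) = g / g2 * (h1 * (R2_minus g1 g2 g)\<^sup>2 - h1 * s) / h0" using pos h by (simp add: field_simps)
    have e3: "(l - g / g2 * (l + d) - h2 * s) + g / g2 * ((l + d) - g / g1 * l - h1 * s) = h0 * (l - s)"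
      unfolding hd using pos by (simp add: field_simps power2_eq_square)
    show ?thesis unfolding e1 e2 s1 s2 add_divide_distrib[symmetric] e3 using h(3) by simp
  qed
  have b2: "l + d - s = g2 * (- h1 / (g2 * h0) * (s - (R2_minus g1 g2 g)\<^sup>2)) + g * (h2 / (g1 * h0) * ((R1 g1 g2 g)\<^sup>2 - s))" for s
  proof -
    have e2: "g * (h2 / (g1 * h0) * ((R1 g1 g2 g)\<^sup>2 - s)) = g / g1 * (h2 * (R1 g1 g2 g)\<^sup>2 - h2 * s) / h0" using pos h by (simp add: field_simps)
    have e1: "g2 * (- h1 / (g2 * h0) * (s - (R2_minus g1 g2 g)\<^sup>2)) = (h1 * (R2_minus g1 g2 g)\<^sup>2 - h1 * s) / h0" using pos h by (simp add: field_simps)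
    have e3: "((l + d) - g / g1 * l - h1 * s) + g / g1 * (l - g / g2 * (l + d) - h2 * s) = h0 * (l + d - s)"
      unfolding hd using pos by (simp add: field_simps power2_eq_square)
    show ?thesis unfolding e1 e2 s1 s2 add_divide_distrib[symmetric] e3 using h(3) by simp
  qed
  have ord: "0 < (R2_minus g1 g2 g)\<^sup>2" "(R2_minus g1 g2 g)\<^sup>2 < (R1 g1 g2 g)\<^sup>2" "(R1 g1 g2 g)\<^sup>2 < lam20 g1 g2 g"
    unfolding R(4) using R(1,2,3) by (auto intro!: power_strict_mono)
  have kp: "0 < h2 / (g1 * h0)" "0 < - h1 / (g2 * h0)" using h pos by (auto intro!: divide_pos_pos divide_neg_pos)
  show ?thesis
    unfolding h1_def[symmetric] h2_def[symmetric] h0_def[symmetric] l_def[symmetric] l2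
    by unfold_locales (fact pos det g1g gg2 ord[unfolded l2] kp b1 b2 lsq area)+
qed

theorem theorem1p6:
  fixes g1 g2 g :: real
  assumes "g1 > 0" and "g2 > 0" and "g > 0"
    and "g\<^sup>2 < g1 * g2"
    and "g > (g1 + sqrt (g1\<^sup>2 + 8 * g1 * g2)) / 4"
    and "g1 < g2"
  shows "\<exists>c>0. \<exists>C>0.
    (\<forall>\<^sub>F \<epsilon> in at_right 0. \<forall>\<eta>1 \<eta>2 lam1 lam2.
       positive_minimizer g1 g2 g \<epsilon> \<eta>1 \<eta>2 \<and> lagrange_multipliers g1 g2 g \<epsilon> \<eta>1 \<eta>2 lam1 lam2 \<longrightarrow>
         \<bar>lam1 - lam10 g1 g2 g\<bar> \<le> C * \<bar>ln \<epsilon>\<bar> * \<epsilon>\<^sup>2 \<and>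
         \<bar>lam2 - lam20 g1 g2 g\<bar> \<le> C * \<bar>ln \<epsilon>\<bar> * \<epsilon>\<^sup>2 \<and>
         Linf_norm UNIV (\<lambda>x. \<eta>1 x - sqrt (a1 g1 g2 g (norm x))) \<le> ereal (C * \<epsilon> powr (1/3)) \<and>
         Linf_norm UNIV (\<lambda>x. \<eta>2 x - sqrt (a2 g1 g2 g (norm x))) \<le> ereal (C * \<epsilon> powr (1/3)) \<and>
         (\<forall>x. norm x \<le> R1 g1 g2 g - \<epsilon> powr (1/3) \<longrightarrow>
            \<bar>\<eta>1 x - sqrt (a1 g1 g2 g (norm x))\<bar> \<le> C * \<epsilon> powr (1/3) * sqrt (a1 g1 g2 g (norm x))) \<and>
         (\<forall>x. R2_minus g1 g2 g + \<epsilon> powr (1/3) < norm x \<and>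
              norm x \<le> R2_plus g1 g2 g - \<epsilon> powr (1/3) \<longrightarrow>
            \<bar>\<eta>2 x - sqrt (a2 g1 g2 g (norm x))\<bar> \<le> C * \<epsilon> powr (1/3) * sqrt (a2 g1 g2 g (norm x))) \<and>
         (\<forall>x. norm x \<ge> R1 g1 g2 g \<longrightarrow>
            \<eta>1 x \<le> C * \<epsilon> powr (1/3) * exp (- c * ((norm x - R1 g1 g2 g) / \<epsilon> powr (2/3)))) \<and>
         (\<forall>x. norm x \<ge> R2_plus g1 g2 g \<longrightarrow>
            \<eta>2 x \<le> C * \<epsilon> powr (1/3) * exp (- c * ((norm x - R2_plus g1 g2 g) / \<epsilon> powr (2/3))))) \<and>
    (\<forall>K. compact K \<and> (\<forall>x\<in>K. norm x \<notin> {R1 g1 g2 g, R2_minus g1 g2 g, R2_plus g1 g2 g}) \<longrightarrow>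
       (\<exists>C\<^sub>K>0. \<forall>\<^sub>F \<epsilon> in at_right 0. \<forall>\<eta>1 \<eta>2 lam1 lam2.
          positive_minimizer g1 g2 g \<epsilon> \<eta>1 \<eta>2 \<and> lagrange_multipliers g1 g2 g \<epsilon> \<eta>1 \<eta>2 lam1 lam2 \<longrightarrow>
            Linf_norm K (\<lambda>x. \<eta>1 x - sqrt (a1 g1 g2 g (norm x))) \<le> ereal (C\<^sub>K * \<bar>ln \<epsilon>\<bar> * \<epsilon>\<^sup>2) \<and>
            Linf_norm K (\<lambda>x. \<eta>2 x - sqrt (a2 g1 g2 g (norm x))) \<le> ereal (C\<^sub>K * \<bar>ln \<epsilon>\<bar> * \<epsilon>\<^sup>2)))"
proof -
  interpret tf_data g1 g2 g "lam10 g1 g2 g" "lam20 g1 g2 g" "\<Gamma>2 g1 g2 g / (g1 * \<Gamma>0 g1 g2 g)" "- \<Gamma>1 g1 g2 g / (g2 * \<Gamma>0 g1 g2 g)"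
    "(R2_minus g1 g2 g)\<^sup>2" "(R1 g1 g2 g)\<^sup>2"
    by (rule profile_tf_data[OF assms])
  note R = radii[OF assms]
  have pos: "0 \<le> R2_minus g1 g2 g" "0 \<le> R1 g1 g2 g" "0 \<le> R2_plus g1 g2 g" using R(1-3) by linarith+
  have sq: "sqrt ((R1 g1 g2 g)\<^sup>2) = R1 g1 g2 g" "sqrt ((R2_minus g1 g2 g)\<^sup>2) = R2_minus g1 g2 g" "sqrt (lam20 g1 g2 g) = R2_plus g1 g2 g"
    using pos by (simp_all add: R(4))
  have le: "r\<^sup>2 \<le> t\<^sup>2 \<longleftrightarrow> r \<le> t" if "0 \<le> r" "0 \<le> t" for r t :: real using that by (simp add: abs_le_square_iff[symmetric])
  have k: "a10 g1 g2 g r = \<Gamma>2 g1 g2 g / (g1 * \<Gamma>0 g1 g2 g) * ((R1 g1 g2 g)\<^sup>2 - r\<^sup>2)"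
    "a20 g1 g2 g r = - \<Gamma>1 g1 g2 g / (g2 * \<Gamma>0 g1 g2 g) * (r\<^sup>2 - (R2_minus g1 g2 g)\<^sup>2)" for r
    unfolding a10_def a20_def R(5,6) by (simp_all add: algebra_simps)
  have a: "a1 g1 g2 g (norm x) = A1 (nsq x)" "a2 g1 g2 g (norm x) = A2 (nsq x)" for x :: "real^2"
  proof -
    have 1: "a10 g1 g2 g r + g / g1 * a20 g1 g2 g r = (lam10 g1 g2 g - r\<^sup>2) / g1" for r
      unfolding k bal1[of "r\<^sup>2"] add_divide_distrib using g_pos(1) by (simp add: mult_ac)
    have 2: "a20 g1 g2 g r + g / g2 * a10 g1 g2 g r = (lam20 g1 g2 g - r\<^sup>2) / g2" for r
      unfolding k bal2[of "r\<^sup>2"] add_divide_distrib using g_pos(2) by (simp add: mult_ac)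
    have c: "nsq x \<le> (R2_minus g1 g2 g)\<^sup>2 \<longleftrightarrow> norm x \<le> R2_minus g1 g2 g" "nsq x \<le> (R1 g1 g2 g)\<^sup>2 \<longleftrightarrow> norm x \<le> R1 g1 g2 g"
      "nsq x \<le> lam20 g1 g2 g \<longleftrightarrow> norm x \<le> R2_plus g1 g2 g"
      unfolding R(4) by (intro le pos norm_ge_zero)+
    show "a1 g1 g2 g (norm x) = A1 (nsq x)" "a2 g1 g2 g (norm x) = A2 (nsq x)"
      unfolding a1_def a2_def A1_def A2_def c 1 2 unfolding k by simp_all
  qed
  have c: "continuous_on UNIV (\<lambda>x. u x - sqrt (A (nsq x)))" if "C_k 2 u" "continuous_on UNIV A" for u :: "real^2 \<Rightarrow> real" and A
    by (intro continuous_intros C_k_2D(3)[OF that(1)] continuous_on_compose2[OF that(2)]) auto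
  have L: "Linf_norm S (\<lambda>x. u x - sqrt (A (nsq x))) \<le> ereal b"
    if "C_k 2 u" "continuous_on UNIV A" "\<And>x. x \<in> S \<Longrightarrow> \<bar>u x - sqrt (A (nsq x))\<bar> \<le> b" for u A S b
    by (rule Linf_norm_le[OF c[OF that(1,2)] that(3)])
  have sol: "sol \<epsilon> \<eta>1 \<eta>2 lam1 lam2"
    if "0 < \<epsilon>" "positive_minimizer g1 g2 g \<epsilon> \<eta>1 \<eta>2 \<and> lagrange_multipliers g1 g2 g \<epsilon> \<eta>1 \<eta>2 lam1 lam2" for \<epsilon> \<eta>1 \<eta>2 lam1 lam2
    using that unfolding sol_def by blast
  have \<epsilon>0: "\<forall>\<^sub>F \<epsilon> in at_right 0. 0 < (\<epsilon>::real)" by (rule eventually_at_right_less)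
  obtain C where C: "0 < C" and ev: "\<forall>\<^sub>F \<epsilon> in at_right 0. \<forall>\<eta>1 \<eta>2 lam1 lam2. sol \<epsilon> \<eta>1 \<eta>2 lam1 lam2 \<longrightarrow> estimates C \<epsilon> \<eta>1 \<eta>2 lam1 lam2"
    using asymptotics by blast
  obtain K where K: "0 < K" and cl: "\<forall>\<^sub>F \<epsilon> in at_right 0. \<forall>\<eta>1 \<eta>2 lam1 lam2. sol \<epsilon> \<eta>1 \<eta>2 lam1 lam2 \<longrightarrow> close K \<epsilon> \<eta>1 \<eta>2 lam1 lam2"
    using close_eventually by blast
  show ?thesis
    unfolding a
  \<comment> \<open>The decay rate \<open>ln 2\<close> is the halving rate of
    \<open>exp_decay\<close>. \<open>C\<close> serves the global estimates, while each compact set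
    gets a constant of its own.\<close>
  proof (rule exI[of _ "ln 2"], rule conjI, simp, rule exI[of _ C], intro conjI allI impI C, goal_cases)
    case 1
    show ?case
      using ev \<epsilon>0
    proof eventually_elim
      case (elim \<epsilon>)
      show ?case
      proof (intro allI impI, goal_cases)
        case (1 \<eta>1 \<eta>2 lam1 lam2)
        then have s: "sol \<epsilon> \<eta>1 \<eta>2 lam1 lam2" by (rule sol[OF elim(2)])
        note e = elim(1)[rule_format, OF s, unfolded estimates_def sq]
        have "Linf_norm UNIV (\<lambda>x. \<eta>1 x - sqrt (A1 (nsq x))) \<le> ereal (C * \<epsilon> powr (1/3))"
          "Linf_norm UNIV (\<lambda>x. \<eta>2 x - sqrt (A2 (nsq x))) \<le> ereal (C * \<epsilon> powr (1/3))"
          by (intro L solD(4,5)[OF s] A_continuous; use e in blast)+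
        with e show ?case by blast
      qed
    qed
  next
    case (2 S)
    then have S: "compact S" "\<forall>x\<in>S. norm x \<notin> {R1 g1 g2 g, R2_minus g1 g2 g, R2_plus g1 g2 g}" by auto
    have avoid: "nsq x \<notin> {(R2_minus g1 g2 g)\<^sup>2, (R1 g1 g2 g)\<^sup>2, lam20 g1 g2 g}" if "x \<in> S" for x
    proof -
      have "norm x \<notin> {R1 g1 g2 g, R2_minus g1 g2 g, R2_plus g1 g2 g}" using S(2) that by blast
      then show ?thesis unfolding R(4) using pos by (simp add: power2_eq_iff_nonneg)
    qed
    obtain C' where C': "0 < C'" and ev': "\<forall>\<^sub>F \<epsilon> in at_right 0. \<forall>\<eta>1 \<eta>2 lam1 lam2. close K \<epsilon> \<eta>1 \<eta>2 lam1 lam2 \<longrightarrow>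
      (\<forall>x\<in>S. \<bar>\<eta>1 x - sqrt (A1 (nsq x))\<bar> \<le> C' * (\<bar>ln \<epsilon>\<bar> * \<epsilon>\<^sup>2) \<and> \<bar>\<eta>2 x - sqrt (A2 (nsq x))\<bar> \<le> C' * (\<bar>ln \<epsilon>\<bar> * \<epsilon>\<^sup>2))"
      using compact_estimate[OF K S(1) avoid] by blast
    show ?case
    proof (rule exI[of _ C'], rule conjI[OF C'], goal_cases)
      case 1
      show ?case
        using ev' cl \<epsilon>0
      proof eventually_elim
        case (elim \<epsilon>)
        show ?case
        proof (intro allI impI, goal_cases)
          case (1 \<eta>1 \<eta>2 lam1 lam2)
          then have s: "sol \<epsilon> \<eta>1 \<eta>2 lam1 lam2" by (rule sol[OF elim(3)])
          from s have e: "\<forall>x\<in>S. \<bar>\<eta>1 x - sqrt (A1 (nsq x))\<bar> \<le> C' * (\<bar>ln \<epsilon>\<bar> * \<epsilon>\<^sup>2) \<and> \<bar>\<eta>2 x - sqrt (A2 (nsq x))\<bar> \<le> C' * (\<bar>ln \<epsilon>\<bar> * \<epsilon>\<^sup>2)"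
            using elim(1,2) by blast
          show ?case
            unfolding mult.assoc[of C'] by (intro conjI L solD(4,5)[OF s] A_continuous; use e in blast)
        qed
      qed
    qed
  qed
qed

end
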